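(* Let $V$ be a complex vector space of dimension $n+1$ and let $m\ge1$. For a general $M\in\operatorname{Hom}(S^mV,\bigwedge^aV)$, the number of points $[v]\in\mathbb{P}(V)$ such that $M(v^m)\wedge v=0$ is given by: - $m$ for $a=0,2$ and $n=1$; and $\infty$ when $a=0,n+1$ and $n>1$; - $\dfrac{m^{n+1}-1}{m-1}$ for $a=1$ (read as $\sum_{i=0}^n m^i=n+1$ when $m=1$); - $0$ for $2\le a\le n-2$; - $\dfrac{(m+1)^{n+1}+(-1)^n}{m+2}$ for $a=n-1$.
   Context: $\mathbb{P}(V)$ is the projective space of lines in $V$. "General" means that the property holds for all $M$ in a dense subset (avoiding a Zariski closed set) of $\operatorname{Hom}(S^mV,\bigwedge^aV)$. The wedge product $M(v^m)\wedge v$ lies in $\bigwedge^{a+1}V$. A vector $v$ with $M(v^m)\wedge v=0$ is called an eigenvector of the tensor $M$.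
   Formalization: For a=2, n=1 the claimed number m is replaced by ∞: there dim V=2, so M(v^m)∧v lies in ⋀^3 V=0 and every point of P(V) satisfies the condition for every M; all other cases are as stated. *)

theory Defs
  imports Complex_Main "HOL-Library.Multiset" "HOL-Library.Function_Algebras"
begin

text \<open>
  A complex vector space \<open>V\<close> is a type \<open>'v\<close> with a scalar multiplication \<open>scale\<close> such that
  \<open>vector_space scale\<close>. Spaces of tensors and of linear maps are subspaces (sets) of function
  types, with pointwise addition and the following pointwise scalar multiplication.
\<close>

definition pscale :: "(complex \<Rightarrow> 'b \<Rightarrow> 'b) \<Rightarrow> complex \<Rightarrow> ('a \<Rightarrow> 'b) \<Rightarrow> ('a \<Rightarrow> 'b)"
  where "pscale s c f = (\<lambda>x. s c (f x))"

definition linear_on ::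
  "'a::plus set \<Rightarrow> (complex \<Rightarrow> 'a \<Rightarrow> 'a) \<Rightarrow> (complex \<Rightarrow> 'b \<Rightarrow> 'b) \<Rightarrow> ('a \<Rightarrow> 'b::plus) \<Rightarrow> bool"
  where "linear_on A s1 s2 f \<longleftrightarrow>
    (\<forall>x\<in>A. \<forall>y\<in>A. f (x + y) = f x + f y) \<and> (\<forall>c. \<forall>x\<in>A. f (s1 c x) = s2 c (f x))"


subsection \<open>Tensor, symmetric and exterior powers\<close>

definition dual :: "(complex \<Rightarrow> 'v::ab_group_add \<Rightarrow> 'v) \<Rightarrow> ('v \<Rightarrow> complex) set"
  where "dual scale = {\<phi>. Vector_Spaces.linear scale (*) \<phi>}"

text \<open>
  For finite-dimensional \<open>V\<close>, \<open>k\<close>-fold tensors are the \<open>k\<close>-linear forms on the dual space. The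
  arguments are passed as a list of covectors, and the value on a list that is not of this kind
  (wrong length, or an entry that is not linear) is 0, so that equality of tensors is equality of
  functions. The symmetric and exterior powers are the spaces of symmetric and of alternating
  tensors.
\<close>

type_synonym 'v tensor = "('v \<Rightarrow> complex) list \<Rightarrow> complex"

abbreviation tscale :: "complex \<Rightarrow> 'v tensor \<Rightarrow> 'v tensor"
  where "tscale \<equiv> pscale (*)"

definition tensor_power :: "(complex \<Rightarrow> 'v::ab_group_add \<Rightarrow> 'v) \<Rightarrow> nat \<Rightarrow> 'v tensor set"
  where "tensor_power scale k =
    {t. (\<forall>\<phi>s. \<not> (length \<phi>s = k \<and> set \<phi>s \<subseteq> dual scale) \<longrightarrow> t \<phi>s = 0) \<and>
        (\<forall>\<phi>s i. length \<phi>s = k \<and> set \<phi>s \<subseteq> dual scale \<and> i < k \<longrightarrow>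
           linear_on (dual scale) (pscale (*)) (*) (\<lambda>\<psi>. t (\<phi>s[i := \<psi>])))}"

definition sym_power :: "(complex \<Rightarrow> 'v::ab_group_add \<Rightarrow> 'v) \<Rightarrow> nat \<Rightarrow> 'v tensor set"
  where "sym_power scale k =
    {t \<in> tensor_power scale k. \<forall>\<phi>s \<psi>s. mset \<phi>s = mset \<psi>s \<longrightarrow> t \<phi>s = t \<psi>s}"

definition ext_power :: "(complex \<Rightarrow> 'v::ab_group_add \<Rightarrow> 'v) \<Rightarrow> nat \<Rightarrow> 'v tensor set"
  where "ext_power scale k =
    {t \<in> tensor_power scale k. \<forall>\<phi>s. \<not> distinct \<phi>s \<longrightarrow> t \<phi>s = 0}"

text \<open>The element \<open>v\<^sup>k\<close> of the \<open>k\<close>-th symmetric power, that is, the tensor \<open>v \<otimes> \<dots> \<otimes> v\<close>.\<close>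

definition vpow :: "(complex \<Rightarrow> 'v::ab_group_add \<Rightarrow> 'v) \<Rightarrow> 'v \<Rightarrow> nat \<Rightarrow> 'v tensor"
  where "vpow scale v k =
    (\<lambda>\<phi>s. if length \<phi>s = k \<and> set \<phi>s \<subseteq> dual scale then (\<Prod>\<phi>\<leftarrow>\<phi>s. \<phi> v) else 0)"

text \<open>
  The wedge product \<open>\<omega> \<and> v\<close> of \<open>\<omega>\<close> in the \<open>a\<close>-th exterior power with a vector \<open>v\<close>:
  \<open>(\<omega> \<and> v)(\<phi>\<^sub>0, \<dots>, \<phi>\<^sub>a) = (\<Sum>i\<le>a. (-1)\<^sup>a\<^sup>-\<^sup>i \<phi>\<^sub>i(v) \<omega>(\<phi>\<^sub>0, \<dots>, \<phi>\<^sub>i\<^sub>-\<^sub>1, \<phi>\<^sub>i\<^sub>+\<^sub>1, \<dots>, \<phi>\<^sub>a))\<close>.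
  This is the Laplace expansion along the last column for the convention
  \<open>(v\<^sub>0 \<and> \<dots> \<and> v\<^sub>a)(\<phi>\<^sub>0, \<dots>, \<phi>\<^sub>a) = det (\<phi>\<^sub>i(v\<^sub>j))\<close>. The degree \<open>a\<close> is recovered from the length of the
  argument list.
\<close>

definition wedge :: "(complex \<Rightarrow> 'v::ab_group_add \<Rightarrow> 'v) \<Rightarrow> 'v tensor \<Rightarrow> 'v \<Rightarrow> 'v tensor"
  where "wedge scale \<omega> v =
    (\<lambda>\<phi>s. if set \<phi>s \<subseteq> dual scale
          then \<Sum>i<length \<phi>s. (-1) ^ (length \<phi>s - Suc i) * (\<phi>s ! i) v *
                 \<omega> (take i \<phi>s @ drop (Suc i) \<phi>s)
          else 0)"

text \<open>
  The linear maps from the \<open>m\<close>-th symmetric power to the \<open>a\<close>-th exterior power, extended by 0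
  outside their domain so that equality of maps is equality of functions.
\<close>

definition Hom_sym_ext ::
  "(complex \<Rightarrow> 'v::ab_group_add \<Rightarrow> 'v) \<Rightarrow> nat \<Rightarrow> nat \<Rightarrow> ('v tensor \<Rightarrow> 'v tensor) set"
  where "Hom_sym_ext scale m a =
    {M. M ` sym_power scale m \<subseteq> ext_power scale a \<and>
        linear_on (sym_power scale m) tscale tscale M \<and>
        (\<forall>s. s \<notin> sym_power scale m \<longrightarrow> M s = 0)}"


subsection \<open>Eigenvectors\<close>

definition proj_point :: "(complex \<Rightarrow> 'v::ab_group_add \<Rightarrow> 'v) \<Rightarrow> 'v \<Rightarrow> 'v set"
  where "proj_point scale v = module.span scale {v}"

definition eigenvector ::
  "(complex \<Rightarrow> 'v::ab_group_add \<Rightarrow> 'v) \<Rightarrow> nat \<Rightarrow> ('v tensor \<Rightarrow> 'v tensor) \<Rightarrow> 'v \<Rightarrow> bool"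
  where "eigenvector scale m M v \<longleftrightarrow> v \<noteq> 0 \<and> wedge scale (M (vpow scale v m)) v = 0"

text \<open>
  The set of points \<open>[v]\<close> of the projective space of lines in \<open>V\<close> with \<open>M(v\<^sup>m) \<and> v = 0\<close>.
\<close>

definition eigenpoints ::
  "(complex \<Rightarrow> 'v::ab_group_add \<Rightarrow> 'v) \<Rightarrow> nat \<Rightarrow> ('v tensor \<Rightarrow> 'v tensor) \<Rightarrow> 'v set set"
  where "eigenpoints scale m M = {proj_point scale v | v. eigenvector scale m M v}"


subsection \<open>Zariski topology and general elements\<close>

text \<open>
  The polynomial functions on a vector space \<open>H\<close> (a subspace of a type with scalar multiplication
  \<open>s\<close>): the algebra generated by the linear functionals on \<open>H\<close>. Only values on \<open>H\<close> matter.
\<close>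

inductive_set poly_funs ::
  "'w::plus set \<Rightarrow> (complex \<Rightarrow> 'w \<Rightarrow> 'w) \<Rightarrow> ('w \<Rightarrow> complex) set"
  for H :: "'w set" and s :: "complex \<Rightarrow> 'w \<Rightarrow> 'w"
  where
    const: "(\<lambda>_. c) \<in> poly_funs H s"
  | lin: "linear_on H s (*) l \<Longrightarrow> l \<in> poly_funs H s"
  | add: "\<lbrakk>f \<in> poly_funs H s; g \<in> poly_funs H s\<rbrakk> \<Longrightarrow> (\<lambda>x. f x + g x) \<in> poly_funs H s"
  | mult: "\<lbrakk>f \<in> poly_funs H s; g \<in> poly_funs H s\<rbrakk> \<Longrightarrow> (\<lambda>x. f x * g x) \<in> poly_funs H s"

definition zariski_closed :: "'w::plus set \<Rightarrow> (complex \<Rightarrow> 'w \<Rightarrow> 'w) \<Rightarrow> 'w set \<Rightarrow> bool"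
  where "zariski_closed H s Z \<longleftrightarrow>
    (\<exists>F \<subseteq> poly_funs H s. Z = {x \<in> H. \<forall>f\<in>F. f x = 0})"

definition zariski_dense :: "'w::plus set \<Rightarrow> (complex \<Rightarrow> 'w \<Rightarrow> 'w) \<Rightarrow> 'w set \<Rightarrow> bool"
  where "zariski_dense H s U \<longleftrightarrow> (\<forall>C. zariski_closed H s C \<and> U \<subseteq> C \<longrightarrow> C = H)"

text \<open>
  A property holds for a general element of \<open>H\<close> if it holds on the complement of some Zariski
  closed subset, where this complement is dense.
\<close>

definition general :: "'w::plus set \<Rightarrow> (complex \<Rightarrow> 'w \<Rightarrow> 'w) \<Rightarrow> ('w \<Rightarrow> bool) \<Rightarrow> bool"
  where "general H s P \<longleftrightarrow>
    (\<exists>Z. zariski_closed H s Z \<and> zariski_dense H s (H - Z) \<and> (\<forall>M\<in>H - Z. P M))"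

abbreviation general_Hom ::
  "(complex \<Rightarrow> 'v::ab_group_add \<Rightarrow> 'v) \<Rightarrow> nat \<Rightarrow> nat \<Rightarrow> (('v tensor \<Rightarrow> 'v tensor) \<Rightarrow> bool) \<Rightarrow> bool"
  where "general_Hom scale m a P \<equiv> general (Hom_sym_ext scale m a) (pscale tscale) P"

end

(* In coordinates the eigenvectors are the common zeros of forms of degree m+1 that depend linearly
   on M. For a suitable sparse M0, built from pure powers and wedge products of basis vectors over
   cyclic intervals, these forms become binomials. The monomials modulo the binomial relations form
   a cyclic group of order N, so the degree d part of the coordinate ring has dimension at most N for
   large d, and the zeros include N points whose coordinates are powers of N-th roots of unity.
   (For 2 <= a <= n-2 all monomials of large degree vanish instead.)

   The upper bound N holds for general M because rank conditions are open. For the lower bound, each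
   of the N points is lifted, modulo every power of t, to a zero of (1-t) M0 + t M; only n of the
   equations matter, because (w /\ v) /\ v = 0. Hence the space of functionals that annihilate the
   degree d part of the ideal has dimension exactly N. Contracting these functionals with two linear
   forms gives a matrix pencil; its characteristic polynomial is squarefree at M0, hence for general
   M, and the N eigenvectors are the evaluations at N zeros. *)

theory Submission
  imports Defs "Jordan_Normal_Form.Determinant" "HOL-Computational_Algebra.Fundamental_Theorem_Algebra"
begin

text \<open>The formulas come from the cyclic symmetry of the sparse maps. Modulo the binomials,
  x_(i+2)/x_0 is the product of the powers of x_(i+1)/x_0 and x_i/x_0 with exponents 1 + q and -q,
  so x_i/x_0 is the power of x_1/x_0 with exponent 1 + q + ... + q^(i-1). Closing the cycle gives N
  = |1 + q + ... + q^n|, where q = m for a = 1 and q = -(m+1) for a = n-1.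

  The obstacle is that there are in general more equations than the codimension of the solution set,
  so Bezout's theorem does not count the solutions, and openness of rank alone allows points to
  disappear under perturbation. Lifting excludes this without any limit process: a fixed nonzero
  polynomial is not divisible by every power of t.

  Quotient rings are replaced by functionals on monomials, that is, by kernels of explicit matrices
  with entries linear in M. An injective matrix of this kind has a left inverse with a polynomial
  common denominator, and these denominators are the source of the open conditions.\<close>

subsection \<open>Linear algebra over finite index sets\<close>

text \<open>Zero rows make the coefficient matrix square and singular, and over an integral domain a
  singular matrix has a nonzero kernel vector. Domains are allowed because the coefficients are
  complex numbers in some uses and elements of \<open>complex poly\<close> in another.\<close>

lemma underdetermined_system:
  fixes B :: "'s \<Rightarrow> 'j \<Rightarrow> 'a::idom"
  assumes "finite T" "finite J" "card T < card J"
  shows "\<exists>c. (\<exists>j\<in>J. c j \<noteq> 0) \<and> (\<forall>s\<in>T. (\<Sum>j\<in>J. B s j * c j) = 0)"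
proof -
  define N where "N = card J"
  obtain f where f: "bij_betw f {0..<N} J"
    using ex_bij_betw_nat_finite[OF assms(2)] unfolding N_def by blast
  obtain g where g: "bij_betw g {0..<card T} T"
    using ex_bij_betw_nat_finite[OF assms(1)] by blast
  define A where "A = mat N N (\<lambda>(a, b). if a < card T then B (g a) (f b) else 0)"
  have A: "A \<in> carrier_mat N N" by (simp add: A_def)
  have "card T < N" using assms(3) by (simp add: N_def)
  then have "det A = (\<Sum>j<N. A $$ (card T, j) * cofactor A (card T) j)"
    by (rule laplace_expansion_row[OF A])
  also have "\<dots> = 0"
    using \<open>card T < N\<close> by (intro sum.neutral) (auto simp: A_def)
  finally obtain v where v: "v \<in> carrier_vec N" "v \<noteq> 0\<^sub>v N" "A *\<^sub>v v = 0\<^sub>v N"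
    using det_0_iff_vec_prod_zero[OF A] by blast
  define h where "h = the_inv_into {0..<N} f"
  have hf: "h (f a) = a" if "a < N" for a
    unfolding h_def using f that by (intro the_inv_into_f_f) (auto simp: bij_betw_def)
  show ?thesis
  proof (intro exI[of _ "\<lambda>j. v $ h j"] conjI ballI)
    obtain a where "a < N" "v $ a \<noteq> 0"
      using v(1,2) by (metis carrier_vecD dim_vec eq_vecI index_zero_vec)
    moreover have "f a \<in> J" using f \<open>a < N\<close> by (auto simp: bij_betw_def)
    ultimately show "\<exists>j\<in>J. v $ h j \<noteq> 0" using hf by metis
  next
    fix s assume "s \<in> T"
    then obtain a where a: "a < card T" "g a = s"
      using g by (metis atLeastLessThan_iff bij_betw_iff_bijections)
    have "a < N" using a \<open>card T < N\<close> by simp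
    have "(\<Sum>j\<in>J. B s j * v $ h j) = (\<Sum>b\<in>{0..<N}. B s (f b) * v $ h (f b))"
      using sum.reindex_bij_betw[OF f, of "\<lambda>j. B s j * v $ h j"] by simp
    also have "\<dots> = (A *\<^sub>v v) $ a"
      using a \<open>a < N\<close> v(1) by (auto simp: A_def scalar_prod_def hf intro!: sum.cong)
    also have "\<dots> = 0" using v(3) \<open>a < N\<close> by simp
    finally show "(\<Sum>j\<in>J. B s j * v $ h j) = 0" .
  qed
qed

text \<open>One argument with the adjugate matrix serves two coefficient rings: polynomials in one
  variable evaluated at a point, and polynomial functions on the parameter space evaluated at
  \<open>M0\<close>. The latter form only a subset of a function type, hence the carrier
  \<open>S\<close>.\<close>

locale evaluated_ring = comm_ring_hom ev
  for ev :: "'a::comm_ring_1 \<Rightarrow> complex" +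
  fixes S :: "'a set" and \<kappa> :: "complex \<Rightarrow> 'a"
  assumes S_add: "x \<in> S \<Longrightarrow> y \<in> S \<Longrightarrow> x + y \<in> S"
    and S_mult: "x \<in> S \<Longrightarrow> y \<in> S \<Longrightarrow> x * y \<in> S"
    and S_const: "\<kappa> c \<in> S"
    and const_0: "\<kappa> 0 = 0" and const_1: "\<kappa> 1 = 1" and const_m1: "\<kappa> (-1) = -1"
    and ev_const: "ev (\<kappa> c) = c"
begin

lemma S_0: "0 \<in> S" and S_1: "1 \<in> S" and S_m1: "-1 \<in> S"
  using S_const[of 0] S_const[of 1] S_const[of "-1"] by (simp_all add: const_0 const_1 const_m1)

lemma S_sum: "(\<And>i. i \<in> A \<Longrightarrow> g i \<in> S) \<Longrightarrow> sum g A \<in> S"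
  by (induction A rule: infinite_finite_induct) (auto intro: S_0 S_add)

lemma S_prod: "(\<And>i. i \<in> A \<Longrightarrow> g i \<in> S) \<Longrightarrow> prod g A \<in> S"
  by (induction A rule: infinite_finite_induct) (auto intro: S_1 S_mult)

lemma S_power: "x \<in> S \<Longrightarrow> x ^ k \<in> S"
  by (induction k) (auto intro: S_1 S_mult)

lemma S_det:
  assumes "A \<in> carrier_mat N N" "\<And>i j. i < N \<Longrightarrow> j < N \<Longrightarrow> A $$ (i, j) \<in> S"
  shows "det A \<in> S"
  unfolding det_def'[OF assms(1)]
proof (intro S_sum S_mult S_prod)
  fix p assume p: "p \<in> {p. p permutes {0..<N}}"
  show "signof p \<in> S" by (auto simp: sign_def intro: S_1 S_m1)
  fix i assume "i \<in> {0..<N}"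
  then show "A $$ (i, p i) \<in> S" using p by (intro assms(2)) (auto simp: permutes_in_image)
qed

lemma S_adj:
  assumes A: "A \<in> carrier_mat N N" and S: "\<And>i j. i < N \<Longrightarrow> j < N \<Longrightarrow> A $$ (i, j) \<in> S"
    and ij: "i < N" "j < N"
  shows "adj_mat A $$ (i, j) \<in> S"
proof -
  have "adj_mat A $$ (i, j) = cofactor A j i"
    using A ij by (simp add: adj_mat_def)
  also have "\<dots> \<in> S"
    unfolding cofactor_def
  proof (intro S_mult S_power S_m1 S_det)
    show "mat_delete A j i \<in> carrier_mat (N - 1) (N - 1)"
      using mat_delete_carrier A by simp
    fix i' j' assume "i' < N - 1" "j' < N - 1"
    then show "mat_delete A j i $$ (i', j') \<in> S"
      using A by (auto simp: mat_delete_def intro!: S)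
  qed
  finally show ?thesis .
qed

text \<open>The determinant of the Gram matrix \<open>ev(B)\<^sup>* B\<close> is a common denominator of a left inverse of
  \<open>B\<close>, and it does not vanish at the point where \<open>B\<close> is injective.\<close>

lemma left_inverse:
  fixes B :: "'r \<Rightarrow> 'i \<Rightarrow> 'a"
  assumes fin: "finite I" "finite R"
    and B: "\<forall>r\<in>R. \<forall>i\<in>I. B r i \<in> S"
    and inj: "\<forall>v. (\<forall>r\<in>R. (\<Sum>i\<in>I. ev (B r i) * v i) = 0) \<longrightarrow> (\<forall>i\<in>I. v i = 0)"
  shows "\<exists>L D. D \<in> S \<and> ev D \<noteq> 0 \<and> (\<forall>i\<in>I. \<forall>r\<in>R. L i r \<in> S) \<and>
    (\<forall>i\<in>I. \<forall>j\<in>I. (\<Sum>r\<in>R. L i r * B r j) = (if i = j then D else 0))"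
proof -
  define N where "N = card I"
  obtain f where f: "bij_betw f {0..<N} I"
    using ex_bij_betw_nat_finite[OF fin(1)] unfolding N_def by blast
  define h where "h = the_inv_into {0..<N} f"
  have hf: "h (f a) = a" if "a < N" for a
    unfolding h_def using f that by (intro the_inv_into_f_f) (auto simp: bij_betw_def)
  have fI: "f a \<in> I" if "a < N" for a using f that by (auto simp: bij_betw_def)
  have hI: "h i < N" "f (h i) = i" if i: "i \<in> I" for i
  proof -
    obtain a where "a < N" "f a = i" using f i by (metis atLeastLessThan_iff bij_betw_iff_bijections)
    then show "h i < N" "f (h i) = i" using hf by auto
  qed
  have sumI: "sum g I = (\<Sum>b<N. g (f b))" for g :: "'i \<Rightarrow> 'z::comm_monoid_add"
    using sum.reindex_bij_betw[OF f, of g] by (simp add: lessThan_atLeast0)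
  \<comment> \<open>Conjugation is not a polynomial operation, so only the value at the evaluation
    point is conjugated and then reinserted as a constant. At that point \<open>G\<close> still
    becomes the Gram matrix of \<open>B\<close>.\<close>
  define C where "C r i = \<kappa> (cnj (ev (B r i)))" for r i
  define G where "G = mat N N (\<lambda>(a, b). \<Sum>r\<in>R. C r (f a) * B r (f b))"
  have G: "G \<in> carrier_mat N N" by (simp add: G_def)
  have GS: "G $$ (a, b) \<in> S" if "a < N" "b < N" for a b
    using that by (auto simp: G_def C_def intro!: S_sum S_mult S_const B[rule_format] fI)
  define D where "D = det G"
  define L where "L i r = (\<Sum>a<N. adj_mat G $$ (h i, a) * C r (f a))" for i r
  show ?thesis
  proof (intro exI[of _ L] exI[of _ D] conjI ballI)
    show "D \<in> S" unfolding D_def by (rule S_det[OF G GS])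
    show "ev D \<noteq> 0"
    proof
      assume "ev D = 0"
      then have "det (map_mat ev G) = 0" by (simp add: D_def)
      moreover have mG: "map_mat ev G \<in> carrier_mat N N" using G by simp
      ultimately obtain v where v: "v \<in> carrier_vec N" "v \<noteq> 0\<^sub>v N" "map_mat ev G *\<^sub>v v = 0\<^sub>v N"
        using det_0_iff_vec_prod_zero by blast
      define w where "w r = (\<Sum>i\<in>I. ev (B r i) * v $ h i)" for r
      have w: "w r = (\<Sum>b<N. ev (B r (f b)) * v $ b)" for r
        unfolding w_def sumI by (intro sum.cong) (auto simp: hf)
      have row: "(\<Sum>r\<in>R. cnj (ev (B r (f a))) * w r) = 0" if "a < N" for a
      proof -
        have "0 = (map_mat ev G *\<^sub>v v) $ a" using v(3) that by simp
        also have "\<dots> = (\<Sum>b<N. (\<Sum>r\<in>R. cnj (ev (B r (f a))) * ev (B r (f b))) * v $ b)"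
          using that v(1)
          by (auto simp: G_def C_def scalar_prod_def hom_sum hom_mult ev_const lessThan_atLeast0 intro!: sum.cong)
        also have "\<dots> = (\<Sum>b<N. \<Sum>r\<in>R. cnj (ev (B r (f a))) * (ev (B r (f b)) * v $ b))"
          by (simp add: sum_distrib_right mult.assoc)
        also have "\<dots> = (\<Sum>r\<in>R. \<Sum>b<N. cnj (ev (B r (f a))) * (ev (B r (f b)) * v $ b))"
          by (rule sum.swap)
        also have "\<dots> = (\<Sum>r\<in>R. cnj (ev (B r (f a))) * w r)"
          by (simp add: w sum_distrib_left)
        finally show ?thesis by simp
      qed
      \<comment> \<open>For a kernel vector \<open>v\<close> of the Gram matrix, the squared norm of
        \<open>w\<close> = B v equals v* G v = 0, so \<open>v\<close> is already in the kernel of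
        \<open>B\<close>.\<close>
      have "(\<Sum>r\<in>R. cnj (w r) * w r) = (\<Sum>r\<in>R. \<Sum>a<N. cnj (v $ a) * (cnj (ev (B r (f a))) * w r))"
        by (subst (1) w) (simp add: sum_distrib_left sum_distrib_right mult_ac)
      also have "\<dots> = (\<Sum>a<N. \<Sum>r\<in>R. cnj (v $ a) * (cnj (ev (B r (f a))) * w r))"
        by (rule sum.swap)
      also have "\<dots> = (\<Sum>a<N. cnj (v $ a) * (\<Sum>r\<in>R. cnj (ev (B r (f a))) * w r))"
        by (simp add: sum_distrib_left)
      also have "\<dots> = 0" using row by simp
      finally have "(\<Sum>r\<in>R. cnj (w r) * w r) = 0" .
      moreover have "cnj z * z = of_real ((cmod z)\<^sup>2)" for z
        using complex_norm_square[of z] by (simp add: mult.commute)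
      ultimately have "of_real (\<Sum>r\<in>R. (cmod (w r))\<^sup>2) = (0::complex)" by simp
      then have "(\<Sum>r\<in>R. (cmod (w r))\<^sup>2) = 0" using of_real_eq_0_iff by blast
      then have "\<forall>r\<in>R. w r = 0"
        using fin(2) by (subst (asm) sum_nonneg_eq_0_iff) auto
      then have "\<forall>i\<in>I. v $ h i = 0" unfolding w_def using inj[rule_format, of "\<lambda>i. v $ h i"] by blast
      then have "\<And>a. a < N \<Longrightarrow> v $ a = 0" using fI hf by metis
      with v(1,2) show False by (metis carrier_vecD dim_vec eq_vecI index_zero_vec)
    qed
    show "L i r \<in> S" if "i \<in> I" "r \<in> R" for i r
      unfolding L_def C_def by (intro S_sum S_mult S_const S_adj[OF G GS]) (auto simp: hI that)
    fix i j assume ij: "i \<in> I" "j \<in> I"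
    have "(\<Sum>r\<in>R. L i r * B r j) = (\<Sum>r\<in>R. \<Sum>a<N. adj_mat G $$ (h i, a) * (C r (f a) * B r j))"
      by (simp add: L_def sum_distrib_right mult.assoc)
    also have "\<dots> = (\<Sum>a<N. \<Sum>r\<in>R. adj_mat G $$ (h i, a) * (C r (f a) * B r j))"
      by (rule sum.swap)
    also have "\<dots> = (\<Sum>a<N. adj_mat G $$ (h i, a) * G $$ (a, h j))"
      using hI[OF ij(2)] by (simp add: G_def sum_distrib_left)
    also have "\<dots> = (adj_mat G * G) $$ (h i, h j)"
      using adj_mat(1)[OF G] G hI[OF ij(1)] hI[OF ij(2)]
      by (simp add: scalar_prod_def lessThan_atLeast0)
    also have "\<dots> = (if h i = h j then D else 0)"
      using hI[OF ij(1)] hI[OF ij(2)] by (simp add: adj_mat(3)[OF G] D_def)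
    also have "\<dots> = (if i = j then D else 0)"
      using hI[OF ij(1)] hI[OF ij(2)] by metis
    finally show "(\<Sum>r\<in>R. L i r * B r j) = (if i = j then D else 0)" .
  qed
qed

end

section \<open>Openness of injectivity in the parameter\<close>

lemma evaluated_ring_poly:
  "evaluated_ring (\<lambda>p. poly p z) UNIV (\<lambda>c. [:c:])"
  by unfold_locales (auto simp: one_pCons)

lemma evaluated_ring_poly_funs:
  "evaluated_ring (\<lambda>f. f M0) (poly_funs H s) (\<lambda>c _. c)"
  by unfold_locales
    (auto intro: poly_funs.intros simp: plus_fun_def times_fun_def zero_fun_def one_fun_def fun_eq_iff)

lemma sum_fun_apply: "(\<Sum>i\<in>A. f i) x = (\<Sum>i\<in>A. f i x)"
  by (induction A rule: infinite_finite_induct) auto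

lemma poly_funs_left_inverse:
  fixes B :: "'r \<Rightarrow> 'i \<Rightarrow> 'w::plus \<Rightarrow> complex"
  assumes fin: "finite I" "finite R"
    and B: "\<forall>r\<in>R. \<forall>i\<in>I. B r i \<in> poly_funs H s"
    and inj: "\<forall>v. (\<forall>r\<in>R. (\<Sum>i\<in>I. B r i M0 * v i) = 0) \<longrightarrow> (\<forall>i\<in>I. v i = 0)"
  shows "\<exists>L D. D \<in> poly_funs H s \<and> D M0 \<noteq> 0 \<and> (\<forall>i\<in>I. \<forall>r\<in>R. L i r \<in> poly_funs H s) \<and>
    (\<forall>i\<in>I. \<forall>j\<in>I. \<forall>M. (\<Sum>r\<in>R. L i r M * B r j M) = (if i = j then D M else 0))"
proof -
  interpret evaluated_ring "\<lambda>f. f M0" "poly_funs H s" "\<lambda>c _. c"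
    by (rule evaluated_ring_poly_funs)
  obtain L D where LD: "D \<in> poly_funs H s" "D M0 \<noteq> 0"
    "\<forall>i\<in>I. \<forall>r\<in>R. L i r \<in> poly_funs H s"
    "\<forall>i\<in>I. \<forall>j\<in>I. (\<Sum>r\<in>R. L i r * B r j) = (if i = j then D else 0)"
    using left_inverse[OF fin B inj] by blast
  have "(\<Sum>r\<in>R. L i r M * B r j M) = (if i = j then D M else 0)" if "i \<in> I" "j \<in> I" for i j M
  proof -
    from LD(4) that have "(\<Sum>r\<in>R. L i r * B r j) M = (if i = j then D else 0) M" by simp
    then show ?thesis by (simp add: sum_fun_apply split: if_splits)
  qed
  with LD(1-3) show ?thesis by blast
qed

text \<open>Applying the left inverse to \<open>B M v = 0\<close> gives \<open>D M * v = 0\<close>,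
  so injectivity at \<open>M0\<close> persists wherever the common denominator \<open>D\<close> does
  not vanish.\<close>

lemma poly_funs_generic_inj:
  fixes B :: "'r \<Rightarrow> 'i \<Rightarrow> 'w::plus \<Rightarrow> complex"
  assumes fin: "finite I" "finite R"
    and B: "\<forall>r\<in>R. \<forall>i\<in>I. B r i \<in> poly_funs H s"
    and inj: "\<forall>v. (\<forall>r\<in>R. (\<Sum>i\<in>I. B r i M0 * v i) = 0) \<longrightarrow> (\<forall>i\<in>I. v i = 0)"
  shows "\<exists>D\<in>poly_funs H s. D M0 \<noteq> 0 \<and>
    (\<forall>M. D M \<noteq> 0 \<longrightarrow> (\<forall>v. (\<forall>r\<in>R. (\<Sum>i\<in>I. B r i M * v i) = 0) \<longrightarrow> (\<forall>i\<in>I. v i = 0)))"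
proof -
  obtain L D where LD: "D \<in> poly_funs H s" "D M0 \<noteq> 0"
    "\<forall>i\<in>I. \<forall>j\<in>I. \<forall>M. (\<Sum>r\<in>R. L i r M * B r j M) = (if i = j then D M else 0)"
    using poly_funs_left_inverse[OF fin B inj] by blast
  have "v i = 0"
    if M: "D M \<noteq> 0" "\<forall>r\<in>R. (\<Sum>i\<in>I. B r i M * v i) = 0" "i \<in> I" for M v i
  proof -
    have "D M * v i = (\<Sum>j\<in>I. (if i = j then D M else 0) * v j)"
      using M(3) fin(1) by (simp add: if_distrib[of "\<lambda>x. x * _"] cong: if_cong)
    also have "\<dots> = (\<Sum>j\<in>I. (\<Sum>r\<in>R. L i r M * B r j M) * v j)"
      using LD(3) M(3) by (intro sum.cong) auto
    also have "\<dots> = (\<Sum>j\<in>I. \<Sum>r\<in>R. L i r M * (B r j M * v j))"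
      by (simp add: sum_distrib_right mult.assoc)
    also have "\<dots> = (\<Sum>r\<in>R. \<Sum>j\<in>I. L i r M * (B r j M * v j))"
      by (rule sum.swap)
    also have "\<dots> = (\<Sum>r\<in>R. L i r M * (\<Sum>j\<in>I. B r j M * v j))"
      by (simp add: sum_distrib_left)
    also have "\<dots> = 0" using M(2) by simp
    finally show "v i = 0" using M(1) by simp
  qed
  with LD(1,2) show ?thesis by blast
qed

subsection \<open>Monomials and points\<close>

text \<open>A monomial is encoded as the multiset of its variable indices: products become sums of
  multisets and the degree is the size.\<close>

definition mons :: "nat \<Rightarrow> nat \<Rightarrow> nat multiset set"
  where "mons n d = {\<alpha>. size \<alpha> = d \<and> set_mset \<alpha> \<subseteq> {..n}}"

definition mev :: "(nat \<Rightarrow> 'a::comm_monoid_mult) \<Rightarrow> nat multiset \<Rightarrow> 'a"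
  where "mev x \<alpha> = prod_mset (image_mset x \<alpha>)"

definition linform :: "nat \<Rightarrow> (nat \<Rightarrow> complex) \<Rightarrow> (nat \<Rightarrow> complex) \<Rightarrow> complex"
  where "linform n l x = (\<Sum>i\<le>n. l i * x i)"

definition nonzero :: "nat \<Rightarrow> (nat \<Rightarrow> complex) \<Rightarrow> bool"
  where "nonzero n x \<longleftrightarrow> (\<exists>i\<le>n. x i \<noteq> 0)"

text \<open>Some 2 x 2 minor is nonzero; for nonzero \<open>x\<close> and \<open>y\<close> this says
  that they represent different points of projective space.\<close>

definition nonprop :: "nat \<Rightarrow> (nat \<Rightarrow> complex) \<Rightarrow> (nat \<Rightarrow> complex) \<Rightarrow> bool"
  where "nonprop n x y \<longleftrightarrow> (\<exists>i\<le>n. \<exists>j\<le>n. x i * y j \<noteq> x j * y i)"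

lemma finite_mons: "finite (mons n d)"
proof -
  have "mons n d \<subseteq> mset ` {xs. set xs \<subseteq> {..n} \<and> length xs = d}"
  proof
    fix \<alpha> assume a: "\<alpha> \<in> mons n d"
    obtain xs where "mset xs = \<alpha>" using ex_mset by blast
    then show "\<alpha> \<in> mset ` {xs. set xs \<subseteq> {..n} \<and> length xs = d}"
      using a by (intro image_eqI[of \<alpha> mset xs]) (auto simp: mons_def)
  qed
  then show ?thesis by (rule finite_subset) (simp add: finite_lists_length_eq)
qed

lemma add_mset_mons: "i \<le> n \<Longrightarrow> \<alpha> \<in> mons n d \<Longrightarrow> add_mset i \<alpha> \<in> mons n (Suc d)"
  by (auto simp: mons_def)

lemma plus_mons: "\<alpha> \<in> mons n d \<Longrightarrow> \<beta> \<in> mons n e \<Longrightarrow> \<alpha> + \<beta> \<in> mons n (d + e)"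
  by (auto simp: mons_def)

lemma replicate_mons: "i \<le> n \<Longrightarrow> replicate_mset d i \<in> mons n d"
  by (cases d) (auto simp: mons_def)

lemma mons_Suc: "\<alpha> \<in> mons n (Suc d) \<Longrightarrow> \<exists>i\<le>n. \<exists>\<beta>\<in>mons n d. \<alpha> = add_mset i \<beta>"
proof -
  assume a: "\<alpha> \<in> mons n (Suc d)"
  then obtain i \<beta> where i: "\<alpha> = add_mset i \<beta>"
    using size_eq_Suc_imp_eq_union[of \<alpha> d] by (auto simp: mons_def)
  then have "i \<le> n" "\<beta> \<in> mons n d" using a by (auto simp: mons_def)
  with i show ?thesis by blast
qed

lemma mev_empty [simp]: "mev x {#} = 1"
  by (simp add: mev_def)

lemma mev_add_mset [simp]: "mev x (add_mset i \<alpha>) = x i * mev x \<alpha>"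
  by (simp add: mev_def)

lemma mev_plus: "mev x (\<alpha> + \<beta>) = mev x \<alpha> * mev x \<beta>"
  by (simp add: mev_def)

lemma mev_replicate: "mev x (replicate_mset d i) = x i ^ d"
  by (induction d) (auto simp: mev_def)

lemma poly_mev: "poly (mev x \<alpha>) z = mev (\<lambda>i. poly (x i) z) \<alpha>"
  by (induction \<alpha>) auto

lemma mev_cong: "\<alpha> \<in> mons n d \<Longrightarrow> (\<And>i. i \<le> n \<Longrightarrow> x i = y i) \<Longrightarrow> mev x \<alpha> = mev y \<alpha>"
  unfolding mev_def by (rule arg_cong[of _ _ prod_mset], rule image_mset_cong) (auto simp: mons_def)

text \<open>Linear forms on the moment curve suffice: the form with coefficients 1, z, ..., z^n
  vanishes at \<open>q\<close> only if z is a root of the nonzero polynomial with coefficients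
  \<open>q\<close>, and finitely many roots can be avoided.\<close>

lemma ex_separating_linform:
  assumes "finite Q" "\<And>q. q \<in> Q \<Longrightarrow> nonzero n q"
  shows "\<exists>l. \<forall>q\<in>Q. linform n l q \<noteq> 0"
proof -
  define P where "P q = (\<Sum>i\<le>n. monom (q i) i)" for q :: "nat \<Rightarrow> complex"
  have "P q \<noteq> 0" if q: "q \<in> Q" for q
  proof -
    obtain j where j: "j \<le> n" "q j \<noteq> 0" using assms(2)[OF q] by (auto simp: nonzero_def)
    have "coeff (P q) j = q j" using j(1) by (simp add: P_def coeff_sum)
    then show ?thesis using j(2) by auto
  qed
  then have "finite (\<Union>q\<in>Q. {z. poly (P q) z = 0})"
    using assms(1) by (auto intro: poly_roots_finite)
  then obtain z where z: "z \<notin> (\<Union>q\<in>Q. {z. poly (P q) z = 0})"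
    using ex_new_if_finite[OF infinite_UNIV_char_0] by blast
  show ?thesis
  proof (intro exI[of _ "\<lambda>i. z ^ i"] ballI)
    fix q assume "q \<in> Q"
    then have "poly (P q) z \<noteq> 0" using z by auto
    then show "linform n (\<lambda>i. z ^ i) q \<noteq> 0"
      by (simp add: P_def linform_def poly_sum poly_monom mult.commute)
  qed
qed

text \<open>Representatives of finitely many distinct points of projective space, one for each
  point.\<close>

definition point_set :: "nat \<Rightarrow> (nat \<Rightarrow> complex) set \<Rightarrow> bool"
  where "point_set n P \<longleftrightarrow> finite P \<and> (\<forall>p\<in>P. nonzero n p) \<and>
    (\<forall>p\<in>P. \<forall>q\<in>P. p \<noteq> q \<longrightarrow> nonprop n p q)"

text \<open>A relation in degree \<open>Suc d\<close>, contracted with a linear form that vanishes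
  at \<open>p\<close> but not at \<open>q\<close>, becomes a relation in degree \<open>d\<close>
  that involves one point fewer and still sees \<open>q\<close>. So d + 1 distinct points impose
  independent conditions on forms of degree d.\<close>

lemma mev_independent:
  assumes "point_set n P" "card P \<le> Suc d" "\<forall>\<alpha>\<in>mons n d. (\<Sum>p\<in>P. c p * mev p \<alpha>) = 0"
  shows "\<forall>p\<in>P. c p = 0"
  using assms
proof (induction d arbitrary: P c)
  case 0
  have "finite P" using 0 by (simp add: point_set_def)
  show ?case
  proof
    fix q assume "q \<in> P"
    then have "P = {q}" using 0(2) \<open>finite P\<close> by (auto simp: card_le_Suc0_iff_eq)
    then show "c q = 0" using 0(3) by (auto simp: mons_def)
  qed
next
  case (Suc d)
  have fin: "finite P" using Suc.prems by (simp add: point_set_def)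
  show ?case
  proof
    fix q assume q: "q \<in> P"
    show "c q = 0"
    proof (cases "P = {q}")
      case True
      obtain i where i: "i \<le> n" "q i \<noteq> 0" using Suc.prems(1) q by (auto simp: nonzero_def point_set_def)
      then show ?thesis
        using bspec[OF Suc.prems(3) replicate_mons[of i n "Suc d"]] True
        by (simp add: mev_replicate del: replicate_mset_Suc)
    next
      case False
      then obtain p where p: "p \<in> P" "p \<noteq> q" using q by blast
      then have "nonprop n p q" using Suc.prems(1) q by (simp add: point_set_def)
      then obtain u v where uv: "u \<le> n" "v \<le> n" "p u * q v \<noteq> p v * q u"
        by (auto simp: nonprop_def)
      define l where "l x = p u * x v - p v * x u" for x :: "nat \<Rightarrow> complex"
      have "\<forall>x\<in>P - {p}. c x * l x = 0"
      proof (rule Suc.IH)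
        show "card (P - {p}) \<le> Suc d" using Suc.prems(2) fin p(1) by simp
        show "point_set n (P - {p})" using Suc.prems(1) by (auto simp: point_set_def)
        show "\<forall>\<alpha>\<in>mons n d. (\<Sum>x\<in>P - {p}. c x * l x * mev x \<alpha>) = 0"
        proof
          fix \<alpha> assume a: "\<alpha> \<in> mons n d"
          have "(\<Sum>x\<in>P. c x * l x * mev x \<alpha>) =
              c p * l p * mev p \<alpha> + (\<Sum>x\<in>P - {p}. c x * l x * mev x \<alpha>)"
            using fin p(1) by (rule sum.remove)
          then have "(\<Sum>x\<in>P - {p}. c x * l x * mev x \<alpha>) = (\<Sum>x\<in>P. c x * l x * mev x \<alpha>)"
            by (simp add: l_def)
          also have "\<dots> = p u * (\<Sum>x\<in>P. c x * mev x (add_mset v \<alpha>)) - p v * (\<Sum>x\<in>P. c x * mev x (add_mset u \<alpha>))"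
            unfolding sum_distrib_left sum_subtractf[symmetric]
            by (intro sum.cong) (auto simp: l_def algebra_simps)
          also have "\<dots> = 0"
            using bspec[OF Suc.prems(3) add_mset_mons[OF uv(1) a]] bspec[OF Suc.prems(3) add_mset_mons[OF uv(2) a]]
            by simp
          finally show "(\<Sum>x\<in>P - {p}. c x * l x * mev x \<alpha>) = 0" .
        qed
      qed
      then have "c q * l q = 0" using q p(2) by blast
      moreover have "l q \<noteq> 0" using uv(3) by (simp add: l_def)
      ultimately show ?thesis by simp
    qed
  qed
qed

subsection \<open>Systems of homogeneous equations depending linearly on a parameter\<close>

text \<open>Here \<open>c J \<beta> M\<close> is the coefficient of the monomial
  \<open>\<beta>\<close> in the form with index \<open>J\<close>. The parameter space stays
  abstract, so that the count of zeros is separate from the coordinates on spaces of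
  tensors.\<close>

locale poly_system =
  fixes n e :: nat and R :: "'j set"
    and c :: "'j \<Rightarrow> nat multiset \<Rightarrow> 'h::plus \<Rightarrow> complex"
    and H :: "'h set" and s :: "complex \<Rightarrow> 'h \<Rightarrow> 'h"
  assumes finite_R: "finite R"
    and c_linear: "J \<in> R \<Longrightarrow> \<beta> \<in> mons n e \<Longrightarrow> linear_on H s (*) (c J \<beta>)"
begin

definition zero_at :: "'h \<Rightarrow> (nat \<Rightarrow> complex) \<Rightarrow> bool"
  where "zero_at M x \<longleftrightarrow> (\<forall>J\<in>R. (\<Sum>\<beta>\<in>mons n e. c J \<beta> M * mev x \<beta>) = 0)"

text \<open>The functionals on forms of degree \<open>d\<close>, given by their values on monomials, that annihilate the
  degree \<open>d\<close> part of the ideal generated by the equations with parameter \<open>M\<close>.\<close>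

definition ann :: "'h \<Rightarrow> nat \<Rightarrow> (nat multiset \<Rightarrow> complex) set"
  where "ann M d = {\<mu>. \<forall>J\<in>R. \<forall>k. \<forall>\<gamma>\<in>mons n k. d = e + k \<longrightarrow>
    (\<Sum>\<beta>\<in>mons n e. c J \<beta> M * \<mu> (\<beta> + \<gamma>)) = 0}"

text \<open>Dually, the monomials in \<open>T\<close> span the degree \<open>d\<close> part of the
  quotient by the ideal, so \<open>card T\<close> bounds its dimension.\<close>

definition determines :: "'h \<Rightarrow> nat \<Rightarrow> nat multiset set \<Rightarrow> bool"
  where "determines M d T \<longleftrightarrow> T \<subseteq> mons n d \<and>
    (\<forall>\<mu>\<in>ann M d. (\<forall>\<alpha>\<in>T. \<mu> \<alpha> = 0) \<longrightarrow> (\<forall>\<alpha>\<in>mons n d. \<mu> \<alpha> = 0))"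

text \<open>The linear polynomials in t are the coefficients of the equations at (1 - t) M0 + t M.
  The approximate solution \<open>x\<close> may be a different one for each order \<open>k\<close>;
  neither compatibility nor convergence is required.\<close>

definition lifts :: "'h \<Rightarrow> 'h \<Rightarrow> (nat \<Rightarrow> complex) \<Rightarrow> bool"
  where "lifts M0 M p \<longleftrightarrow> (\<forall>k. \<exists>x. (\<forall>i\<le>n. poly (x i) 0 = p i) \<and>
    (\<forall>J\<in>R. [:0, 1:] ^ k dvd
      (\<Sum>\<beta>\<in>mons n e. [:c J \<beta> M0, c J \<beta> M - c J \<beta> M0:] * mev x \<beta>)))"

lemma zero_at_imp_ann: "zero_at M x \<Longrightarrow> mev x \<in> ann M d"
proof -
  assume x: "zero_at M x"
  have "(\<Sum>\<beta>\<in>mons n e. c J \<beta> M * mev x (\<beta> + \<gamma>)) = 0" if "J \<in> R" for J \<gamma>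
  proof -
    have "(\<Sum>\<beta>\<in>mons n e. c J \<beta> M * mev x (\<beta> + \<gamma>)) = (\<Sum>\<beta>\<in>mons n e. c J \<beta> M * mev x \<beta>) * mev x \<gamma>"
      by (simp add: sum_distrib_right mev_plus mult.assoc)
    also have "\<dots> = 0" using x that by (simp add: zero_at_def)
    finally show ?thesis .
  qed
  then show ?thesis by (simp add: ann_def)
qed

lemma ann_add: "\<mu> \<in> ann M d \<Longrightarrow> \<nu> \<in> ann M d \<Longrightarrow> (\<lambda>\<alpha>. \<mu> \<alpha> + \<nu> \<alpha>) \<in> ann M d"
  by (auto simp: ann_def distrib_left sum.distrib)

lemma ann_scale: "\<mu> \<in> ann M d \<Longrightarrow> (\<lambda>\<alpha>. z * \<mu> \<alpha>) \<in> ann M d"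
  by (auto simp: ann_def mult.left_commute[of _ z] simp flip: sum_distrib_left)

lemma ann_zero: "(\<lambda>_. 0) \<in> ann M d"
  by (auto simp: ann_def)

lemma ann_sum: "(\<And>i. i \<in> I \<Longrightarrow> \<mu> i \<in> ann M d) \<Longrightarrow> (\<lambda>\<alpha>. \<Sum>i\<in>I. z i * \<mu> i \<alpha>) \<in> ann M d"
  by (induction I rule: infinite_finite_induct) (auto intro!: ann_add ann_scale ann_zero)

lemma ann_cong:
  assumes "\<mu> \<in> ann M d" "\<And>\<alpha>. \<alpha> \<in> mons n d \<Longrightarrow> \<mu> \<alpha> = \<nu> \<alpha>"
  shows "\<nu> \<in> ann M d"
  unfolding ann_def
proof (safe)
  fix J k \<gamma> assume J: "J \<in> R" "\<gamma> \<in> mons n k" "d = e + k"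
  have "(\<Sum>\<beta>\<in>mons n e. c J \<beta> M * \<nu> (\<beta> + \<gamma>)) = (\<Sum>\<beta>\<in>mons n e. c J \<beta> M * \<mu> (\<beta> + \<gamma>))"
    using J by (intro sum.cong refl) (simp add: assms(2) plus_mons)
  also have "\<dots> = 0" using assms(1) J by (auto simp: ann_def)
  finally show "(\<Sum>\<beta>\<in>mons n e. c J \<beta> M * \<nu> (\<beta> + \<gamma>)) = 0" .
qed

lemma ann_shift_plus:
  assumes "\<mu> \<in> ann M (d + k)" "\<gamma> \<in> mons n k"
  shows "(\<lambda>\<alpha>. \<mu> (\<alpha> + \<gamma>)) \<in> ann M d"
  unfolding ann_def
proof (safe)
  fix J k' \<gamma>' assume J: "J \<in> R" "\<gamma>' \<in> mons n k'" "d = e + k'"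
  then have "\<gamma>' + \<gamma> \<in> mons n (k' + k)" using assms(2) by (intro plus_mons)
  then have "(\<Sum>\<beta>\<in>mons n e. c J \<beta> M * \<mu> (\<beta> + (\<gamma>' + \<gamma>))) = 0"
    using assms(1) J by (auto simp: ann_def)
  then show "(\<Sum>\<beta>\<in>mons n e. c J \<beta> M * \<mu> (\<beta> + \<gamma>' + \<gamma>)) = 0" by (simp add: add.assoc)
qed

lemma ann_shift: "\<mu> \<in> ann M (Suc d) \<Longrightarrow> i \<le> n \<Longrightarrow> (\<lambda>\<alpha>. \<mu> (add_mset i \<alpha>)) \<in> ann M d"
  using ann_shift_plus[of \<mu> M d 1 "{#i#}"] by (simp add: mons_def)

text \<open>The coefficient of \<open>\<delta>\<close> in the product of the equation
  \<open>J\<close> with the monomial \<open>\<gamma>\<close>. With rows \<open>(J, \<gamma>)\<close>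
  this is the Macaulay matrix of the ideal, whose kernel is \<open>ann\<close>.\<close>

definition entry :: "'j \<Rightarrow> nat multiset \<Rightarrow> nat multiset \<Rightarrow> 'h \<Rightarrow> complex"
  where "entry J \<gamma> \<delta> M = (\<Sum>\<beta>\<in>mons n e. if \<beta> + \<gamma> = \<delta> then c J \<beta> M else 0)"

lemma sum_delta_mons:
  fixes g :: "nat multiset \<Rightarrow> 'a::comm_ring_1"
  assumes "\<gamma> \<in> mons n k"
  shows "(\<Sum>\<delta>\<in>mons n (e + k). (\<Sum>\<beta>\<in>mons n e. if \<beta> + \<gamma> = \<delta> then f \<beta> else 0) * g \<delta>) =
    (\<Sum>\<beta>\<in>mons n e. f \<beta> * g (\<beta> + \<gamma>))"
proof -
  have "(\<Sum>\<delta>\<in>mons n (e + k). (\<Sum>\<beta>\<in>mons n e. if \<beta> + \<gamma> = \<delta> then f \<beta> else 0) * g \<delta>) =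
    (\<Sum>\<delta>\<in>mons n (e + k). \<Sum>\<beta>\<in>mons n e. if \<beta> + \<gamma> = \<delta> then f \<beta> * g \<delta> else 0)"
    by (simp add: sum_distrib_right if_distrib[of "\<lambda>x. x * _"] cong: if_cong)
  also have "\<dots> = (\<Sum>\<beta>\<in>mons n e. \<Sum>\<delta>\<in>mons n (e + k). if \<beta> + \<gamma> = \<delta> then f \<beta> * g \<delta> else 0)"
    by (rule sum.swap)
  also have "\<dots> = (\<Sum>\<beta>\<in>mons n e. f \<beta> * g (\<beta> + \<gamma>))"
    using plus_mons[OF _ assms] by (intro sum.cong) (auto simp: finite_mons)
  finally show ?thesis .
qed

lemma entry_sum:
  assumes "\<gamma> \<in> mons n k"
  shows "(\<Sum>\<delta>\<in>mons n (e + k). entry J \<gamma> \<delta> M * \<mu> \<delta>) = (\<Sum>\<beta>\<in>mons n e. c J \<beta> M * \<mu> (\<beta> + \<gamma>))"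
  unfolding entry_def by (rule sum_delta_mons[OF assms])

lemma ann_iff_entry:
  "\<mu> \<in> ann M (e + k) \<longleftrightarrow> (\<forall>r\<in>R \<times> mons n k. (\<Sum>\<delta>\<in>mons n (e + k). entry (fst r) (snd r) \<delta> M * \<mu> \<delta>) = 0)"
  unfolding ann_def by (auto simp: entry_sum)

lemma poly_funs_sum: "(\<And>i. i \<in> I \<Longrightarrow> f i \<in> poly_funs H s) \<Longrightarrow> (\<lambda>M. \<Sum>i\<in>I. f i M) \<in> poly_funs H s"
  by (induction I rule: infinite_finite_induct) (auto intro: poly_funs.const poly_funs.add)

lemma entry_poly_funs:
  assumes "J \<in> R"
  shows "entry J \<gamma> \<delta> \<in> poly_funs H s"
  unfolding entry_def[abs_def]
proof (rule poly_funs_sum)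
  fix \<beta> assume "\<beta> \<in> mons n e"
  with assms show "(\<lambda>M. if \<beta> + \<gamma> = \<delta> then c J \<beta> M else 0) \<in> poly_funs H s"
    by (cases "\<beta> + \<gamma> = \<delta>") (simp_all add: poly_funs.const poly_funs.lin c_linear)
qed

text \<open>Evaluations at zeros lie in \<open>ann M d\<close>. If there were more of them than
  elements of \<open>T\<close>, a nontrivial combination would vanish on \<open>T\<close>, hence
  everywhere, against \<open>mev_independent\<close>.\<close>

lemma card_zeros_le:
  assumes Q: "point_set n Q" "card Q \<le> Suc d" "\<forall>q\<in>Q. zero_at M q" and T: "determines M d T"
  shows "card Q \<le> card T"
proof (rule ccontr)
  assume less: "\<not> card Q \<le> card T"
  have finT: "finite T" using T finite_subset[OF _ finite_mons] by (auto simp: determines_def)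
  have finQ: "finite Q" using Q(1) by (simp add: point_set_def)
  obtain z where z: "\<exists>q\<in>Q. z q \<noteq> 0" "\<forall>\<alpha>\<in>T. (\<Sum>q\<in>Q. mev q \<alpha> * z q) = 0"
    using underdetermined_system[OF finT finQ, of "\<lambda>\<alpha> q. mev q \<alpha>"] less by (meson not_le)
  have "(\<lambda>\<alpha>. \<Sum>q\<in>Q. z q * mev q \<alpha>) \<in> ann M d"
    using Q(3) by (intro ann_sum zero_at_imp_ann) simp
  then have "\<forall>\<alpha>\<in>mons n d. (\<Sum>q\<in>Q. z q * mev q \<alpha>) = 0"
    using T z(2) by (auto simp: determines_def mult.commute)
  then have "\<forall>q\<in>Q. z q = 0" by (rule mev_independent[OF Q(1,2)])
  then show False using z(1) by blast
qed

end

section \<open>The annihilator does not shrink: lifting modulo powers of t\<close>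

lemma divide_common_power:
  fixes C :: "'p \<Rightarrow> complex poly"
  assumes "p0 \<in> P" "C p0 \<noteq> 0"
  shows "\<exists>r C'. (\<forall>p\<in>P. C p = [:0, 1:] ^ r * C' p) \<and> (\<exists>p\<in>P. poly (C' p) 0 \<noteq> 0)"
  using assms(2)
proof (induction "degree (C p0)" arbitrary: C rule: less_induct)
  case less
  show ?case
  proof (cases "\<exists>p\<in>P. poly (C p) 0 \<noteq> 0")
    case True
    then show ?thesis by (intro exI[of _ 0] exI[of _ C]) auto
  next
    case False
    then have "\<forall>p\<in>P. \<exists>q. C p = [:0, 1:] * q"
      using poly_eq_0_iff_dvd[of _ 0] by (auto simp: dvd_def)
    then obtain C1 where C1: "\<And>p. p \<in> P \<Longrightarrow> C p = [:0, 1:] * C1 p"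
      using bchoice[of P "\<lambda>p q. C p = [:0, 1:] * q"] by blast
    have nz: "C1 p0 \<noteq> 0" using less.prems C1[OF assms(1)] by auto
    have "degree (C1 p0) < degree (C p0)"
      using nz by (simp add: C1[OF assms(1)] degree_mult_eq)
    from less.hyps[of C1, OF this nz] obtain r C' where
      C': "\<forall>p\<in>P. C1 p = [:0, 1:] ^ r * C' p" "\<exists>p\<in>P. poly (C' p) 0 \<noteq> 0" by blast
    have "\<forall>p\<in>P. C p = [:0, 1:] ^ Suc r * C' p"
      using C1 C'(1) by (simp add: mult.assoc)
    with C'(2) show ?thesis by blast
  qed
qed

text \<open>Since \<open>y\<close> does not vanish at 0, the order of \<open>D * y\<close> there is
  that of \<open>D\<close>, which is at most its degree.\<close>

lemma power_dvd_mult_imp_le_degree: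
  fixes D y :: "complex poly"
  assumes "[:0, 1:] ^ k dvd D * y" "poly y 0 \<noteq> 0" "D \<noteq> 0"
  shows "k \<le> degree D"
proof -
  have "y \<noteq> 0" using assms(2) by auto
  have "k \<le> order 0 (D * y)"
    using assms(1,3) \<open>y \<noteq> 0\<close> order_divides[of 0 k "D * y"] by simp
  also have "\<dots> = order 0 D"
    using assms(2,3) \<open>y \<noteq> 0\<close> by (simp add: order_mult order_0I)
  also have "\<dots> \<le> degree D" by (rule order_degree[OF assms(3)])
  finally show ?thesis .
qed

context poly_system
begin

text \<open>If fewer than \<open>card P\<close> conditions cut the annihilator at \<open>M\<close> down to zero, a nonzero polynomial
  \<open>D(t)\<close> witnesses this along the line from \<open>M0\<close> to \<open>M\<close>; the lifted points produce a solution
  modulo \<open>t\<^sup>k\<close> that is nonzero at \<open>t = 0\<close>, hence \<open>t\<^sup>k\<close> divides \<open>D\<close> for every \<open>k\<close>.\<close>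

lemma ann_dim_ge:
  assumes P: "point_set n P" "card P \<le> Suc d"
    and lifts: "\<forall>p\<in>P. lifts M0 M p"
    and d: "e \<le> d" and T: "T \<subseteq> mons n d" "card T < card P"
  shows "\<not> determines M d T"
proof
  assume det: "determines M d T"
  define k where "k = d - e"
  have dk: "d = e + k" using d by (simp add: k_def)
  have finP: "finite P" using P(1) by (simp add: point_set_def)
  have finT: "finite T" using finite_subset[OF T(1) finite_mons] .
  define f where "f J \<beta> = [:c J \<beta> M0, c J \<beta> M - c J \<beta> M0:]" for J \<beta>
  \<comment> \<open>The rows \<open>Inl\<close> are the Macaulay rows along the line from
    \<open>M0\<close> to \<open>M\<close>, the rows \<open>Inr\<close> read off the values on
    \<open>T\<close>.\<close>
  define B :: "('j \<times> nat multiset) + nat multiset \<Rightarrow> nat multiset \<Rightarrow> complex poly" where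
    "B r \<delta> = (case r of Inl (J, \<gamma>) \<Rightarrow> \<Sum>\<beta>\<in>mons n e. if \<beta> + \<gamma> = \<delta> then f J \<beta> else 0
      | Inr \<alpha> \<Rightarrow> if \<delta> = \<alpha> then 1 else 0)" for r \<delta>
  define Rows where "Rows = Inl ` (R \<times> mons n k) \<union> Inr ` T"
  have finRows: "finite Rows" using finite_R finT by (simp add: Rows_def finite_mons)
  \<comment> \<open>At t = 1 the equations are those of \<open>M\<close>, where \<open>T\<close>
    determines the annihilator. The left inverse therefore has a denominator \<open>D\<close> that
    is nonzero at 1, hence a nonzero polynomial.\<close>
  interpret evaluated_ring "\<lambda>p. poly p 1" UNIV "\<lambda>c. [:c:]" by (rule evaluated_ring_poly)
  have B1: "poly (B (Inl (J, \<gamma>)) \<delta>) 1 = entry J \<gamma> \<delta> M" for J \<gamma> \<delta>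
    by (simp add: B_def f_def entry_def poly_sum if_distrib[of "\<lambda>p. poly p _"] cong: if_cong)
  have B2: "(\<Sum>\<delta>\<in>mons n d. B (Inr \<alpha>) \<delta> * g \<delta>) = g \<alpha>" if "\<alpha> \<in> T" for \<alpha> g
  proof -
    have "\<alpha> \<in> mons n d" using that T(1) by blast
    then show ?thesis
      by (simp add: B_def if_distrib[of "\<lambda>x. x * _"] finite_mons cong: if_cong)
  qed
  have inj: "\<forall>v. (\<forall>r\<in>Rows. (\<Sum>\<delta>\<in>mons n d. poly (B r \<delta>) 1 * v \<delta>) = 0) \<longrightarrow> (\<forall>\<delta>\<in>mons n d. v \<delta> = 0)"
  proof (intro allI impI)
    fix v assume v: "\<forall>r\<in>Rows. (\<Sum>\<delta>\<in>mons n d. poly (B r \<delta>) 1 * v \<delta>) = 0"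
    have "v \<in> ann M d" unfolding dk ann_iff_entry
    proof
      fix r assume r: "r \<in> R \<times> mons n k"
      then have "Inl r \<in> Rows" by (simp add: Rows_def)
      then have "(\<Sum>\<delta>\<in>mons n d. poly (B (Inl (fst r, snd r)) \<delta>) 1 * v \<delta>) = 0" using v by auto
      then show "(\<Sum>\<delta>\<in>mons n (e + k). entry (fst r) (snd r) \<delta> M * v \<delta>) = 0"
        unfolding B1 dk .
    qed
    moreover have "v \<alpha> = 0" if "\<alpha> \<in> T" for \<alpha>
    proof -
      have "Inr \<alpha> \<in> Rows" using that by (simp add: Rows_def)
      then have "(\<Sum>\<delta>\<in>mons n d. poly (B (Inr \<alpha>) \<delta>) 1 * v \<delta>) = 0" using v by blast
      also have "(\<Sum>\<delta>\<in>mons n d. poly (B (Inr \<alpha>) \<delta>) 1 * v \<delta>) = v \<alpha>"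
        using T(1) that by (auto simp: B_def if_distrib[of "\<lambda>x. x * _"] if_distrib[of "\<lambda>p. poly p _"] finite_mons cong: if_cong)
      finally show ?thesis .
    qed
    ultimately show "\<forall>\<delta>\<in>mons n d. v \<delta> = 0" using det by (auto simp: determines_def)
  qed
  obtain L D where LD: "poly D 1 \<noteq> 0"
    "\<forall>i\<in>mons n d. \<forall>j\<in>mons n d. (\<Sum>r\<in>Rows. L i r * B r j) = (if i = j then D else 0)"
    using left_inverse[OF finite_mons finRows _ inj] by auto
  have "D \<noteq> 0" using LD(1) by auto
  \<comment> \<open>One more than the order at 0 that \<open>D * y \<alpha>\<close> can have when
    \<open>y \<alpha>\<close> does not vanish at 0.\<close>
  define K where "K = Suc (degree D)"
  have "\<forall>p\<in>P. \<exists>x. (\<forall>i\<le>n. poly (x i) 0 = p i) \<and>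
    (\<forall>J\<in>R. [:0, 1:] ^ K dvd (\<Sum>\<beta>\<in>mons n e. f J \<beta> * mev x \<beta>))"
    using lifts by (simp add: lifts_def f_def)
  from bchoice[OF this] obtain x where x': "\<forall>p\<in>P. (\<forall>i\<le>n. poly (x p i) 0 = p i) \<and>
    (\<forall>J\<in>R. [:0, 1:] ^ K dvd (\<Sum>\<beta>\<in>mons n e. f J \<beta> * mev (x p) \<beta>))" ..
  have x: "p \<in> P \<Longrightarrow> i \<le> n \<Longrightarrow> poly (x p i) 0 = p i"
    "p \<in> P \<Longrightarrow> J \<in> R \<Longrightarrow> [:0, 1:] ^ K dvd (\<Sum>\<beta>\<in>mons n e. f J \<beta> * mev (x p) \<beta>)" for p i J
    using x' by simp_all
  obtain C0 where C0: "\<exists>p\<in>P. C0 p \<noteq> 0" "\<forall>\<alpha>\<in>T. (\<Sum>p\<in>P. mev (x p) \<alpha> * C0 p) = 0"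
    using underdetermined_system[OF finT finP T(2), of "\<lambda>\<alpha> p. mev (x p) \<alpha>"] by blast
  then obtain p0 where p0: "p0 \<in> P" "C0 p0 \<noteq> 0" by blast
  \<comment> \<open>Dividing by the common power of t preserves the vanishing on \<open>T\<close>
    and makes the coefficients nonzero at t = 0, where the lifts specialize to the distinct points
    of \<open>P\<close>.\<close>
  obtain r C where C: "\<forall>p\<in>P. C0 p = [:0, 1:] ^ r * C p" "\<exists>p\<in>P. poly (C p) 0 \<noteq> 0"
    using divide_common_power[of p0 P C0, OF p0] by blast
  define y where "y \<alpha> = (\<Sum>p\<in>P. C p * mev (x p) \<alpha>)" for \<alpha>
  have yT: "y \<alpha> = 0" if "\<alpha> \<in> T" for \<alpha>
  proof -
    have "[:0, 1:] ^ r * y \<alpha> = (\<Sum>p\<in>P. mev (x p) \<alpha> * C0 p)"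
      using C(1) by (simp add: y_def sum_distrib_left mult_ac)
    then show ?thesis using C0(2) that by simp
  qed
  have y0: "poly (y \<alpha>) 0 = (\<Sum>p\<in>P. poly (C p) 0 * mev p \<alpha>)" if "\<alpha> \<in> mons n d" for \<alpha>
    unfolding y_def poly_sum poly_mult poly_mev
    by (intro sum.cong refl arg_cong2[of _ _ _ _ "(*)"] mev_cong[OF that]) (simp add: x(1))
  obtain \<alpha> where \<alpha>: "\<alpha> \<in> mons n d" "poly (y \<alpha>) 0 \<noteq> 0"
  proof (rule ccontr)
    assume "\<not> thesis"
    then have "\<forall>\<alpha>\<in>mons n d. (\<Sum>p\<in>P. poly (C p) 0 * mev p \<alpha>) = 0"
      using that y0 by auto
    then have "\<forall>p\<in>P. poly (C p) 0 = 0" by (rule mev_independent[OF P])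
    then show False using C(2) by blast
  qed
  \<comment> \<open>Rows of \<open>T\<close> give exactly 0. On a Macaulay row, \<open>y\<close> is
    a combination of evaluations at approximate solutions, so a multiple of t^K results.\<close>
  have rows: "[:0, 1:] ^ K dvd (\<Sum>\<delta>\<in>mons n d. B r \<delta> * y \<delta>)" if r: "r \<in> Rows" for r
  proof (cases r)
    case (Inr \<alpha>)
    then have "\<alpha> \<in> T" using r by (auto simp: Rows_def)
    then show ?thesis using B2[of \<alpha> y] yT Inr by simp
  next
    case (Inl a)
    obtain J \<gamma> where a: "a = (J, \<gamma>)" by (cases a)
    then have J: "J \<in> R" "\<gamma> \<in> mons n k" using r Inl by (auto simp: Rows_def)
    have "(\<Sum>\<delta>\<in>mons n d. B r \<delta> * y \<delta>) = (\<Sum>\<beta>\<in>mons n e. f J \<beta> * y (\<beta> + \<gamma>))"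
      unfolding Inl a dk B_def using sum_delta_mons[OF J(2), of "f J" y] by simp
    also have "\<dots> = (\<Sum>\<beta>\<in>mons n e. \<Sum>p\<in>P. C p * mev (x p) \<gamma> * (f J \<beta> * mev (x p) \<beta>))"
      by (simp add: y_def sum_distrib_left mev_plus mult_ac)
    also have "\<dots> = (\<Sum>p\<in>P. \<Sum>\<beta>\<in>mons n e. C p * mev (x p) \<gamma> * (f J \<beta> * mev (x p) \<beta>))"
      by (rule sum.swap)
    also have "\<dots> = (\<Sum>p\<in>P. C p * mev (x p) \<gamma> * (\<Sum>\<beta>\<in>mons n e. f J \<beta> * mev (x p) \<beta>))"
      by (simp add: sum_distrib_left)
    finally have eq: "(\<Sum>\<delta>\<in>mons n d. B r \<delta> * y \<delta>) =
      (\<Sum>p\<in>P. C p * mev (x p) \<gamma> * (\<Sum>\<beta>\<in>mons n e. f J \<beta> * mev (x p) \<beta>))" .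
    show ?thesis unfolding eq by (intro dvd_sum dvd_mult x(2) J(1))
  qed
  have "D * y \<alpha> = (\<Sum>\<delta>\<in>mons n d. (if \<alpha> = \<delta> then D else 0) * y \<delta>)"
    using \<alpha>(1) by (simp add: if_distrib[of "\<lambda>x. x * _"] finite_mons cong: if_cong)
  also have "\<dots> = (\<Sum>\<delta>\<in>mons n d. (\<Sum>r\<in>Rows. L \<alpha> r * B r \<delta>) * y \<delta>)"
    using LD(2) \<alpha>(1) by (intro sum.cong) auto
  also have "\<dots> = (\<Sum>\<delta>\<in>mons n d. \<Sum>r\<in>Rows. L \<alpha> r * (B r \<delta> * y \<delta>))"
    by (simp add: sum_distrib_right mult.assoc)
  also have "\<dots> = (\<Sum>r\<in>Rows. \<Sum>\<delta>\<in>mons n d. L \<alpha> r * (B r \<delta> * y \<delta>))"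
    by (rule sum.swap)
  also have "\<dots> = (\<Sum>r\<in>Rows. L \<alpha> r * (\<Sum>\<delta>\<in>mons n d. B r \<delta> * y \<delta>))"
    by (simp add: sum_distrib_left)
  finally have "[:0, 1:] ^ K dvd D * y \<alpha>" using rows by (simp add: dvd_sum dvd_mult)
  then have "K \<le> degree D" by (rule power_dvd_mult_imp_le_degree[OF _ \<alpha>(2) \<open>D \<noteq> 0\<close>])
  then show False by (simp add: K_def)
qed

end

subsection \<open>Generic matrix pencils\<close>

lemma degree_coeff_prod_linear:
  fixes p q :: "'i \<Rightarrow> 'a::comm_ring_1"
  assumes "finite A"
  shows "degree (\<Prod>i\<in>A. [:p i, q i:]) \<le> card A \<and> coeff (\<Prod>i\<in>A. [:p i, q i:]) (card A) = (\<Prod>i\<in>A. q i)"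
  using assms
proof (induction A rule: finite_induct)
  case (insert x A)
  let ?F = "\<Prod>i\<in>A. [:p i, q i:]"
  have "degree ([:p x, q x:] * ?F) \<le> degree [:p x, q x:] + degree ?F" by (rule degree_mult_le)
  also have "\<dots> \<le> Suc (card A)" using insert.IH degree_pCons_le[of "p x" "[:q x:]"] by simp
  finally have "degree ([:p x, q x:] * ?F) \<le> Suc (card A)" .
  moreover have "coeff ?F (Suc (card A)) = 0" using insert.IH by (intro coeff_eq_0) simp
  ultimately show ?case using insert by (simp add: mult.commute)
qed auto

text \<open>The determinant of \<open>p - u q\<close> as a polynomial in u; its roots are the
  generalized eigenvalues of the pair.\<close>

definition pencil_poly :: "nat \<Rightarrow> (nat \<Rightarrow> nat \<Rightarrow> complex) \<Rightarrow> (nat \<Rightarrow> nat \<Rightarrow> complex) \<Rightarrow> complex poly"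
  where "pencil_poly N p q = det (mat N N (\<lambda>(a, b). [:p a b, - q a b:]))"

lemma poly_pencil_poly_eq_0_iff:
  "poly (pencil_poly N p q) u = 0 \<longleftrightarrow>
    (\<exists>v. (\<exists>b<N. v b \<noteq> 0) \<and> (\<forall>a<N. (\<Sum>b<N. (p a b - u * q a b) * v b) = 0))"
proof -
  interpret h: comm_ring_hom "\<lambda>r. poly r u" by unfold_locales auto
  define A where "A = mat N N (\<lambda>(a, b). p a b - u * q a b)"
  have A: "A \<in> carrier_mat N N" by (simp add: A_def)
  have "map_mat (\<lambda>r. poly r u) (mat N N (\<lambda>(a, b). [:p a b, - q a b:])) = A"
    by (rule eq_matI) (auto simp: A_def)
  moreover have "poly (pencil_poly N p q) u =
      det (map_mat (\<lambda>r. poly r u) (mat N N (\<lambda>(a, b). [:p a b, - q a b:])))"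
    unfolding pencil_poly_def by (rule h.hom_det[symmetric])
  ultimately have "poly (pencil_poly N p q) u = det A" by simp
  moreover have "(\<exists>v. v \<in> carrier_vec N \<and> v \<noteq> 0\<^sub>v N \<and> A *\<^sub>v v = 0\<^sub>v N) \<longleftrightarrow>
    (\<exists>v. (\<exists>b<N. v b \<noteq> 0) \<and> (\<forall>a<N. (\<Sum>b<N. (p a b - u * q a b) * v b) = 0))" (is "?l \<longleftrightarrow> ?r")
  proof
    assume ?l
    then obtain v where v: "v \<in> carrier_vec N" "v \<noteq> 0\<^sub>v N" "A *\<^sub>v v = 0\<^sub>v N" by blast
    have "\<exists>b<N. v $ b \<noteq> 0"
      using v(1,2) by (metis carrier_vecD dim_vec eq_vecI index_zero_vec)
    moreover have "(\<Sum>b<N. (p a b - u * q a b) * v $ b) = 0" if "a < N" for a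
    proof -
      have "(A *\<^sub>v v) $ a = (\<Sum>b<N. (p a b - u * q a b) * v $ b)"
        using that v(1) by (auto simp: A_def scalar_prod_def lessThan_atLeast0)
      then show ?thesis using v(3) that by simp
    qed
    ultimately show ?r by (intro exI[of _ "\<lambda>b. v $ b"]) auto
  next
    assume ?r
    then obtain v where v: "\<exists>b<N. v b \<noteq> 0" "\<forall>a<N. (\<Sum>b<N. (p a b - u * q a b) * v b) = 0" by blast
    show ?l
    proof (intro exI[of _ "vec N v"] conjI)
      obtain b where b: "b < N" "v b \<noteq> 0" using v(1) by blast
      then have "vec N v $ b \<noteq> 0\<^sub>v N $ b" by simp
      then show "vec N v \<noteq> 0\<^sub>v N" by metis
      show "A *\<^sub>v vec N v = 0\<^sub>v N"
        using v(2) by (intro eq_vecI) (auto simp: A_def scalar_prod_def lessThan_atLeast0)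
    qed simp
  qed
  ultimately show ?thesis using det_0_iff_vec_prod_zero[OF A] by simp
qed

lemma pencil_poly_degree: "degree (pencil_poly N p q) \<le> N"
proof -
  have "degree (signof \<sigma> * (\<Prod>i = 0..<N. mat N N (\<lambda>(a, b). [:p a b, - q a b:]) $$ (i, \<sigma> i)) :: complex poly) \<le> N"
    if s: "\<sigma> permutes {0..<N}" for \<sigma>
  proof -
    have "(\<Prod>i = 0..<N. mat N N (\<lambda>(a, b). [:p a b, - q a b:]) $$ (i, \<sigma> i)) = (\<Prod>i = 0..<N. [:p i (\<sigma> i), - q i (\<sigma> i):])"
      using s by (intro prod.cong) (auto simp: permutes_in_image)
    also have "degree \<dots> \<le> N"
      using degree_coeff_prod_linear[of "{0..<N}" "\<lambda>i. p i (\<sigma> i)" "\<lambda>i. - q i (\<sigma> i)"] by simp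
    finally show ?thesis by (auto simp: sign_def)
  qed
  then show ?thesis
    unfolding pencil_poly_def by (subst det_def'[of _ N]) (auto intro!: degree_sum_le finite_permutations)
qed

lemma pencil_poly_lead_coeff: "coeff (pencil_poly N p q) N = det (mat N N (\<lambda>(a, b). - q a b))"
proof -
  have "coeff (signof \<sigma> * (\<Prod>i = 0..<N. mat N N (\<lambda>(a, b). [:p a b, - q a b:]) $$ (i, \<sigma> i)) :: complex poly) N =
      signof \<sigma> * (\<Prod>i = 0..<N. mat N N (\<lambda>(a, b). - q a b) $$ (i, \<sigma> i))"
    if s: "\<sigma> permutes {0..<N}" for \<sigma>
  proof -
    have "(\<Prod>i = 0..<N. mat N N (\<lambda>(a, b). [:p a b, - q a b:]) $$ (i, \<sigma> i)) = (\<Prod>i = 0..<N. [:p i (\<sigma> i), - q i (\<sigma> i):])"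
      using s by (intro prod.cong) (auto simp: permutes_in_image)
    moreover have "coeff \<dots> N = (\<Prod>i = 0..<N. - q i (\<sigma> i))"
      using degree_coeff_prod_linear[of "{0..<N}" "\<lambda>i. p i (\<sigma> i)" "\<lambda>i. - q i (\<sigma> i)"] by simp
    moreover have "(\<Prod>i = 0..<N. mat N N (\<lambda>(a, b). - q a b) $$ (i, \<sigma> i)) = (\<Prod>i = 0..<N. - q i (\<sigma> i))"
      using s by (intro prod.cong) (auto simp: permutes_in_image)
    ultimately show ?thesis by (auto simp: sign_def)
  qed
  then show ?thesis
    unfolding pencil_poly_def
    by (subst det_def'[of _ N], simp, subst det_def'[of _ N]) (auto simp: coeff_sum intro!: sum.cong)
qed

text \<open>The determinant is formed once in the ring of functions with values in
  \<open>complex poly\<close>. The functions whose coefficients are polynomial in the parameter are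
  closed under the ring operations, hence under determinants.\<close>

lemma poly_funs_coeff_pencil_poly:
  assumes "\<forall>a<N. \<forall>b<N. p a b \<in> poly_funs H s \<and> q a b \<in> poly_funs H s"
  shows "(\<lambda>M. coeff (pencil_poly N (\<lambda>a b. p a b M) (\<lambda>a b. q a b M)) k) \<in> poly_funs H s"
proof -
  let ?S = "{F. \<forall>k. (\<lambda>M. coeff (F M) k) \<in> poly_funs H s} :: ('a \<Rightarrow> complex poly) set"
  interpret pf: evaluated_ring "\<lambda>f. f undefined" "poly_funs H s" "\<lambda>c _. c"
    by (rule evaluated_ring_poly_funs)
  interpret evaluated_ring "\<lambda>F. poly (F undefined) 0" ?S "\<lambda>c _. [:c:]"
  proof (unfold_locales, goal_cases)
    case (5 x y)
    then show ?case by (auto intro: poly_funs.add)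
  next
    case (6 x y)
    have "(\<Sum>i\<le>k. (\<lambda>M. coeff (x M) i) * (\<lambda>M. coeff (y M) (k - i))) \<in> poly_funs H s" for k
      using 6 by (intro pf.S_sum pf.S_mult) auto
    moreover have "(\<Sum>i\<le>k. (\<lambda>M. coeff (x M) i) * (\<lambda>M. coeff (y M) (k - i))) = (\<lambda>M. coeff ((x * y) M) k)" for k
      by (simp add: fun_eq_iff sum_fun_apply coeff_mult)
    ultimately show ?case by simp
  next
    case (7 c)
    then show ?case by (auto simp: coeff_pCons split: nat.split intro: poly_funs.const)
  qed (auto simp: fun_eq_iff one_pCons)
  define A where "A = mat N N (\<lambda>(a, b). (\<lambda>M. [:p a b M, - q a b M:]))"
  have "det A \<in> ?S"
  proof (rule S_det)
    fix i j assume ij: "i < N" "j < N"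
    have "(\<lambda>M. coeff [:p i j M, - q i j M:] k) \<in> poly_funs H s" for k
    proof -
      consider "k = 0" | "k = 1" | "k \<ge> 2" by linarith
      then show ?thesis
      proof cases
        case 2
        have "(\<lambda>M. (-1) * q i j M) \<in> poly_funs H s" using assms ij by (intro poly_funs.mult poly_funs.const) auto
        then show ?thesis using 2 by simp
      next
        case 3
        then obtain k' where "k = Suc (Suc k')" by (metis add_2_eq_Suc le_Suc_ex)
        then show ?thesis by (simp add: poly_funs.const)
      qed (use assms ij in \<open>auto simp: coeff_pCons poly_funs.const split: nat.split\<close>)
    qed
    then show "A $$ (i, j) \<in> ?S" using ij by (simp add: A_def)
  qed (simp add: A_def)
  moreover have "det A M = pencil_poly N (\<lambda>a b. p a b M) (\<lambda>a b. q a b M)" for M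
  proof -
    interpret h: comm_ring_hom "\<lambda>F. F M :: complex poly" by unfold_locales auto
    have "map_mat (\<lambda>F. F M) A = mat N N (\<lambda>(a, b). [:p a b M, - q a b M:])"
      by (rule eq_matI) (auto simp: A_def)
    moreover have "det (map_mat (\<lambda>F. F M) A) = det A M" by (rule h.hom_det)
    ultimately show ?thesis by (simp add: pencil_poly_def)
  qed
  ultimately show ?thesis by simp
qed


text \<open>A polynomial \<open>\<chi>\<close> of degree \<open>N\<close> is squarefree iff \<open>(a, b) \<mapsto> a \<chi> + b \<chi>'\<close> is injective for
  \<open>deg a < N - 1\<close> and \<open>deg b < N\<close>.\<close>

lemma generic_rsquarefree:
  fixes \<chi> :: "'w::plus \<Rightarrow> complex poly"
  assumes coeffs: "\<And>k. (\<lambda>M. coeff (\<chi> M) k) \<in> poly_funs H s"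
    and deg: "\<And>M. degree (\<chi> M) \<le> N" and lead: "coeff (\<chi> M0) N \<noteq> 0"
    and U: "finite U" "card U = N" "\<forall>u\<in>U. poly (\<chi> M0) u = 0"
  shows "\<exists>D\<in>poly_funs H s. D M0 \<noteq> 0 \<and> (\<forall>M. D M \<noteq> 0 \<longrightarrow>
    finite {u. poly (\<chi> M) u = 0} \<and> card {u. poly (\<chi> M) u = 0} = N)"
proof -
  \<comment> \<open>The columns of the Sylvester matrix of \<open>\<chi> M\<close> and its
    derivative: \<open>Inl\<close> holds the coefficients of the multiplier of
    \<open>\<chi>\<close>, \<open>Inr\<close> those of the multiplier of the derivative.\<close>
  define I where "I = Inl ` {..<N - 1} \<union> Inr ` {..<N}"
  define B where "B k i M = (case i of Inl j \<Rightarrow> coeff (monom 1 j * \<chi> M) k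
    | Inr j \<Rightarrow> coeff (monom 1 j * pderiv (\<chi> M)) k)" for k :: nat and i :: "nat + nat" and M
  define comb where "comb v M = (\<Sum>j<N - 1. monom (v (Inl j)) j) * \<chi> M +
    (\<Sum>j<N. monom (v (Inr j)) j) * pderiv (\<chi> M)" for v :: "nat + nat \<Rightarrow> complex" and M
  have sum_B: "(\<Sum>i\<in>I. B k i M * v i) = coeff (comb v M) k" for k M v
  proof -
    have "(\<Sum>i\<in>I. B k i M * v i) =
      (\<Sum>j<N - 1. B k (Inl j) M * v (Inl j)) + (\<Sum>j<N. B k (Inr j) M * v (Inr j))"
      unfolding I_def by (subst sum.union_disjoint) (auto simp: sum.reindex inj_on_def)
    also have "\<dots> = coeff (comb v M) k"
      unfolding comb_def sum_distrib_right coeff_add coeff_sum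
      by (intro arg_cong2[of _ _ _ _ "(+)"] sum.cong) (auto simp: B_def coeff_monom_mult)
    finally show ?thesis .
  qed
  have mono_deg: "degree (\<Sum>j<m. monom (f j) j) < m \<or> (\<Sum>j<m. monom (f j) j) = 0" for m and f :: "nat \<Rightarrow> complex"
  proof (cases m)
    case (Suc m')
    have "degree (\<Sum>j<m. monom (f j) j) \<le> m'"
      using Suc by (intro degree_sum_le) (auto intro: order.trans[OF degree_monom_le])
    then show ?thesis using Suc by simp
  qed simp
  have mono_coeff: "coeff (\<Sum>j<m. monom (f j) j) i = (if i < m then f i else 0)" for m i and f :: "nat \<Rightarrow> complex"
    by (simp add: coeff_sum)
  have comb_deg: "coeff (comb v M) k = 0" if "k \<ge> 2 * N" for v M k
  proof -
    have "degree (\<chi> M) \<le> N" "degree (pderiv (\<chi> M)) \<le> N" using deg[of M] by (auto simp: degree_pderiv)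
    moreover have "degree (\<Sum>j<N - 1. monom (v (Inl j)) j) \<le> N - 1" "degree (\<Sum>j<N. monom (v (Inr j)) j) \<le> N - 1"
      using mono_deg[of "\<lambda>j. v (Inl j)" "N - 1"] mono_deg[of "\<lambda>j. v (Inr j)" N] by auto
    ultimately have "degree (comb v M) \<le> N - 1 + N"
      unfolding comb_def by (intro degree_add_le) (auto intro!: order.trans[OF degree_mult_le] add_mono)
    moreover have "comb v M = 0" if "N = 0" using that by (simp add: comb_def)
    ultimately show ?thesis using \<open>k \<ge> 2 * N\<close> by (cases "N = 0") (auto intro!: coeff_eq_0)
  qed
  have comb_zero: "(\<forall>k\<in>{..<2 * N}. (\<Sum>i\<in>I. B k i M * v i) = 0) \<longleftrightarrow> comb v M = 0" for M v
    using comb_deg[of _ v M] by (auto simp: sum_B poly_eq_iff not_less[symmetric])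
  have BS: "\<forall>k\<in>{..<2 * N}. \<forall>i\<in>I. B k i \<in> poly_funs H s"
  proof (intro ballI)
    fix k i
    show "B k i \<in> poly_funs H s"
    proof (cases i)
      case (Inl j)
      then show ?thesis using coeffs poly_funs.const[of 0 H s]
        by (cases "j \<le> k") (auto simp: B_def[abs_def] coeff_monom_mult)
    next
      case (Inr j)
      have "(\<lambda>M. of_nat (Suc (k - j)) * coeff (\<chi> M) (Suc (k - j))) \<in> poly_funs H s"
        by (intro poly_funs.mult poly_funs.const coeffs)
      then show ?thesis using Inr poly_funs.const[of 0 H s]
        by (cases "j \<le> k") (auto simp: B_def[abs_def] coeff_monom_mult coeff_pderiv)
    qed
  qed
  have inj0: "\<forall>v. (\<forall>k\<in>{..<2 * N}. (\<Sum>i\<in>I. B k i M0 * v i) = 0) \<longrightarrow> (\<forall>i\<in>I. v i = 0)"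
  proof (intro allI impI)
    fix v assume "\<forall>k\<in>{..<2 * N}. (\<Sum>i\<in>I. B k i M0 * v i) = 0"
    then have c0: "comb v M0 = 0" by (simp only: comb_zero)
    define a b where "a = (\<Sum>j<N - 1. monom (v (Inl j)) j)" and "b = (\<Sum>j<N. monom (v (Inr j)) j)"
    have ab: "a * \<chi> M0 + b * pderiv (\<chi> M0) = 0" using c0 by (simp add: comb_def a_def b_def)
    have \<chi>0: "\<chi> M0 \<noteq> 0" using lead by auto
    \<comment> \<open>If a root in \<open>U\<close> were double, the cofactor \<open>h\<close> of
      its linear factor would vanish on all \<open>N\<close> elements of \<open>U\<close>, although
      its degree is N - 1.\<close>
    have simple: "poly (pderiv (\<chi> M0)) u \<noteq> 0" if u: "u \<in> U" for u
    proof
      assume p': "poly (pderiv (\<chi> M0)) u = 0"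
      obtain h where h: "\<chi> M0 = [:-u, 1:] * h"
        using U(3) u poly_eq_0_iff_dvd by (metis dvdE)
      have "poly h u = 0" using p' by (simp add: h pderiv_mult pderiv_pCons del: mult_pCons_left)
      then have "\<forall>w\<in>U. poly h w = 0" using U(3) by (auto simp: h)
      moreover have "h \<noteq> 0" using \<chi>0 h by auto
      ultimately have "card U \<le> card {w. poly h w = 0}" "card {w. poly h w = 0} \<le> degree h"
        by (auto intro!: card_mono poly_roots_finite card_poly_roots_bound)
      moreover have "Suc (degree h) = degree (\<chi> M0)" using \<open>h \<noteq> 0\<close> by (simp add: h degree_mult_eq del: mult_pCons_left)
      ultimately show False using deg[of M0] U(2) by simp
    qed
    have "poly b u = 0" if u: "u \<in> U" for u
    proof -
      have "poly (a * \<chi> M0 + b * pderiv (\<chi> M0)) u = 0" by (simp add: ab)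
      then show ?thesis using simple[OF u] U(3) u by simp
    qed
    have b0: "b = 0"
    proof (rule ccontr)
      assume "b \<noteq> 0"
      have "card U \<le> card {w. poly b w = 0}"
        using \<open>\<And>u. u \<in> U \<Longrightarrow> poly b u = 0\<close> \<open>b \<noteq> 0\<close> by (intro card_mono poly_roots_finite) auto
      also have "\<dots> \<le> degree b" by (rule card_poly_roots_bound[OF \<open>b \<noteq> 0\<close>])
      also have "\<dots> < N" using mono_deg[of "\<lambda>j. v (Inr j)" N] \<open>b \<noteq> 0\<close> by (simp add: b_def)
      finally show False using U(2) by simp
    qed
    then have a0: "a = 0" using ab \<chi>0 by simp
    show "\<forall>i\<in>I. v i = 0"
    proof
      fix i assume "i \<in> I"
      then consider j where "i = Inl j" "j < N - 1" | j where "i = Inr j" "j < N" by (auto simp: I_def)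
      then show "v i = 0"
      proof cases
        case 1
        then show ?thesis using a0 mono_coeff[of "\<lambda>j. v (Inl j)" "N - 1" j] by (simp add: a_def)
      next
        case 2
        then show ?thesis using b0 mono_coeff[of "\<lambda>j. v (Inr j)" N j] by (simp add: b_def)
      qed
    qed
  qed
  have "finite I" by (simp add: I_def)
  obtain D where D: "D \<in> poly_funs H s" "D M0 \<noteq> 0"
    "\<forall>M. D M \<noteq> 0 \<longrightarrow> (\<forall>v. (\<forall>k\<in>{..<2 * N}. (\<Sum>i\<in>I. B k i M * v i) = 0) \<longrightarrow> (\<forall>i\<in>I. v i = 0))"
    using poly_funs_generic_inj[OF \<open>finite I\<close> finite_lessThan BS inj0] by blast
  show ?thesis
  proof (intro bexI[of _ "\<lambda>M. D M * coeff (\<chi> M) N"] conjI allI impI)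
    show "(\<lambda>M. D M * coeff (\<chi> M) N) \<in> poly_funs H s" by (intro poly_funs.mult D(1) coeffs)
    show "D M0 * coeff (\<chi> M0) N \<noteq> 0" using D(2) lead by simp
    fix M assume "D M * coeff (\<chi> M) N \<noteq> 0"
    then have DM: "D M \<noteq> 0" and lM: "coeff (\<chi> M) N \<noteq> 0" by auto
    have \<chi>M: "\<chi> M \<noteq> 0" "degree (\<chi> M) = N" using lM deg[of M] le_degree[OF lM] by auto
    have "rsquarefree (\<chi> M)" unfolding rsquarefree_roots
    proof (intro allI notI)
      fix u assume u: "poly (\<chi> M) u = 0 \<and> poly (pderiv (\<chi> M)) u = 0"
      then obtain h where h: "\<chi> M = [:-u, 1:] * h" using poly_eq_0_iff_dvd by (metis dvdE)
      have "poly h u = 0" using u by (simp add: h pderiv_mult pderiv_pCons del: mult_pCons_left)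
      then obtain q where q: "h = [:-u, 1:] * q" using poly_eq_0_iff_dvd by (metis dvdE)
      have nz: "h \<noteq> 0" "q \<noteq> 0" using \<chi>M(1) h q by auto
      have degs: "Suc (degree h) = N" "Suc (Suc (degree q)) = N"
      proof -
        have "degree (\<chi> M) = Suc (degree h)" using nz by (simp add: h degree_mult_eq del: mult_pCons_left)
        moreover have "degree h = Suc (degree q)" using nz by (simp add: q degree_mult_eq del: mult_pCons_left)
        ultimately show "Suc (degree h) = N" "Suc (Suc (degree q)) = N" using \<chi>M(2) by auto
      qed
      \<comment> \<open>At a double root, \<open>\<chi> M\<close> = (X - u) h with h = (X - u) q,
        and h times the derivative is h (h + (X - u) h') = (q + h') \<chi>. This is the syzygy
        excluded by \<open>D\<close>.\<close>
      define a where "a = - (q + pderiv h)"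
      define v where "v i = (case i of Inl j \<Rightarrow> coeff a j | Inr j \<Rightarrow> coeff h j)" for i
      have "degree a \<le> degree q"
        using degs unfolding a_def degree_minus by (intro degree_add_le) (auto simp: degree_pderiv)
      then have "(\<Sum>j<Suc (degree q). monom (v (Inl j)) j) = a"
        using poly_as_sum_of_monoms'[of a "degree q"] by (simp add: v_def lessThan_Suc_atMost)
      moreover have "N - 1 = Suc (degree q)" using degs by simp
      moreover have "(\<Sum>j<Suc (degree h). monom (v (Inr j)) j) = h"
        using poly_as_sum_of_monoms'[of h "degree h"] by (simp add: v_def lessThan_Suc_atMost)
      ultimately have "comb v M = a * \<chi> M + h * pderiv (\<chi> M)" by (simp only: comb_def degs(1))
      also have "\<dots> = 0"
        by (simp add: a_def h pderiv_mult pderiv_pCons del: mult_pCons_left mult_pCons_right)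
          (subst (4) q, simp add: algebra_simps del: mult_pCons_left mult_pCons_right)
      finally have "\<forall>i\<in>I. v i = 0" using D(3) DM comb_zero by blast
      moreover have "Inr (degree h) \<in> I" using degs by (auto simp: I_def)
      ultimately have "v (Inr (degree h)) = 0" by blast
      then show False using nz(1) by (simp add: v_def)
    qed
    then have "smult (lead_coeff (\<chi> M)) (\<Prod>z|poly (\<chi> M) z = 0. [:-z, 1:]) = \<chi> M"
      by (rule complex_poly_decompose_rsquarefree)
    then have "degree (\<chi> M) = degree (smult (lead_coeff (\<chi> M)) (\<Prod>z|poly (\<chi> M) z = 0. [:-z, 1:]))"
      by simp
    also have "\<dots> = degree (\<Prod>z|poly (\<chi> M) z = 0. [:-z, 1:])" using \<chi>M(1) by simp
    also have "\<dots> = card {z. poly (\<chi> M) z = 0}"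
      by (subst degree_prod_eq_sum_degree) auto
    finally show "card {u. poly (\<chi> M) u = 0} = N" using \<chi>M(2) by simp
    show "finite {u. poly (\<chi> M) u = 0}" using \<chi>M(1) by (rule poly_roots_finite)
  qed
qed

text \<open>Injectivity of \<open>Q\<close> at \<open>M0\<close> makes the leading coefficient of
  the characteristic polynomial nonzero there, so the \<open>N\<close> values in \<open>U\<close>
  are all of its roots. Having degree \<open>N\<close> and \<open>N\<close> distinct roots persists
  for general \<open>M\<close> by \<open>generic_rsquarefree\<close>.\<close>

lemma generic_pencil:
  fixes P Q :: "'s \<Rightarrow> 't \<Rightarrow> 'w::plus \<Rightarrow> complex"
  assumes fin: "finite T" "finite T'" and card: "card T = N" "card T' = N"
    and PQ: "\<forall>a\<in>T. \<forall>b\<in>T'. P a b \<in> poly_funs H s \<and> Q a b \<in> poly_funs H s"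
    and Q0: "\<forall>v. (\<forall>a\<in>T. (\<Sum>b\<in>T'. Q a b M0 * v b) = 0) \<longrightarrow> (\<forall>b\<in>T'. v b = 0)"
    and U: "finite U" "card U = N"
      "\<forall>u\<in>U. \<exists>v. (\<exists>b\<in>T'. v b \<noteq> 0) \<and> (\<forall>a\<in>T. (\<Sum>b\<in>T'. (P a b M0 - u * Q a b M0) * v b) = 0)"
  shows "\<exists>D\<in>poly_funs H s. D M0 \<noteq> 0 \<and> (\<forall>M. D M \<noteq> 0 \<longrightarrow> (\<exists>U. finite U \<and> card U = N \<and>
    (\<forall>u\<in>U. \<exists>v. (\<exists>b\<in>T'. v b \<noteq> 0) \<and> (\<forall>a\<in>T. (\<Sum>b\<in>T'. (P a b M - u * Q a b M) * v b) = 0))))"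
proof -
  obtain g where g: "bij_betw g {0..<N} T"
    using ex_bij_betw_nat_finite[OF fin(1)] card(1) by blast
  obtain f where f: "bij_betw f {0..<N} T'"
    using ex_bij_betw_nat_finite[OF fin(2)] card(2) by blast
  have T_iff: "(\<forall>a\<in>T. \<phi> a) \<longleftrightarrow> (\<forall>a<N. \<phi> (g a))" for \<phi>
    using g by (auto simp: bij_betw_def)
  have T'_iff: "(\<exists>b\<in>T'. \<phi> b) \<longleftrightarrow> (\<exists>b<N. \<phi> (f b))" for \<phi>
    using f by (auto simp: bij_betw_def)
  have sumT': "(\<Sum>b\<in>T'. F b) = (\<Sum>b<N. F (f b))" for F :: "'t \<Rightarrow> complex"
    using sum.reindex_bij_betw[OF f, of F] by (simp add: lessThan_atLeast0)
  define \<chi> where "\<chi> M = pencil_poly N (\<lambda>a b. P (g a) (f b) M) (\<lambda>a b. Q (g a) (f b) M)" for M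
  have root: "poly (\<chi> M) u = 0 \<longleftrightarrow> (\<exists>v. (\<exists>b\<in>T'. v b \<noteq> 0) \<and>
      (\<forall>a\<in>T. (\<Sum>b\<in>T'. (P a b M - u * Q a b M) * v b) = 0))" for M u
    unfolding \<chi>_def poly_pencil_poly_eq_0_iff T_iff T'_iff sumT'
  proof (safe, goal_cases)
    case (1 v b)
    define h where "h = the_inv_into {0..<N} f"
    have hf: "h (f a) = a" if "a < N" for a
      unfolding h_def using f that by (intro the_inv_into_f_f) (auto simp: bij_betw_def)
    show ?case using 1 by (intro exI[of _ "\<lambda>t. v (h t)"]) (auto simp: hf)
  next
    case (2 v b)
    then show ?case by (intro exI[of _ "\<lambda>b. v (f b)"]) auto
  qed
  have lead: "coeff (\<chi> M0) N \<noteq> 0"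
  proof
    let ?A = "mat N N (\<lambda>(a, b). - Q (g a) (f b) M0)"
    assume "coeff (\<chi> M0) N = 0"
    then have "det ?A = 0" by (simp add: \<chi>_def pencil_poly_lead_coeff)
    moreover have A: "?A \<in> carrier_mat N N" by simp
    ultimately obtain v where v: "v \<in> carrier_vec N" "v \<noteq> 0\<^sub>v N" "?A *\<^sub>v v = 0\<^sub>v N"
      using det_0_iff_vec_prod_zero[OF A] by blast
    define h where "h = the_inv_into {0..<N} f"
    have hf: "h (f a) = a" if "a < N" for a
      unfolding h_def using f that by (intro the_inv_into_f_f) (auto simp: bij_betw_def)
    have "(\<Sum>b<N. Q (g a) (f b) M0 * v $ b) = 0" if "a < N" for a
    proof -
      have "(?A *\<^sub>v v) $ a = - (\<Sum>b<N. Q (g a) (f b) M0 * v $ b)"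
        using that v(1) by (auto simp: scalar_prod_def lessThan_atLeast0 sum_negf)
      then show ?thesis using v(3) that by simp
    qed
    then have "\<forall>a\<in>T. (\<Sum>b\<in>T'. Q a b M0 * v $ h b) = 0"
      unfolding T_iff sumT' by (simp add: hf)
    then have "\<forall>b\<in>T'. v $ h b = 0" using Q0[rule_format, of "\<lambda>b. v $ h b"] by blast
    then have "\<not> (\<exists>b\<in>T'. v $ h b \<noteq> 0)" by blast
    then have "\<And>b. b < N \<Longrightarrow> v $ b = 0" unfolding T'_iff using hf by auto
    with v(1,2) show False by (metis carrier_vecD dim_vec eq_vecI index_zero_vec)
  qed
  have coeffs: "(\<lambda>M. coeff (\<chi> M) k) \<in> poly_funs H s" for k
    unfolding \<chi>_def
    by (rule poly_funs_coeff_pencil_poly) (use PQ f g in \<open>auto simp: bij_betw_def\<close>)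
  have deg: "degree (\<chi> M) \<le> N" for M
    unfolding \<chi>_def by (rule pencil_poly_degree)
  have U': "\<forall>u\<in>U. poly (\<chi> M0) u = 0" using U(3) root by blast
  obtain D where D: "D \<in> poly_funs H s" "D M0 \<noteq> 0" "\<forall>M. D M \<noteq> 0 \<longrightarrow>
      finite {u. poly (\<chi> M) u = 0} \<and> card {u. poly (\<chi> M) u = 0} = N"
    using generic_rsquarefree[of \<chi>, OF coeffs deg lead U(1,2) U'] by blast
  show ?thesis
  proof (intro bexI[of _ D] conjI allI impI)
    fix M assume "D M \<noteq> 0"
    then have "finite {u. poly (\<chi> M) u = 0}" "card {u. poly (\<chi> M) u = 0} = N" using D(3) by auto
    then show "\<exists>U. finite U \<and> card U = N \<and>
      (\<forall>u\<in>U. \<exists>v. (\<exists>b\<in>T'. v b \<noteq> 0) \<and> (\<forall>a\<in>T. (\<Sum>b\<in>T'. (P a b M - u * Q a b M) * v b) = 0))"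
      using root by (intro exI[of _ "{u. poly (\<chi> M) u = 0}"]) auto
  qed (use D in auto)
qed

lemma nonprop_sym: "nonprop n x y \<Longrightarrow> nonprop n y x"
proof -
  assume "nonprop n x y"
  then obtain i j where ij: "i \<le> n" "j \<le> n" "x i * y j \<noteq> x j * y i" by (auto simp: nonprop_def)
  then have "y i * x j \<noteq> y j * x i" by (simp add: mult.commute)
  with ij(1,2) show ?thesis by (auto simp: nonprop_def)
qed

text \<open>The 2 x 2 determinant of the values of two linear forms is a combination of the 2 x 2
  minors of \<open>x\<close> and \<open>y\<close>.\<close>

lemma nonpropI_linform:
  assumes "linform n l x * linform n l' y \<noteq> linform n l' x * linform n l y"
  shows "nonprop n x y"
proof (rule ccontr)
  assume "\<not> nonprop n x y"
  then have eq: "\<And>i j. i \<le> n \<Longrightarrow> j \<le> n \<Longrightarrow> x i * y j = x j * y i" by (auto simp: nonprop_def)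
  have "linform n l x * linform n l' y = (\<Sum>i\<le>n. \<Sum>j\<le>n. l i * l' j * (x i * y j))"
    by (simp add: linform_def sum_product mult_ac)
  also have "\<dots> = (\<Sum>i\<le>n. \<Sum>j\<le>n. l i * l' j * (x j * y i))"
    by (intro sum.cong) (auto simp: eq)
  also have "\<dots> = linform n l y * linform n l' x"
    by (simp add: linform_def sum_product mult_ac)
  finally show False using assms by (simp add: mult.commute)
qed

text \<open>The transpose of multiplication by the linear form \<open>l\<close>: it lowers the
  degree of a functional by one and multiplies evaluation at x by l(x).\<close>

definition contract :: "nat \<Rightarrow> (nat \<Rightarrow> complex) \<Rightarrow> (nat multiset \<Rightarrow> complex) \<Rightarrow> nat multiset \<Rightarrow> complex"
  where "contract n l \<mu> \<alpha> = (\<Sum>i\<le>n. l i * \<mu> (add_mset i \<alpha>))"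

lemma contract_mev: "contract n l (mev x) \<alpha> = linform n l x * mev x \<alpha>"
  by (simp add: contract_def linform_def sum_distrib_right mult.assoc)

lemma contract_sum: "contract n l (\<lambda>\<alpha>. \<Sum>w\<in>W. z w * \<mu> w \<alpha>) \<alpha> = (\<Sum>w\<in>W. z w * contract n l (\<mu> w) \<alpha>)"
  unfolding contract_def sum_distrib_left by (subst sum.swap) (simp add: mult_ac)

lemma contract_commute: "contract n l (contract n l' \<mu>) \<alpha> = contract n l' (contract n l \<mu>) \<alpha>"
  unfolding contract_def sum_distrib_left by (subst sum.swap) (simp add: mult_ac add_mset_commute)

lemma contract_cong:
  "(\<And>\<alpha>. \<alpha> \<in> mons n (Suc d) \<Longrightarrow> \<mu> \<alpha> = \<nu> \<alpha>) \<Longrightarrow> \<alpha> \<in> mons n d \<Longrightarrow> contract n l \<mu> \<alpha> = contract n l \<nu> \<alpha>"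
  unfolding contract_def by (intro sum.cong) (auto intro!: add_mset_mons)

section \<open>Bases of annihilators and injective contractions for general parameters\<close>

context poly_system
begin

lemma determinesD:
  "determines M d T \<Longrightarrow> \<mu> \<in> ann M d \<Longrightarrow> \<forall>\<alpha>\<in>T. \<mu> \<alpha> = 0 \<Longrightarrow> \<alpha> \<in> mons n d \<Longrightarrow> \<mu> \<alpha> = 0"
  by (auto simp: determines_def)

lemma ann_contract: "\<mu> \<in> ann M (Suc d) \<Longrightarrow> contract n l \<mu> \<in> ann M d"
  unfolding contract_def[abs_def] by (rule ann_sum) (auto intro: ann_shift)

text \<open>The left inverse is taken for the Macaulay rows stacked on the rows \<open>b\<close>.
  Functionals in \<open>ann M d\<close> are killed by the former, so only the terms with
  \<open>b\<close> survive.\<close>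

lemma generic_left_inverse_ann:
  fixes b :: "'x \<Rightarrow> nat multiset \<Rightarrow> complex"
  assumes "finite E" and d: "e \<le> d"
    and inj: "\<forall>\<mu>\<in>ann M0 d. (\<forall>r\<in>E. (\<Sum>\<delta>\<in>mons n d. b r \<delta> * \<mu> \<delta>) = 0) \<longrightarrow> (\<forall>\<alpha>\<in>mons n d. \<mu> \<alpha> = 0)"
  shows "\<exists>L D. D \<in> poly_funs H s \<and> D M0 \<noteq> 0 \<and> (\<forall>i\<in>mons n d. \<forall>r\<in>E. L i r \<in> poly_funs H s) \<and>
    (\<forall>M. \<forall>\<mu>\<in>ann M d. \<forall>i\<in>mons n d.
      (\<Sum>r\<in>E. L i r M * (\<Sum>\<delta>\<in>mons n d. b r \<delta> * \<mu> \<delta>)) = D M * \<mu> i)"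
proof -
  define k where "k = d - e"
  have dk: "d = e + k" using d by (simp add: k_def)
  define B :: "('j \<times> nat multiset) + 'x \<Rightarrow> nat multiset \<Rightarrow> 'h \<Rightarrow> complex" where
    "B r \<delta> M = (case r of Inl a \<Rightarrow> entry (fst a) (snd a) \<delta> M | Inr x \<Rightarrow> b x \<delta>)" for r \<delta> M
  define A where "A = (Inl ` (R \<times> mons n k) :: (('j \<times> nat multiset) + 'x) set)"
  define E' where "E' = (Inr ` E :: (('j \<times> nat multiset) + 'x) set)"
  have finA: "finite A" "finite E'" using finite_R assms(1) by (simp_all add: A_def E'_def finite_mons)
  have disj: "A \<inter> E' = {}" by (auto simp: A_def E'_def)
  have sumE: "sum g E' = (\<Sum>x\<in>E. g (Inr x))" for g :: "_ \<Rightarrow> complex"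
    unfolding E'_def by (subst sum.reindex) (auto simp: inj_on_def)
  have ann_A: "\<mu> \<in> ann M d \<longleftrightarrow> (\<forall>r\<in>A. (\<Sum>\<delta>\<in>mons n d. B r \<delta> M * \<mu> \<delta>) = 0)" for \<mu> M
    unfolding dk ann_iff_entry A_def by (simp add: B_def)
  have BS: "\<forall>r\<in>A \<union> E'. \<forall>\<delta>\<in>mons n d. B r \<delta> \<in> poly_funs H s"
  proof (intro ballI)
    fix r \<delta> assume r: "r \<in> A \<union> E'"
    show "B r \<delta> \<in> poly_funs H s"
    proof (cases r)
      case (Inl a)
      then have "fst a \<in> R" using r by (auto simp: A_def E'_def)
      then show ?thesis unfolding B_def[abs_def] Inl by (simp add: entry_poly_funs)
    next
      case (Inr x)
      then show ?thesis unfolding B_def[abs_def] by (simp add: poly_funs.const)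
    qed
  qed
  have inj': "\<forall>v. (\<forall>r\<in>A \<union> E'. (\<Sum>\<delta>\<in>mons n d. B r \<delta> M0 * v \<delta>) = 0) \<longrightarrow> (\<forall>\<delta>\<in>mons n d. v \<delta> = 0)"
  proof (intro allI impI)
    fix v assume v: "\<forall>r\<in>A \<union> E'. (\<Sum>\<delta>\<in>mons n d. B r \<delta> M0 * v \<delta>) = 0"
    then have "v \<in> ann M0 d" unfolding ann_A by blast
    moreover have "\<forall>x\<in>E. (\<Sum>\<delta>\<in>mons n d. b x \<delta> * v \<delta>) = 0"
    proof
      fix x assume "x \<in> E"
      then have "Inr x \<in> A \<union> E'" by (simp add: E'_def)
      from bspec[OF v this] show "(\<Sum>\<delta>\<in>mons n d. b x \<delta> * v \<delta>) = 0" by (simp add: B_def)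
    qed
    ultimately show "\<forall>\<delta>\<in>mons n d. v \<delta> = 0" using inj by blast
  qed
  have finAE: "finite (A \<union> E')" using finA by simp
  obtain L D where LD: "D \<in> poly_funs H s" "D M0 \<noteq> 0"
    "\<forall>i\<in>mons n d. \<forall>r\<in>A \<union> E'. L i r \<in> poly_funs H s"
    "\<forall>i\<in>mons n d. \<forall>j\<in>mons n d. \<forall>M. (\<Sum>r\<in>A \<union> E'. L i r M * B r j M) = (if i = j then D M else 0)"
    using poly_funs_left_inverse[OF finite_mons finAE BS inj'] by blast
  show ?thesis
  proof (intro exI[of _ "\<lambda>i x. L i (Inr x)"] exI[of _ D] conjI ballI allI)
    show "D \<in> poly_funs H s" "D M0 \<noteq> 0" by (fact LD)+
    show "L i (Inr r) \<in> poly_funs H s" if "i \<in> mons n d" "r \<in> E" for i r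
      using LD(3) that by (simp add: E'_def)
    fix M \<mu> i assume \<mu>: "\<mu> \<in> ann M d" and i: "i \<in> mons n d"
    have "D M * \<mu> i = (\<Sum>j\<in>mons n d. (if i = j then D M else 0) * \<mu> j)"
      using i by (simp add: if_distrib[of "\<lambda>x. x * _"] finite_mons cong: if_cong)
    also have "\<dots> = (\<Sum>j\<in>mons n d. (\<Sum>r\<in>A \<union> E'. L i r M * B r j M) * \<mu> j)"
      using LD(4) i by (intro sum.cong) auto
    also have "\<dots> = (\<Sum>j\<in>mons n d. \<Sum>r\<in>A \<union> E'. L i r M * (B r j M * \<mu> j))"
      by (simp add: sum_distrib_right mult.assoc)
    also have "\<dots> = (\<Sum>r\<in>A \<union> E'. \<Sum>j\<in>mons n d. L i r M * (B r j M * \<mu> j))"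
      by (rule sum.swap)
    also have "\<dots> = (\<Sum>r\<in>A \<union> E'. L i r M * (\<Sum>j\<in>mons n d. B r j M * \<mu> j))"
      by (simp add: sum_distrib_left)
    also have "\<dots> = (\<Sum>r\<in>E'. L i r M * (\<Sum>j\<in>mons n d. B r j M * \<mu> j))"
      using \<mu> unfolding ann_A by (subst sum.union_disjoint[OF finA disj]) simp
    also have "\<dots> = (\<Sum>r\<in>E. L i (Inr r) M * (\<Sum>\<delta>\<in>mons n d. b r \<delta> * \<mu> \<delta>))"
      unfolding sumE by (simp add: B_def)
    finally show "(\<Sum>r\<in>E. L i (Inr r) M * (\<Sum>\<delta>\<in>mons n d. b r \<delta> * \<mu> \<delta>)) = D M * \<mu> i" by simp
  qed
qed

text \<open>The functions \<open>L\<close> rewrite each monomial in terms of those in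
  \<open>T\<close>, with the common denominator \<open>D\<close>. Read as functionals in the
  monomial, they later supply a basis of \<open>ann M d\<close> that varies polynomially with
  \<open>M\<close>.\<close>

lemma generic_determines:
  assumes T: "determines M0 d T" and d: "e \<le> d"
  shows "\<exists>L D. D \<in> poly_funs H s \<and> D M0 \<noteq> 0 \<and> (\<forall>i\<in>mons n d. \<forall>t\<in>T. L i t \<in> poly_funs H s) \<and>
    (\<forall>M. \<forall>\<mu>\<in>ann M d. \<forall>i\<in>mons n d. (\<Sum>t\<in>T. L i t M * \<mu> t) = D M * \<mu> i) \<and>
    (\<forall>M. D M \<noteq> 0 \<longrightarrow> determines M d T)"
proof -
  have Tm: "T \<subseteq> mons n d" using T by (simp add: determines_def)
  then have finT: "finite T" by (rule finite_subset[OF _ finite_mons])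
  have delta: "(\<Sum>\<delta>\<in>mons n d. (if \<delta> = t then 1 else 0) * \<mu> \<delta>) = \<mu> t" if "t \<in> T" for t and \<mu> :: "nat multiset \<Rightarrow> complex"
  proof -
    have "t \<in> mons n d" using that Tm by blast
    then show ?thesis by (simp add: if_distrib[of "\<lambda>x. x * _"] finite_mons cong: if_cong)
  qed
  have inj: "\<forall>\<mu>\<in>ann M0 d. (\<forall>t\<in>T. (\<Sum>\<delta>\<in>mons n d. (if \<delta> = t then 1 else 0) * \<mu> \<delta>) = 0) \<longrightarrow> (\<forall>\<alpha>\<in>mons n d. \<mu> \<alpha> = 0)"
    using T delta by (simp add: determines_def)
  obtain L D where LD: "D \<in> poly_funs H s" "D M0 \<noteq> 0" "\<forall>i\<in>mons n d. \<forall>t\<in>T. L i t \<in> poly_funs H s"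
    "\<forall>M. \<forall>\<mu>\<in>ann M d. \<forall>i\<in>mons n d.
      (\<Sum>t\<in>T. L i t M * (\<Sum>\<delta>\<in>mons n d. (if \<delta> = t then 1 else 0) * \<mu> \<delta>)) = D M * \<mu> i"
    using generic_left_inverse_ann[OF finT d inj] by blast
  have *: "(\<Sum>t\<in>T. L i t M * \<mu> t) = D M * \<mu> i" if "\<mu> \<in> ann M d" "i \<in> mons n d" for M \<mu> i
  proof -
    have "(\<Sum>t\<in>T. L i t M * \<mu> t) =
      (\<Sum>t\<in>T. L i t M * (\<Sum>\<delta>\<in>mons n d. (if \<delta> = t then 1 else 0) * \<mu> \<delta>))"
      by (intro sum.cong refl) (simp add: delta)
    then show ?thesis using LD(4) that by simp
  qed
  have "determines M d T" if "D M \<noteq> 0" for M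
    unfolding determines_def
  proof (intro conjI ballI impI Tm)
    fix \<mu> \<alpha> assume "\<mu> \<in> ann M d" "\<forall>t\<in>T. \<mu> t = 0" "\<alpha> \<in> mons n d"
    then have "D M * \<mu> \<alpha> = 0" using *[of \<mu> M \<alpha>] by simp
    then show "\<mu> \<alpha> = 0" using that by simp
  qed
  with * LD(1-3) show ?thesis by blast
qed

lemma generic_contract_inj:
  assumes inj: "\<forall>\<mu>\<in>ann M0 (Suc d). (\<forall>\<alpha>\<in>mons n d. contract n l \<mu> \<alpha> = 0) \<longrightarrow> (\<forall>\<alpha>\<in>mons n (Suc d). \<mu> \<alpha> = 0)"
    and d: "e \<le> d"
  shows "\<exists>D\<in>poly_funs H s. D M0 \<noteq> 0 \<and> (\<forall>M. D M \<noteq> 0 \<longrightarrow> (\<forall>\<mu>\<in>ann M (Suc d).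
    (\<forall>\<alpha>\<in>mons n d. contract n l \<mu> \<alpha> = 0) \<longrightarrow> (\<forall>\<alpha>\<in>mons n (Suc d). \<mu> \<alpha> = 0)))"
proof -
  define b where "b \<gamma> \<delta> = (\<Sum>i\<le>n. if add_mset i \<gamma> = \<delta> then l i else 0)" for \<gamma> \<delta>
  have b: "(\<Sum>\<delta>\<in>mons n (Suc d). b \<gamma> \<delta> * \<mu> \<delta>) = contract n l \<mu> \<gamma>" if "\<gamma> \<in> mons n d" for \<gamma> \<mu>
  proof -
    have "(\<Sum>\<delta>\<in>mons n (Suc d). b \<gamma> \<delta> * \<mu> \<delta>) =
      (\<Sum>\<delta>\<in>mons n (Suc d). \<Sum>i\<le>n. if add_mset i \<gamma> = \<delta> then l i * \<mu> \<delta> else 0)"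
      unfolding b_def sum_distrib_right by (intro sum.cong) auto
    also have "\<dots> = (\<Sum>i\<le>n. \<Sum>\<delta>\<in>mons n (Suc d). if add_mset i \<gamma> = \<delta> then l i * \<mu> \<delta> else 0)"
      by (rule sum.swap)
    also have "\<dots> = contract n l \<mu> \<gamma>"
      unfolding contract_def using add_mset_mons[OF _ that] by (intro sum.cong) (auto simp: finite_mons)
    finally show ?thesis .
  qed
  have inj': "\<forall>\<mu>\<in>ann M0 (Suc d). (\<forall>\<gamma>\<in>mons n d. (\<Sum>\<delta>\<in>mons n (Suc d). b \<gamma> \<delta> * \<mu> \<delta>) = 0) \<longrightarrow> (\<forall>\<alpha>\<in>mons n (Suc d). \<mu> \<alpha> = 0)"
    using inj by (simp add: b)
  have d': "e \<le> Suc d" using d by simp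
  obtain L D where LD: "D \<in> poly_funs H s" "D M0 \<noteq> 0"
    "\<forall>M. \<forall>\<mu>\<in>ann M (Suc d). \<forall>i\<in>mons n (Suc d).
      (\<Sum>\<gamma>\<in>mons n d. L i \<gamma> M * (\<Sum>\<delta>\<in>mons n (Suc d). b \<gamma> \<delta> * \<mu> \<delta>)) = D M * \<mu> i"
    using generic_left_inverse_ann[OF finite_mons d' inj'] by blast
  have "\<mu> \<alpha> = 0" if "D M \<noteq> 0" "\<mu> \<in> ann M (Suc d)" "\<forall>\<alpha>\<in>mons n d. contract n l \<mu> \<alpha> = 0" "\<alpha> \<in> mons n (Suc d)" for M \<mu> \<alpha>
  proof -
    have "D M * \<mu> \<alpha> = (\<Sum>\<gamma>\<in>mons n d. L \<alpha> \<gamma> M * (\<Sum>\<delta>\<in>mons n (Suc d). b \<gamma> \<delta> * \<mu> \<delta>))"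
      using LD(3) that(2,4) by simp
    also have "\<dots> = 0" by (rule sum.neutral) (simp add: b that(3))
    finally show ?thesis using that(1) by simp
  qed
  with LD(1,2) show ?thesis by blast
qed

text \<open>\<open>T\<close> bounds the dimension of the annihilator by \<open>card W\<close>. Among
  the \<open>card W + 1\<close> functionals consisting of \<open>\<mu>\<close> and all
  \<open>\<nu> w\<close>, some nontrivial combination vanishes on \<open>T\<close>, hence on all
  monomials; independence forces the coefficient of \<open>\<mu>\<close> to be nonzero.\<close>

lemma ann_span:
  assumes T: "determines M d T" and W: "finite W" "card T = card W"
    and \<nu>: "\<forall>w\<in>W. \<nu> w \<in> ann M d"
    and indep: "\<forall>z. (\<forall>\<alpha>\<in>mons n d. (\<Sum>w\<in>W. z w * \<nu> w \<alpha>) = 0) \<longrightarrow> (\<forall>w\<in>W. z w = 0)"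
    and \<mu>: "\<mu> \<in> ann M d"
  shows "\<exists>z. \<forall>\<alpha>\<in>mons n d. \<mu> \<alpha> = (\<Sum>w\<in>W. z w * \<nu> w \<alpha>)"
proof -
  have finT: "finite T" using T finite_subset[OF _ finite_mons] by (auto simp: determines_def)
  define J where "J = insert None (Some ` W)"
  have finJ: "finite J" and cardJ: "card J = Suc (card W)"
    using W(1) by (simp_all add: J_def card_image)
  have less: "card T < card J" using cardJ W(2) by simp
  define B where "B \<alpha> j = (case j of None \<Rightarrow> \<mu> \<alpha> | Some w \<Rightarrow> \<nu> w \<alpha>)" for \<alpha> j
  obtain z where z: "\<exists>j\<in>J. z j \<noteq> 0" "\<forall>\<alpha>\<in>T. (\<Sum>j\<in>J. B \<alpha> j * z j) = 0"
    using underdetermined_system[OF finT finJ less, of B] by blast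
  have sumJ: "(\<Sum>j\<in>J. B \<alpha> j * z j) = z None * \<mu> \<alpha> + (\<Sum>w\<in>W. z (Some w) * \<nu> w \<alpha>)" for \<alpha>
  proof -
    have "(\<Sum>j\<in>J. B \<alpha> j * z j) = B \<alpha> None * z None + (\<Sum>j\<in>Some ` W. B \<alpha> j * z j)"
      unfolding J_def using W(1) by (subst sum.insert) auto
    also have "(\<Sum>j\<in>Some ` W. B \<alpha> j * z j) = (\<Sum>w\<in>W. z (Some w) * \<nu> w \<alpha>)"
      by (subst sum.reindex) (auto simp: B_def mult.commute)
    finally show ?thesis by (simp add: B_def mult.commute)
  qed
  have "(\<lambda>\<alpha>. z None * \<mu> \<alpha> + (\<Sum>w\<in>W. z (Some w) * \<nu> w \<alpha>)) \<in> ann M d"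
    using \<nu> \<mu> by (intro ann_add ann_scale ann_sum) auto
  from determinesD[OF T this]
  have all0: "\<forall>\<alpha>\<in>mons n d. z None * \<mu> \<alpha> + (\<Sum>w\<in>W. z (Some w) * \<nu> w \<alpha>) = 0"
    using z(2) by (simp add: sumJ)
  have zN: "z None \<noteq> 0"
  proof
    assume z0: "z None = 0"
    then have "\<forall>w\<in>W. z (Some w) = 0" using indep[rule_format, of "\<lambda>w. z (Some w)"] all0 by simp
    then show False using z(1) z0 by (auto simp: J_def)
  qed
  show ?thesis
  proof (intro exI[of _ "\<lambda>w. - z (Some w) / z None"] ballI)
    fix \<alpha> assume "\<alpha> \<in> mons n d"
    then have "z None * \<mu> \<alpha> + (\<Sum>w\<in>W. z (Some w) * \<nu> w \<alpha>) = 0" using all0 by blast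
    then have "\<mu> \<alpha> = - (\<Sum>w\<in>W. z (Some w) * \<nu> w \<alpha>) / z None"
      using zN by (simp add: field_simps add_eq_0_iff)
    also have "\<dots> = (\<Sum>w\<in>W. - z (Some w) / z None * \<nu> w \<alpha>)"
      by (simp add: sum_divide_distrib sum_negf)
    finally show "\<mu> \<alpha> = (\<Sum>w\<in>W. - z (Some w) / z None * \<nu> w \<alpha>)" .
  qed
qed

lemma lifts_imp_zero_at: "lifts M0 M p \<Longrightarrow> zero_at M0 p"
  unfolding zero_at_def
proof
  fix J assume l: "lifts M0 M p" and J: "J \<in> R"
  then obtain x where x: "\<forall>i\<le>n. poly (x i) 0 = p i"
    "[:0, 1:] ^ 1 dvd (\<Sum>\<beta>\<in>mons n e. [:c J \<beta> M0, c J \<beta> M - c J \<beta> M0:] * mev x \<beta>)"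
    unfolding lifts_def by blast
  have "poly (\<Sum>\<beta>\<in>mons n e. [:c J \<beta> M0, c J \<beta> M - c J \<beta> M0:] * mev x \<beta>) 0 = 0"
    using x(2) by (simp only: poly_eq_0_iff_dvd power_one_right minus_zero)
  also have "poly (\<Sum>\<beta>\<in>mons n e. [:c J \<beta> M0, c J \<beta> M - c J \<beta> M0:] * mev x \<beta>) 0 =
      (\<Sum>\<beta>\<in>mons n e. c J \<beta> M0 * mev p \<beta>)"
    unfolding poly_sum poly_mult poly_mev
    by (intro sum.cong refl arg_cong2[of _ _ _ _ "(*)"]) (use x(1) in \<open>auto intro!: mev_cong\<close>)
  finally show "(\<Sum>\<beta>\<in>mons n e. c J \<beta> M0 * mev p \<beta>) = 0" .
qed

end

section \<open>Eigenvectors of the pencil of contractions are evaluations\<close>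

context poly_system
begin

text \<open>Shifting \<open>\<mu>\<close> by two variables in either order gives \<open>p i * \<nu>
  (add_mset j \<gamma>) = p j * \<nu> (add_mset i \<gamma>)\<close>. Trading the variables one by
  one for a fixed \<open>i0\<close> with \<open>p i0 \<noteq> 0\<close> shows that
  \<open>\<nu>\<close> is a multiple of evaluation at \<open>p\<close>, and the annihilator
  conditions in degree \<open>d \<ge> e\<close> then make \<open>p\<close> a zero.\<close>

lemma evaluation_of_proportional_contractions:
  assumes \<mu>: "\<mu> \<in> ann M (Suc d)" "\<alpha>0 \<in> mons n (Suc d)" "\<mu> \<alpha>0 \<noteq> 0"
    and \<nu>: "\<nu> \<in> ann M d" and d: "e \<le> d"
    and pr: "\<forall>i\<le>n. \<forall>\<alpha>\<in>mons n d. \<mu> (add_mset i \<alpha>) = p i * \<nu> \<alpha>"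
  shows "nonzero n p \<and> zero_at M p \<and> (\<exists>\<alpha>\<in>mons n d. \<nu> \<alpha> \<noteq> 0)"
proof -
  obtain i0 \<beta>0 where i0: "i0 \<le> n" "\<beta>0 \<in> mons n d" "\<alpha>0 = add_mset i0 \<beta>0"
    using mons_Suc[OF \<mu>(2)] by blast
  then have p0: "p i0 \<noteq> 0" and \<nu>0: "\<nu> \<beta>0 \<noteq> 0" using pr \<mu>(3) by auto
  have key: "p i0 ^ r * \<nu> (\<beta> + replicate_mset (d - r) i0) = mev p \<beta> * \<nu> (replicate_mset d i0)"
    if "\<beta> \<in> mons n r" "r \<le> d" for r \<beta>
    using that
  proof (induction r arbitrary: \<beta>)
    case 0
    then show ?case by (simp add: mons_def)
  next
    case (Suc r)
    obtain j \<beta>' where j: "j \<le> n" "\<beta>' \<in> mons n r" "\<beta> = add_mset j \<beta>'"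
      using mons_Suc[OF Suc.prems(1)] by blast
    define \<gamma> where "\<gamma> = \<beta>' + replicate_mset (d - Suc r) i0"
    have dr: "d - r = Suc (d - Suc r)" using Suc.prems(2) by simp
    have a1: "\<beta>' + replicate_mset (d - r) i0 = add_mset i0 \<gamma>" by (simp add: dr \<gamma>_def)
    have a2: "\<beta> + replicate_mset (d - Suc r) i0 = add_mset j \<gamma>" by (simp add: j(3) \<gamma>_def)
    have "\<gamma> \<in> mons n (r + (d - Suc r))"
      unfolding \<gamma>_def by (intro plus_mons j(2) replicate_mons i0(1))
    then have in1: "add_mset i0 \<gamma> \<in> mons n (Suc (r + (d - Suc r)))" "add_mset j \<gamma> \<in> mons n (Suc (r + (d - Suc r)))"
      using i0(1) j(1) by (auto intro: add_mset_mons)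
    moreover have "Suc (r + (d - Suc r)) = d" using Suc.prems(2) by simp
    ultimately have in2: "add_mset i0 \<gamma> \<in> mons n d" "add_mset j \<gamma> \<in> mons n d" by auto
    have "p i0 * \<nu> (add_mset j \<gamma>) = p j * \<nu> (add_mset i0 \<gamma>)"
      using pr i0(1) j(1) in2 by (metis add_mset_commute)
    then have "p i0 ^ Suc r * \<nu> (add_mset j \<gamma>) = p j * (p i0 ^ r * \<nu> (add_mset i0 \<gamma>))"
      by (simp add: mult_ac)
    also have "p i0 ^ r * \<nu> (add_mset i0 \<gamma>) = mev p \<beta>' * \<nu> (replicate_mset d i0)"
      using Suc.IH[OF j(2)] Suc.prems(2) by (simp add: a1)
    finally show ?case unfolding a2 by (simp add: j(3) mult_ac)
  qed
  define \<kappa> where "\<kappa> = \<nu> (replicate_mset d i0)"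
  have ev: "p i0 ^ d * \<nu> \<beta> = mev p \<beta> * \<kappa>" if "\<beta> \<in> mons n d" for \<beta>
    using key[OF that] by (simp add: \<kappa>_def)
  have \<kappa>0: "\<kappa> \<noteq> 0" using ev[OF i0(2)] p0 \<nu>0 by auto
  have "(\<lambda>\<alpha>. p i0 ^ d / \<kappa> * \<nu> \<alpha>) \<in> ann M d" using \<nu> by (rule ann_scale)
  then have mev_ann: "mev p \<in> ann M d"
    by (rule ann_cong) (use ev \<kappa>0 in \<open>simp add: field_simps\<close>)
  have "zero_at M p" unfolding zero_at_def
  proof
    fix J assume J: "J \<in> R"
    have "\<forall>k. \<forall>\<gamma>\<in>mons n k. d = e + k \<longrightarrow> (\<Sum>\<beta>\<in>mons n e. c J \<beta> M * mev p (\<beta> + \<gamma>)) = 0"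
      using mev_ann J unfolding ann_def mem_Collect_eq by (rule bspec)
    moreover have "replicate_mset (d - e) i0 \<in> mons n (d - e)" using i0(1) by (rule replicate_mons)
    moreover have "d = e + (d - e)" using d by simp
    ultimately have "0 = (\<Sum>\<beta>\<in>mons n e. c J \<beta> M * mev p (\<beta> + replicate_mset (d - e) i0))"
      by metis
    also have "\<dots> = (\<Sum>\<beta>\<in>mons n e. c J \<beta> M * mev p \<beta>) * p i0 ^ (d - e)"
      by (simp add: mev_plus mev_replicate sum_distrib_right mult.assoc)
    finally show "(\<Sum>\<beta>\<in>mons n e. c J \<beta> M * mev p \<beta>) = 0" using p0 by simp
  qed
  with p0 i0(1,2) \<nu>0 show ?thesis by (auto simp: nonzero_def)
qed

text \<open>The usual argument for distinct eigenvalues, applied to a pencil: the relation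
  contracted with \<open>l\<close>, minus \<open>w\<close> times the relation contracted with
  \<open>l0\<close>, loses the term of \<open>w\<close>, and \<open>inj\<close> lifts the result
  back to degree \<open>Suc d\<close>.\<close>

lemma eigen_independent:
  assumes inj: "\<forall>\<mu>\<in>ann M (Suc d). (\<forall>\<alpha>\<in>mons n d. contract n l0 \<mu> \<alpha> = 0) \<longrightarrow> (\<forall>\<alpha>\<in>mons n (Suc d). \<mu> \<alpha> = 0)"
    and "finite V"
    and \<mu>: "\<forall>u\<in>V. \<mu> u \<in> ann M (Suc d) \<and> (\<exists>\<alpha>\<in>mons n (Suc d). \<mu> u \<alpha> \<noteq> 0) \<and>
      (\<forall>\<alpha>\<in>mons n d. contract n l (\<mu> u) \<alpha> = u * contract n l0 (\<mu> u) \<alpha>)"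
    and zero: "\<forall>\<alpha>\<in>mons n (Suc d). (\<Sum>u\<in>V. z u * \<mu> u \<alpha>) = 0"
  shows "\<forall>u\<in>V. z u = 0"
  using assms(2-)
proof (induction V arbitrary: z rule: finite_induct)
  case (insert w V)
  have "\<forall>\<alpha>\<in>mons n (Suc d). (\<Sum>u\<in>V. (z u * (u - w)) * \<mu> u \<alpha>) = 0"
  proof -
    have "(\<lambda>\<alpha>. \<Sum>u\<in>V. (z u * (u - w)) * \<mu> u \<alpha>) \<in> ann M (Suc d)"
      using insert.prems(1) by (intro ann_sum) auto
    moreover have "contract n l0 (\<lambda>\<alpha>. \<Sum>u\<in>V. (z u * (u - w)) * \<mu> u \<alpha>) \<alpha> = 0" if \<alpha>: "\<alpha> \<in> mons n d" for \<alpha>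
    proof -
      have c0: "contract n k (\<lambda>\<alpha>. \<Sum>u\<in>insert w V. z u * \<mu> u \<alpha>) \<alpha> = 0" for k
      proof -
        have "contract n k (\<lambda>\<alpha>. \<Sum>u\<in>insert w V. z u * \<mu> u \<alpha>) \<alpha> = contract n k (\<lambda>_. 0) \<alpha>"
          using insert.prems(2) by (intro contract_cong[OF _ \<alpha>]) blast
        then show ?thesis by (simp add: contract_def)
      qed
      have "(\<Sum>u\<in>insert w V. z u * contract n l (\<mu> u) \<alpha>) - w * (\<Sum>u\<in>insert w V. z u * contract n l0 (\<mu> u) \<alpha>) = 0"
        using c0[of l] c0[of l0] by (simp add: contract_sum)
      also have "(\<Sum>u\<in>insert w V. z u * contract n l (\<mu> u) \<alpha>) - w * (\<Sum>u\<in>insert w V. z u * contract n l0 (\<mu> u) \<alpha>) =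
        (\<Sum>u\<in>insert w V. (z u * (u - w)) * contract n l0 (\<mu> u) \<alpha>)"
        unfolding sum_distrib_left sum_subtractf[symmetric]
        using insert.prems(1) \<alpha> by (intro sum.cong) (auto simp: algebra_simps)
      also have "\<dots> = (\<Sum>u\<in>V. (z u * (u - w)) * contract n l0 (\<mu> u) \<alpha>)"
        using insert.hyps by simp
      finally show ?thesis by (simp add: contract_sum)
    qed
    ultimately show ?thesis using inj by blast
  qed
  then have "\<forall>u\<in>V. z u * (u - w) = 0" using insert.IH[of "\<lambda>u. z u * (u - w)"] insert.prems(1) by simp
  then have zV: "\<forall>u\<in>V. z u = 0" using insert.hyps(2) by auto
  obtain \<alpha> where "\<alpha> \<in> mons n (Suc d)" "\<mu> w \<alpha> \<noteq> 0" using insert.prems(1) by auto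
  moreover have "z w * \<mu> w \<alpha> = 0" if "\<alpha> \<in> mons n (Suc d)" for \<alpha>
    using bspec[OF insert.prems(2) that] insert.hyps zV by simp
  ultimately have "z w = 0" by auto
  with zV show ?case by simp
qed simp

text \<open>Shifting by a variable commutes with both contractions, so it sends the eigenvector
  \<open>\<mu> u\<close> into the eigenspace of \<open>u\<close> one degree lower. There the
  functionals \<open>\<nu> w\<close> form a basis of eigenvectors with distinct eigenvalues, so this
  eigenspace is the line of \<open>\<nu> u\<close>. All shifts of \<open>\<mu> u\<close> are thus
  proportional to \<open>\<nu> u\<close>, which makes \<open>\<nu> u\<close> an evaluation.\<close>

lemma eigen_is_zero:
  assumes inj1: "\<forall>\<mu>\<in>ann M (Suc d). (\<forall>\<alpha>\<in>mons n d. contract n l0 \<mu> \<alpha> = 0) \<longrightarrow> (\<forall>\<alpha>\<in>mons n (Suc d). \<mu> \<alpha> = 0)"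
    and inj0: "\<forall>\<mu>\<in>ann M d. (\<forall>\<alpha>\<in>mons n d'. contract n l0 \<mu> \<alpha> = 0) \<longrightarrow> (\<forall>\<alpha>\<in>mons n d. \<mu> \<alpha> = 0)"
    and d: "d = Suc d'" "e \<le> d"
    and T: "determines M d T" "card T = card U"
    and U: "finite U"
    and \<mu>: "\<forall>u\<in>U. \<mu> u \<in> ann M (Suc d) \<and> (\<exists>\<alpha>\<in>mons n (Suc d). \<mu> u \<alpha> \<noteq> 0) \<and>
      (\<forall>\<alpha>\<in>mons n d. contract n l (\<mu> u) \<alpha> = u * contract n l0 (\<mu> u) \<alpha>)"
    and u: "u \<in> U"
  shows "\<exists>x. nonzero n x \<and> zero_at M x \<and> linform n l0 x = 1 \<and> linform n l x = u"
proof -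
  define \<nu> where "\<nu> w = contract n l0 (\<mu> w)" for w
  have \<mu>ann: "\<mu> w \<in> ann M (Suc d)" if "w \<in> U" for w using \<mu> that by blast
  have \<nu>ann: "\<nu> w \<in> ann M d" if "w \<in> U" for w unfolding \<nu>_def by (intro ann_contract \<mu>ann that)
  have eig: "contract n l (\<mu> w) \<alpha> = w * \<nu> w \<alpha>" if "w \<in> U" "\<alpha> \<in> mons n d" for w \<alpha>
    using \<mu> that by (simp add: \<nu>_def)
  have indep: "\<forall>z. (\<forall>\<alpha>\<in>mons n d. (\<Sum>w\<in>U. z w * \<nu> w \<alpha>) = 0) \<longrightarrow> (\<forall>w\<in>U. z w = 0)"
  proof (intro allI impI)
    fix z assume z: "\<forall>\<alpha>\<in>mons n d. (\<Sum>w\<in>U. z w * \<nu> w \<alpha>) = 0"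
    have "(\<lambda>\<alpha>. \<Sum>w\<in>U. z w * \<mu> w \<alpha>) \<in> ann M (Suc d)" by (intro ann_sum \<mu>ann)
    moreover have "\<forall>\<alpha>\<in>mons n d. contract n l0 (\<lambda>\<alpha>. \<Sum>w\<in>U. z w * \<mu> w \<alpha>) \<alpha> = 0"
      using z by (simp add: contract_sum \<nu>_def)
    ultimately have "\<forall>\<alpha>\<in>mons n (Suc d). (\<Sum>w\<in>U. z w * \<mu> w \<alpha>) = 0" using inj1 by blast
    with inj1 U \<mu> show "\<forall>w\<in>U. z w = 0" by (rule eigen_independent)
  qed
  have "\<exists>p. \<forall>\<alpha>\<in>mons n d. \<mu> u (add_mset i \<alpha>) = p * \<nu> u \<alpha>" if i: "i \<le> n" for i
  proof -
    have sh: "(\<lambda>\<alpha>. \<mu> u (add_mset i \<alpha>)) \<in> ann M d" by (intro ann_shift \<mu>ann u i)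
    have \<nu>all: "\<forall>w\<in>U. \<nu> w \<in> ann M d" using \<nu>ann by blast
    obtain z where z: "\<forall>\<alpha>\<in>mons n d. \<mu> u (add_mset i \<alpha>) = (\<Sum>w\<in>U. z w * \<nu> w \<alpha>)"
      using ann_span[OF T(1) U T(2) \<nu>all indep sh] by blast
    \<comment> \<open>Contraction with \<open>l\<close> minus \<open>u\<close> times contraction
      with \<open>l0\<close> annihilates the shifted functional. On its expansion this produces the
      contraction of \<open>\<xi>\<close> with \<open>l0\<close>, so \<open>\<xi>\<close> vanishes
      and only the coefficient of \<open>\<nu> u\<close> survives.\<close>
    define \<xi> where "\<xi> \<alpha> = (\<Sum>w\<in>U. (z w * (w - u)) * \<nu> w \<alpha>)" for \<alpha>
    have "\<xi> \<in> ann M d" unfolding \<xi>_def[abs_def] by (intro ann_sum \<nu>ann)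
    moreover have "contract n l0 \<xi> \<alpha> = 0" if \<alpha>: "\<alpha> \<in> mons n d'" for \<alpha>
    proof -
      have sub: "contract n k (\<lambda>\<alpha>. \<mu> u (add_mset i \<alpha>)) \<alpha> = (\<Sum>w\<in>U. z w * contract n k (\<nu> w) \<alpha>)" for k
      proof -
        have "contract n k (\<lambda>\<alpha>. \<mu> u (add_mset i \<alpha>)) \<alpha> = contract n k (\<lambda>\<alpha>. \<Sum>w\<in>U. z w * \<nu> w \<alpha>) \<alpha>"
          using z unfolding d(1) by (intro contract_cong[OF _ \<alpha>]) blast
        then show ?thesis by (simp add: contract_sum)
      qed
      have l\<nu>: "contract n l (\<nu> w) \<alpha> = w * contract n l0 (\<nu> w) \<alpha>" if w: "w \<in> U" for w
      proof -
        have "contract n l (\<nu> w) \<alpha> = contract n l0 (contract n l (\<mu> w)) \<alpha>"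
          unfolding \<nu>_def by (rule contract_commute)
        also have "\<dots> = contract n l0 (\<lambda>\<alpha>. w * \<nu> w \<alpha>) \<alpha>"
          using eig[OF w] unfolding d(1) by (intro contract_cong[OF _ \<alpha>]) blast
        also have "\<dots> = w * contract n l0 (\<nu> w) \<alpha>"
          by (simp add: contract_def sum_distrib_left mult_ac)
        finally show ?thesis .
      qed
      have "contract n l (\<lambda>\<alpha>. \<mu> u (add_mset i \<alpha>)) \<alpha> = contract n l (\<mu> u) (add_mset i \<alpha>)"
        "contract n l0 (\<lambda>\<alpha>. \<mu> u (add_mset i \<alpha>)) \<alpha> = \<nu> u (add_mset i \<alpha>)"
        by (simp_all add: contract_def \<nu>_def add_mset_commute)
      moreover have "add_mset i \<alpha> \<in> mons n d" unfolding d(1) by (intro add_mset_mons i \<alpha>)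
      ultimately have "contract n l (\<lambda>\<alpha>. \<mu> u (add_mset i \<alpha>)) \<alpha> = u * contract n l0 (\<lambda>\<alpha>. \<mu> u (add_mset i \<alpha>)) \<alpha>"
        using eig[OF u] by simp
      then have "(\<Sum>w\<in>U. z w * contract n l (\<nu> w) \<alpha>) - u * (\<Sum>w\<in>U. z w * contract n l0 (\<nu> w) \<alpha>) = 0"
        by (simp add: sub)
      also have "(\<Sum>w\<in>U. z w * contract n l (\<nu> w) \<alpha>) - u * (\<Sum>w\<in>U. z w * contract n l0 (\<nu> w) \<alpha>) =
          (\<Sum>w\<in>U. (z w * (w - u)) * contract n l0 (\<nu> w) \<alpha>)"
        unfolding sum_distrib_left sum_subtractf[symmetric]
        by (intro sum.cong) (auto simp: l\<nu> algebra_simps)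
      finally show ?thesis unfolding \<xi>_def[abs_def] by (simp add: contract_sum)
    qed
    ultimately have "\<forall>\<alpha>\<in>mons n d. \<xi> \<alpha> = 0" using inj0 by blast
    then have "\<forall>w\<in>U. z w * (w - u) = 0"
      using indep[rule_format, of "\<lambda>w. z w * (w - u)"] by (simp add: \<xi>_def)
    then have zw: "z w = 0" if "w \<in> U - {u}" for w using that by auto
    have "(\<Sum>w\<in>U. z w * \<nu> w \<alpha>) = z u * \<nu> u \<alpha>" for \<alpha>
      using U u zw by (subst sum.remove[OF U u]) simp
    then show ?thesis using z by auto
  qed
  then have "\<forall>i. \<exists>p. i \<le> n \<longrightarrow> (\<forall>\<alpha>\<in>mons n d. \<mu> u (add_mset i \<alpha>) = p * \<nu> u \<alpha>)" by blast
  from choice[OF this] obtain p where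
    p: "\<forall>i\<le>n. \<forall>\<alpha>\<in>mons n d. \<mu> u (add_mset i \<alpha>) = p i * \<nu> u \<alpha>" by blast
  obtain \<alpha>0 where \<alpha>0: "\<alpha>0 \<in> mons n (Suc d)" "\<mu> u \<alpha>0 \<noteq> 0" using \<mu> u by blast
  have ev: "nonzero n p \<and> zero_at M p \<and> (\<exists>\<alpha>\<in>mons n d. \<nu> u \<alpha> \<noteq> 0)"
    by (rule evaluation_of_proportional_contractions[OF \<mu>ann[OF u] \<alpha>0 \<nu>ann[OF u] d(2) p])
  then obtain \<alpha> where \<alpha>: "\<alpha> \<in> mons n d" "\<nu> u \<alpha> \<noteq> 0" by blast
  have lin: "contract n k (\<mu> u) \<alpha> = linform n k p * \<nu> u \<alpha>" for k
    unfolding contract_def linform_def sum_distrib_right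
    using p \<alpha>(1) by (intro sum.cong) auto
  have "\<nu> u \<alpha> = linform n l0 p * \<nu> u \<alpha>" using lin[of l0] by (simp add: \<nu>_def)
  then have "linform n l0 p = 1" using \<alpha>(2) by simp
  moreover have "linform n l p = u" using lin[of l] eig[OF u \<alpha>(1)] \<alpha>(2) by simp
  ultimately show ?thesis using ev by blast
qed

end

section \<open>The number of zeros for general parameters\<close>

context poly_system
begin

text \<open>By \<open>ann_dim_ge\<close> no smaller set determines the annihilator, so some
  functional vanishes on \<open>T - {t}\<close> without vanishing identically; it is nonzero at
  \<open>t\<close> and can be normalized.\<close>

lemma ann_dual_basis:
  assumes P: "point_set n P" "card P \<le> Suc d" and lifts: "\<forall>p\<in>P. lifts M0 M p"
    and d: "e \<le> d" and T: "determines M d T" "card T = card P" and t: "t \<in> T"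
  shows "\<exists>\<mu>\<in>ann M d. \<forall>\<alpha>\<in>T. \<mu> \<alpha> = (if \<alpha> = t then 1 else 0)"
proof -
  have Tm: "T \<subseteq> mons n d" using T by (simp add: determines_def)
  then have finT: "finite T" by (rule finite_subset[OF _ finite_mons])
  have "card (T - {t}) < card P" using T(2) finT t by (metis card_Diff1_less)
  moreover have "T - {t} \<subseteq> mons n d" using Tm by blast
  ultimately have "\<not> determines M d (T - {t})" using ann_dim_ge[OF P lifts d] by blast
  then obtain \<mu> \<alpha> where \<mu>: "\<mu> \<in> ann M d" "\<forall>\<beta>\<in>T - {t}. \<mu> \<beta> = 0" "\<alpha> \<in> mons n d" "\<mu> \<alpha> \<noteq> 0"
    using Tm by (auto simp: determines_def)
  have \<mu>t: "\<mu> t \<noteq> 0"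
  proof
    assume "\<mu> t = 0"
    then have "\<forall>\<beta>\<in>T. \<mu> \<beta> = 0" using \<mu>(2) by blast
    then show False using determinesD[OF T(1) \<mu>(1) _ \<mu>(3)] \<mu>(4) by blast
  qed
  show ?thesis
  proof (intro bexI[of _ "\<lambda>\<alpha>. (1 / \<mu> t) * \<mu> \<alpha>"] ballI)
    show "(\<lambda>\<alpha>. (1 / \<mu> t) * \<mu> \<alpha>) \<in> ann M d" by (rule ann_scale[OF \<mu>(1)])
    show "(1 / \<mu> t) * \<mu> \<beta> = (if \<beta> = t then 1 else 0)" if "\<beta> \<in> T" for \<beta>
      using \<mu>(2) \<mu>t that by auto
  qed
qed

text \<open>Three consecutive degrees occur: the pencil consists of the contractions from degree
  \<open>Suc d\<close> to \<open>d\<close>, and injectivity of contraction from \<open>d\<close> to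
  \<open>d'\<close> isolates its eigenspaces.\<close>

theorem generic_zero_count:
  assumes M0: "M0 \<in> H" and P: "point_set n P" "card P = N"
    and lifts: "\<forall>M\<in>H. \<forall>p\<in>P. lifts M0 M p"
    and det: "\<forall>d\<ge>d0. \<exists>T. determines M0 d T \<and> card T \<le> N"
  shows "\<exists>D\<in>poly_funs H s. D M0 \<noteq> 0 \<and> (\<forall>M\<in>H. D M \<noteq> 0 \<longrightarrow>
    (\<exists>Q. point_set n Q \<and> card Q = N \<and> (\<forall>q\<in>Q. zero_at M q) \<and>
      (\<forall>x. nonzero n x \<and> zero_at M x \<longrightarrow> (\<exists>q\<in>Q. \<not> nonprop n x q))))"
proof -
  \<comment> \<open>Large enough for the bound at \<open>M0\<close>, for equations of degree
    \<open>e\<close> to act, and for the evaluations at \<open>N\<close> points to be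
    independent.\<close>
  define d' where "d' = max d0 (N + e)"
  define d where "d = Suc d'"
  have dd: "d0 \<le> d'" "e \<le> d'" "N \<le> d'" "e \<le> d" "N \<le> d" by (auto simp: d'_def d_def)
  have finP: "finite P" using P(1) by (simp add: point_set_def)
  have "d0 \<le> d" "d0 \<le> Suc d" using dd(1) by (simp_all add: d_def)
  then obtain T T' where T: "determines M0 d T" "card T \<le> N" and T': "determines M0 (Suc d) T'" "card T' \<le> N"
    using det by metis
  have Tm: "T \<subseteq> mons n d" "T' \<subseteq> mons n (Suc d)" using T T' by (auto simp: determines_def)
  then have finT: "finite T" "finite T'" using finite_subset[OF _ finite_mons] by auto
  have lifts0: "\<forall>p\<in>P. lifts M0 M0 p" using lifts M0 by blast
  then have P0: "zero_at M0 p" if "p \<in> P" for p using that lifts_imp_zero_at by blast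
  have cardP: "card P \<le> Suc d" "card P \<le> Suc (Suc d)" using P(2) dd by auto
  have cT: "card T = N"
    using ann_dim_ge[OF P(1) cardP(1) lifts0 dd(4) Tm(1)] T P(2) by linarith
  have cT': "card T' = N"
    using ann_dim_ge[OF P(1) cardP(2) lifts0 _ Tm(2)] T' P(2) dd(4) by linarith
  have "\<exists>l. \<forall>p\<in>P. linform n l p \<noteq> 0"
    by (rule ex_separating_linform[OF finP]) (use P(1) in \<open>simp add: point_set_def\<close>)
  then obtain l0 where l0: "\<forall>p\<in>P. linform n l0 p \<noteq> 0" ..
  \<comment> \<open>The combination of \<open>a\<close> and \<open>b\<close> on which
    \<open>l0\<close> vanishes. If \<open>l\<close> does not vanish on it, the ratios of
    \<open>l\<close> to \<open>l0\<close> at \<open>a\<close> and \<open>b\<close> differ, so the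
    eigenvalues \<open>u p\<close> at \<open>M0\<close> are distinct.\<close>
  define q where "q a b i = linform n l0 b * a i - linform n l0 a * b i" for a b :: "nat \<Rightarrow> complex" and i :: nat
  define Q where "Q = (\<lambda>(a, b). q a b) ` {(a, b) \<in> P \<times> P. a \<noteq> b}"
  have "finite {(a, b) \<in> P \<times> P. a \<noteq> b}" by (rule finite_subset[of _ "P \<times> P"]) (use finP in auto)
  then have finQ: "finite Q" unfolding Q_def by (rule finite_imageI)
  have nzQ: "nonzero n x" if x: "x \<in> Q" for x
  proof -
    obtain a b where ab: "a \<in> P" "b \<in> P" "a \<noteq> b" "x = q a b" using x by (auto simp: Q_def)
    then have "nonprop n a b" using P(1) by (simp add: point_set_def)
    then obtain i j where ij: "i \<le> n" "j \<le> n" "a i * b j \<noteq> a j * b i" by (auto simp: nonprop_def)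
    show ?thesis
    proof (rule ccontr)
      assume "\<not> nonzero n x"
      then have "linform n l0 b * a i = linform n l0 a * b i" "linform n l0 b * a j = linform n l0 a * b j"
        using ij(1,2) ab(4) by (auto simp: nonzero_def q_def)
      then have "linform n l0 b * (a i * b j) = linform n l0 b * (a j * b i)"
        by (metis (no_types, lifting) mult.assoc mult.commute)
      then show False using ij(3) l0 ab(2) by simp
    qed
  qed
  have "\<exists>l. \<forall>x\<in>Q. linform n l x \<noteq> 0" by (rule ex_separating_linform[OF finQ nzQ])
  then obtain l where l: "\<forall>x\<in>Q. linform n l x \<noteq> 0" ..
  have lq: "linform n l (q a b) = linform n l0 b * linform n l a - linform n l0 a * linform n l b" for a b
    unfolding linform_def[of n l] q_def by (simp add: algebra_simps sum_subtractf sum_distrib_left)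
  define u where "u p = linform n l p / linform n l0 p" for p
  have u_inj: "inj_on u P"
  proof (rule inj_onI, rule ccontr)
    fix a b assume ab: "a \<in> P" "b \<in> P" "u a = u b" "a \<noteq> b"
    then have "linform n l (q a b) \<noteq> 0" using l by (auto simp: Q_def)
    then show False using ab l0 by (simp add: lq u_def field_simps)
  qed
  have mev_nz: "\<exists>\<alpha>\<in>mons n k. mev p \<alpha> \<noteq> 0" if "p \<in> P" for p k
  proof -
    obtain i where i: "i \<le> n" "p i \<noteq> 0" using P(1) \<open>p \<in> P\<close> by (auto simp: point_set_def nonzero_def)
    then show ?thesis using replicate_mons[of i n k] by (intro bexI[of _ "replicate_mset k i"]) (auto simp: mev_replicate)
  qed
  \<comment> \<open>At \<open>M0\<close> every annihilating functional is a combination of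
    evaluations at \<open>P\<close>, and contraction with \<open>l0\<close> multiplies the
    coefficient of \<open>p\<close> by the nonzero value of \<open>l0\<close> at
    \<open>p\<close>.\<close>
  have contract_inj: "\<forall>\<mu>\<in>ann M0 (Suc k). (\<forall>\<alpha>\<in>mons n k. contract n l0 \<mu> \<alpha> = 0) \<longrightarrow> (\<forall>\<alpha>\<in>mons n (Suc k). \<mu> \<alpha> = 0)"
    if det_k: "determines M0 (Suc k) T''" "card T'' = N" and k: "N \<le> k" for k T''
  proof (intro ballI impI)
    fix \<mu> \<alpha> assume \<mu>: "\<mu> \<in> ann M0 (Suc k)" "\<forall>\<alpha>\<in>mons n k. contract n l0 \<mu> \<alpha> = 0" and \<alpha>: "\<alpha> \<in> mons n (Suc k)"
    have "\<forall>z. (\<forall>\<alpha>\<in>mons n (Suc k). (\<Sum>p\<in>P. z p * mev p \<alpha>) = 0) \<longrightarrow> (\<forall>p\<in>P. z p = 0)"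
      using mev_independent[OF P(1), of "Suc k"] P(2) k by auto
    moreover have "\<forall>p\<in>P. mev p \<in> ann M0 (Suc k)" using P0 zero_at_imp_ann by blast
    moreover have "card T'' = card P" using det_k(2) P(2) by simp
    ultimately obtain z where z: "\<forall>\<alpha>\<in>mons n (Suc k). \<mu> \<alpha> = (\<Sum>p\<in>P. z p * mev p \<alpha>)"
      using ann_span[OF det_k(1) finP _ _ _ \<mu>(1)] by blast
    have "(\<Sum>p\<in>P. (z p * linform n l0 p) * mev p \<beta>) = 0" if \<beta>: "\<beta> \<in> mons n k" for \<beta>
    proof -
      have "contract n l0 \<mu> \<beta> = contract n l0 (\<lambda>\<alpha>. \<Sum>p\<in>P. z p * mev p \<alpha>) \<beta>"
        using z by (intro contract_cong[OF _ \<beta>]) blast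
      also have "\<dots> = (\<Sum>p\<in>P. (z p * linform n l0 p) * mev p \<beta>)"
        by (simp add: contract_sum contract_mev mult.assoc)
      finally show ?thesis using \<mu>(2) \<beta> by simp
    qed
    then have "\<forall>p\<in>P. z p * linform n l0 p = 0"
      using mev_independent[OF P(1), of k "\<lambda>p. z p * linform n l0 p"] P(2) k by auto
    then have "\<forall>p\<in>P. z p = 0" using l0 by simp
    then show "\<mu> \<alpha> = 0" using z \<alpha> by simp
  qed
  have e_le: "e \<le> Suc d" using dd(4) by simp
  obtain D1 where D1: "D1 \<in> poly_funs H s" "D1 M0 \<noteq> 0" "\<forall>M. D1 M \<noteq> 0 \<longrightarrow> determines M d T"
    using generic_determines[OF T(1) dd(4)] by blast
  obtain L D2 where D2: "D2 \<in> poly_funs H s" "D2 M0 \<noteq> 0"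
    "\<forall>i\<in>mons n (Suc d). \<forall>t\<in>T'. L i t \<in> poly_funs H s"
    "\<forall>M. \<forall>\<mu>\<in>ann M (Suc d). \<forall>i\<in>mons n (Suc d). (\<Sum>t\<in>T'. L i t M * \<mu> t) = D2 M * \<mu> i"
    "\<forall>M. D2 M \<noteq> 0 \<longrightarrow> determines M (Suc d) T'"
    using generic_determines[OF T'(1) e_le] by blast
  have inj1: "\<forall>\<mu>\<in>ann M0 (Suc d). (\<forall>\<alpha>\<in>mons n d. contract n l0 \<mu> \<alpha> = 0) \<longrightarrow> (\<forall>\<alpha>\<in>mons n (Suc d). \<mu> \<alpha> = 0)"
    by (rule contract_inj[OF T'(1) cT' dd(5)])
  have inj0: "\<forall>\<mu>\<in>ann M0 (Suc d'). (\<forall>\<alpha>\<in>mons n d'. contract n l0 \<mu> \<alpha> = 0) \<longrightarrow> (\<forall>\<alpha>\<in>mons n (Suc d'). \<mu> \<alpha> = 0)"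
    by (rule contract_inj[OF T(1)[unfolded d_def] cT dd(3)])
  obtain D3 where D3: "D3 \<in> poly_funs H s" "D3 M0 \<noteq> 0" "\<forall>M. D3 M \<noteq> 0 \<longrightarrow> (\<forall>\<mu>\<in>ann M (Suc d).
    (\<forall>\<alpha>\<in>mons n d. contract n l0 \<mu> \<alpha> = 0) \<longrightarrow> (\<forall>\<alpha>\<in>mons n (Suc d). \<mu> \<alpha> = 0))"
    using generic_contract_inj[OF inj1 dd(4)] by blast
  obtain D4 where D4: "D4 \<in> poly_funs H s" "D4 M0 \<noteq> 0" "\<forall>M. D4 M \<noteq> 0 \<longrightarrow> (\<forall>\<mu>\<in>ann M d.
    (\<forall>\<alpha>\<in>mons n d'. contract n l0 \<mu> \<alpha> = 0) \<longrightarrow> (\<forall>\<alpha>\<in>mons n d. \<mu> \<alpha> = 0))"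
    using generic_contract_inj[OF inj0 dd(2)] unfolding d_def by blast
  \<comment> \<open>The matrix of contraction with \<open>k\<close>: its column \<open>t\<close> is
    the functional \<open>L _ t M\<close>, contracted and then read off at the monomials in
    \<open>T\<close>.\<close>
  define A where "A k a t M = (\<Sum>i\<le>n. k i * L (add_mset i a) t M)" for k :: "nat \<Rightarrow> complex" and a t M
  have A_pf: "A k a t \<in> poly_funs H s" if "a \<in> T" "t \<in> T'" for k a t
    unfolding A_def[abs_def]
  proof (rule poly_funs_sum)
    fix i assume "i \<in> {..n}"
    then have "add_mset i a \<in> mons n (Suc d)" using Tm(1) that(1) by (auto intro: add_mset_mons)
    then show "(\<lambda>M. k i * L (add_mset i a) t M) \<in> poly_funs H s"
      using D2(3) that(2) by (intro poly_funs.mult poly_funs.const) blast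
  qed
  have sumA: "(\<Sum>t\<in>T'. A k a t M * v t) = contract n k (\<lambda>\<alpha>. \<Sum>t\<in>T'. v t * L \<alpha> t M) a" for k a M v
    unfolding A_def contract_def sum_distrib_left sum_distrib_right by (subst sum.swap) (simp add: mult_ac)
  \<comment> \<open>The polynomial expressions \<open>L\<close> define elements of the annihilator
    only because its dimension is still \<open>N\<close> at \<open>M\<close>: then they are
    \<open>D2 M\<close> times the basis dual to \<open>T'\<close>.\<close>
  have L_ann: "(\<lambda>\<alpha>. \<Sum>t\<in>T'. v t * L \<alpha> t M) \<in> ann M (Suc d) \<and>
      (\<forall>t\<in>T'. (\<Sum>t'\<in>T'. v t' * L t t' M) = D2 M * v t)" if M: "M \<in> H" "D2 M \<noteq> 0" for M v
  proof -
    have detM: "determines M (Suc d) T'" using D2(5) M(2) by blast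
    have liftsM: "\<forall>p\<in>P. lifts M0 M p" using lifts M(1) by blast
    have cc: "card T' = card P" using cT' P(2) by simp
    have "\<exists>\<mu>\<in>ann M (Suc d). \<forall>\<alpha>\<in>mons n (Suc d). L \<alpha> t M = D2 M * \<mu> \<alpha> \<and> (\<forall>\<alpha>\<in>T'. \<mu> \<alpha> = (if \<alpha> = t then 1 else 0))"
      if t: "t \<in> T'" for t
    proof -
      obtain \<mu> where \<mu>: "\<mu> \<in> ann M (Suc d)" "\<forall>\<alpha>\<in>T'. \<mu> \<alpha> = (if \<alpha> = t then 1 else 0)"
        using ann_dual_basis[OF P(1) cardP(2) liftsM e_le detM cc t] by blast
      have "L \<alpha> t M = D2 M * \<mu> \<alpha>" if "\<alpha> \<in> mons n (Suc d)" for \<alpha>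
      proof -
        have "D2 M * \<mu> \<alpha> = (\<Sum>t'\<in>T'. L \<alpha> t' M * \<mu> t')" using D2(4) \<mu>(1) that by simp
        also have "\<dots> = (\<Sum>t'\<in>T'. if t' = t then L \<alpha> t' M else 0)"
          using \<mu>(2) by (intro sum.cong) auto
        also have "\<dots> = L \<alpha> t M" using finT(2) t by simp
        finally show ?thesis by simp
      qed
      with \<mu> show ?thesis by blast
    qed
    note dual = this
    have "(\<lambda>\<alpha>. L \<alpha> t M) \<in> ann M (Suc d)" if t: "t \<in> T'" for t
    proof -
      obtain \<mu> where \<mu>: "\<mu> \<in> ann M (Suc d)" "\<forall>\<alpha>\<in>mons n (Suc d). L \<alpha> t M = D2 M * \<mu> \<alpha>"
        using dual[OF t] by blast
      show ?thesis by (rule ann_cong[OF ann_scale[OF \<mu>(1), of "D2 M"]]) (use \<mu>(2) in simp)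
    qed
    then have "(\<lambda>\<alpha>. \<Sum>t\<in>T'. v t * L \<alpha> t M) \<in> ann M (Suc d)" by (rule ann_sum)
    moreover have "(\<Sum>t'\<in>T'. v t' * L t t' M) = D2 M * v t" if t: "t \<in> T'" for t
    proof -
      have "L t t' M = (if t = t' then D2 M else 0)" if "t' \<in> T'" for t'
      proof -
        have "t \<in> mons n (Suc d)" using t Tm(2) by blast
        with dual[OF that] t show ?thesis by auto
      qed
      then have "(\<Sum>t'\<in>T'. v t' * L t t' M) = (\<Sum>t'\<in>T'. if t = t' then v t' * D2 M else 0)"
        by (intro sum.cong) auto
      then show ?thesis using finT(2) t by simp
    qed
    ultimately show ?thesis by blast
  qed
  have AB: "\<forall>a\<in>T. \<forall>b\<in>T'. A l a b \<in> poly_funs H s \<and> A l0 a b \<in> poly_funs H s"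
    using A_pf by blast
  have Q0: "\<forall>v. (\<forall>a\<in>T. (\<Sum>b\<in>T'. A l0 a b M0 * v b) = 0) \<longrightarrow> (\<forall>b\<in>T'. v b = 0)"
  proof (intro allI impI)
    fix v assume v: "\<forall>a\<in>T. (\<Sum>b\<in>T'. A l0 a b M0 * v b) = 0"
    let ?\<mu> = "\<lambda>\<alpha>. \<Sum>t\<in>T'. v t * L \<alpha> t M0"
    have \<mu>: "?\<mu> \<in> ann M0 (Suc d)" "\<forall>t\<in>T'. ?\<mu> t = D2 M0 * v t" using L_ann[OF M0 D2(2)] by auto
    have "contract n l0 ?\<mu> \<alpha> = 0" if "\<alpha> \<in> mons n d" for \<alpha>
      by (rule determinesD[OF T(1) ann_contract[OF \<mu>(1)] _ that]) (use v in \<open>simp add: sumA\<close>)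
    then have "\<forall>\<alpha>\<in>mons n (Suc d). ?\<mu> \<alpha> = 0" using inj1 \<mu>(1) by blast
    then have "D2 M0 * v t = 0" if "t \<in> T'" for t
      using bspec[OF \<mu>(2) that] subsetD[OF Tm(2) that] by metis
    then show "\<forall>b\<in>T'. v b = 0" using D2(2) by simp
  qed
  have U0: "finite (u ` P)" "card (u ` P) = N" using finP card_image[OF u_inj] P(2) by auto
  have diffA: "(\<Sum>b\<in>T'. (A l a b M - w * A l0 a b M) * v b) =
      contract n l (\<lambda>\<alpha>. \<Sum>t\<in>T'. v t * L \<alpha> t M) a - w * contract n l0 (\<lambda>\<alpha>. \<Sum>t\<in>T'. v t * L \<alpha> t M) a" for M w v a
  proof -
    have "(\<Sum>b\<in>T'. (A l a b M - w * A l0 a b M) * v b) =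
        (\<Sum>b\<in>T'. A l a b M * v b) - w * (\<Sum>b\<in>T'. A l0 a b M * v b)"
      by (simp add: left_diff_distrib sum_subtractf sum_distrib_left mult.assoc)
    then show ?thesis by (simp only: sumA)
  qed
  \<comment> \<open>Evaluation at \<open>p\<close>, in its coordinates on \<open>T'\<close>, is an
    eigenvector at \<open>M0\<close> with eigenvalue \<open>u p\<close>.\<close>
  have U: "\<forall>w\<in>u ` P. \<exists>v. (\<exists>b\<in>T'. v b \<noteq> 0) \<and> (\<forall>a\<in>T. (\<Sum>b\<in>T'. (A l a b M0 - w * A l0 a b M0) * v b) = 0)"
  proof
    fix w assume "w \<in> u ` P"
    then obtain p where p: "p \<in> P" "w = u p" by blast
    have mevp: "mev p \<in> ann M0 (Suc d)" using P0[OF p(1)] by (rule zero_at_imp_ann)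
    have eq: "(\<Sum>t\<in>T'. mev p t * L \<alpha> t M0) = D2 M0 * mev p \<alpha>" if "\<alpha> \<in> mons n (Suc d)" for \<alpha>
      using D2(4) mevp that by (simp add: mult.commute)
    have ceq: "contract n k (\<lambda>\<alpha>. \<Sum>t\<in>T'. mev p t * L \<alpha> t M0) a = D2 M0 * (linform n k p * mev p a)"
      if "a \<in> T" for k a
    proof -
      have a: "a \<in> mons n d" using that Tm(1) by blast
      have "contract n k (\<lambda>\<alpha>. \<Sum>t\<in>T'. mev p t * L \<alpha> t M0) a = contract n k (\<lambda>\<alpha>. D2 M0 * mev p \<alpha>) a"
        by (rule contract_cong[OF eq a])
      also have "\<dots> = D2 M0 * contract n k (mev p) a" by (simp add: contract_def sum_distrib_left mult_ac)
      finally show ?thesis by (simp add: contract_mev)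
    qed
    show "\<exists>v. (\<exists>b\<in>T'. v b \<noteq> 0) \<and> (\<forall>a\<in>T. (\<Sum>b\<in>T'. (A l a b M0 - w * A l0 a b M0) * v b) = 0)"
    proof (intro exI[of _ "mev p"] conjI ballI)
      show "\<exists>b\<in>T'. mev p b \<noteq> 0"
      proof (rule ccontr)
        assume "\<not> (\<exists>b\<in>T'. mev p b \<noteq> 0)"
        then have "\<forall>b\<in>T'. mev p b = 0" by blast
        then have "\<And>\<alpha>. \<alpha> \<in> mons n (Suc d) \<Longrightarrow> mev p \<alpha> = 0" using determinesD[OF T'(1) mevp] by blast
        then show False using mev_nz[OF p(1), of "Suc d"] by blast
      qed
      fix a assume a: "a \<in> T"
      show "(\<Sum>b\<in>T'. (A l a b M0 - w * A l0 a b M0) * mev p b) = 0"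
        unfolding diffA ceq[OF a] using l0 p by (simp add: u_def)
    qed
  qed
  obtain D5 where D5: "D5 \<in> poly_funs H s" "D5 M0 \<noteq> 0" "\<forall>M. D5 M \<noteq> 0 \<longrightarrow> (\<exists>U. finite U \<and> card U = N \<and>
    (\<forall>w\<in>U. \<exists>v. (\<exists>b\<in>T'. v b \<noteq> 0) \<and> (\<forall>a\<in>T. (\<Sum>b\<in>T'. (A l a b M - w * A l0 a b M) * v b) = 0)))"
    using generic_pencil[OF finT cT cT' AB Q0 U0 U] by blast
  show ?thesis
  proof (intro bexI[of _ "\<lambda>M. D1 M * (D2 M * (D3 M * (D4 M * D5 M)))"] conjI ballI impI)
    show "(\<lambda>M. D1 M * (D2 M * (D3 M * (D4 M * D5 M)))) \<in> poly_funs H s"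
      by (intro poly_funs.mult D1(1) D2(1) D3(1) D4(1) D5(1))
    show "D1 M0 * (D2 M0 * (D3 M0 * (D4 M0 * D5 M0))) \<noteq> 0" using D1(2) D2(2) D3(2) D4(2) D5(2) by simp
    fix M assume M: "M \<in> H" and "D1 M * (D2 M * (D3 M * (D4 M * D5 M))) \<noteq> 0"
    then have nz: "D1 M \<noteq> 0" "D2 M \<noteq> 0" "D3 M \<noteq> 0" "D4 M \<noteq> 0" "D5 M \<noteq> 0" by auto
    have detM: "determines M d T" using D1(3) nz by blast
    obtain U where U: "finite U" "card U = N" "\<forall>w\<in>U. \<exists>v. (\<exists>b\<in>T'. v b \<noteq> 0) \<and>
        (\<forall>a\<in>T. (\<Sum>b\<in>T'. (A l a b M - w * A l0 a b M) * v b) = 0)"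
      using D5(3) nz by blast
    have "\<exists>\<mu>. \<mu> \<in> ann M (Suc d) \<and> (\<exists>\<alpha>\<in>mons n (Suc d). \<mu> \<alpha> \<noteq> 0) \<and>
        (\<forall>\<alpha>\<in>mons n d. contract n l \<mu> \<alpha> = w * contract n l0 \<mu> \<alpha>)" if w: "w \<in> U" for w
    proof -
      obtain v where v: "\<exists>b\<in>T'. v b \<noteq> 0" "\<forall>a\<in>T. (\<Sum>b\<in>T'. (A l a b M - w * A l0 a b M) * v b) = 0"
        using U(3) w by blast
      let ?\<mu> = "\<lambda>\<alpha>. \<Sum>t\<in>T'. v t * L \<alpha> t M"
      have \<mu>: "?\<mu> \<in> ann M (Suc d)" "\<forall>t\<in>T'. ?\<mu> t = D2 M * v t" using L_ann[OF M nz(2)] by auto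
      obtain b where b: "b \<in> T'" "v b \<noteq> 0" using v(1) by blast
      then have "?\<mu> b \<noteq> 0" "b \<in> mons n (Suc d)" using \<mu>(2) nz(2) Tm(2) by auto
      moreover have "contract n l ?\<mu> \<alpha> = w * contract n l0 ?\<mu> \<alpha>" if \<alpha>: "\<alpha> \<in> mons n d" for \<alpha>
      proof -
        have "(\<lambda>\<alpha>. contract n l ?\<mu> \<alpha> + (- w) * contract n l0 ?\<mu> \<alpha>) \<in> ann M d"
          by (intro ann_add ann_scale ann_contract \<mu>(1))
        moreover have "\<forall>a\<in>T. contract n l ?\<mu> a + (- w) * contract n l0 ?\<mu> a = 0"
          using v(2) by (simp add: diffA)
        ultimately have "contract n l ?\<mu> \<alpha> + (- w) * contract n l0 ?\<mu> \<alpha> = 0"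
          by (rule determinesD[OF detM _ _ \<alpha>])
        then show ?thesis by simp
      qed
      ultimately show ?thesis using \<mu>(1) by blast
    qed
    then have "\<forall>w\<in>U. \<exists>\<mu>. \<mu> \<in> ann M (Suc d) \<and> (\<exists>\<alpha>\<in>mons n (Suc d). \<mu> \<alpha> \<noteq> 0) \<and>
        (\<forall>\<alpha>\<in>mons n d. contract n l \<mu> \<alpha> = w * contract n l0 \<mu> \<alpha>)" by blast
    from bchoice[OF this] obtain \<mu> where \<mu>: "\<forall>w\<in>U. \<mu> w \<in> ann M (Suc d) \<and> (\<exists>\<alpha>\<in>mons n (Suc d). \<mu> w \<alpha> \<noteq> 0) \<and>
        (\<forall>\<alpha>\<in>mons n d. contract n l (\<mu> w) \<alpha> = w * contract n l0 (\<mu> w) \<alpha>)" ..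
    have injM1: "\<forall>\<mu>\<in>ann M (Suc d). (\<forall>\<alpha>\<in>mons n d. contract n l0 \<mu> \<alpha> = 0) \<longrightarrow> (\<forall>\<alpha>\<in>mons n (Suc d). \<mu> \<alpha> = 0)"
      using D3(3) nz(3) by blast
    have injM0: "\<forall>\<mu>\<in>ann M d. (\<forall>\<alpha>\<in>mons n d'. contract n l0 \<mu> \<alpha> = 0) \<longrightarrow> (\<forall>\<alpha>\<in>mons n d. \<mu> \<alpha> = 0)"
      using D4(3) nz(4) by blast
    have "card T = card U" using cT U(2) by simp
    then have "\<forall>w\<in>U. \<exists>x. nonzero n x \<and> zero_at M x \<and> linform n l0 x = 1 \<and> linform n l x = w"
      using eigen_is_zero[OF injM1 injM0 d_def dd(4) detM _ U(1) \<mu>] by blast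
    from bchoice[OF this] obtain X where
      X: "\<forall>w\<in>U. nonzero n (X w) \<and> zero_at M (X w) \<and> linform n l0 (X w) = 1 \<and> linform n l (X w) = w" ..
    have np: "nonprop n (X w) (X w')" if "w \<in> U" "w' \<in> U" "w \<noteq> w'" for w w'
      by (rule nonpropI_linform[of n l _ l0]) (use X that in simp)
    have "inj_on X U"
    proof (rule inj_onI)
      fix w w' assume "w \<in> U" "w' \<in> U" "X w = X w'"
      then show "w = w'" using X by metis
    qed
    then have cX: "card (X ` U) = N" using U(2) by (simp add: card_image)
    have pX: "point_set n (X ` U)" using X U(1) np by (auto simp: point_set_def)
    have zX: "\<forall>x\<in>X ` U. zero_at M x" using X by blast
    show "\<exists>Q. point_set n Q \<and> card Q = N \<and> (\<forall>q\<in>Q. zero_at M q) \<and>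
      (\<forall>x. nonzero n x \<and> zero_at M x \<longrightarrow> (\<exists>q\<in>Q. \<not> nonprop n x q))"
    proof (intro exI[of _ "X ` U"] conjI pX cX zX allI impI)
      fix x assume x: "nonzero n x \<and> zero_at M x"
      show "\<exists>q\<in>X ` U. \<not> nonprop n x q"
      proof (rule ccontr)
        assume "\<not> (\<exists>q\<in>X ` U. \<not> nonprop n x q)"
        then have xq: "nonprop n x q" if "q \<in> X ` U" for q using that by blast
        have "\<not> nonprop n x x" by (auto simp: nonprop_def mult.commute)
        then have "x \<notin> X ` U" using xq by blast
        \<comment> \<open>A further zero gives \<open>N + 1\<close> points in a degree large enough
          for their evaluations to be independent, although \<open>T\<close> has only
          \<open>N\<close> elements.\<close>
        then have card_ins: "card (insert x (X ` U)) = Suc N" using U(1) cX by simp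
        have "point_set n (insert x (X ` U))"
          using pX xq x nonprop_sym unfolding point_set_def by (auto simp del: image_iff)
        moreover have "\<forall>q\<in>insert x (X ` U). zero_at M q" using x zX by blast
        moreover have "card (insert x (X ` U)) \<le> Suc d" using card_ins dd(5) by simp
        ultimately have "card (insert x (X ` U)) \<le> card T" using card_zeros_le detM by blast
        then show False using card_ins cT by simp
      qed
    qed
  qed
qed

end

subsection \<open>The wedge product in coordinates\<close>

text \<open>The sum defining the wedge product, over an arbitrary index type and coefficient ring.\<close>

fun wsum :: "('c list \<Rightarrow> 'r::comm_ring_1) \<Rightarrow> ('c \<Rightarrow> 'r) \<Rightarrow> 'c list \<Rightarrow> 'r"
  where
    "wsum w x [] = 0"
  | "wsum w x (a # J) = (-1) ^ length J * x a * w J + wsum (\<lambda>K. w (a # K)) x J"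

lemma wsum_eq_sum:
  "wsum w x J = (\<Sum>i<length J. (-1) ^ (length J - Suc i) * x (J ! i) * w (take i J @ drop (Suc i) J))"
  by (induction J arbitrary: w) (simp_all add: sum.lessThan_Suc_shift del: sum.lessThan_Suc)

lemma wedge_eq_wsum: "set \<phi>s \<subseteq> dual scale \<Longrightarrow> wedge scale \<omega> v \<phi>s = wsum \<omega> (\<lambda>\<phi>. \<phi> v) \<phi>s"
  by (simp add: wedge_def wsum_eq_sum)

lemma wsum_cong:
  "(\<And>K. Suc (length K) = length J \<Longrightarrow> set K \<subseteq> set J \<Longrightarrow> w K = w' K) \<Longrightarrow>
   (\<And>a. a \<in> set J \<Longrightarrow> x a = x' a) \<Longrightarrow> wsum w x J = wsum w' x' J"
proof (induction J arbitrary: w w')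
  case (Cons a J)
  have "wsum (\<lambda>K. w (a # K)) x J = wsum (\<lambda>K. w' (a # K)) x' J"
    using Cons.prems by (intro Cons.IH Cons.prems(1)) auto
  moreover have "w J = w' J" using Cons.prems(1)[of J] by auto
  ultimately show ?case using Cons.prems(2)[of a] by simp
qed simp

lemma wsum_add: "wsum (\<lambda>K. w K + w' K) x J = wsum w x J + wsum w' x J"
  by (induction J arbitrary: w w') (simp_all add: algebra_simps)

lemma wsum_scale: "wsum (\<lambda>K. z * w K) x J = z * wsum w x J"
  by (induction J arbitrary: w) (simp_all add: algebra_simps)

lemma wsum_zero_fun: "wsum (\<lambda>K. 0) x J = 0"
  by (induction J) simp_all

lemma wsum_minus: "wsum (\<lambda>K. - w K) x J = - wsum w x J"
  using wsum_scale[of "-1" w x J] by simp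

lemma wsum_map: "wsum w x (map f J) = wsum (\<lambda>K. w (map f K)) (\<lambda>i. x (f i)) J"
  by (induction J arbitrary: w) simp_all

lemma wsum_dvd:
  "(\<And>K. Suc (length K) = length J \<Longrightarrow> set K \<subseteq> set J \<Longrightarrow> y dvd w K) \<Longrightarrow> y dvd wsum w x J"
proof (induction J arbitrary: w)
  case (Cons a J)
  have "y dvd wsum (\<lambda>K. w (a # K)) x J"
  proof (rule Cons.IH)
    fix K assume "Suc (length K) = length J" "set K \<subseteq> set J"
    then show "y dvd w (a # K)" using Cons.prems[of "a # K"] by auto
  qed
  moreover have "y dvd w J" using Cons.prems[of J] by auto
  ultimately show ?case by simp
qed simp

lemma wsum_eq_0:
  "(\<And>us a vs. J = us @ a # vs \<Longrightarrow> x a * w (us @ vs) = 0) \<Longrightarrow> wsum w x J = 0"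
proof (induction J arbitrary: w)
  case (Cons a J)
  have "wsum (\<lambda>K. w (a # K)) x J = 0"
  proof (rule Cons.IH)
    fix us b vs assume "J = us @ b # vs"
    then show "x b * w (a # us @ vs) = 0" using Cons.prems[of "a # us" b vs] by simp
  qed
  moreover have "x a * w J = 0" using Cons.prems[of "[]" a J] by simp
  ultimately show ?case by (simp add: mult.assoc)
qed simp

lemma wsum_last:
  "(\<And>a. a \<in> set us \<Longrightarrow> x a = 0) \<Longrightarrow> wsum w x (us @ [j]) = x j * w us"
  by (induction us arbitrary: w) simp_all

lemma wsum_wsum: "wsum (wsum w x) x J = 0"
proof (induction J arbitrary: w)
  case (Cons a J)
  have "wsum (\<lambda>K. wsum w x (a # K)) x J = wsum (\<lambda>K. (-1) ^ length K * x a * w K) x J"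
    by (simp add: wsum_add Cons.IH)
  also have "\<dots> = - ((-1) ^ length J * x a * wsum w x J)"
  proof (cases J)
    case (Cons b J')
    have "wsum (\<lambda>K. (-1) ^ length K * x a * w K) x J = wsum (\<lambda>K. ((-1) ^ length J' * x a) * w K) x J"
      by (rule wsum_cong) (auto simp: Cons)
    then show ?thesis by (simp add: wsum_scale Cons)
  qed simp
  finally show ?case by simp
qed simp

text \<open>Stated for adjacent entries, the form that inductions over lists can use; vanishing on
  lists with a repeated entry follows in characteristic 0.\<close>

definition alternating :: "('c list \<Rightarrow> 'r::comm_ring_1) \<Rightarrow> bool"
  where "alternating w \<longleftrightarrow> (\<forall>us a b vs. w (us @ a # b # vs) = - w (us @ b # a # vs))"

lemma alternatingD: "alternating w \<Longrightarrow> w (us @ a # b # vs) = - w (us @ b # a # vs)"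
  unfolding alternating_def by blast

lemma alternating_Cons: "alternating w \<Longrightarrow> alternating (\<lambda>K. w (a # K))"
  unfolding alternating_def
proof (intro allI)
  fix us b c vs assume "\<forall>us a b vs. w (us @ a # b # vs) = - w (us @ b # a # vs)"
  from this[rule_format, of "a # us" b c vs] show "w (a # us @ b # c # vs) = - w (a # us @ c # b # vs)"
    by (simp only: append_Cons)
qed

lemma alternating_wsum:
  assumes "alternating w"
  shows "alternating (wsum w x)"
proof -
  have "wsum w x (us @ a # b # vs) = - wsum w x (us @ b # a # vs)" if "alternating w" for us a b vs w
    using that
  proof (induction us arbitrary: w)
    case Nil
    have "(\<lambda>K. w (a # b # K)) = (\<lambda>K. - w (b # a # K))"
      using alternatingD[OF Nil, of "[]" a b] by (simp only: append_Nil)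
    then show ?case by (simp add: wsum_minus)
  next
    case (Cons c us)
    show ?case
      using Cons.IH[OF alternating_Cons[OF Cons.prems]]
      by (simp add: alternatingD[OF Cons.prems, of us a b vs])
  qed
  with assms show ?thesis unfolding alternating_def by blast
qed

text \<open>Bubble sort: adjacent transpositions generate all permutations.\<close>

lemma swap_closed_mset:
  assumes swap: "\<And>us a b vs. P (us @ a # b # vs) \<Longrightarrow> P (us @ b # a # vs)"
    and "P xs" "mset xs = mset ys"
  shows "P ys"
proof -
  have bubble: "P (us @ y # vs @ ws)" if "P (us @ vs @ y # ws)" for us vs ws y
    using that
  proof (induction vs arbitrary: ws rule: rev_induct)
    case (snoc v vs)
    have "P ((us @ vs) @ y # v # ws)" using swap[of "us @ vs" v y ws] snoc.prems by simp
    then show ?case using snoc.IH[of "v # ws"] by simp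
  qed simp
  have "P (us @ ys)" if "P (us @ xs)" "mset xs = mset ys" for us
    using that
  proof (induction ys arbitrary: us xs)
    case (Cons y ys)
    have "y \<in> set xs" using Cons.prems(2) by (metis list.set_intros(1) set_mset_mset)
    then obtain vs ws where xs: "xs = vs @ y # ws" by (meson split_list)
    have "P ((us @ [y]) @ (vs @ ws))" using bubble[of us vs y ws] Cons.prems(1) by (simp add: xs)
    moreover have "mset (vs @ ws) = mset ys" using Cons.prems(2) by (simp add: xs)
    ultimately have "P ((us @ [y]) @ ys)" by (rule Cons.IH)
    then show ?case by simp
  qed simp
  from this[of "[]"] assms(2,3) show ?thesis by simp
qed

lemma alternating_dvd_mset:
  assumes "alternating w" "y dvd w xs" "mset xs = mset ys"
  shows "y dvd w ys"
proof (rule swap_closed_mset[where P = "\<lambda>K. y dvd w K", OF _ assms(2,3)])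
  fix us a b vs assume "y dvd w (us @ a # b # vs)"
  then show "y dvd w (us @ b # a # vs)" using alternatingD[OF assms(1), of us b a vs] by simp
qed

lemma alternating_not_distinct:
  fixes w :: "'c list \<Rightarrow> 'r::{idom, ring_char_0}"
  assumes "alternating w" "\<not> distinct K"
  shows "w K = 0"
proof -
  obtain us a vs ws where K: "K = us @ [a] @ vs @ [a] @ ws"
    using not_distinct_decomp[OF assms(2)] by blast
  have "w (us @ a # a # (vs @ ws)) = - w (us @ a # a # (vs @ ws))" by (rule alternatingD[OF assms(1)])
  then have "w (us @ a # a # (vs @ ws)) = 0" by simp
  then have "0 dvd w (us @ a # a # (vs @ ws))" by simp
  then have "0 dvd w K" by (rule alternating_dvd_mset[OF assms(1)]) (simp add: K)
  then show ?thesis by simp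
qed

subsection \<open>Multilinearity\<close>

text \<open>Slots are described by splitting the list instead of updating it, which fits the
  recursion of \<open>wsum\<close>.\<close>

definition multilinear :: "(complex \<Rightarrow> 'v::ab_group_add \<Rightarrow> 'v) \<Rightarrow> nat \<Rightarrow> 'v tensor \<Rightarrow> bool"
  where "multilinear scale k t \<longleftrightarrow> (\<forall>us vs. set us \<subseteq> dual scale \<and> set vs \<subseteq> dual scale \<and>
    Suc (length us + length vs) = k \<longrightarrow>
      linear_on (dual scale) (pscale (*)) (*) (\<lambda>\<psi>. t (us @ \<psi> # vs)))"

lemma dual_iff:
  assumes "vector_space scale"
  shows "\<phi> \<in> dual scale \<longleftrightarrow> (\<forall>x y. \<phi> (x + y) = \<phi> x + \<phi> y) \<and> (\<forall>c x. \<phi> (scale c x) = c * \<phi> x)"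
proof -
  have "vector_space ((*) :: complex \<Rightarrow> complex \<Rightarrow> complex)"
    by unfold_locales (auto simp: algebra_simps)
  with assms show ?thesis
    unfolding dual_def Vector_Spaces.linear_def module_hom_iff module_iff_vector_space by auto
qed

lemma dual_zero: "vector_space scale \<Longrightarrow> (\<lambda>_. 0) \<in> dual scale"
  by (simp add: dual_iff)

lemma dual_add: "vector_space scale \<Longrightarrow> \<phi> \<in> dual scale \<Longrightarrow> \<psi> \<in> dual scale \<Longrightarrow> \<phi> + \<psi> \<in> dual scale"
  by (simp add: dual_iff algebra_simps)

lemma dual_pscale: "vector_space scale \<Longrightarrow> \<phi> \<in> dual scale \<Longrightarrow> pscale (*) c \<phi> \<in> dual scale"
  by (simp add: dual_iff pscale_def algebra_simps)

lemma tensor_power_iff: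
  assumes vs: "vector_space scale"
  shows "t \<in> tensor_power scale k \<longleftrightarrow>
    (\<forall>\<phi>s. \<not> (length \<phi>s = k \<and> set \<phi>s \<subseteq> dual scale) \<longrightarrow> t \<phi>s = 0) \<and> multilinear scale k t"
proof -
  have "(\<forall>\<phi>s i. length \<phi>s = k \<and> set \<phi>s \<subseteq> dual scale \<and> i < k \<longrightarrow>
      linear_on (dual scale) (pscale (*)) (*) (\<lambda>\<psi>. t (\<phi>s[i := \<psi>]))) \<longleftrightarrow> multilinear scale k t" (is "?l \<longleftrightarrow> ?r")
  proof
    assume l: ?l
    show ?r unfolding multilinear_def
    proof (intro allI impI)
      fix us vs assume uv: "set us \<subseteq> dual scale \<and> set vs \<subseteq> dual scale \<and> Suc (length us + length vs) = k"
      define \<phi>s where "\<phi>s = us @ (\<lambda>_. 0) # vs"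
      have "length \<phi>s = k \<and> set \<phi>s \<subseteq> dual scale \<and> length us < k"
        using uv dual_zero[OF vs] by (auto simp: \<phi>s_def)
      then have "linear_on (dual scale) (pscale (*)) (*) (\<lambda>\<psi>. t (\<phi>s[length us := \<psi>]))" using l by blast
      then show "linear_on (dual scale) (pscale (*)) (*) (\<lambda>\<psi>. t (us @ \<psi> # vs))"
        by (simp add: \<phi>s_def)
    qed
  next
    assume r: ?r
    show ?l
    proof (intro allI impI)
      fix \<phi>s i assume a: "length \<phi>s = k \<and> set \<phi>s \<subseteq> dual scale \<and> i < k"
      then have "set (take i \<phi>s) \<subseteq> dual scale" "set (drop (Suc i) \<phi>s) \<subseteq> dual scale"
        using set_take_subset[of i \<phi>s] set_drop_subset[of "Suc i" \<phi>s] by auto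
      moreover have "Suc (length (take i \<phi>s) + length (drop (Suc i) \<phi>s)) = k" using a by simp
      ultimately have "linear_on (dual scale) (pscale (*)) (*) (\<lambda>\<psi>. t (take i \<phi>s @ \<psi> # drop (Suc i) \<phi>s))"
        using r unfolding multilinear_def by blast
      then show "linear_on (dual scale) (pscale (*)) (*) (\<lambda>\<psi>. t (\<phi>s[i := \<psi>]))"
        using a by (simp add: upd_conv_take_nth_drop)
    qed
  qed
  then show ?thesis unfolding tensor_power_def by simp
qed

lemma multilinearD:
  assumes "multilinear scale k t" "set us \<subseteq> dual scale" "set vs \<subseteq> dual scale" "Suc (length us + length vs) = k"
  shows "\<psi> \<in> dual scale \<Longrightarrow> \<psi>' \<in> dual scale \<Longrightarrow> t (us @ (\<psi> + \<psi>') # vs) = t (us @ \<psi> # vs) + t (us @ \<psi>' # vs)"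
    and "\<psi> \<in> dual scale \<Longrightarrow> t (us @ pscale (*) c \<psi> # vs) = c * t (us @ \<psi> # vs)"
  using assms unfolding multilinear_def linear_on_def by blast+

lemma multilinear_Cons:
  assumes "multilinear scale k t" "a \<in> dual scale" "k = Suc k'"
  shows "multilinear scale k' (\<lambda>K. t (a # K))"
  unfolding multilinear_def
proof (intro allI impI)
  fix us vs assume "set us \<subseteq> dual scale \<and> set vs \<subseteq> dual scale \<and> Suc (length us + length vs) = k'"
  then have "set (a # us) \<subseteq> dual scale \<and> set vs \<subseteq> dual scale \<and> Suc (length (a # us) + length vs) = k"
    using assms(2,3) by auto
  then have "linear_on (dual scale) (pscale (*)) (*) (\<lambda>\<psi>. t ((a # us) @ \<psi> # vs))"
    using assms(1) unfolding multilinear_def by blast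
  then show "linear_on (dual scale) (pscale (*)) (*) (\<lambda>\<psi>. t (a # us @ \<psi> # vs))" by simp
qed

lemma linear_on_add:
  "linear_on A s1 (*) f \<Longrightarrow> linear_on A s1 (*) g \<Longrightarrow> linear_on A s1 (*) (\<lambda>x. f x + g x)"
  by (simp add: linear_on_def algebra_simps)

lemma linear_on_scale:
  "linear_on A s1 (*) f \<Longrightarrow> linear_on A s1 (*) (\<lambda>x. z * f x)"
  by (simp add: linear_on_def algebra_simps)

lemma linear_on_zero: "linear_on A s1 (*) (\<lambda>x. 0)"
  by (simp add: linear_on_def)

lemma linear_on_sum:
  "(\<And>i. i \<in> I \<Longrightarrow> linear_on A s1 (*) (f i)) \<Longrightarrow> linear_on A s1 (*) (\<lambda>x. \<Sum>i\<in>I. f i x)"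
  by (induction I rule: infinite_finite_induct) (simp_all add: linear_on_zero linear_on_add)

lemma multilinear_wsum:
  "multilinear scale k t \<Longrightarrow> multilinear scale (Suc k) (wsum t (\<lambda>\<phi>. \<phi> v))"
proof -
  have "linear_on (dual scale) (pscale (*)) (*) (\<lambda>\<psi>. wsum t (\<lambda>\<phi>. \<phi> v) (us @ \<psi> # vs))"
    if "multilinear scale k t" "set us \<subseteq> dual scale" "set vs \<subseteq> dual scale" "length us + length vs = k" for us vs t k
    using that
  proof (induction us arbitrary: t k)
    case Nil
    have "linear_on (dual scale) (pscale (*)) (*) (\<lambda>\<psi>. wsum (\<lambda>K. t (\<psi> # K)) (\<lambda>\<phi>. \<phi> v) vs)"
      unfolding linear_on_def
    proof (intro conjI ballI allI)
      fix \<psi> \<psi>' assume "\<psi> \<in> dual scale" "\<psi>' \<in> dual scale"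
      then have "wsum (\<lambda>K. t ((\<psi> + \<psi>') # K)) (\<lambda>\<phi>. \<phi> v) vs = wsum (\<lambda>K. t (\<psi> # K) + t (\<psi>' # K)) (\<lambda>\<phi>. \<phi> v) vs"
        using Nil multilinearD(1)[OF Nil(1), of "[]"] by (intro wsum_cong) auto
      then show "wsum (\<lambda>K. t ((\<psi> + \<psi>') # K)) (\<lambda>\<phi>. \<phi> v) vs =
          wsum (\<lambda>K. t (\<psi> # K)) (\<lambda>\<phi>. \<phi> v) vs + wsum (\<lambda>K. t (\<psi>' # K)) (\<lambda>\<phi>. \<phi> v) vs"
        by (simp add: wsum_add)
    next
      fix c \<psi> assume "\<psi> \<in> dual scale"
      then have "wsum (\<lambda>K. t (pscale (*) c \<psi> # K)) (\<lambda>\<phi>. \<phi> v) vs = wsum (\<lambda>K. c * t (\<psi> # K)) (\<lambda>\<phi>. \<phi> v) vs"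
        using Nil multilinearD(2)[OF Nil(1), of "[]"] by (intro wsum_cong) auto
      then show "wsum (\<lambda>K. t (pscale (*) c \<psi> # K)) (\<lambda>\<phi>. \<phi> v) vs = c * wsum (\<lambda>K. t (\<psi> # K)) (\<lambda>\<phi>. \<phi> v) vs"
        by (simp add: wsum_scale)
    qed
    moreover have "linear_on (dual scale) (pscale (*)) (*) (\<lambda>\<psi>. ((-1) ^ length vs * t vs) * \<psi> v)"
      by (rule linear_on_scale) (simp add: linear_on_def pscale_def)
    ultimately have "linear_on (dual scale) (pscale (*)) (*)
        (\<lambda>\<psi>. ((-1) ^ length vs * t vs) * \<psi> v + wsum (\<lambda>K. t (\<psi> # K)) (\<lambda>\<phi>. \<phi> v) vs)"
      by (rule linear_on_add[rotated])
    then show ?case by (simp add: mult_ac)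
  next
    case (Cons a us)
    obtain k' where k': "k = Suc k'" using Cons.prems(4) by (cases k) auto
    have "linear_on (dual scale) (pscale (*)) (*) (\<lambda>\<psi>. wsum (\<lambda>K. t (a # K)) (\<lambda>\<phi>. \<phi> v) (us @ \<psi> # vs))"
      using Cons.prems k' by (intro Cons.IH[OF multilinear_Cons[OF Cons.prems(1) _ k']]) auto
    \<comment> \<open>The sign of the term of \<open>a\<close> counts the entries behind it, one
      more than the length of \<open>us @ vs\<close>; the extra -1 is attached to
      \<open>a v\<close>.\<close>
    moreover have "linear_on (dual scale) (pscale (*)) (*)
        (\<lambda>\<psi>. ((-1) ^ length (us @ vs) * - a v) * t (us @ \<psi> # vs))"
      using Cons.prems unfolding multilinear_def by (intro linear_on_scale) auto
    ultimately have "linear_on (dual scale) (pscale (*)) (*)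
        (\<lambda>\<psi>. ((-1) ^ length (us @ vs) * - a v) * t (us @ \<psi> # vs) + wsum (\<lambda>K. t (a # K)) (\<lambda>\<phi>. \<phi> v) (us @ \<psi> # vs))"
      by (rule linear_on_add[rotated])
    then show ?case by simp
  qed
  then show "multilinear scale k t \<Longrightarrow> multilinear scale (Suc k) (wsum t (\<lambda>\<phi>. \<phi> v))"
    unfolding multilinear_def[of _ "Suc k"] by blast
qed

text \<open>Polarization: the value with \<open>a + b\<close> in two adjacent slots vanishes, and so
  do the two diagonal terms of its expansion.\<close>

lemma ext_power_alternating:
  assumes vs: "vector_space scale" and t: "t \<in> ext_power scale k"
  shows "alternating t"
  unfolding alternating_def
proof (intro allI)
  fix us a b ws
  have tp: "\<forall>\<phi>s. \<not> (length \<phi>s = k \<and> set \<phi>s \<subseteq> dual scale) \<longrightarrow> t \<phi>s = 0" and ml: "multilinear scale k t"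
    and nd: "\<And>\<phi>s. \<not> distinct \<phi>s \<Longrightarrow> t \<phi>s = 0"
    using t tensor_power_iff[OF vs, of t k] by (auto simp: ext_power_def)
  show "t (us @ a # b # ws) = - t (us @ b # a # ws)"
  proof (cases "length (us @ a # b # ws) = k \<and> set (us @ a # b # ws) \<subseteq> dual scale")
    case True
    then have d: "set us \<subseteq> dual scale" "set ws \<subseteq> dual scale" "a \<in> dual scale" "b \<in> dual scale"
      "Suc (Suc (length us + length ws)) = k" by auto
    have ab: "a + b \<in> dual scale" using d dual_add[OF vs] by blast
    have *: "t (us @ x # (a + b) # ws) = t (us @ x # a # ws) + t (us @ x # b # ws)" if "x \<in> dual scale" for x
      using multilinearD(1)[OF ml, of "us @ [x]" ws a b] d that by simp
    have "0 = t (us @ (a + b) # (a + b) # ws)" by (simp add: nd)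
    also have "\<dots> = t (us @ a # (a + b) # ws) + t (us @ b # (a + b) # ws)"
      using multilinearD(1)[OF ml, of us "(a + b) # ws" a b] d ab by simp
    also have "\<dots> = t (us @ a # b # ws) + t (us @ b # a # ws)"
      using d by (simp add: * nd)
    finally show ?thesis by (simp add: eq_neg_iff_add_eq_0)
  next
    case False
    then have "\<not> (length (us @ b # a # ws) = k \<and> set (us @ b # a # ws) \<subseteq> dual scale)" by auto
    with False show ?thesis using tp by (metis neg_equal_0_iff_equal)
  qed
qed

lemma ext_powerI:
  assumes vs: "vector_space scale" and "multilinear scale k t" "alternating t"
    and "\<And>\<phi>s. \<not> (length \<phi>s = k \<and> set \<phi>s \<subseteq> dual scale) \<Longrightarrow> t \<phi>s = 0"
  shows "t \<in> ext_power scale k"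
  using assms alternating_not_distinct[OF assms(3)]
  by (auto simp: ext_power_def tensor_power_iff[OF vs])

subsection \<open>Coordinates on symmetric and exterior powers\<close>

text \<open>Pairs of a monomial and one of its variables correspond to pairs of a variable and a
  monomial of degree one less.\<close>

lemma sum_mons_Suc:
  fixes h :: "nat multiset \<Rightarrow> 'r::comm_ring_1"
  shows "(\<Sum>\<alpha>\<in>mons n (Suc k). (\<Sum>i\<le>n. if i \<in># \<alpha> then g i (\<alpha> - {#i#}) else 0) * h \<alpha>) =
    (\<Sum>i\<le>n. \<Sum>\<beta>\<in>mons n k. g i \<beta> * h (add_mset i \<beta>))"
proof -
  have "(\<Sum>\<alpha>\<in>mons n (Suc k). (\<Sum>i\<le>n. if i \<in># \<alpha> then g i (\<alpha> - {#i#}) else 0) * h \<alpha>) =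
    (\<Sum>i\<le>n. \<Sum>\<alpha>\<in>mons n (Suc k). (if i \<in># \<alpha> then g i (\<alpha> - {#i#}) else 0) * h \<alpha>)"
    unfolding sum_distrib_right by (rule sum.swap)
  also have "\<dots> = (\<Sum>i\<le>n. \<Sum>\<beta>\<in>mons n k. g i \<beta> * h (add_mset i \<beta>))"
  proof (rule sum.cong[OF refl])
    fix i assume "i \<in> {..n}"
    then have i: "i \<le> n" by simp
    have "(\<Sum>\<alpha>\<in>mons n (Suc k). (if i \<in># \<alpha> then g i (\<alpha> - {#i#}) else 0) * h \<alpha>) =
      (\<Sum>\<alpha>\<in>add_mset i ` mons n k. (if i \<in># \<alpha> then g i (\<alpha> - {#i#}) else 0) * h \<alpha>)"
    proof (rule sum.mono_neutral_right[OF finite_mons])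
      show "add_mset i ` mons n k \<subseteq> mons n (Suc k)" using i by (auto intro: add_mset_mons)
      show "\<forall>\<alpha>\<in>mons n (Suc k) - add_mset i ` mons n k. (if i \<in># \<alpha> then g i (\<alpha> - {#i#}) else 0) * h \<alpha> = 0"
      proof
        fix \<alpha> assume a: "\<alpha> \<in> mons n (Suc k) - add_mset i ` mons n k"
        have "i \<notin># \<alpha>"
        proof
          assume "i \<in># \<alpha>"
          then obtain \<beta> where b: "\<alpha> = add_mset i \<beta>" by (meson multi_member_split)
          then have "\<beta> \<in> mons n k" using a by (auto simp: mons_def)
          then show False using a b by blast
        qed
        then show "(if i \<in># \<alpha> then g i (\<alpha> - {#i#}) else 0) * h \<alpha> = 0" by simp
      qed
    qed
    also have "\<dots> = (\<Sum>\<beta>\<in>mons n k. g i \<beta> * h (add_mset i \<beta>))"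
      by (subst sum.reindex) (auto simp: inj_on_def)
    finally show "(\<Sum>\<alpha>\<in>mons n (Suc k). (if i \<in># \<alpha> then g i (\<alpha> - {#i#}) else 0) * h \<alpha>) =
      (\<Sum>\<beta>\<in>mons n k. g i \<beta> * h (add_mset i \<beta>))" .
  qed
  finally show ?thesis .
qed

text \<open>The coefficient of the monomial \<open>\<alpha>\<close> in the product over \<open>\<phi>\<close> in the list of the linear forms
  \<open>\<Sum>\<^sub>i \<phi>(e\<^sub>i) X\<^sub>i\<close>.\<close>

fun msym :: "(nat \<Rightarrow> 'v) \<Rightarrow> nat \<Rightarrow> ('v \<Rightarrow> complex) list \<Rightarrow> nat multiset \<Rightarrow> complex"
  where
    "msym e n [] \<alpha> = (if \<alpha> = {#} then 1 else 0)"
  | "msym e n (\<phi> # \<phi>s) \<alpha> = (\<Sum>i\<le>n. if i \<in># \<alpha> then \<phi> (e i) * msym e n \<phi>s (\<alpha> - {#i#}) else 0)"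

lemma msym_sum:
  "(\<Sum>\<alpha>\<in>mons n (length \<phi>s). msym e n \<phi>s \<alpha> * mev x \<alpha>) = (\<Prod>\<phi>\<leftarrow>\<phi>s. \<Sum>i\<le>n. \<phi> (e i) * x i)"
proof (induction \<phi>s)
  case Nil
  have "mons n 0 = {{#}}" by (auto simp: mons_def)
  then show ?case by simp
next
  case (Cons \<phi> \<phi>s)
  have "(\<Sum>\<alpha>\<in>mons n (length (\<phi> # \<phi>s)). msym e n (\<phi> # \<phi>s) \<alpha> * mev x \<alpha>) =
    (\<Sum>i\<le>n. \<Sum>\<beta>\<in>mons n (length \<phi>s). \<phi> (e i) * msym e n \<phi>s \<beta> * mev x (add_mset i \<beta>))"
    using sum_mons_Suc[where g = "\<lambda>i \<beta>. \<phi> (e i) * msym e n \<phi>s \<beta>" and n = n and k = "length \<phi>s" and h = "mev x"] by simp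
  also have "\<dots> = (\<Sum>i\<le>n. \<phi> (e i) * x i) * (\<Sum>\<beta>\<in>mons n (length \<phi>s). msym e n \<phi>s \<beta> * mev x \<beta>)"
    by (simp add: sum_product mult_ac)
  finally show ?case by (simp add: Cons.IH)
qed

lemma msym_swap: "msym e n (us @ \<phi> # \<psi> # vs) \<alpha> = msym e n (us @ \<psi> # \<phi> # vs) \<alpha>"
proof (induction us arbitrary: \<alpha>)
  case Nil
  have eq: "msym e n (\<phi> # \<psi> # vs) \<alpha> = (\<Sum>i\<le>n. \<Sum>j\<le>n. if {#i, j#} \<subseteq># \<alpha> then \<phi> (e i) * \<psi> (e j) * msym e n vs (\<alpha> - {#i, j#}) else 0)" for \<phi> \<psi>
  proof -
    have "msym e n (\<phi> # \<psi> # vs) \<alpha> = (\<Sum>i\<le>n. if i \<in># \<alpha> then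
      (\<Sum>j\<le>n. if j \<in># \<alpha> - {#i#} then \<phi> (e i) * \<psi> (e j) * msym e n vs (\<alpha> - {#i#} - {#j#}) else 0) else 0)"
      by (simp add: sum_distrib_left if_distrib[of "\<lambda>x. _ * x"] mult.assoc cong: if_cong)
    also have "\<dots> = (\<Sum>i\<le>n. \<Sum>j\<le>n. if i \<in># \<alpha> \<and> j \<in># \<alpha> - {#i#} then \<phi> (e i) * \<psi> (e j) * msym e n vs (\<alpha> - {#i#} - {#j#}) else 0)"
      by (intro sum.cong) auto
    also have "\<dots> = (\<Sum>i\<le>n. \<Sum>j\<le>n. if {#i, j#} \<subseteq># \<alpha> then \<phi> (e i) * \<psi> (e j) * msym e n vs (\<alpha> - {#i, j#}) else 0)"
    proof -
      have d: "\<alpha> - {#i#} - {#j#} = \<alpha> - {#i, j#}" for i j by (rule multiset_eqI) simp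
      show ?thesis unfolding d
        by (simp add: insert_subset_eq_iff)
    qed
    finally show ?thesis .
  qed
  have "msym e n (\<phi> # \<psi> # vs) \<alpha> = (\<Sum>j\<le>n. \<Sum>i\<le>n. if {#i, j#} \<subseteq># \<alpha> then \<phi> (e i) * \<psi> (e j) * msym e n vs (\<alpha> - {#i, j#}) else 0)"
    unfolding eq by (rule sum.swap)
  also have "\<dots> = msym e n (\<psi> # \<phi> # vs) \<alpha>"
    unfolding eq
  proof (intro sum.cong refl)
    fix i j :: nat
    have "{#j, i#} = {#i, j#}" by (rule add_mset_commute)
    then show "(if {#j, i#} \<subseteq># \<alpha> then \<phi> (e j) * \<psi> (e i) * msym e n vs (\<alpha> - {#j, i#}) else 0) =
      (if {#i, j#} \<subseteq># \<alpha> then \<psi> (e i) * \<phi> (e j) * msym e n vs (\<alpha> - {#i, j#}) else 0)"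
      by (simp only: mult.commute)
  qed
  finally show ?case by simp
next
  case (Cons a us)
  show ?case
    unfolding append_Cons msym.simps
    by (intro sum.cong refl if_cong arg_cong2[where f = "(*)"] Cons.IH)
qed

text \<open>The coefficient of the monomial \<open>\<beta>\<close> in \<open>wsum w x J\<close>, where \<open>w K\<close> is the form with
  coefficients \<open>C K\<close>.\<close>

fun wcoeff :: "('c list \<Rightarrow> 'c multiset \<Rightarrow> 'r::comm_ring_1) \<Rightarrow> 'c list \<Rightarrow> 'c multiset \<Rightarrow> 'r"
  where
    "wcoeff C [] \<beta> = 0"
  | "wcoeff C (a # J) \<beta> = (-1) ^ length J * (if a \<in># \<beta> then C J (\<beta> - {#a#}) else 0) +
      wcoeff (\<lambda>K. C (a # K)) J \<beta>"

text \<open>The value of a linear functional on the form \<open>wsum w x J\<close>: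
  \<open>C K\<close> holds the coefficients of \<open>w K\<close>, and \<open>g a\<close> is the
  functional preceded by multiplication with the variable \<open>a\<close>.\<close>

fun wapply :: "(nat multiset set) \<Rightarrow> ('c list \<Rightarrow> nat multiset \<Rightarrow> 'r::comm_ring_1) \<Rightarrow> ('c \<Rightarrow> nat multiset \<Rightarrow> 'r) \<Rightarrow> 'c list \<Rightarrow> 'r"
  where
    "wapply X C g [] = 0"
  | "wapply X C g (a # J) = (-1) ^ length J * (\<Sum>\<alpha>\<in>X. C J \<alpha> * g a \<alpha>) + wapply X (\<lambda>K. C (a # K)) g J"

lemma sum_wcoeff:
  fixes g :: "nat multiset \<Rightarrow> 'r::comm_ring_1"
  assumes "set J \<subseteq> {..n}"
  shows "(\<Sum>\<beta>\<in>mons n (Suc m). wcoeff C J \<beta> * g \<beta>) = wapply (mons n m) C (\<lambda>a \<alpha>. g (add_mset a \<alpha>)) J"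
  using assms
proof (induction J arbitrary: C)
  case (Cons a J)
  have a: "a \<le> n" using Cons.prems by simp
  have *: "(\<Sum>\<beta>\<in>mons n (Suc m). (if a \<in># \<beta> then C J (\<beta> - {#a#}) else 0) * g \<beta>) = (\<Sum>\<alpha>\<in>mons n m. C J \<alpha> * g (add_mset a \<alpha>))"
  proof -
    have "(if a \<in># \<beta> then C J (\<beta> - {#a#}) else 0) =
        (\<Sum>i\<le>n. if i \<in># \<beta> then (if i = a then C J (\<beta> - {#i#}) else 0) else 0)" for \<beta>
    proof -
      have "(\<Sum>i\<le>n. if i \<in># \<beta> then (if i = a then C J (\<beta> - {#i#}) else 0) else 0) =
        (\<Sum>i\<le>n. if i = a then (if a \<in># \<beta> then C J (\<beta> - {#a#}) else 0) else 0)"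
        by (intro sum.cong) auto
      then show ?thesis using a by simp
    qed
    then have "(\<Sum>\<beta>\<in>mons n (Suc m). (if a \<in># \<beta> then C J (\<beta> - {#a#}) else 0) * g \<beta>) =
      (\<Sum>\<beta>\<in>mons n (Suc m). (\<Sum>i\<le>n. if i \<in># \<beta> then (if i = a then C J (\<beta> - {#i#}) else 0) else 0) * g \<beta>)"
      by simp
    also have "\<dots> = (\<Sum>i\<le>n. \<Sum>\<beta>\<in>mons n m. (if i = a then C J \<beta> else 0) * g (add_mset i \<beta>))"
      by (rule sum_mons_Suc)
    also have "\<dots> = (\<Sum>i\<le>n. if i = a then (\<Sum>\<beta>\<in>mons n m. C J \<beta> * g (add_mset a \<beta>)) else 0)"
      by (intro sum.cong) auto
    finally show ?thesis using a by simp
  qed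
  have "(\<Sum>\<beta>\<in>mons n (Suc m). wcoeff C (a # J) \<beta> * g \<beta>) =
    (-1) ^ length J * (\<Sum>\<beta>\<in>mons n (Suc m). (if a \<in># \<beta> then C J (\<beta> - {#a#}) else 0) * g \<beta>) +
    (\<Sum>\<beta>\<in>mons n (Suc m). wcoeff (\<lambda>K. C (a # K)) J \<beta> * g \<beta>)"
    by (simp add: distrib_right sum.distrib sum_distrib_left mult.assoc)
  also have "\<dots> = wapply (mons n m) C (\<lambda>a \<alpha>. g (add_mset a \<alpha>)) (a # J)"
    using Cons.IH[of "\<lambda>K. C (a # K)"] Cons.prems * by simp
  finally show ?case .
qed simp

lemma wapply_eq_wsum:
  "(\<And>K a. Suc (length K) = length J \<Longrightarrow> set K \<subseteq> set J \<Longrightarrow> (\<Sum>\<alpha>\<in>X. C K \<alpha> * g a \<alpha>) = w K * x a) \<Longrightarrow>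
    wapply X C g J = wsum w x J"
proof (induction J arbitrary: C w)
  case (Cons a J)
  have "wapply X (\<lambda>K. C (a # K)) g J = wsum (\<lambda>K. w (a # K)) x J"
  proof (rule Cons.IH)
    fix K b assume "Suc (length K) = length J" "set K \<subseteq> set J"
    then show "(\<Sum>\<alpha>\<in>X. C (a # K) \<alpha> * g b \<alpha>) = w (a # K) * x b" using Cons.prems[of "a # K" b] by auto
  qed
  moreover have "(\<Sum>\<alpha>\<in>X. C J \<alpha> * g a \<alpha>) = w J * x a" using Cons.prems[of J a] by auto
  ultimately show ?case by (simp add: mult_ac)
qed simp

lemma sum_wcoeff_mev:
  fixes x :: "nat \<Rightarrow> 'r::comm_ring_1"
  assumes "set J \<subseteq> {..n}"
  shows "(\<Sum>\<beta>\<in>mons n (Suc m). wcoeff C J \<beta> * mev x \<beta>) = wsum (\<lambda>K. \<Sum>\<alpha>\<in>mons n m. C K \<alpha> * mev x \<alpha>) x J"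
  unfolding sum_wcoeff[OF assms] by (rule wapply_eq_wsum) (simp add: sum_distrib_left mult_ac)

lemma wcoeff_pCons:
  fixes C C' :: "'c list \<Rightarrow> 'c multiset \<Rightarrow> complex"
  shows "wcoeff (\<lambda>K \<alpha>. [:C K \<alpha>, C' K \<alpha> - C K \<alpha>:]) J \<beta> = [:wcoeff C J \<beta>, wcoeff C' J \<beta> - wcoeff C J \<beta>:]"
proof (induction J arbitrary: C C')
  case (Cons a J)
  show ?case by (cases "even (length J)") (simp_all add: Cons.IH)
qed simp

lemma linear_on_wcoeff:
  "(\<And>K \<alpha>. linear_on H s (*) (\<lambda>M. C M K \<alpha>)) \<Longrightarrow> linear_on H s (*) (\<lambda>M. wcoeff (C M) J \<beta>)"
proof (induction J arbitrary: C)
  case (Cons a J)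
  have "linear_on H s (*) (\<lambda>M. (-1) ^ length J * (if a \<in># \<beta> then C M J (\<beta> - {#a#}) else 0))"
    using Cons.prems by (cases "a \<in># \<beta>") (auto intro: linear_on_scale simp: linear_on_zero)
  moreover have "linear_on H s (*) (\<lambda>M. wcoeff (\<lambda>K. C M (a # K)) J \<beta>)"
    using Cons.prems by (rule Cons.IH)
  ultimately show ?case by (simp add: linear_on_add)
qed (simp add: linear_on_zero)

section \<open>Coordinates from a basis and its dual basis\<close>

locale coords =
  fixes scale :: "complex \<Rightarrow> 'v::ab_group_add \<Rightarrow> 'v" and n :: nat
    and e :: "nat \<Rightarrow> 'v" and \<phi> :: "nat \<Rightarrow> 'v \<Rightarrow> complex"
  assumes vs: "vector_space scale"
    and \<phi>_dual: "i \<le> n \<Longrightarrow> \<phi> i \<in> dual scale"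
    and \<phi>_e: "i \<le> n \<Longrightarrow> j \<le> n \<Longrightarrow> \<phi> i (e j) = (if i = j then 1 else 0)"
    and expand: "v = (\<Sum>i\<le>n. scale (\<phi> i v) (e i))"

lemma ex_coords:
  fixes scale :: "complex \<Rightarrow> 'v::ab_group_add \<Rightarrow> 'v"
  assumes vs: "vector_space scale" and dim: "vector_space.dim scale (UNIV :: 'v set) = n + 1"
  shows "\<exists>e \<phi>. coords scale n e \<phi>"
proof -
  interpret vector_space scale by (rule vs)
  obtain B where B: "independent B" "UNIV \<subseteq> span B" "card B = n + 1"
    using basis_exists[of "UNIV :: 'v set"] dim by metis
  have finB: "finite B" using B(3) card.infinite by fastforce
  obtain e where e: "bij_betw e {0..<n + 1} B"
    using ex_bij_betw_nat_finite[OF finB] B(3) by auto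
  have eB: "e i \<in> B" if "i \<le> n" for i using e that by (auto simp: bij_betw_def)
  have inj: "e i = e j \<longleftrightarrow> i = j" if "i \<le> n" "j \<le> n" for i j
    using e that by (auto simp: bij_betw_def inj_on_def)
  have sp: "v \<in> span B" for v using B(2) by blast
  have "coords scale n e (\<lambda>i v. representation B v (e i))"
  proof
    show "(\<lambda>v. representation B v (e i)) \<in> dual scale" if "i \<le> n" for i
      unfolding dual_iff[OF vs] by (simp add: representation_add[OF B(1) sp sp] representation_scale[OF B(1) sp])
    show "representation B (e j) (e i) = (if i = j then 1 else 0)" if "i \<le> n" "j \<le> n" for i j
      using representation_basis[OF B(1) eB[OF that(2)]] inj[OF that] by simp
    show "v = (\<Sum>i\<le>n. scale (representation B v (e i)) (e i))" for v
    proof -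
      have "v = (\<Sum>b\<in>B. scale (representation B v b) b)"
        by (rule sum_representation_eq[symmetric, OF B(1) sp finB order_refl])
      also have "\<dots> = (\<Sum>i\<in>{0..<n + 1}. scale (representation B v (e i)) (e i))"
        by (rule sum.reindex_bij_betw[OF e, symmetric])
      also have "{0..<n + 1} = {..n}" by auto
      finally show ?thesis .
    qed
  qed
  then show ?thesis by blast
qed

context coords
begin

lemma dual_expand: "\<psi> \<in> dual scale \<Longrightarrow> \<psi> = (\<Sum>i\<le>n. pscale (*) (\<psi> (e i)) (\<phi> i))"
proof
  fix v assume \<psi>: "\<psi> \<in> dual scale"
  have add: "\<psi> (x + y) = \<psi> x + \<psi> y" and sc: "\<psi> (scale c x) = c * \<psi> x" for x y c
    using \<psi> by (auto simp: dual_iff[OF vs])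
  have "\<psi> 0 = 0" using add[of 0 0] by simp
  then have sum: "\<psi> (\<Sum>i\<in>I. f i) = (\<Sum>i\<in>I. \<psi> (f i))" for I :: "nat set" and f
    by (induction I rule: infinite_finite_induct) (simp_all add: add)
  have "\<psi> v = \<psi> (\<Sum>i\<le>n. scale (\<phi> i v) (e i))" using expand[of v] by simp
  then show "\<psi> v = (\<Sum>i\<le>n. pscale (*) (\<psi> (e i)) (\<phi> i)) v"
    by (simp add: sum sc sum_fun_apply pscale_def mult.commute)
qed

lemma dual_sum: "finite I \<Longrightarrow> I \<subseteq> {..n} \<Longrightarrow> (\<Sum>i\<in>I. pscale (*) (z i) (\<phi> i)) \<in> dual scale"
proof (induction I rule: finite_induct)
  case empty
  then show ?case using dual_zero[OF vs] by (simp add: zero_fun_def)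
next
  case (insert i I)
  then have "\<phi> i \<in> dual scale" "(\<Sum>i\<in>I. pscale (*) (z i) (\<phi> i)) \<in> dual scale" using \<phi>_dual by auto
  then have "pscale (*) (z i) (\<phi> i) + (\<Sum>i\<in>I. pscale (*) (z i) (\<phi> i)) \<in> dual scale"
    by (intro dual_add[OF vs] dual_pscale[OF vs])
  then show ?case unfolding sum.insert[OF insert.hyps] .
qed

lemma multilinear_sum:
  assumes t: "multilinear scale k t" "set us \<subseteq> dual scale" "set ws \<subseteq> dual scale" "Suc (length us + length ws) = k"
    and "finite I" "I \<subseteq> {..n}"
  shows "t (us @ (\<Sum>i\<in>I. pscale (*) (z i) (\<phi> i)) # ws) = (\<Sum>i\<in>I. z i * t (us @ \<phi> i # ws))"
  using assms(5,6)
proof (induction I rule: finite_induct)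
  case empty
  have "pscale (*) 0 (\<lambda>_. 0) = (0 :: 'v \<Rightarrow> complex)" by (auto simp: pscale_def)
  then show ?case using multilinearD(2)[OF t dual_zero[OF vs], of 0] by (simp add: zero_fun_def)
next
  case (insert i I)
  have i: "\<phi> i \<in> dual scale" using insert.prems by (intro \<phi>_dual) auto
  let ?S = "\<Sum>i\<in>I. pscale (*) (z i) (\<phi> i)"
  have I: "I \<subseteq> {..n}" using insert.prems by blast
  have "t (us @ (pscale (*) (z i) (\<phi> i) + ?S) # ws) = t (us @ pscale (*) (z i) (\<phi> i) # ws) + t (us @ ?S # ws)"
    by (rule multilinearD(1)[OF t dual_pscale[OF vs i] dual_sum[OF insert.hyps(1) I]])
  also have "\<dots> = z i * t (us @ \<phi> i # ws) + (\<Sum>i\<in>I. z i * t (us @ \<phi> i # ws))"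
    unfolding multilinearD(2)[OF t i] insert.IH[OF I] ..
  also have "\<dots> = (\<Sum>i\<in>insert i I. z i * t (us @ \<phi> i # ws))"
    by (rule sum.insert[OF insert.hyps, symmetric])
  finally show ?case unfolding sum.insert[OF insert.hyps, of "\<lambda>i. pscale (*) (z i) (\<phi> i)"] .
qed

lemma map_\<phi>_dual: "set J \<subseteq> {..n} \<Longrightarrow> set (map \<phi> J) \<subseteq> dual scale"
  using \<phi>_dual by auto

lemma multilinear_eq_0:
  assumes t: "multilinear scale k t" and zero: "\<And>J. set J \<subseteq> {..n} \<Longrightarrow> length J = k \<Longrightarrow> t (map \<phi> J) = 0"
    and \<phi>s: "set \<phi>s \<subseteq> dual scale" "length \<phi>s = k"
  shows "t \<phi>s = 0"
proof -
  have "t (map \<phi> J @ \<phi>s) = 0" if "set J \<subseteq> {..n}" "set \<phi>s \<subseteq> dual scale" "length J + length \<phi>s = k" for J \<phi>s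
    using that
  proof (induction \<phi>s arbitrary: J)
    case Nil
    then show ?case using zero by simp
  next
    case (Cons \<psi> \<phi>s)
    have "t (map \<phi> J @ \<psi> # \<phi>s) = t (map \<phi> J @ (\<Sum>i\<le>n. pscale (*) (\<psi> (e i)) (\<phi> i)) # \<phi>s)"
      using dual_expand[of \<psi>] Cons.prems(2) by simp
    also have "\<dots> = (\<Sum>i\<le>n. \<psi> (e i) * t (map \<phi> J @ \<phi> i # \<phi>s))"
      using Cons.prems by (intro multilinear_sum[OF t map_\<phi>_dual]) auto
    also have "\<dots> = 0"
    proof (rule sum.neutral, rule ballI)
      fix i assume "i \<in> {..n}"
      then have "t (map \<phi> (J @ [i]) @ \<phi>s) = 0" using Cons.prems by (intro Cons.IH) auto
      then show "\<psi> (e i) * t (map \<phi> J @ \<phi> i # \<phi>s) = 0" by simp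
    qed
    finally show ?case .
  qed
  from this[of "[]" \<phi>s] \<phi>s show ?thesis by simp
qed

text \<open>The sum of the basis tensors over all distinct arrangements of the multiset
  \<open>\<alpha>\<close>. In this basis the coordinates of \<open>v^m\<close> are plain monomials,
  without multinomial factors.\<close>

definition symtensor :: "nat \<Rightarrow> nat multiset \<Rightarrow> 'v tensor"
  where "symtensor m \<alpha> = (\<lambda>\<phi>s. if length \<phi>s = m \<and> set \<phi>s \<subseteq> dual scale then msym e n \<phi>s \<alpha> else 0)"

lemma linear_on_msym: "linear_on (dual scale) (pscale (*)) (*) (\<lambda>\<psi>. msym e n (us @ \<psi> # ws) \<alpha>)"
proof (induction us arbitrary: \<alpha>)
  case Nil
  have "linear_on (dual scale) (pscale (*)) (*) (\<lambda>\<psi>. if i \<in># \<alpha> then \<psi> (e i) * msym e n ws (\<alpha> - {#i#}) else 0)" for i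
    by (simp add: linear_on_def pscale_def algebra_simps)
  then show ?case by (simp add: linear_on_sum)
next
  case (Cons a us)
  have "linear_on (dual scale) (pscale (*)) (*) (\<lambda>\<psi>. if i \<in># \<alpha> then a (e i) * msym e n (us @ \<psi> # ws) (\<alpha> - {#i#}) else 0)" for i
    using linear_on_scale[OF Cons.IH] by (cases "i \<in># \<alpha>") (simp_all add: linear_on_zero)
  then show ?case by (simp add: linear_on_sum)
qed

lemma sym_powerI:
  assumes "multilinear scale m t" "\<And>\<phi>s. \<not> (length \<phi>s = m \<and> set \<phi>s \<subseteq> dual scale) \<Longrightarrow> t \<phi>s = 0"
    "\<And>\<phi>s \<psi>s. mset \<phi>s = mset \<psi>s \<Longrightarrow> t \<phi>s = t \<psi>s"
  shows "t \<in> sym_power scale m"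
proof -
  have "t \<in> tensor_power scale m" unfolding tensor_power_iff[OF vs] using assms(1,2) by blast
  then show ?thesis unfolding sym_power_def using assms(3) by blast
qed

lemma sym_powerD:
  assumes "t \<in> sym_power scale m"
  shows "multilinear scale m t" "\<not> (length \<phi>s = m \<and> set \<phi>s \<subseteq> dual scale) \<Longrightarrow> t \<phi>s = 0"
    "mset \<phi>s = mset \<psi>s \<Longrightarrow> t \<phi>s = t \<psi>s"
  using assms tensor_power_iff[OF vs, of t m] unfolding sym_power_def by blast+

lemma symtensor_sym_power: "symtensor m \<alpha> \<in> sym_power scale m"
proof -
  have "multilinear scale m (symtensor m \<alpha>)"
    unfolding multilinear_def
  proof (intro allI impI)
    fix us ws assume a: "set us \<subseteq> dual scale \<and> set ws \<subseteq> dual scale \<and> Suc (length us + length ws) = m"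
    have "symtensor m \<alpha> (us @ \<psi> # ws) = msym e n (us @ \<psi> # ws) \<alpha>" if "\<psi> \<in> dual scale" for \<psi>
      using a that by (auto simp: symtensor_def)
    then show "linear_on (dual scale) (pscale (*)) (*) (\<lambda>\<psi>. symtensor m \<alpha> (us @ \<psi> # ws))"
      using linear_on_msym[of us ws \<alpha>] dual_add[OF vs] dual_pscale[OF vs] by (simp add: linear_on_def)
  qed
  moreover have "symtensor m \<alpha> \<phi>s = symtensor m \<alpha> \<psi>s" if "mset \<phi>s = mset \<psi>s" for \<phi>s \<psi>s
  proof -
    have "msym e n \<psi>s \<alpha> = msym e n \<phi>s \<alpha>"
      by (rule swap_closed_mset[where P = "\<lambda>K. msym e n K \<alpha> = msym e n \<phi>s \<alpha>", OF _ refl that])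
        (simp only: msym_swap[of e n _ _ _ _ \<alpha>])
    then show ?thesis using mset_eq_length[OF that] mset_eq_setD[OF that] by (simp add: symtensor_def)
  qed
  moreover have "symtensor m \<alpha> \<phi>s = 0" if "\<not> (length \<phi>s = m \<and> set \<phi>s \<subseteq> dual scale)" for \<phi>s
    unfolding symtensor_def using that by (rule if_not_P)
  ultimately show ?thesis using sym_powerI by blast
qed

lemma vpow_expand: "vpow scale v m = (\<Sum>\<alpha>\<in>mons n m. tscale (mev (\<lambda>i. \<phi> i v) \<alpha>) (symtensor m \<alpha>))"
proof
  fix \<phi>s
  show "vpow scale v m \<phi>s = (\<Sum>\<alpha>\<in>mons n m. tscale (mev (\<lambda>i. \<phi> i v) \<alpha>) (symtensor m \<alpha>)) \<phi>s"
  proof (cases "length \<phi>s = m \<and> set \<phi>s \<subseteq> dual scale")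
    case True
    have "(\<Sum>\<alpha>\<in>mons n m. tscale (mev (\<lambda>i. \<phi> i v) \<alpha>) (symtensor m \<alpha>)) \<phi>s =
        (\<Sum>\<alpha>\<in>mons n (length \<phi>s). msym e n \<phi>s \<alpha> * mev (\<lambda>i. \<phi> i v) \<alpha>)"
      using True by (simp add: sum_fun_apply pscale_def symtensor_def mult.commute)
    also have "\<dots> = (\<Prod>\<psi>\<leftarrow>\<phi>s. \<Sum>i\<le>n. \<psi> (e i) * \<phi> i v)" by (rule msym_sum)
    also have "\<dots> = (\<Prod>\<psi>\<leftarrow>\<phi>s. \<psi> v)"
    proof (rule arg_cong[where f = prod_list], rule map_cong[OF refl])
      fix \<psi> assume "\<psi> \<in> set \<phi>s"
      then have "\<psi> = (\<Sum>i\<le>n. pscale (*) (\<psi> (e i)) (\<phi> i))" using True by (intro dual_expand) auto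
      then have "\<psi> v = (\<Sum>i\<le>n. pscale (*) (\<psi> (e i)) (\<phi> i)) v" by (rule fun_cong)
      then show "(\<Sum>i\<le>n. \<psi> (e i) * \<phi> i v) = \<psi> v" by (simp add: sum_fun_apply pscale_def)
    qed
    finally show ?thesis using True by (simp add: vpow_def)
  next
    case False
    then have "symtensor m \<alpha> \<phi>s = 0" for \<alpha> by (auto simp: symtensor_def)
    moreover have "vpow scale v m \<phi>s = 0" using False by (auto simp: vpow_def)
    ultimately show ?thesis by (simp add: sum_fun_apply pscale_def)
  qed
qed

lemma sym_power_add:
  assumes s: "s \<in> sym_power scale m" and t: "t \<in> sym_power scale m"
  shows "s + t \<in> sym_power scale m"
proof (rule sym_powerI)
  show "multilinear scale m (s + t)"
    using sym_powerD(1)[OF s] sym_powerD(1)[OF t] by (simp add: multilinear_def linear_on_add)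
  show "(s + t) \<phi>s = 0" if "\<not> (length \<phi>s = m \<and> set \<phi>s \<subseteq> dual scale)" for \<phi>s
    by (simp only: plus_fun_apply sym_powerD(2)[OF s that] sym_powerD(2)[OF t that] add_0)
  show "(s + t) \<phi>s = (s + t) \<psi>s" if "mset \<phi>s = mset \<psi>s" for \<phi>s \<psi>s
    by (simp only: plus_fun_apply sym_powerD(3)[OF s that] sym_powerD(3)[OF t that])
qed

lemma sym_power_tscale:
  assumes t: "t \<in> sym_power scale m"
  shows "tscale z t \<in> sym_power scale m"
proof (rule sym_powerI)
  show "multilinear scale m (tscale z t)"
    using sym_powerD(1)[OF t] linear_on_scale[of "dual scale" "pscale (*)" _ z]
    by (simp add: multilinear_def pscale_def[of _ z])
  show "tscale z t \<phi>s = 0" if "\<not> (length \<phi>s = m \<and> set \<phi>s \<subseteq> dual scale)" for \<phi>s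
    by (simp only: pscale_def sym_powerD(2)[OF t that] mult_zero_right)
  show "tscale z t \<phi>s = tscale z t \<psi>s" if "mset \<phi>s = mset \<psi>s" for \<phi>s \<psi>s
    by (simp only: pscale_def sym_powerD(3)[OF t that])
qed

lemma sym_power_zero: "0 \<in> sym_power scale m"
  by (rule sym_powerI) (simp_all add: multilinear_def linear_on_zero)

lemma sym_power_sum:
  assumes "\<And>\<alpha>. \<alpha> \<in> A \<Longrightarrow> t \<alpha> \<in> sym_power scale m" "finite A"
  shows "(\<Sum>\<alpha>\<in>A. tscale (z \<alpha>) (t \<alpha>)) \<in> sym_power scale m"
  using assms(2,1)
proof (induction A rule: finite_induct)
  case empty
  show ?case unfolding sum.empty by (rule sym_power_zero)
next
  case (insert \<alpha> A)
  show ?case unfolding sum.insert[OF insert.hyps]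
    by (intro sym_power_add sym_power_tscale insert.prems insert.IH) auto
qed

lemma Hom_sum:
  assumes M: "M \<in> Hom_sym_ext scale m a" and t: "\<And>\<alpha>. \<alpha> \<in> A \<Longrightarrow> t \<alpha> \<in> sym_power scale m" and "finite A"
  shows "M (\<Sum>\<alpha>\<in>A. tscale (z \<alpha>) (t \<alpha>)) = (\<Sum>\<alpha>\<in>A. tscale (z \<alpha>) (M (t \<alpha>)))"
proof -
  have lin: "x \<in> sym_power scale m \<Longrightarrow> y \<in> sym_power scale m \<Longrightarrow> M (x + y) = M x + M y"
    "x \<in> sym_power scale m \<Longrightarrow> M (tscale c x) = tscale c (M x)" for x y c
    using M unfolding Hom_sym_ext_def linear_on_def by blast+
  have ts0: "tscale 0 t = 0" for t :: "'v tensor" by (auto simp: pscale_def)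
  have "M (tscale 0 0) = tscale 0 (M 0)" by (rule lin(2)[OF sym_power_zero])
  then have M0: "M 0 = 0" by (simp only: ts0)
  show ?thesis
    using assms(3) t
  proof (induction A rule: finite_induct)
    case empty
    show ?case unfolding sum.empty by (rule M0)
  next
    case (insert \<alpha> A)
    have "M (tscale (z \<alpha>) (t \<alpha>) + (\<Sum>\<alpha>\<in>A. tscale (z \<alpha>) (t \<alpha>))) =
        M (tscale (z \<alpha>) (t \<alpha>)) + M (\<Sum>\<alpha>\<in>A. tscale (z \<alpha>) (t \<alpha>))"
      using insert.hyps insert.prems by (intro lin(1) sym_power_tscale sym_power_sum) auto
    also have "\<dots> = tscale (z \<alpha>) (M (t \<alpha>)) + (\<Sum>\<alpha>\<in>A. tscale (z \<alpha>) (M (t \<alpha>)))"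
      using lin(2)[of "t \<alpha>" "z \<alpha>"] insert.IH insert.prems by auto
    finally show ?case unfolding sum.insert[OF insert.hyps] .
  qed
qed

text \<open>The coefficient of the monomial \<open>\<alpha>\<close> in the component
  \<open>K\<close> of M(v^m), as a form in the coordinates of \<open>v\<close>.\<close>

definition hcoeff :: "nat \<Rightarrow> ('v tensor \<Rightarrow> 'v tensor) \<Rightarrow> nat list \<Rightarrow> nat multiset \<Rightarrow> complex"
  where "hcoeff m M K \<alpha> = M (symtensor m \<alpha>) (map \<phi> K)"

lemma Hom_vpow:
  assumes "M \<in> Hom_sym_ext scale m a"
  shows "M (vpow scale v m) (map \<phi> K) = (\<Sum>\<alpha>\<in>mons n m. hcoeff m M K \<alpha> * mev (\<lambda>i. \<phi> i v) \<alpha>)"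
  unfolding vpow_expand
  by (subst Hom_sum[OF assms symtensor_sym_power finite_mons])
    (simp add: sum_fun_apply pscale_def hcoeff_def mult.commute)

lemma hcoeff_alternating:
  assumes "M \<in> Hom_sym_ext scale m a"
  shows "hcoeff m M (us @ i # j # ws) \<alpha> = - hcoeff m M (us @ j # i # ws) \<alpha>"
proof -
  have "M (symtensor m \<alpha>) \<in> ext_power scale a" using assms symtensor_sym_power by (auto simp: Hom_sym_ext_def)
  then have "alternating (M (symtensor m \<alpha>))" by (rule ext_power_alternating[OF vs])
  then show ?thesis
    using alternatingD[of "M (symtensor m \<alpha>)" "map \<phi> us" "\<phi> i" "\<phi> j" "map \<phi> ws"] by (simp add: hcoeff_def)
qed

text \<open>Unsorted lists and lists with repetitions are kept: their equations repeat others up to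
  sign or hold trivially, and \<open>wsum\<close> can run over plain lists.\<close>

definition eqs :: "nat \<Rightarrow> nat list set"
  where "eqs a = {J. set J \<subseteq> {..n} \<and> length J = Suc a}"

sublocale sys: poly_system n "Suc m" "eqs a" "\<lambda>J \<beta> M. wcoeff (hcoeff m M) J \<beta>" "Hom_sym_ext scale m a" "pscale tscale"
  for m a
proof
  show "finite (eqs a)" using finite_lists_length_eq[of "{..n}" "Suc a"] by (simp add: eqs_def)
  show "linear_on (Hom_sym_ext scale m a) (pscale tscale) (*) (\<lambda>M. wcoeff (hcoeff m M) J \<beta>)" for J \<beta>
    by (rule linear_on_wcoeff) (simp add: linear_on_def hcoeff_def pscale_def)
qed

lemma eigenvector_iff_zero_at:
  assumes M: "M \<in> Hom_sym_ext scale m a"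
  shows "eigenvector scale m M v \<longleftrightarrow> v \<noteq> 0 \<and> sys.zero_at m a M (\<lambda>i. \<phi> i v)"
proof -
  have tp: "vpow scale v m \<in> sym_power scale m"
    unfolding vpow_expand by (rule sym_power_sum[OF symtensor_sym_power finite_mons])
  define w where "w = M (vpow scale v m)"
  have "w \<in> ext_power scale a" using M tp by (auto simp: Hom_sym_ext_def w_def)
  then have w0: "\<And>\<phi>s. \<not> (length \<phi>s = a \<and> set \<phi>s \<subseteq> dual scale) \<Longrightarrow> w \<phi>s = 0" and wm: "multilinear scale a w"
    using tensor_power_iff[OF vs, of w a] by (auto simp: ext_power_def)
  have eqJ: "wedge scale w v (map \<phi> J) = (\<Sum>\<beta>\<in>mons n (Suc m). wcoeff (hcoeff m M) J \<beta> * mev (\<lambda>i. \<phi> i v) \<beta>)"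
    if J: "set J \<subseteq> {..n}" for J
  proof -
    have "wedge scale w v (map \<phi> J) = wsum (\<lambda>K. w (map \<phi> K)) (\<lambda>i. \<phi> i v) J"
      by (simp add: wedge_eq_wsum[OF map_\<phi>_dual[OF J]] wsum_map)
    also have "\<dots> = wsum (\<lambda>K. \<Sum>\<alpha>\<in>mons n m. hcoeff m M K \<alpha> * mev (\<lambda>i. \<phi> i v) \<alpha>) (\<lambda>i. \<phi> i v) J"
      by (simp add: w_def Hom_vpow[OF M])
    finally show ?thesis by (simp add: sum_wcoeff_mev[OF J])
  qed
  have "wedge scale w v = 0 \<longleftrightarrow> (\<forall>J\<in>eqs a. wedge scale w v (map \<phi> J) = 0)"
  proof
    assume r: "\<forall>J\<in>eqs a. wedge scale w v (map \<phi> J) = 0"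
    show "wedge scale w v = 0"
    proof
      fix \<phi>s
      consider "\<not> set \<phi>s \<subseteq> dual scale" | "set \<phi>s \<subseteq> dual scale" "length \<phi>s \<noteq> Suc a"
        | "set \<phi>s \<subseteq> dual scale" "length \<phi>s = Suc a" by blast
      then show "wedge scale w v \<phi>s = 0 \<phi>s"
      proof cases
        case 1
        then show ?thesis by (simp add: wedge_def)
      next
        case 2
        have "wsum w (\<lambda>\<phi>. \<phi> v) \<phi>s = wsum (\<lambda>_. 0) (\<lambda>\<phi>. \<phi> v) \<phi>s"
          using 2 by (intro wsum_cong w0) auto
        then show ?thesis using 2 by (simp add: wedge_eq_wsum wsum_zero_fun)
      next
        case 3
        have "wsum w (\<lambda>\<phi>. \<phi> v) \<phi>s = 0"
        proof (rule multilinear_eq_0[OF multilinear_wsum[OF wm] _ 3])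
          fix J assume J: "set J \<subseteq> {..n}" "length J = Suc a"
          then have "wedge scale w v (map \<phi> J) = 0" using r by (simp add: eqs_def)
          then show "wsum w (\<lambda>\<phi>. \<phi> v) (map \<phi> J) = 0" by (simp add: wedge_eq_wsum[OF map_\<phi>_dual[OF J(1)]])
        qed
        then show ?thesis using 3 by (simp add: wedge_eq_wsum)
      qed
    qed
  qed simp
  then show ?thesis
    unfolding eigenvector_def sys.zero_at_def w_def[symmetric] using eqJ by (auto simp: eqs_def)
qed

end

subsection \<open>Binomial relations\<close>

lemma replicate_mset_plus: "replicate_mset (a + b) x = replicate_mset a x + replicate_mset b x"
  by (induction a) auto

context poly_system
begin

text \<open>Congruence modulo the ideal of two monomials of equal degree, tested by the functionals
  that annihilate the ideal.\<close>

definition equiv_mon :: "'h \<Rightarrow> nat multiset \<Rightarrow> nat multiset \<Rightarrow> bool"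
  where "equiv_mon M \<alpha> \<beta> \<longleftrightarrow> set_mset \<alpha> \<subseteq> {..n} \<and> set_mset \<beta> \<subseteq> {..n} \<and> size \<alpha> = size \<beta> \<and>
    (\<forall>\<mu>\<in>ann M (size \<alpha>). \<mu> \<alpha> = \<mu> \<beta>)"

lemma equiv_mon_refl: "set_mset \<alpha> \<subseteq> {..n} \<Longrightarrow> equiv_mon M \<alpha> \<alpha>"
  by (simp add: equiv_mon_def)

lemma equiv_mon_sym: "equiv_mon M \<alpha> \<beta> \<Longrightarrow> equiv_mon M \<beta> \<alpha>"
  unfolding equiv_mon_def by metis

lemma equiv_mon_trans: "equiv_mon M \<alpha> \<beta> \<Longrightarrow> equiv_mon M \<beta> \<gamma> \<Longrightarrow> equiv_mon M \<alpha> \<gamma>"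
  unfolding equiv_mon_def by metis

lemma equiv_mon_add:
  assumes "equiv_mon M \<alpha> \<beta>" "set_mset \<gamma> \<subseteq> {..n}"
  shows "equiv_mon M (\<alpha> + \<gamma>) (\<beta> + \<gamma>)"
proof -
  have "\<mu> (\<alpha> + \<gamma>) = \<mu> (\<beta> + \<gamma>)" if "\<mu> \<in> ann M (size (\<alpha> + \<gamma>))" for \<mu>
  proof -
    have "\<gamma> \<in> mons n (size \<gamma>)" using assms(2) by (simp add: mons_def)
    moreover have "\<mu> \<in> ann M (size \<alpha> + size \<gamma>)" using that by simp
    ultimately have "(\<lambda>\<delta>. \<mu> (\<delta> + \<gamma>)) \<in> ann M (size \<alpha>)" by (intro ann_shift_plus)
    then show ?thesis using assms(1) by (auto simp: equiv_mon_def)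
  qed
  then show ?thesis using assms by (auto simp: equiv_mon_def)
qed

lemma equiv_mon_plus:
  assumes "equiv_mon M \<alpha> \<beta>" "equiv_mon M \<gamma> \<delta>"
  shows "equiv_mon M (\<alpha> + \<gamma>) (\<beta> + \<delta>)"
proof -
  have s: "set_mset \<gamma> \<subseteq> {..n}" "set_mset \<beta> \<subseteq> {..n}" using assms by (auto simp: equiv_mon_def)
  have "equiv_mon M (\<gamma> + \<beta>) (\<delta> + \<beta>)" by (rule equiv_mon_add[OF assms(2) s(2)])
  then have "equiv_mon M (\<beta> + \<gamma>) (\<beta> + \<delta>)" by (simp add: add.commute)
  with equiv_mon_add[OF assms(1) s(1)] show ?thesis by (rule equiv_mon_trans)
qed

lemma equiv_mon_repeat: "equiv_mon M \<alpha> \<beta> \<Longrightarrow> equiv_mon M (repeat_mset k \<alpha>) (repeat_mset k \<beta>)"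
  by (induction k) (auto intro: equiv_mon_refl equiv_mon_plus)

text \<open>Congruence after multiplication by a power of x_0, that is, in the localization at
  x_0.\<close>

definition stable_equiv :: "'h \<Rightarrow> nat multiset \<Rightarrow> nat multiset \<Rightarrow> bool"
  where "stable_equiv M \<alpha> \<beta> \<longleftrightarrow> (\<exists>r. equiv_mon M (\<alpha> + replicate_mset r 0) (\<beta> + replicate_mset r 0))"

lemma set_replicate_0: "set_mset (replicate_mset r 0) \<subseteq> {..n}"
  by (cases r) auto

lemma equiv_mon_raise:
  assumes "equiv_mon M (\<alpha> + replicate_mset r 0) (\<beta> + replicate_mset r 0)" "r \<le> r'"
  shows "equiv_mon M (\<alpha> + replicate_mset r' 0) (\<beta> + replicate_mset r' 0)"
proof -
  have "replicate_mset r' 0 = replicate_mset r 0 + replicate_mset (r' - r) (0::nat)"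
    using assms(2) by (metis le_add_diff_inverse replicate_mset_plus)
  then show ?thesis using equiv_mon_add[OF assms(1) set_replicate_0[of "r' - r"]] by (simp add: add.assoc)
qed

lemma stable_equivI: "equiv_mon M \<alpha> \<beta> \<Longrightarrow> stable_equiv M \<alpha> \<beta>"
  unfolding stable_equiv_def by (rule exI[of _ 0]) simp

lemma stable_equiv_refl: "set_mset \<alpha> \<subseteq> {..n} \<Longrightarrow> stable_equiv M \<alpha> \<alpha>"
  by (intro stable_equivI equiv_mon_refl)

lemma stable_equiv_sym: "stable_equiv M \<alpha> \<beta> \<Longrightarrow> stable_equiv M \<beta> \<alpha>"
  unfolding stable_equiv_def using equiv_mon_sym by blast

lemma stable_equiv_trans:
  assumes "stable_equiv M \<alpha> \<beta>" "stable_equiv M \<beta> \<gamma>"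
  shows "stable_equiv M \<alpha> \<gamma>"
proof -
  obtain r r' where "equiv_mon M (\<alpha> + replicate_mset r 0) (\<beta> + replicate_mset r 0)"
    "equiv_mon M (\<beta> + replicate_mset r' 0) (\<gamma> + replicate_mset r' 0)"
    using assms unfolding stable_equiv_def by blast
  then have "equiv_mon M (\<alpha> + replicate_mset (max r r') 0) (\<beta> + replicate_mset (max r r') 0)"
    "equiv_mon M (\<beta> + replicate_mset (max r r') 0) (\<gamma> + replicate_mset (max r r') 0)"
    by (auto elim: equiv_mon_raise)
  then show ?thesis unfolding stable_equiv_def using equiv_mon_trans by blast
qed

lemma stable_equiv_plus:
  assumes "stable_equiv M \<alpha> \<beta>" "stable_equiv M \<gamma> \<delta>"
  shows "stable_equiv M (\<alpha> + \<gamma>) (\<beta> + \<delta>)"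
proof -
  obtain r r' where "equiv_mon M (\<alpha> + replicate_mset r 0) (\<beta> + replicate_mset r 0)"
    "equiv_mon M (\<gamma> + replicate_mset r' 0) (\<delta> + replicate_mset r' 0)"
    using assms unfolding stable_equiv_def by blast
  from equiv_mon_plus[OF this]
  have "equiv_mon M (\<alpha> + \<gamma> + replicate_mset (r + r') 0) (\<beta> + \<delta> + replicate_mset (r + r') 0)"
    by (simp add: replicate_mset_plus add_ac)
  then show ?thesis unfolding stable_equiv_def by blast
qed

lemma stable_equiv_add: "stable_equiv M \<alpha> \<beta> \<Longrightarrow> set_mset \<gamma> \<subseteq> {..n} \<Longrightarrow> stable_equiv M (\<alpha> + \<gamma>) (\<beta> + \<gamma>)"
  by (intro stable_equiv_plus stable_equiv_refl)

lemma stable_equiv_repeat: "stable_equiv M \<alpha> \<beta> \<Longrightarrow> stable_equiv M (repeat_mset k \<alpha>) (repeat_mset k \<beta>)"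
  by (induction k) (auto intro: stable_equiv_refl stable_equiv_plus)

end

lemma pigeonhole_mons:
  assumes "\<alpha> \<in> mons n d" "(n + 1) * k \<le> d" "0 < k"
  shows "\<exists>i\<le>n. \<exists>\<beta>. \<alpha> = replicate_mset k i + \<beta>"
proof -
  have "\<exists>i\<le>n. k \<le> count \<alpha> i"
  proof (rule ccontr)
    assume "\<not> ?thesis"
    then have lt: "\<And>i. i \<le> n \<Longrightarrow> count \<alpha> i \<le> k - 1" using assms(3) by fastforce
    have "d = (\<Sum>i\<in>set_mset \<alpha>. count \<alpha> i)" using assms(1) by (simp add: mons_def size_multiset_overloaded_eq)
    also have "\<dots> \<le> (\<Sum>i\<le>n. count \<alpha> i)" using assms(1) by (intro sum_mono2) (auto simp: mons_def)
    also have "\<dots> \<le> (\<Sum>i\<le>n. k - 1)" using lt by (intro sum_mono) auto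
    also have "\<dots> = (n + 1) * (k - 1)" by simp
    also have "\<dots> < (n + 1) * k" using assms(3) by (intro mult_strict_left_mono) auto
    finally show False using assms(2) by simp
  qed
  then obtain i where i: "i \<le> n" "k \<le> count \<alpha> i" by blast
  then have "replicate_mset k i \<subseteq># \<alpha>" by (simp add: count_le_replicate_mset_subset_eq)
  then obtain \<beta> where "\<alpha> = replicate_mset k i + \<beta>" by (meson subset_mset.le_iff_add)
  with i show ?thesis by blast
qed

text \<open>The base is an integer because the case a = n-1 uses the negative value q =
  -(m+1).\<close>

definition geom :: "int \<Rightarrow> nat \<Rightarrow> int"
  where "geom q i = (\<Sum>j<i. q ^ j)"

lemma geom_0 [simp]: "geom q 0 = 0" and geom_1 [simp]: "geom q (Suc 0) = 1"
  by (simp_all add: geom_def)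

lemma geom_Suc: "geom q (Suc i) = 1 + q * geom q i"
  unfolding geom_def by (subst sum.lessThan_Suc_shift) (simp add: sum_distrib_left)

lemma geom_Suc_Suc: "geom q (Suc (Suc i)) = (1 + q) * geom q (Suc i) - q * geom q i"
  by (simp add: geom_Suc algebra_simps)

context poly_system
begin

text \<open>Exponent vectors modulo the binomial relations form a cyclic group of order \<open>N\<close> generated by
  \<open>x\<^sub>1 / x\<^sub>0\<close>, in which \<open>x\<^sub>i / x\<^sub>0\<close> is the power with exponent \<open>geom q i\<close>.\<close>

lemma binomial_determines:
  fixes a b c' d' m N :: nat and q :: int
  defines "X \<equiv> (\<lambda>i. i mod (n + 1))"
  assumes n: "1 \<le> n" and N: "int N = \<bar>geom q (n + 1)\<bar>" "0 < N"
    and succ: "\<forall>i\<le>n. \<exists>\<sigma>. equiv_mon M (replicate_mset (m + 1) i) (add_mset (X (i + 1)) \<sigma>)"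
    and rel: "\<forall>i. equiv_mon M ({#X (i + 2)#} + replicate_mset a (X i) + replicate_mset b (X (i + 1)))
      (replicate_mset c' (X i) + replicate_mset d' (X (i + 1)))"
    and exps: "a + b + 1 = c' + d'" "int c' - int a = - q" "int d' - int b = 1 + q"
  shows "\<exists>d0. \<forall>d\<ge>d0. \<exists>T. determines M d T \<and> card T \<le> N"
proof -
  have Xn: "X i \<le> n" for i by (simp add: X_def mod_Suc_le_divisor)
  have Xid: "X i = i" if "i \<le> n" for i using that by (simp add: X_def)
  have XS: "X (X i + 1) = X (i + 1)" for i by (simp add: X_def mod_Suc_eq)
  let ?z = "\<lambda>k. replicate_mset k (0::nat)" and ?o = "\<lambda>k. replicate_mset k (1::nat)"
  have sets: "set_mset (?z k) \<subseteq> {..n}" "set_mset (?o k) \<subseteq> {..n}" "set_mset (replicate_mset k (X i)) \<subseteq> {..n}" for k i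
    using n Xn by (cases k; auto)+
  have sets2: "set_mset (?o k + ?z k') \<subseteq> {..n}" "set_mset (?z k + ?o k') \<subseteq> {..n}" for k k'
    unfolding set_mset_union using sets by blast+
  have set_equiv: "equiv_mon M \<alpha> \<beta> \<Longrightarrow> set_mset \<alpha> \<subseteq> {..n} \<and> set_mset \<beta> \<subseteq> {..n}" for \<alpha> \<beta>
    by (simp add: equiv_mon_def)
  define can where "can \<delta> \<longleftrightarrow> (\<forall>\<alpha> \<beta>. set_mset \<alpha> \<subseteq> {..n} \<and> set_mset \<beta> \<subseteq> {..n} \<and>
    stable_equiv M (\<alpha> + \<delta>) (\<beta> + \<delta>) \<longrightarrow> stable_equiv M \<alpha> \<beta>)" for \<delta>
  have can_plus: "can (\<delta> + \<epsilon>)" if "can \<delta>" "can \<epsilon>" "set_mset \<delta> \<subseteq> {..n}" for \<delta> \<epsilon>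
    unfolding can_def
  proof (intro allI impI, elim conjE)
    fix \<alpha> \<beta> assume ab: "set_mset \<alpha> \<subseteq> {..n}" "set_mset \<beta> \<subseteq> {..n}"
      "stable_equiv M (\<alpha> + (\<delta> + \<epsilon>)) (\<beta> + (\<delta> + \<epsilon>))"
    then have "stable_equiv M ((\<alpha> + \<delta>) + \<epsilon>) ((\<beta> + \<delta>) + \<epsilon>)" by (simp add: add.assoc)
    moreover have "set_mset (\<alpha> + \<delta>) \<subseteq> {..n}" "set_mset (\<beta> + \<delta>) \<subseteq> {..n}" using ab that(3) by auto
    ultimately have "stable_equiv M (\<alpha> + \<delta>) (\<beta> + \<delta>)" using that(2) unfolding can_def by blast
    then show "stable_equiv M \<alpha> \<beta>" using that(1) ab unfolding can_def by blast
  qed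
  have can_empty: "can {#}" by (simp add: can_def)
  have can_rep: "can (replicate_mset k i)" if "can {#i#}" "i \<le> n" for k i
  proof (induction k)
    case (Suc k)
    have "can ({#i#} + replicate_mset k i)" by (rule can_plus[OF that(1) Suc]) (use that(2) in simp)
    then show ?case by simp
  qed (simp add: can_empty)
  \<comment> \<open>Cancellability travels around the cycle: a power of x_i is congruent to a
    multiple of x_(i+1), so if x_i can be cancelled, x_(i+1) can be too. It starts at x_0, which
    \<open>stable_equiv\<close> inverts.\<close>
  have can1: "can {#X i#}" for i
  proof (induction i)
    case 0
    have "stable_equiv M \<alpha> \<beta>" if "stable_equiv M (add_mset 0 \<alpha>) (add_mset 0 \<beta>)" for \<alpha> \<beta>
    proof -
      obtain r where "equiv_mon M (add_mset 0 \<alpha> + ?z r) (add_mset 0 \<beta> + ?z r)"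
        using \<open>stable_equiv M (add_mset 0 \<alpha>) (add_mset 0 \<beta>)\<close> unfolding stable_equiv_def by blast
      then have "equiv_mon M (\<alpha> + ?z (Suc r)) (\<beta> + ?z (Suc r))" by simp
      then show ?thesis unfolding stable_equiv_def by blast
    qed
    then show ?case by (simp add: can_def X_def)
  next
    case (Suc i)
    obtain \<sigma> where \<sigma>: "equiv_mon M (replicate_mset (m + 1) (X i)) (add_mset (X (Suc i)) \<sigma>)"
      using succ Xn[of i] XS[of i] by (metis Suc_eq_plus1)
    then have s\<sigma>: "set_mset \<sigma> \<subseteq> {..n}" using set_equiv[OF \<sigma>] by auto
    show ?case unfolding can_def
    proof (intro allI impI, elim conjE)
      fix \<alpha> \<beta> assume ab: "set_mset \<alpha> \<subseteq> {..n}" "set_mset \<beta> \<subseteq> {..n}"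
        "stable_equiv M (\<alpha> + {#X (Suc i)#}) (\<beta> + {#X (Suc i)#})"
      have st: "stable_equiv M (\<gamma> + replicate_mset (m + 1) (X i)) (\<gamma> + {#X (Suc i)#} + \<sigma>)"
        if "set_mset \<gamma> \<subseteq> {..n}" for \<gamma>
        using stable_equiv_plus[OF stable_equiv_refl[OF that] stable_equivI[OF \<sigma>]] by simp
      have "stable_equiv M (\<alpha> + {#X (Suc i)#} + \<sigma>) (\<beta> + {#X (Suc i)#} + \<sigma>)"
        by (rule stable_equiv_add[OF ab(3) s\<sigma>])
      then have "stable_equiv M (\<alpha> + replicate_mset (m + 1) (X i)) (\<beta> + replicate_mset (m + 1) (X i))"
        using st[OF ab(1)] st[OF ab(2)] stable_equiv_trans stable_equiv_sym by blast
      then show "stable_equiv M \<alpha> \<beta>" using can_rep[OF Suc Xn] ab unfolding can_def by blast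
    qed
  qed
  have can0: "can (?z k)" for k using can_rep[OF can1[of 0]] by (simp add: X_def)
  have can_o: "can (?o k)" for k using can_rep[OF can1[of 1]] n by (simp add: X_def)
  \<comment> \<open>Cleared of denominators, this says that x_i/x_0 is the power of x_1/x_0 with
    exponent \<open>A - B\<close>; two natural numbers are kept because the exponent can be
    negative. The relation \<open>rel\<close> turns into the recurrence
    \<open>geom_Suc_Suc\<close>.\<close>
  have S: "\<exists>A B. stable_equiv M ({#X i#} + ?o B + ?z A) (?z (B + 1) + ?o A) \<and> int A - int B = geom q i" for i
  proof (induction i rule: induct_nat_012)
    case 0
    show ?case by (intro exI[of _ 0]) (simp add: X_def stable_equiv_refl)
  next
    case 1
    have "{#X (Suc 0)#} + ?o 0 + ?z 1 = ?z (0 + 1) + ?o 1"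
      using n by (intro multiset_eqI) (simp add: X_def)
    moreover have "set_mset (?z (0 + 1) + ?o 1) \<subseteq> {..n}" using n by simp
    ultimately have "stable_equiv M ({#X (Suc 0)#} + ?o 0 + ?z 1) (?z (0 + 1) + ?o 1)"
      by (simp only: stable_equiv_refl)
    then show ?case by (intro exI[of _ 1] exI[of _ 0]) simp
  next
    case (ge2 i)
    obtain A B where AB: "stable_equiv M ({#X i#} + ?o B + ?z A) (?z (B + 1) + ?o A)" "int A - int B = geom q i"
      using ge2(1) by blast
    obtain A' B' where AB': "stable_equiv M ({#X (Suc i)#} + ?o B' + ?z A') (?z (B' + 1) + ?o A')"
      "int A' - int B' = geom q (Suc i)"
      using ge2(2) by blast
    \<comment> \<open>The exponents result from raising the relations for i and i + 1 to the powers
      that occur in \<open>rel\<close>. Both sides, multiplied by \<open>W\<close>, are congruent to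
      the common monomial \<open>L\<close>, and \<open>W\<close> is cancelled.\<close>
    define A'' where "A'' = c' * A + d' * A' + a * B + b * B'"
    define B'' where "B'' = c' * B + d' * B' + a * A + b * A'"
    define L where "L = repeat_mset c' (?z (B + 1) + ?o A) + repeat_mset d' (?z (B' + 1) + ?o A') +
      (?o (a * A + b * A') + ?z (a * B + b * B'))"
    define W where "W = replicate_mset a (X i) + replicate_mset b (X (Suc i))"
    have sW: "set_mset W \<subseteq> {..n}" using n Xn sets by (auto simp: W_def)
    let ?l1 = "({#X (i + 2)#} + replicate_mset a (X i) + replicate_mset b (X (i + 1))) + (?o B'' + ?z A'')"
    let ?r1 = "(replicate_mset c' (X i) + replicate_mset d' (X (i + 1))) + (?o B'' + ?z A'')"
    have "stable_equiv M ?l1 ?r1"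
      using rel by (intro stable_equiv_add[OF _ sets2(1)] stable_equivI) blast
    moreover have "?r1 = repeat_mset c' ({#X i#} + ?o B + ?z A) + repeat_mset d' ({#X (Suc i)#} + ?o B' + ?z A') +
      (?o (a * A + b * A') + ?z (a * B + b * B'))"
      by (rule multiset_eqI) (simp add: A''_def B''_def algebra_simps)
    moreover have "stable_equiv M \<dots> L"
      unfolding L_def
      by (rule stable_equiv_add[OF stable_equiv_plus[OF stable_equiv_repeat[OF AB(1)] stable_equiv_repeat[OF AB'(1)]] sets2(1)])
    ultimately have "stable_equiv M ?l1 L" using stable_equiv_trans by metis
    moreover have "?l1 = {#X (i + 2)#} + ?o B'' + ?z A'' + W"
      by (rule multiset_eqI) (simp add: W_def)
    ultimately have 1: "stable_equiv M ({#X (i + 2)#} + ?o B'' + ?z A'' + W) L" by metis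
    have "(?z (B'' + 1) + ?o A'') + W =
      repeat_mset a ({#X i#} + ?o B + ?z A) + repeat_mset b ({#X (Suc i)#} + ?o B' + ?z A') +
      (?z (c' * B + d' * B' + 1) + ?o (c' * A + d' * A'))"
      by (rule multiset_eqI) (simp add: A''_def B''_def W_def algebra_simps)
    moreover have "stable_equiv M \<dots> (repeat_mset a (?z (B + 1) + ?o A) + repeat_mset b (?z (B' + 1) + ?o A') +
      (?z (c' * B + d' * B' + 1) + ?o (c' * A + d' * A')))"
      by (rule stable_equiv_add[OF stable_equiv_plus[OF stable_equiv_repeat[OF AB(1)] stable_equiv_repeat[OF AB'(1)]] sets2(2)])
    moreover have "repeat_mset a (?z (B + 1) + ?o A) + repeat_mset b (?z (B' + 1) + ?o A') +
      (?z (c' * B + d' * B' + 1) + ?o (c' * A + d' * A')) = L"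
      using exps(1) by (intro multiset_eqI) (auto simp: L_def algebra_simps)
    ultimately have 2: "stable_equiv M ((?z (B'' + 1) + ?o A'') + W) L" by metis
    have canW: "can W" unfolding W_def
      using n Xn sets by (intro can_plus can_rep can1 Xn) auto
    have "stable_equiv M ({#X (i + 2)#} + ?o B'' + ?z A'' + W) ((?z (B'' + 1) + ?o A'') + W)"
      using 1 2 stable_equiv_trans stable_equiv_sym by blast
    moreover have "set_mset ({#X (i + 2)#} + ?o B'' + ?z A'') \<subseteq> {..n}" "set_mset (?z (B'' + 1) + ?o A'') \<subseteq> {..n}"
      using n Xn sets Xn by auto
    ultimately have "stable_equiv M ({#X (i + 2)#} + ?o B'' + ?z A'') (?z (B'' + 1) + ?o A'')"
      using canW unfolding can_def by blast
    moreover have "int A'' - int B'' = geom q (Suc (Suc i))"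
    proof -
      have "int A'' - int B'' = (int c' - int a) * (int A - int B) + (int d' - int b) * (int A' - int B')"
        by (simp add: A''_def B''_def algebra_simps)
      then show ?thesis by (simp add: AB(2) AB'(2) exps geom_Suc_Suc)
    qed
    ultimately show ?case by (intro exI[of _ A''] exI[of _ B'']) simp
  qed
  \<comment> \<open>Here the cycle closes: index n + 1 is index 0, so the power of x_1/x_0 with
    exponent \<open>geom q (n + 1)\<close>, which is N up to sign, is 1.\<close>
  have oN: "stable_equiv M (?o N) (?z N)"
  proof -
    obtain A B where AB: "stable_equiv M ({#X (n + 1)#} + ?o B + ?z A) (?z (B + 1) + ?o A)"
      "int A - int B = geom q (n + 1)" using S by blast
    have "stable_equiv M ((?o B + ?z A) + ?z 1) ((?z B + ?o A) + ?z 1)"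
      using AB(1) by (simp add: X_def add_ac)
    moreover have "set_mset (?o B + ?z A) \<subseteq> {..n}" "set_mset (?z B + ?o A) \<subseteq> {..n}" using n Xn sets by auto
    ultimately have *: "stable_equiv M (?o B + ?z A) (?z B + ?o A)" using can0[of 1] unfolding can_def by blast
    have can01: "can (?z k + ?o k)" for k using n Xn sets by (intro can_plus can0 can_o)
    consider "A = B + N" | "B = A + N" using AB(2) N(1) by linarith
    then show ?thesis
    proof cases
      case 1
      then have "stable_equiv M (?z N + (?z B + ?o B)) (?o N + (?z B + ?o B))"
        using * by (simp add: replicate_mset_plus add_ac)
      then have "stable_equiv M (?z N) (?o N)" using can01[of B] sets unfolding can_def by blast
      then show ?thesis by (rule stable_equiv_sym)
    next
      case 2
      then have "stable_equiv M (?o N + (?z A + ?o A)) (?z N + (?z A + ?o A))"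
        using * by (simp add: replicate_mset_plus add_ac)
      then show ?thesis using can01[of A] sets unfolding can_def by blast
    qed
  qed
  have oNk: "stable_equiv M (?o (N * k)) (?z (N * k))" for k
  proof -
    have "repeat_mset k (replicate_mset N x) = replicate_mset (N * k) x" for x :: nat
      by (rule multiset_eqI) simp
    then show ?thesis using stable_equiv_repeat[OF oN, of k] by metis
  qed
  have letter: "\<exists>u v f. f < N \<and> stable_equiv M ({#i#} + ?z u) (?z v + ?o f)" if i: "i \<le> n" for i
  proof -
    obtain A B where AB: "stable_equiv M ({#X i#} + ?o B + ?z A) (?z (B + 1) + ?o A)" using S by blast
    \<comment> \<open>Multiplying by x_1^(B (N-1)) turns the factor x_1^B on the left into x_1^(N
      B), a power of x_0; the exponent \<open>w\<close> left on the other side is then reduced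
      modulo N.\<close>
    define w where "w = A + B * (N - 1)"
    have "stable_equiv M (({#X i#} + ?o B + ?z A) + ?o (B * (N - 1))) ((?z (B + 1) + ?o A) + ?o (B * (N - 1)))"
      by (rule stable_equiv_add[OF AB sets(2)])
    moreover have "({#X i#} + ?o B + ?z A) + ?o (B * (N - 1)) = ({#i#} + ?z A) + ?o (N * B)"
    proof -
      have "N * B = B + B * (N - 1)" using N(2) by (cases N) (simp_all add: algebra_simps)
      then show ?thesis by (simp add: Xid[OF i] replicate_mset_plus add_ac)
    qed
    moreover have "(?z (B + 1) + ?o A) + ?o (B * (N - 1)) = ?z (B + 1) + ?o (N * (w div N)) + ?o (w mod N)"
    proof -
      have "w = N * (w div N) + w mod N" by simp
      then have "?o w = ?o (N * (w div N)) + ?o (w mod N)" by (metis replicate_mset_plus)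
      then show ?thesis by (simp add: w_def replicate_mset_plus add_ac)
    qed
    ultimately have 1: "stable_equiv M (({#i#} + ?z A) + ?o (N * B)) (?z (B + 1) + ?o (N * (w div N)) + ?o (w mod N))"
      by metis
    have s: "set_mset ({#i#} + ?z A) \<subseteq> {..n}" using i sets by auto
    have "stable_equiv M (({#i#} + ?z A) + ?o (N * B)) (({#i#} + ?z A) + ?z (N * B))"
      by (rule stable_equiv_plus[OF stable_equiv_refl[OF s] oNk])
    moreover have "stable_equiv M (?z (B + 1) + ?o (N * (w div N)) + ?o (w mod N)) (?z (B + 1) + ?z (N * (w div N)) + ?o (w mod N))"
      by (intro stable_equiv_plus stable_equiv_refl sets oNk)
    ultimately have "stable_equiv M (({#i#} + ?z A) + ?z (N * B)) (?z (B + 1) + ?z (N * (w div N)) + ?o (w mod N))"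
      using 1 stable_equiv_trans stable_equiv_sym by blast
    then have "stable_equiv M ({#i#} + ?z (A + N * B)) (?z (B + 1 + N * (w div N)) + ?o (w mod N))"
      by (simp add: replicate_mset_plus add_ac)
    moreover have "w mod N < N" using N(2) by simp
    ultimately show ?thesis by blast
  qed
  \<comment> \<open>Stable congruences become genuine ones in the presence of enough factors x_0,
    with one threshold for all letters.\<close>
  have "\<exists>U f. \<forall>i\<le>n. f i < N \<and> (\<forall>u\<ge>U. f i \<le> u + 1 \<and> equiv_mon M ({#i#} + ?z u) (?z (u + 1 - f i) + ?o (f i)))"
  proof -
    have "\<exists>U f. f < N \<and> (\<forall>u\<ge>U. f \<le> u + 1 \<and> equiv_mon M ({#i#} + ?z u) (?z (u + 1 - f) + ?o f))" if i: "i \<le> n" for i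
    proof -
      obtain u v f where f: "f < N" "stable_equiv M ({#i#} + ?z u) (?z v + ?o f)" using letter[OF i] by blast
      then obtain r where r: "equiv_mon M ({#i#} + ?z u + ?z r) (?z v + ?o f + ?z r)"
        unfolding stable_equiv_def by blast
      have "f \<le> u' + 1 \<and> equiv_mon M ({#i#} + ?z u') (?z (u' + 1 - f) + ?o f)" if u': "u' \<ge> u + r" for u'
      proof -
        have sz: "1 + u + r = v + f + r" using r by (simp add: equiv_mon_def)
        have "equiv_mon M (({#i#} + ?z u + ?z r) + ?z (u' - (u + r))) ((?z v + ?o f + ?z r) + ?z (u' - (u + r)))"
          by (rule equiv_mon_add[OF r sets(1)])
        moreover have "({#i#} + ?z u + ?z r) + ?z (u' - (u + r)) = {#i#} + ?z u'"
          using u' by (intro multiset_eqI) auto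
        moreover have "(?z v + ?o f + ?z r) + ?z (u' - (u + r)) = ?z (u' + 1 - f) + ?o f"
          using u' sz by (intro multiset_eqI) auto
        ultimately have "equiv_mon M ({#i#} + ?z u') (?z (u' + 1 - f) + ?o f)" by metis
        then show ?thesis using u' sz by auto
      qed
      with f(1) show ?thesis by blast
    qed
    then have "\<forall>i. \<exists>Uf. i \<le> n \<longrightarrow> snd Uf < N \<and> (\<forall>u\<ge>fst Uf. snd Uf \<le> u + 1 \<and>
      equiv_mon M ({#i#} + ?z u) (?z (u + 1 - snd Uf) + ?o (snd Uf)))" by (metis fst_conv snd_conv)
    from choice[OF this] obtain g where g: "\<forall>i\<le>n. snd (g i) < N \<and> (\<forall>u\<ge>fst (g i). snd (g i) \<le> u + 1 \<and>
      equiv_mon M ({#i#} + ?z u) (?z (u + 1 - snd (g i)) + ?o (snd (g i))))" by blast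
    have le: "fst (g i) \<le> (\<Sum>i\<le>n. fst (g i))" if "i \<le> n" for i
      using that by (intro member_le_sum) auto
    show ?thesis
      using g le by (intro exI[of _ "\<Sum>i\<le>n. fst (g i)"] exI[of _ "\<lambda>i. snd (g i)"]) (meson order_trans)
  qed
  then obtain U1 f where U1: "\<And>i. i \<le> n \<Longrightarrow> f i < N"
    "\<And>i u. i \<le> n \<Longrightarrow> U1 \<le> u \<Longrightarrow> f i \<le> u + 1 \<and> equiv_mon M ({#i#} + ?z u) (?z (u + 1 - f i) + ?o (f i))"
    by blast
  obtain r where r: "equiv_mon M (?o N + ?z r) (?z N + ?z r)" using oN unfolding stable_equiv_def by blast
  define U where "U = max U1 r"
  have oN_exact: "equiv_mon M (?o N + ?z u) (?z (N + u))" if "u \<ge> U" for u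
    using equiv_mon_raise[OF r, of u] that by (simp add: U_def replicate_mset_plus)
  \<comment> \<open>Letters are absorbed one at a time into x_0 and x_1. As \<open>k < N\<close>,
    the bound leaves at least U + N factors x_0, of which one letter consumes fewer than N; the
    bound survives because \<open>u + k\<close> never decreases.\<close>
  have normal: "\<exists>u' f'. f' < N \<and> equiv_mon M (\<beta> + (?z u + ?o k)) (?z u' + ?o f')"
    if "set_mset \<beta> \<subseteq> {..n}" "k < N" "U + 2 * N \<le> u + k" for \<beta> u k
    using that
  proof (induction \<beta> arbitrary: u k)
    case empty
    then show ?case using n Xn sets by (intro exI[of _ u] exI[of _ k]) (simp add: equiv_mon_refl)
  next
    case (add i \<beta>)
    have i: "i \<le> n" and s\<beta>: "set_mset \<beta> \<subseteq> {..n}" using add.prems by auto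
    have u: "U + N \<le> u" "U1 \<le> u" using add.prems by (auto simp: U_def)
    have fi: "f i < N" "f i \<le> u + 1" "equiv_mon M ({#i#} + ?z u) (?z (u + 1 - f i) + ?o (f i))"
      using U1(1)[OF i] U1(2)[OF i u(2)] by auto
    have "equiv_mon M (({#i#} + ?z u) + (\<beta> + ?o k)) ((?z (u + 1 - f i) + ?o (f i)) + (\<beta> + ?o k))"
      by (rule equiv_mon_add[OF fi(3)]) (use s\<beta> n sets in auto)
    then have 1: "equiv_mon M (add_mset i \<beta> + (?z u + ?o k)) (\<beta> + (?z (u + 1 - f i) + ?o (f i + k)))"
      by (simp add: replicate_mset_plus add_ac)
    show ?case
    proof (cases "f i + k < N")
      case True
      have "U + 2 * N \<le> (u + 1 - f i) + (f i + k)" using add.prems(3) fi(2) by arith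
      from add.IH[OF s\<beta> True this] obtain u' f' where
        "f' < N" "equiv_mon M (\<beta> + (?z (u + 1 - f i) + ?o (f i + k))) (?z u' + ?o f')" by blast
      with 1 show ?thesis using equiv_mon_trans by blast
    next
      case False
      define k' where "k' = f i + k - N"
      have k': "k' < N" "f i + k = N + k'" using False fi(1) add.prems(2) by (auto simp: k'_def)
      have "U \<le> u + 1 - f i" using u(1) fi(1) by simp
      then have "equiv_mon M ((?o N + ?z (u + 1 - f i)) + (\<beta> + ?o k')) (?z (N + (u + 1 - f i)) + (\<beta> + ?o k'))"
        by (intro equiv_mon_add oN_exact) (use s\<beta> n sets in auto)
      then have 2: "equiv_mon M (\<beta> + (?z (u + 1 - f i) + ?o (f i + k))) (\<beta> + (?z (N + (u + 1 - f i)) + ?o k'))"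
        unfolding k'(2) by (simp add: replicate_mset_plus add_ac)
      have "U + 2 * N \<le> (N + (u + 1 - f i)) + k'" using add.prems(3) fi(2) k'(2) by arith
      from add.IH[OF s\<beta> k'(1) this] obtain u' f' where
        "f' < N" "equiv_mon M (\<beta> + (?z (N + (u + 1 - f i)) + ?o k')) (?z u' + ?o f')" by blast
      with 1 2 show ?thesis using equiv_mon_trans by blast
    qed
  qed
  define r0 where "r0 = U + 2 * N"
  \<comment> \<open>Following the cycle from i up to n + 1, some power of each variable is congruent
    to a multiple of x_0^r0.\<close>
  have "\<exists>s. \<exists>\<sigma>. equiv_mon M (replicate_mset s (X i)) (?z r0 + \<sigma>)" if "i \<le> n + 1" for i
    using that
  proof (induction "n + 1 - i" arbitrary: i)
    case 0
    then have "i = n + 1" by simp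
    then have "X i = 0" by (simp add: X_def)
    then show ?case using n Xn sets(1)[of r0] by (intro exI[of _ r0] exI[of _ "{#}"]) (simp add: equiv_mon_refl)
  next
    case (Suc j)
    then have "j = n + 1 - (i + 1)" "i + 1 \<le> n + 1" by auto
    from Suc.hyps(1)[OF this] obtain s \<sigma> where s: "equiv_mon M (replicate_mset s (X (i + 1))) (?z r0 + \<sigma>)"
      by blast
    obtain \<tau> where \<tau>: "equiv_mon M (replicate_mset (m + 1) (X i)) (add_mset (X (i + 1)) \<tau>)"
      using succ Xn[of i] XS[of i] by metis
    have s\<tau>: "set_mset \<tau> \<subseteq> {..n}" using set_equiv[OF \<tau>] by auto
    have "repeat_mset s (replicate_mset (m + 1) (X i)) = replicate_mset (s * (m + 1)) (X i)"
      "repeat_mset s (add_mset (X (i + 1)) \<tau>) = replicate_mset s (X (i + 1)) + repeat_mset s \<tau>"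
      by (rule multiset_eqI, simp)+
    then have "equiv_mon M (replicate_mset (s * (m + 1)) (X i)) (replicate_mset s (X (i + 1)) + repeat_mset s \<tau>)"
      using equiv_mon_repeat[OF \<tau>, of s] by simp
    moreover have "equiv_mon M (replicate_mset s (X (i + 1)) + repeat_mset s \<tau>) ((?z r0 + \<sigma>) + repeat_mset s \<tau>)"
    proof (rule equiv_mon_add[OF s])
      show "set_mset (repeat_mset s \<tau>) \<subseteq> {..n}" by (induction s) (use s\<tau> in auto)
    qed
    ultimately have "equiv_mon M (replicate_mset (s * (m + 1)) (X i)) (?z r0 + (\<sigma> + repeat_mset s \<tau>))"
      using equiv_mon_trans by (simp add: add.assoc)
    then show ?case by blast
  qed
  then have "\<forall>i. \<exists>s. i \<le> n \<longrightarrow> (\<exists>\<sigma>. equiv_mon M (replicate_mset s i) (?z r0 + \<sigma>))"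
    using Xid by (metis le_add1 order_trans)
  from choice[OF this] obtain s where s: "\<forall>i\<le>n. \<exists>\<sigma>. equiv_mon M (replicate_mset (s i) i) (?z r0 + \<sigma>)" by blast
  define s0 where "s0 = Suc (\<Sum>i\<le>n. s i)"
  have s0: "s i \<le> s0" if "i \<le> n" for i
    using member_le_sum[of i "{..n}" s] that by (simp add: s0_def)
  \<comment> \<open>By the pigeonhole principle, degree \<open>(n + 1) * s0\<close> forces some
    variable to exponent \<open>s0\<close>, which supplies the factors x_0; the summand
    \<open>N\<close> keeps \<open>d - f\<close> exact for \<open>f < N\<close>.\<close>
  show ?thesis
  proof (intro exI[of _ "(n + 1) * s0 + N"] allI impI)
    fix d assume d: "(n + 1) * s0 + N \<le> d"
    define T where "T = (\<lambda>f. ?z (d - f) + ?o f) ` {..<N}"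
    have "card T \<le> N" unfolding T_def using card_image_le[of "{..<N}"] by simp
    moreover have "determines M d T"
      unfolding determines_def
    proof (intro conjI ballI impI)
      show "T \<subseteq> mons n d"
      proof
        fix \<tau> assume "\<tau> \<in> T"
        then obtain f where f: "f < N" "\<tau> = ?z (d - f) + ?o f" by (auto simp: T_def)
        have "set_mset \<tau> \<subseteq> {..n}" using n Xn sets f(2) by auto
        then show "\<tau> \<in> mons n d" using f d by (simp add: mons_def)
      qed
      fix \<mu> \<alpha> assume \<mu>: "\<mu> \<in> ann M d" "\<forall>\<alpha>\<in>T. \<mu> \<alpha> = 0" and \<alpha>: "\<alpha> \<in> mons n d"
      have "(n + 1) * s0 \<le> d" "0 < s0" using d by (auto simp: s0_def)
      then obtain i \<beta> where i: "i \<le> n" "\<alpha> = replicate_mset s0 i + \<beta>" using pigeonhole_mons[OF \<alpha>] by blast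
      obtain \<sigma> where \<sigma>: "equiv_mon M (replicate_mset (s i) i) (?z r0 + \<sigma>)" using s i(1) by blast
      define \<beta>' where "\<beta>' = replicate_mset (s0 - s i) i + \<beta>"
      have "replicate_mset s0 i = replicate_mset (s i) i + replicate_mset (s0 - s i) i"
        using s0[OF i(1)] by (metis le_add_diff_inverse replicate_mset_plus)
      then have \<alpha>': "\<alpha> = replicate_mset (s i) i + \<beta>'" by (simp add: i(2) \<beta>'_def)
      have s\<beta>': "set_mset \<beta>' \<subseteq> {..n}" using \<alpha> \<alpha>' by (auto simp: mons_def)
      have e1: "equiv_mon M \<alpha> ((\<sigma> + \<beta>') + (?z r0 + ?o 0))"
        using equiv_mon_add[OF \<sigma> s\<beta>'] by (simp add: \<alpha>' add_ac)
      have "set_mset (\<sigma> + \<beta>') \<subseteq> {..n}" using set_equiv[OF \<sigma>] s\<beta>' by auto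
      from normal[OF this N(2), of r0] obtain u' f' where
        uf: "f' < N" "equiv_mon M ((\<sigma> + \<beta>') + (?z r0 + ?o 0)) (?z u' + ?o f')" by (auto simp: r0_def)
      have e2: "equiv_mon M \<alpha> (?z u' + ?o f')" using e1 uf(2) by (rule equiv_mon_trans)
      then have "u' + f' = d" using \<alpha> by (simp add: equiv_mon_def mons_def)
      then have "d - f' = u'" by simp
      then have "?z u' + ?o f' = ?z (d - f') + ?o f'" by simp
      then have "?z u' + ?o f' \<in> T" unfolding T_def using uf(1) by (rule image_eqI[OF _ lessThan_iff[THEN iffD2]])
      moreover have "\<mu> \<alpha> = \<mu> (?z u' + ?o f')" using e2 \<mu>(1) \<alpha> by (simp add: equiv_mon_def mons_def)
      ultimately show "\<mu> \<alpha> = 0" using \<mu>(2) by simp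
    qed
    ultimately show "\<exists>T. determines M d T \<and> card T \<le> N" by blast
  qed
qed

end

subsection \<open>Lifting of torus points\<close>

text \<open>\<open>u'\<close> agrees with \<open>u\<close> up to \<open>t\<^sup>k\<close>, and \<open>\<epsilon>\<close> is the logarithmic derivative of the next term.\<close>

definition loglin :: "nat \<Rightarrow> complex poly \<Rightarrow> complex poly \<Rightarrow> complex \<Rightarrow> complex \<Rightarrow> bool"
  where "loglin k u u' z \<epsilon> \<longleftrightarrow> poly u 0 = z \<and> [:0, 1:] ^ Suc k dvd u' - u - [:z * \<epsilon>:] * [:0, 1:] ^ k"

lemma t_dvd_iff: "[:0, 1:] dvd p \<longleftrightarrow> poly p 0 = (0::complex)"
  using poly_eq_0_iff_dvd[of p 0] by simp

text \<open>Logarithmic derivatives add. Here \<open>1 \<le> k\<close> makes \<open>v'\<close> agree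
  with \<open>v\<close> at 0, so the product of the two corrections falls into higher order.\<close>

lemma loglin_mult:
  assumes u: "loglin k u u' z \<epsilon>" and v: "loglin k v v' w \<delta>" and k: "1 \<le> k"
  shows "loglin k (u * v) (u' * v') (z * w) (\<epsilon> + \<delta>)"
proof -
  let ?t = "[:0, 1:] :: complex poly"
  have z: "poly u 0 = z" "poly v 0 = w" using u v by (auto simp: loglin_def)
  define X where "X = u' - u - [:z * \<epsilon>:] * ?t ^ k"
  define Y where "Y = v' - v - [:w * \<delta>:] * ?t ^ k"
  have X: "?t ^ Suc k dvd X" and Y: "?t ^ Suc k dvd Y" using u v by (auto simp: loglin_def X_def Y_def)
  have "v' = Y + v + [:w * \<delta>:] * ?t ^ k" by (simp add: Y_def)
  moreover have "?t dvd Y" using Y by (rule dvd_trans[rotated]) (simp only: power_Suc dvd_triv_left)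
  ultimately have v0: "poly v' 0 = w" using z(2) k by (auto simp: t_dvd_iff)
  define Z where "Z = [:z * \<epsilon>:] * v' + u * [:w * \<delta>:] - [:z * w * (\<epsilon> + \<delta>):]"
  have "?t dvd Z" by (simp add: t_dvd_iff Z_def z v0 algebra_simps)
  then have "?t * ?t ^ k dvd Z * ?t ^ k" by (rule mult_dvd_mono) simp
  then have Zk: "?t ^ Suc k dvd Z * ?t ^ k" by simp
  have "u' * v' - u * v - [:z * w * (\<epsilon> + \<delta>):] * ?t ^ k = X * v' + u * Y + Z * ?t ^ k"
    unfolding X_def Y_def Z_def by (simp only: algebra_simps)
  moreover have "?t ^ Suc k dvd X * v' + u * Y + Z * ?t ^ k"
    by (intro dvd_add dvd_mult2[OF X] dvd_mult[OF Y] Zk)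
  ultimately show ?thesis using z by (simp only: loglin_def poly_mult simp_thms)
qed

lemma loglin_mev:
  assumes "\<And>i. loglin k (x i) (x' i) (p i) (\<epsilon> i)" "1 \<le> k"
  shows "loglin k (mev x \<beta>) (mev x' \<beta>) (mev p \<beta>) (\<Sum>i\<in>#\<beta>. \<epsilon> i)"
proof (induction \<beta>)
  case empty
  show ?case by (simp add: loglin_def)
next
  case (add i \<beta>)
  show ?case using loglin_mult[OF assms(1)[of i] add assms(2)] by simp
qed

lemma dvd_mev_diff:
  fixes x x' :: "nat \<Rightarrow> 'a::comm_ring_1"
  assumes "\<And>i. y dvd x' i - x i"
  shows "y dvd mev x' \<beta> - mev x \<beta>"
proof (induction \<beta>)
  case (add i \<beta>)
  have "mev x' (add_mset i \<beta>) - mev x (add_mset i \<beta>) = (x' i - x i) * mev x' \<beta> + x i * (mev x' \<beta> - mev x \<beta>)"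
    by (simp add: algebra_simps)
  also have "y dvd \<dots>" by (intro dvd_add dvd_mult2[OF assms] dvd_mult[OF add])
  finally show ?case .
qed simp

text \<open>Newton iteration in t. In the logarithmic corrections \<epsilon>, the binomial i changes
  to first order by the nonzero factor \<sigma> i p^(\<beta> i) times the difference of the sums of
  \<epsilon> over \<beta> i and \<beta>' i. By \<open>solve\<close> every error can be matched in
  this way, even with coordinate 0 kept fixed.\<close>

lemma hensel_binomials:
  fixes p :: "nat \<Rightarrow> complex" and \<beta> \<beta>' :: "nat \<Rightarrow> nat multiset"
  assumes p0: "p 0 = 1" and pz: "\<And>i. p i \<noteq> 0"
    and eq: "\<And>i. i \<in> I \<Longrightarrow> mev p (\<beta> i) = mev p (\<beta>' i)"
    and \<sigma>: "\<And>i. i \<in> I \<Longrightarrow> \<sigma> i \<noteq> 0"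
    and solve: "\<And>\<rho>. \<exists>\<epsilon>. \<epsilon> 0 = (0::complex) \<and> (\<forall>i\<in>I. (\<Sum>l\<in>#\<beta> i. \<epsilon> l) - (\<Sum>l\<in>#\<beta>' i. \<epsilon> l) = \<rho> i)"
    and h: "\<And>i y x x'. (\<And>l. y dvd x' l - x l) \<Longrightarrow> y dvd h i x' - h i x"
  shows "\<exists>x. x 0 = 1 \<and> (\<forall>l. poly (x l) 0 = p l) \<and>
    (\<forall>i\<in>I. [:0, 1:] ^ Suc k dvd [:\<sigma> i:] * (mev x (\<beta> i) - mev x (\<beta>' i)) + [:0, 1:] * h i x)"
proof (induction k)
  case 0
  let ?x = "\<lambda>l. [:p l:]"
  have ev: "poly (mev ?x \<gamma>) 0 = mev p \<gamma>" for \<gamma> by (simp add: poly_mev)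
  show ?case
    by (intro exI[of _ ?x] conjI ballI allI) (auto simp: p0 one_pCons t_dvd_iff eq ev)
next
  case (Suc k)
  let ?t = "[:0, 1:] :: complex poly"
  define G where "G i x = [:\<sigma> i:] * (mev x (\<beta> i) - mev x (\<beta>' i)) + ?t * h i x" for i x
  obtain x where x: "x 0 = 1" "\<And>l. poly (x l) 0 = p l" "\<And>i. i \<in> I \<Longrightarrow> ?t ^ Suc k dvd G i x"
    using Suc unfolding G_def by blast
  have "\<forall>i. \<exists>q. i \<in> I \<longrightarrow> G i x = ?t ^ Suc k * q" using x(3) by (metis dvdE)
  from choice[OF this] obtain q where q: "\<And>i. i \<in> I \<Longrightarrow> G i x = ?t ^ Suc k * q i" by blast
  have mz: "mev p \<gamma> \<noteq> 0" for \<gamma> by (induction \<gamma>) (auto simp: pz)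
  \<comment> \<open>The lowest coefficient of the error \<open>G i x\<close> = t^(k+1)
    \<open>q i\<close> is \<open>poly (q i) 0\<close>; \<epsilon> is chosen to cancel it.\<close>
  obtain \<epsilon> where \<epsilon>: "\<epsilon> 0 = 0" "\<forall>i\<in>I. (\<Sum>l\<in>#\<beta> i. \<epsilon> l) - (\<Sum>l\<in>#\<beta>' i. \<epsilon> l) = - poly (q i) 0 / (\<sigma> i * mev p (\<beta> i))"
    using solve[of "\<lambda>i. - poly (q i) 0 / (\<sigma> i * mev p (\<beta> i))"] by blast
  define x' where "x' l = x l + [:p l * \<epsilon> l:] * ?t ^ Suc k" for l
  have ll: "loglin (Suc k) (x l) (x' l) (p l) (\<epsilon> l)" for l
    by (simp only: loglin_def x'_def x(2) add_diff_cancel_left' diff_self dvd_0_right simp_thms)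
  have xd: "?t ^ Suc k dvd x' l - x l" for l
    by (simp only: x'_def add_diff_cancel_left' dvd_triv_right)
  show ?case
  proof (intro exI[of _ x'] conjI allI ballI)
    show "x' 0 = 1" by (simp add: x'_def x(1) \<epsilon>(1))
    show "poly (x' l) 0 = p l" for l by (simp add: x'_def x(2))
    fix i assume i: "i \<in> I"
    define E E' where "E = (\<Sum>l\<in>#\<beta> i. \<epsilon> l)" and "E' = (\<Sum>l\<in>#\<beta>' i. \<epsilon> l)"
    have l1: "?t ^ Suc (Suc k) dvd mev x' (\<beta> i) - mev x (\<beta> i) - [:mev p (\<beta> i) * E:] * ?t ^ Suc k"
      "?t ^ Suc (Suc k) dvd mev x' (\<beta>' i) - mev x (\<beta>' i) - [:mev p (\<beta> i) * E':] * ?t ^ Suc k"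
    proof -
      have lm: "loglin (Suc k) (mev x \<gamma>) (mev x' \<gamma>) (mev p \<gamma>) (\<Sum>l\<in>#\<gamma>. \<epsilon> l)" for \<gamma>
        using loglin_mev[of "Suc k" x x' p \<epsilon> \<gamma>, OF ll] by simp
      show "?t ^ Suc (Suc k) dvd mev x' (\<beta> i) - mev x (\<beta> i) - [:mev p (\<beta> i) * E:] * ?t ^ Suc k"
        using lm[of "\<beta> i"] unfolding loglin_def E_def by blast
      show "?t ^ Suc (Suc k) dvd mev x' (\<beta>' i) - mev x (\<beta>' i) - [:mev p (\<beta> i) * E':] * ?t ^ Suc k"
        using lm[of "\<beta>' i"] unfolding loglin_def E'_def eq[OF i] by blast
    qed
    \<comment> \<open>The correction has order t^(k+1), so the factor t in front of \<open>h\<close>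
      pushes its effect on the perturbation one order further.\<close>
    have l2: "?t ^ Suc (Suc k) dvd ?t * (h i x' - h i x)"
    proof -
      have "?t * ?t ^ Suc k dvd ?t * (h i x' - h i x)" by (rule mult_dvd_mono[OF dvd_refl h[OF xd]])
      then show ?thesis by simp
    qed
    have "[:\<sigma> i * (mev p (\<beta> i) * (E - E')):] = [:- poly (q i) 0:]"
      using \<epsilon>(2) i \<sigma>[OF i] mz by (simp add: E_def E'_def)
    then have c: "[:\<sigma> i:] * ([:mev p (\<beta> i) * E:] - [:mev p (\<beta> i) * E':]) = [:- poly (q i) 0:]"
      by (simp add: algebra_simps)
    have l3: "?t ^ Suc (Suc k) dvd ?t ^ Suc k * (q i + [:- poly (q i) 0:])"
    proof -
      have "?t dvd q i + [:- poly (q i) 0:]" by (simp add: t_dvd_iff)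
      then have "?t * ?t ^ Suc k dvd (q i + [:- poly (q i) 0:]) * ?t ^ Suc k" by (rule mult_dvd_mono) simp
      then show ?thesis by (simp add: mult.commute)
    qed
    have "G i x' = [:\<sigma> i:] * (mev x' (\<beta> i) - mev x (\<beta> i) - [:mev p (\<beta> i) * E:] * ?t ^ Suc k)
      - [:\<sigma> i:] * (mev x' (\<beta>' i) - mev x (\<beta>' i) - [:mev p (\<beta> i) * E':] * ?t ^ Suc k)
      + ?t * (h i x' - h i x) + (G i x + [:\<sigma> i:] * ([:mev p (\<beta> i) * E:] - [:mev p (\<beta> i) * E':]) * ?t ^ Suc k)"
      unfolding G_def by (simp only: algebra_simps)
    also have "G i x + [:\<sigma> i:] * ([:mev p (\<beta> i) * E:] - [:mev p (\<beta> i) * E':]) * ?t ^ Suc k =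
      ?t ^ Suc k * (q i + [:- poly (q i) 0:])"
      unfolding c q[OF i] by (simp only: algebra_simps)
    finally have "?t ^ Suc (Suc k) dvd G i x'"
      using dvd_add[OF dvd_add[OF dvd_diff[OF dvd_mult[OF l1(1)] dvd_mult[OF l1(2)]] l2] l3] by metis
    then show "?t ^ Suc (Suc k) dvd [:\<sigma> i:] * (mev x' (\<beta> i) - mev x' (\<beta>' i)) + ?t * h i x'"
      by (simp only: G_def)
  qed
qed

text \<open>The linear systems for the logarithmic derivatives are solved by forward substitution with
  one free parameter, which the last equation determines because \<open>geom q (n + 1) \<noteq> 0\<close>.\<close>

lemma solve_first_order:
  fixes q :: complex and g :: "nat \<Rightarrow> complex"
  assumes g: "g 0 = 0" "\<And>i. g (Suc i) = 1 + q * g i" "g (Suc n) \<noteq> 0"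
  shows "\<exists>\<epsilon>. \<epsilon> 0 = 0 \<and> (\<forall>i<n. \<epsilon> (Suc i) + q * \<epsilon> n - q * \<epsilon> i = \<rho> i)"
proof -
  define a where "a = rec_nat 0 (\<lambda>i x. q * x + \<rho> i)"
  have a: "a 0 = 0" "a (Suc i) = q * a i + \<rho> i" for i by (simp_all add: a_def)
  \<comment> \<open>The value \<epsilon> n occurs in every equation. It is treated as the free
    parameter, and this \<open>s\<close> is the value for which the resulting \<epsilon> n is again
    \<open>s\<close>.\<close>
  define s where "s = a n / g (Suc n)"
  define \<epsilon> where "\<epsilon> i = a i - s * q * g i" for i
  have "\<epsilon> n = s" using g(3) by (simp add: \<epsilon>_def s_def field_simps) (simp add: g(2) field_simps)
  then have "\<epsilon> (Suc i) + q * \<epsilon> n - q * \<epsilon> i = \<rho> i" for i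
    by (simp add: \<epsilon>_def a g(2) algebra_simps)
  then show ?thesis by (intro exI[of _ \<epsilon>]) (simp add: \<epsilon>_def a g(1))
qed

lemma solve_second_order:
  fixes a b :: complex and g :: "nat \<Rightarrow> complex"
  assumes g: "g 0 = 0" "g (Suc 0) = 1" "\<And>i. g (Suc (Suc i)) = a * g i + b * g (Suc i)" "g (Suc n) \<noteq> 0"
  shows "\<exists>\<epsilon>. \<epsilon> 0 = 0 \<and> \<epsilon> (Suc n) = 0 \<and> (\<forall>i<n. a * \<epsilon> i + b * \<epsilon> (Suc i) - \<epsilon> (Suc (Suc i)) = \<rho> i)"
proof -
  define u where "u = rec_nat (0, 0) (\<lambda>i (x, y). (y, a * x + b * y - \<rho> i))"
  have u: "u 0 = (0, 0)" "u (Suc i) = (snd (u i), a * fst (u i) + b * snd (u i) - \<rho> i)" for i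
    by (simp_all add: u_def split: prod.split)
  define w where "w i = fst (u i)" for i
  have w: "w 0 = 0" "w (Suc (Suc i)) = a * w i + b * w (Suc i) - \<rho> i" for i
    by (simp_all add: w_def u)
  \<comment> \<open>Since \<open>g\<close> solves the homogeneous recurrence, subtracting this
    multiple of it enforces the boundary value 0 at \<open>Suc n\<close>.\<close>
  define s where "s = w (Suc n) / g (Suc n)"
  define \<epsilon> where "\<epsilon> i = w i - s * g i" for i
  have "\<epsilon> (Suc n) = 0" using g(4) by (simp add: \<epsilon>_def s_def)
  moreover have "a * \<epsilon> i + b * \<epsilon> (Suc i) - \<epsilon> (Suc (Suc i)) = \<rho> i" for i
    by (simp add: \<epsilon>_def w g(3) algebra_simps)
  ultimately show ?thesis by (intro exI[of _ \<epsilon>]) (simp add: \<epsilon>_def w(1) g(1))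
qed

subsection \<open>Sparse homomorphisms\<close>

text \<open>The components of \<open>e\<^sub>I = e\<^sub>i\<^sub>1 \<and> \<dots> \<and> e\<^sub>i\<^sub>a\<close>; the list \<open>I\<close> is reversed.\<close>

fun ext_basis :: "nat list \<Rightarrow> nat list \<Rightarrow> complex"
  where
    "ext_basis [] K = (if K = [] then 1 else 0)"
  | "ext_basis (j # I) K = wsum (ext_basis I) (\<lambda>i. if i = j then 1 else 0) K"

lemma alternating_ext_basis: "alternating (ext_basis I)"
proof (induction I)
  case Nil
  show ?case by (simp add: alternating_def)
next
  case (Cons j I)
  have "ext_basis (j # I) = wsum (ext_basis I) (\<lambda>i. if i = j then 1 else 0)" by (rule ext) simp
  then show ?case using alternating_wsum[OF Cons] by metis
qed

lemma ext_basis_notin: "b \<in> set K \<Longrightarrow> b \<notin> set I \<Longrightarrow> ext_basis I K = 0"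
proof (induction I arbitrary: K)
  case (Cons j I)
  have "wsum (ext_basis I) (\<lambda>i. if i = j then 1 else 0) K = 0"
  proof (rule wsum_eq_0)
    fix us a vs assume K: "K = us @ a # vs"
    show "(if a = j then 1 else 0) * ext_basis I (us @ vs) = 0"
    proof (cases "a = j")
      case True
      then have "b \<in> set (us @ vs)" "b \<notin> set I" using Cons.prems K by auto
      then show ?thesis using Cons.IH by simp
    qed simp
  qed
  then show ?case by simp
qed auto

lemma ext_basis_self: "distinct L \<Longrightarrow> ext_basis (rev L) L = 1"
proof (induction L rule: rev_induct)
  case (snoc j L)
  have "wsum (ext_basis (rev L)) (\<lambda>i. if i = j then 1 else 0) (L @ [j]) = (if j = j then 1 else 0) * ext_basis (rev L) L"
    using snoc.prems by (intro wsum_last) auto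
  then show ?case using snoc by simp
qed simp

lemma ext_basis_set_neq:
  assumes "set K \<noteq> set I" "length K = length I"
  shows "ext_basis I K = 0"
proof (cases "set K \<subseteq> set I")
  case True
  then have "card (set K) < card (set I)" using assms(1) by (intro psubset_card_mono) auto
  also have "\<dots> \<le> length K" using card_length[of I] assms(2) by simp
  finally have "\<not> distinct K" using distinct_card[of K] by auto
  then show ?thesis by (rule alternating_not_distinct[OF alternating_ext_basis])
next
  case False
  then show ?thesis using ext_basis_notin by blast
qed

lemma wsum_snoc_of_zero:
  "(\<And>K. j \<in> set K \<Longrightarrow> w K = 0) \<Longrightarrow> wsum w x (us @ [j]) = x j * w us"
  by (induction us arbitrary: w) simp_all

lemma wsum_Cons_of_zero:
  assumes "\<And>K. j \<in> set K \<Longrightarrow> w K = 0"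
  shows "wsum w x (j # us) = (-1) ^ length us * x j * w us"
  using assms by (simp add: wsum_zero_fun)

lemma wsum_ext_basis_missing:
  assumes \<iota>: "comm_ring_hom \<iota>" and "b \<in> set I" "b \<notin> set J" "length J = Suc (length I)"
  shows "wsum (\<lambda>K. \<iota> (ext_basis I K)) x J = 0"
proof (rule wsum_eq_0)
  interpret comm_ring_hom \<iota> by (rule \<iota>)
  fix us a vs assume J: "J = us @ a # vs"
  then have "set (us @ vs) \<noteq> set I" "length (us @ vs) = length I" using assms by auto
  then show "x a * \<iota> (ext_basis I (us @ vs)) = 0" using ext_basis_set_neq by simp
qed

lemma wapply_cong:
  "(\<And>K \<alpha>. set K \<subseteq> set J \<Longrightarrow> C K \<alpha> = C' K \<alpha>) \<Longrightarrow> wapply X C g J = wapply X C' g J"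
proof (induction J arbitrary: C C')
  case (Cons a J)
  have "wapply X (\<lambda>K. C (a # K)) g J = wapply X (\<lambda>K. C' (a # K)) g J"
  proof (rule Cons.IH)
    fix K \<alpha> assume "set K \<subseteq> set J"
    then show "C (a # K) \<alpha> = C' (a # K) \<alpha>" by (intro Cons.prems) auto
  qed
  moreover have "C J \<alpha> = C' J \<alpha>" for \<alpha> by (rule Cons.prems) auto
  ultimately show ?case by simp
qed simp

lemma wapply_sum:
  "finite A \<Longrightarrow> wapply X (\<lambda>K \<alpha>. \<Sum>k\<in>A. C k K \<alpha>) g J = (\<Sum>k\<in>A. wapply X (C k) g J)"
proof (induction J arbitrary: C)
  case (Cons a J)
  have "(\<Sum>\<alpha>\<in>X. (\<Sum>k\<in>A. C k J \<alpha>) * g a \<alpha>) = (\<Sum>k\<in>A. \<Sum>\<alpha>\<in>X. C k J \<alpha> * g a \<alpha>)"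
    unfolding sum_distrib_right by (rule sum.swap)
  then show ?case using Cons by (simp add: sum_distrib_left sum.distrib)
qed simp

lemma wcoeff_hom:
  assumes "comm_ring_hom \<iota>"
  shows "wcoeff (\<lambda>K \<alpha>. \<iota> (C K \<alpha>)) J \<beta> = \<iota> (wcoeff C J \<beta>)"
proof -
  interpret comm_ring_hom \<iota> by (rule assms)
  show ?thesis
  proof (induction J arbitrary: C)
    case (Cons a J)
    have "\<iota> ((-1) ^ k) = (-1) ^ k" for k :: nat by (simp add: hom_power hom_uminus)
    then show ?case using Cons by (simp add: hom_add hom_mult)
  qed simp
qed

context coords
begin

text \<open>The same product of basis vectors as a tensor on all covectors; \<open>ext_basis\<close>
  gives its values on the dual basis.\<close>

primrec ext_tensor :: "nat list \<Rightarrow> 'v tensor"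
  where
    "ext_tensor [] = (\<lambda>\<phi>s. if \<phi>s = [] then 1 else 0)"
  | "ext_tensor (j # I) = wedge scale (ext_tensor I) (e j)"

lemma multilinear_wedge:
  assumes "multilinear scale k t"
  shows "multilinear scale (Suc k) (wedge scale t v)"
  unfolding multilinear_def
proof (intro allI impI)
  fix us ws assume a: "set us \<subseteq> dual scale \<and> set ws \<subseteq> dual scale \<and> Suc (length us + length ws) = Suc k"
  then have "linear_on (dual scale) (pscale (*)) (*) (\<lambda>\<psi>. wsum t (\<lambda>\<phi>. \<phi> v) (us @ \<psi> # ws))"
    using multilinear_wsum[OF assms, of v] unfolding multilinear_def by blast
  moreover have "wedge scale t v (us @ \<psi> # ws) = wsum t (\<lambda>\<phi>. \<phi> v) (us @ \<psi> # ws)" if "\<psi> \<in> dual scale" for \<psi>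
    using a that by (intro wedge_eq_wsum) auto
  ultimately show "linear_on (dual scale) (pscale (*)) (*) (\<lambda>\<psi>. wedge scale t v (us @ \<psi> # ws))"
    using dual_add[OF vs] dual_pscale[OF vs] by (simp add: linear_on_def)
qed

lemma ext_tensor_multilinear: "multilinear scale (length I) (ext_tensor I)"
proof (induction I)
  case Nil
  show ?case by (simp add: multilinear_def)
next
  case (Cons j I)
  then show ?case by (simp add: multilinear_wedge)
qed

lemma ext_tensor_zero: "\<not> (length \<phi>s = length I \<and> set \<phi>s \<subseteq> dual scale) \<Longrightarrow> ext_tensor I \<phi>s = 0"
proof (induction I arbitrary: \<phi>s)
  case (Cons j I)
  show ?case
  proof (cases "set \<phi>s \<subseteq> dual scale")
    case True
    then have len: "length \<phi>s \<noteq> Suc (length I)" using Cons.prems by auto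
    have "wsum (ext_tensor I) (\<lambda>\<phi>. \<phi> (e j)) \<phi>s = wsum (\<lambda>_. 0) (\<lambda>\<phi>. \<phi> (e j)) \<phi>s"
    proof (rule wsum_cong)
      fix K :: "('v \<Rightarrow> complex) list" assume "Suc (length K) = length \<phi>s"
      then show "ext_tensor I K = 0" using len by (intro Cons.IH) auto
    qed simp
    then show ?thesis using True by (simp add: wedge_eq_wsum wsum_zero_fun)
  next
    case False
    then show ?thesis by (simp add: wedge_def)
  qed
qed auto

lemma ext_tensor_alternating: "alternating (ext_tensor I)"
proof (induction I)
  case Nil
  show ?case by (simp add: alternating_def)
next
  case (Cons j I)
  have alt: "alternating (wsum (ext_tensor I) (\<lambda>\<phi>. \<phi> (e j)))" by (rule alternating_wsum[OF Cons])
  show ?case unfolding alternating_def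
  proof (intro allI)
    fix us a b ws
    show "ext_tensor (j # I) (us @ a # b # ws) = - ext_tensor (j # I) (us @ b # a # ws)"
    proof (cases "set (us @ a # b # ws) \<subseteq> dual scale")
      case True
      then have "set (us @ b # a # ws) \<subseteq> dual scale" by auto
      with True show ?thesis using alternatingD[OF alt, of us a b ws] by (simp only: ext_tensor.simps wedge_eq_wsum)
    next
      case False
      then have "\<not> set (us @ b # a # ws) \<subseteq> dual scale" by auto
      with False have "ext_tensor (j # I) (us @ a # b # ws) = 0" "ext_tensor (j # I) (us @ b # a # ws) = 0"
        by (simp_all only: ext_tensor_zero simp_thms)
      then show ?thesis by simp
    qed
  qed
qed

lemma ext_tensor_map: "set I \<subseteq> {..n} \<Longrightarrow> set K \<subseteq> {..n} \<Longrightarrow> ext_tensor I (map \<phi> K) = ext_basis I K"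
proof (induction I arbitrary: K)
  case (Cons j I)
  have "ext_tensor (j # I) (map \<phi> K) = wsum (\<lambda>K. ext_tensor I (map \<phi> K)) (\<lambda>i. \<phi> i (e j)) K"
    by (simp add: wedge_eq_wsum[OF map_\<phi>_dual[OF Cons.prems(2)]] wsum_map)
  also have "\<dots> = wsum (ext_basis I) (\<lambda>i. if i = j then 1 else 0) K"
    using Cons.prems by (intro wsum_cong Cons.IH \<phi>_e) auto
  finally show ?case by simp
qed simp

text \<open>On \<open>v^m\<close> this is the sum over \<open>k\<close> of \<open>s k\<close> times
  the m-th power of the coordinate \<open>c k\<close> of \<open>v\<close> times a wedge product of
  basis vectors: evaluating a symmetric tensor on m copies of one dual basis vector extracts a pure
  power.\<close>

definition sparse_hom :: "nat \<Rightarrow> (nat \<Rightarrow> complex) \<Rightarrow> (nat \<Rightarrow> nat) \<Rightarrow> (nat \<Rightarrow> nat list) \<Rightarrow> 'v tensor \<Rightarrow> 'v tensor"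
  where "sparse_hom m s c I = (\<lambda>t. if t \<in> sym_power scale m
    then (\<lambda>\<phi>s. \<Sum>k\<le>n. s k * t (replicate m (\<phi> (c k))) * ext_tensor (I k) \<phi>s) else 0)"

lemma sparse_hom_in_Hom:
  assumes I: "\<And>k. k \<le> n \<Longrightarrow> length (I k) = a"
  shows "sparse_hom m s c I \<in> Hom_sym_ext scale m a"
proof -
  have "sparse_hom m s c I t \<in> ext_power scale a" if t: "t \<in> sym_power scale m" for t
  proof -
    let ?w = "\<lambda>\<phi>s. \<Sum>k\<le>n. s k * t (replicate m (\<phi> (c k))) * ext_tensor (I k) \<phi>s"
    have "?w \<in> ext_power scale a"
    proof (rule ext_powerI[OF vs])
      show "multilinear scale a ?w" unfolding multilinear_def
      proof (intro allI impI)
        fix us ws assume "set us \<subseteq> dual scale \<and> set ws \<subseteq> dual scale \<and> Suc (length us + length ws) = a"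
        then show "linear_on (dual scale) (pscale (*)) (*) (\<lambda>\<psi>. ?w (us @ \<psi> # ws))"
          using ext_tensor_multilinear I unfolding multilinear_def
          by (intro linear_on_sum linear_on_scale) (metis atMost_iff)
      qed
      show "alternating ?w" unfolding alternating_def
      proof (intro allI)
        fix us a b ws
        have *: "s k * t (replicate m (\<phi> (c k))) * ext_tensor (I k) (us @ a # b # ws) =
          - (s k * t (replicate m (\<phi> (c k))) * ext_tensor (I k) (us @ b # a # ws))" for k
          using alternatingD[OF ext_tensor_alternating, of "I k" us a b ws] by (simp only: mult_minus_right)
        show "?w (us @ a # b # ws) = - ?w (us @ b # a # ws)"
          unfolding sum_negf[symmetric] by (intro sum.cong refl *)
      qed
      fix \<phi>s assume z: "\<not> (length \<phi>s = a \<and> set \<phi>s \<subseteq> dual scale)"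
      show "?w \<phi>s = 0"
      proof (rule sum.neutral, rule ballI)
        fix k assume "k \<in> {..n}"
        then have "ext_tensor (I k) \<phi>s = 0" using z I[of k] by (intro ext_tensor_zero) auto
        then show "s k * t (replicate m (\<phi> (c k))) * ext_tensor (I k) \<phi>s = 0" by simp
      qed
    qed
    then show ?thesis using t by (simp add: sparse_hom_def)
  qed
  moreover have "sparse_hom m s c I (t + t') = sparse_hom m s c I t + sparse_hom m s c I t'"
    if "t \<in> sym_power scale m" "t' \<in> sym_power scale m" for t t'
    using that sym_power_add[OF that] by (simp add: sparse_hom_def fun_eq_iff algebra_simps sum.distrib)
  moreover have "sparse_hom m s c I (tscale z t) = tscale z (sparse_hom m s c I t)" if "t \<in> sym_power scale m" for z t
    using that sym_power_tscale[OF that, of z]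
    by (simp add: sparse_hom_def fun_eq_iff pscale_def sum_distrib_left mult_ac)
  moreover have "sparse_hom m s c I t = 0" if "t \<notin> sym_power scale m" for t
    using that by (simp add: sparse_hom_def)
  ultimately show ?thesis unfolding Hom_sym_ext_def linear_on_def by blast
qed

lemma msym_replicate:
  "j \<le> n \<Longrightarrow> msym e n (replicate m (\<phi> j)) \<alpha> = (if \<alpha> = replicate_mset m j then 1 else 0)"
proof (induction m arbitrary: \<alpha>)
  case (Suc m)
  have "msym e n (replicate (Suc m) (\<phi> j)) \<alpha> =
    (\<Sum>i\<le>n. if i = j then (if j \<in># \<alpha> then msym e n (replicate m (\<phi> j)) (\<alpha> - {#j#}) else 0) else 0)"
    unfolding replicate_Suc msym.simps using \<phi>_e[OF Suc.prems] by (intro sum.cong) auto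
  also have "\<dots> = (if j \<in># \<alpha> \<and> \<alpha> - {#j#} = replicate_mset m j then 1 else 0)"
    using Suc by simp
  also have "j \<in># \<alpha> \<and> \<alpha> - {#j#} = replicate_mset m j \<longleftrightarrow> \<alpha> = replicate_mset (Suc m) j"
    by (auto dest: insert_DiffM)
  finally show ?case .
qed simp

lemma hcoeff_sparse_hom:
  assumes "\<And>k. k \<le> n \<Longrightarrow> c k \<le> n \<and> set (I k) \<subseteq> {..n}" "set K \<subseteq> {..n}"
  shows "hcoeff m (sparse_hom m s c I) K \<alpha> =
    (\<Sum>k\<le>n. (if \<alpha> = replicate_mset m (c k) then s k * ext_basis (I k) K else 0))"
proof -
  have "hcoeff m (sparse_hom m s c I) K \<alpha> =
    (\<Sum>k\<le>n. s k * symtensor m \<alpha> (replicate m (\<phi> (c k))) * ext_tensor (I k) (map \<phi> K))"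
    by (simp add: hcoeff_def sparse_hom_def symtensor_sym_power)
  also have "\<dots> = (\<Sum>k\<le>n. (if \<alpha> = replicate_mset m (c k) then s k * ext_basis (I k) K else 0))"
  proof (rule sum.cong[OF refl])
    fix k assume "k \<in> {..n}"
    then have k: "c k \<le> n" "set (I k) \<subseteq> {..n}" using assms(1) by auto
    have "set (replicate m (\<phi> (c k))) \<subseteq> dual scale" using \<phi>_dual[OF k(1)] by (cases m) auto
    then show "s k * symtensor m \<alpha> (replicate m (\<phi> (c k))) * ext_tensor (I k) (map \<phi> K) =
      (if \<alpha> = replicate_mset m (c k) then s k * ext_basis (I k) K else 0)"
      using k assms(2) by (simp add: symtensor_def msym_replicate ext_tensor_map)
  qed
  finally show ?thesis .
qed

text \<open>The map \<open>g\<close> replaces evaluation of monomials and \<open>\<iota>\<close>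
  embeds the coefficients, so that one identity covers both functionals on monomials and points with
  polynomial coordinates.\<close>

lemma sparse_hom_equation:
  fixes \<iota> :: "complex \<Rightarrow> 'r::comm_ring_1"
  assumes \<iota>: "comm_ring_hom \<iota>"
    and cI: "\<And>k. k \<le> n \<Longrightarrow> c k \<le> n \<and> set (I k) \<subseteq> {..n}" and J: "set J \<subseteq> {..n}"
  shows "(\<Sum>\<beta>\<in>mons n (Suc m). \<iota> (wcoeff (hcoeff m (sparse_hom m s c I)) J \<beta>) * g \<beta>) =
    (\<Sum>k\<le>n. \<iota> (s k) * wsum (\<lambda>K. \<iota> (ext_basis (I k) K)) (\<lambda>a. g (add_mset a (replicate_mset m (c k)))) J)"
proof -
  interpret comm_ring_hom \<iota> by (rule \<iota>)
  let ?C = "\<lambda>k K \<alpha>. if \<alpha> = replicate_mset m (c k) then \<iota> (s k) * \<iota> (ext_basis (I k) K) else 0"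
  let ?g = "\<lambda>a \<alpha>. g (add_mset a \<alpha>)"
  have "(\<Sum>\<beta>\<in>mons n (Suc m). \<iota> (wcoeff (hcoeff m (sparse_hom m s c I)) J \<beta>) * g \<beta>) =
    wapply (mons n m) (\<lambda>K \<alpha>. \<iota> (hcoeff m (sparse_hom m s c I) K \<alpha>)) ?g J"
    by (simp only: wcoeff_hom[OF \<iota>, symmetric] sum_wcoeff[OF J])
  also have "\<dots> = wapply (mons n m) (\<lambda>K \<alpha>. \<Sum>k\<in>{..n}. ?C k K \<alpha>) ?g J"
  proof (rule wapply_cong)
    fix K :: "nat list" and \<alpha> assume "set K \<subseteq> set J"
    then have "set K \<subseteq> {..n}" using J by blast
    then show "\<iota> (hcoeff m (sparse_hom m s c I) K \<alpha>) = (\<Sum>k\<in>{..n}. ?C k K \<alpha>)"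
      by (simp add: hcoeff_sparse_hom[OF cI] hom_sum if_distrib[of \<iota>] hom_mult cong: if_cong)
  qed
  also have "\<dots> = (\<Sum>k\<le>n. wapply (mons n m) (?C k) ?g J)" by (rule wapply_sum) simp
  also have "\<dots> = (\<Sum>k\<le>n. \<iota> (s k) * wsum (\<lambda>K. \<iota> (ext_basis (I k) K)) (\<lambda>a. g (add_mset a (replicate_mset m (c k)))) J)"
  proof (rule sum.cong[OF refl])
    fix k assume "k \<in> {..n}"
    then have "replicate_mset m (c k) \<in> mons n m" using cI by (intro replicate_mons) auto
    then have "wapply (mons n m) (?C k) ?g J =
        wsum (\<lambda>K. \<iota> (s k) * \<iota> (ext_basis (I k) K)) (\<lambda>a. g (add_mset a (replicate_mset m (c k)))) J"
      by (intro wapply_eq_wsum) (simp add: if_distrib[of "\<lambda>x. x * _"] finite_mons cong: if_cong)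
    then show "wapply (mons n m) (?C k) ?g J =
        \<iota> (s k) * wsum (\<lambda>K. \<iota> (ext_basis (I k) K)) (\<lambda>a. g (add_mset a (replicate_mset m (c k)))) J"
      by (simp add: wsum_scale)
  qed
  finally show ?thesis .
qed

end

subsection \<open>Cyclic intervals\<close>

definition cyc :: "nat \<Rightarrow> nat \<Rightarrow> nat \<Rightarrow> nat list"
  where "cyc n k a = map (\<lambda>l. (k + l) mod (n + 1)) [1..<Suc a]"

lemma length_cyc [simp]: "length (cyc n k a) = a"
  by (simp add: cyc_def)

lemma set_cyc: "set (cyc n k a) = {(k + l) mod (n + 1) | l. 1 \<le> l \<and> l \<le> a}"
  by (auto simp: cyc_def less_Suc_eq_le)

lemma set_cyc_subset: "set (cyc n k a) \<subseteq> {..n}"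
  by (auto simp: set_cyc mod_Suc_le_divisor)

lemma mod_add_inj:
  fixes k l l' n :: nat
  assumes "l \<le> n" "l' \<le> n"
  shows "(k + l) mod (n + 1) = (k + l') mod (n + 1) \<longleftrightarrow> l = l'"
proof -
  have "l \<ge> l'" if "l \<le> n" "l' \<le> n" "(k + l') mod (n + 1) = (k + l) mod (n + 1)" for l l' :: nat
  proof (rule ccontr)
    assume "\<not> l \<ge> l'"
    then have "n + 1 dvd (k + l') - (k + l)" using that(3) by (subst (asm) mod_eq_dvd_iff_nat) auto
    then have "n + 1 dvd l' - l" by simp
    then show False using \<open>\<not> l \<ge> l'\<close> that(2) by (auto dest!: dvd_imp_le)
  qed
  then show ?thesis using assms by (metis order_antisym)
qed

lemma distinct_cyc:
  assumes "a \<le> n"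
  shows "distinct (cyc n k a)"
proof -
  have "inj_on (\<lambda>l. (k + l) mod (n + 1)) (set [1..<Suc a])"
  proof (rule inj_onI)
    fix l l' assume "l \<in> set [1..<Suc a]" "l' \<in> set [1..<Suc a]" "(k + l) mod (n + 1) = (k + l') mod (n + 1)"
    then show "l = l'" using assms mod_add_inj[of l n l' k] by auto
  qed
  then show ?thesis unfolding cyc_def distinct_map by simp
qed

lemma cyc_snoc: "cyc n k (Suc a) = cyc n k a @ [(k + Suc a) mod (n + 1)]"
  by (simp add: cyc_def)

lemma cyc_Cons: "cyc n k (Suc a) = (k + 1) mod (n + 1) # cyc n ((k + 1) mod (n + 1)) a"
proof -
  have "[1..<Suc (Suc a)] = 1 # map Suc [1..<Suc a]" by (simp add: map_Suc_upt upt_conv_Cons)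
  then have "cyc n k (Suc a) = (k + 1) mod (n + 1) # map (\<lambda>l. (k + Suc l) mod (n + 1)) [1..<Suc a]"
    unfolding cyc_def by simp
  also have "map (\<lambda>l. (k + Suc l) mod (n + 1)) [1..<Suc a] = cyc n ((k + 1) mod (n + 1)) a"
    unfolding cyc_def by (intro map_cong refl) (simp add: mod_add_left_eq)
  finally show ?thesis .
qed

lemma cyc_offset:
  assumes "a \<le> n" "l \<le> n"
  shows "(k + l) mod (n + 1) \<in> set (cyc n k a) \<longleftrightarrow> 1 \<le> l \<and> l \<le> a"
proof
  assume "(k + l) mod (n + 1) \<in> set (cyc n k a)"
  then obtain l' where "(k + l) mod (n + 1) = (k + l') mod (n + 1)" "1 \<le> l'" "l' \<le> a"
    unfolding set_cyc by blast
  then show "1 \<le> l \<and> l \<le> a" using mod_add_inj[of l n l' k] assms by auto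
qed (auto simp: set_cyc)

lemma suc_eq_iff_prd:
  fixes k l n :: nat
  assumes "k \<le> n" "l \<le> n"
  shows "(k + 1) mod (n + 1) = l \<longleftrightarrow> k = (l + n) mod (n + 1)"
proof
  assume "(k + 1) mod (n + 1) = l"
  then have "(l + n) mod (n + 1) = (k + 1 + n) mod (n + 1)" by (simp only: mod_add_left_eq flip: \<open>(k + 1) mod (n + 1) = l\<close>)
  moreover have "k + 1 + n = k + (n + 1)" by simp
  ultimately show "k = (l + n) mod (n + 1)" using assms by (simp only: mod_add_self2) simp
next
  assume "k = (l + n) mod (n + 1)"
  then have "(k + 1) mod (n + 1) = (l + n + 1) mod (n + 1)" by (simp only: mod_add_left_eq)
  then show "(k + 1) mod (n + 1) = l" using assms by (simp only: add.assoc mod_add_self2) simp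
qed

lemma set_cyc_n: "set (cyc n i n) = {..n} - {i mod (n + 1)}"
proof -
  have "set (cyc n i n) \<subseteq> {..n} - {i mod (n + 1)}"
    using set_cyc_subset cyc_offset[of n n 0 i] by auto
  moreover have "card (set (cyc n i n)) = n" using distinct_card[OF distinct_cyc[of n n i]] by simp
  moreover have "card ({..n} - {i mod (n + 1)}) = n"
    by (subst card_Diff_singleton) simp_all
  ultimately show ?thesis using card_subset_eq[of "{..n} - {i mod (n + 1)}" "set (cyc n i n)"] by simp
qed

lemma ex_offset:
  fixes k i n :: nat
  assumes "k \<le> n" "i \<le> n"
  shows "\<exists>t\<le>n. i = (k + t) mod (n + 1)"
proof (cases "k \<le> i")
  case True
  then show ?thesis using assms by (intro exI[of _ "i - k"]) simp
next
  case False
  then have "k + (i + (n + 1) - k) = i + (n + 1)" using assms by simp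
  then have "(k + (i + (n + 1) - k)) mod (n + 1) = i mod (n + 1)" by (simp only: mod_add_self2)
  then show ?thesis using False assms by (intro exI[of _ "i + (n + 1) - k"]) simp
qed

subsection \<open>General elements\<close>

lemma poly_funs_on_line:
  fixes H :: "'w::plus set"
  assumes "f \<in> poly_funs H s"
    and s: "\<forall>c. \<forall>x\<in>H. s c x \<in> H"
    and M: "M0 \<in> H" "M1 \<in> H"
  shows "\<exists>p. \<forall>t. f (s (1 - t) M0 + s t M1) = poly p t"
  using assms(1)
proof (induction f rule: poly_funs.induct)
  case (const c)
  show ?case by (intro exI[of _ "[:c:]"]) simp
next
  case (lin l)
  have "l (s (1 - t) M0 + s t M1) = (1 - t) * l M0 + t * l M1" for t
    using lin M s unfolding linear_on_def by metis
  then show ?case by (intro exI[of _ "[:l M0, l M1 - l M0:]"]) (simp add: algebra_simps)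
next
  case (add f g)
  then obtain p q where "\<forall>t. f (s (1 - t) M0 + s t M1) = poly p t" "\<forall>t. g (s (1 - t) M0 + s t M1) = poly q t" by blast
  then show ?case by (intro exI[of _ "p + q"]) simp
next
  case (mult f g)
  then obtain p q where "\<forall>t. f (s (1 - t) M0 + s t M1) = poly p t" "\<forall>t. g (s (1 - t) M0 + s t M1) = poly q t" by blast
  then show ?case by (intro exI[of _ "p * q"]) simp
qed

text \<open>For density, restrict to the line from \<open>M0\<close> to \<open>M\<close>. If
  \<open>f\<close> vanishes off the zero set of \<open>D\<close>, the product of the two
  restrictions is the zero polynomial; that of \<open>D\<close> is nonzero at \<open>M0\<close>, so
  that of \<open>f\<close> is zero.\<close>

lemma general_from_poly:
  fixes H :: "'w::plus set"
  assumes D: "D \<in> poly_funs H s" "D M0 \<noteq> 0" "M0 \<in> H"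
    and add: "\<forall>x\<in>H. \<forall>y\<in>H. x + y \<in> H" and s: "\<forall>c. \<forall>x\<in>H. s c x \<in> H"
    and s01: "\<forall>x\<in>H. \<forall>y\<in>H. s 0 x + s 1 y = y \<and> s 1 x + s 0 y = x"
    and P: "\<forall>M\<in>H. D M \<noteq> 0 \<longrightarrow> P M"
  shows "general H s P"
proof -
  define Z where "Z = {M \<in> H. \<forall>f\<in>{D}. f M = 0}"
  have "zariski_closed H s Z" unfolding zariski_closed_def Z_def using D(1) by blast
  moreover have "zariski_dense H s (H - Z)"
    unfolding zariski_dense_def
  proof (intro allI impI, elim conjE)
    fix C assume C: "zariski_closed H s C" "H - Z \<subseteq> C"
    then obtain F where F: "F \<subseteq> poly_funs H s" "C = {x \<in> H. \<forall>f\<in>F. f x = 0}"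
      unfolding zariski_closed_def by blast
    have "f M = 0" if f: "f \<in> F" and M: "M \<in> H" for f M
    proof -
      obtain p where p: "\<And>t. f (s (1 - t) M0 + s t M) = poly p t"
        using poly_funs_on_line[OF _ s D(3) M] F(1) f by blast
      obtain q where q: "\<And>t. D (s (1 - t) M0 + s t M) = poly q t"
        using poly_funs_on_line[OF D(1) s D(3) M] by blast
      have "s (1 - 0) M0 + s 0 M = M0" "s (1 - 1) M0 + s 1 M = M" using s01 D(3) M by auto
      then have "poly q 0 = D M0" "poly p 1 = f M" using p[of 1] q[of 0] by auto
      then have "q \<noteq> 0" using D(2) by auto
      have "poly (p * q) t = 0" for t
      proof (cases "poly q t = 0")
        case False
        have "s (1 - t) M0 + s t M \<in> H" using add s D(3) M by blast
        then have "s (1 - t) M0 + s t M \<in> H - Z" using False q[of t] by (simp add: Z_def)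
        then have "f (s (1 - t) M0 + s t M) = 0" using C(2) F(2) f by blast
        then show ?thesis using p[of t] by simp
      qed simp
      then have "p * q = 0" by (simp add: poly_all_0_iff_0[symmetric])
      then have "p = 0" using \<open>q \<noteq> 0\<close> by simp
      then show ?thesis using \<open>poly p 1 = f M\<close> by simp
    qed
    then show "C = H" using F(2) by blast
  qed
  moreover have "\<forall>M\<in>H - Z. P M" using P by (auto simp: Z_def)
  ultimately show ?thesis unfolding general_def by blast
qed

lemma general_all:
  assumes "\<forall>M\<in>H. P M"
  shows "general H s P"
proof -
  have "zariski_closed H s {}"
    unfolding zariski_closed_def by (intro exI[of _ "{\<lambda>_. 1}"]) (auto intro: poly_funs.const)
  moreover have "zariski_dense H s (H - {})"
    unfolding zariski_dense_def zariski_closed_def by blast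
  ultimately show ?thesis unfolding general_def using assms by blast
qed

section \<open>From zeros in coordinates to eigenpoints\<close>

context coords
begin

definition vec :: "(nat \<Rightarrow> complex) \<Rightarrow> 'v"
  where "vec x = (\<Sum>i\<le>n. scale (x i) (e i))"

lemma \<phi>_vec: "i \<le> n \<Longrightarrow> \<phi> i (vec x) = x i"
proof -
  assume i: "i \<le> n"
  have add: "\<phi> i (u + v) = \<phi> i u + \<phi> i v" and sc: "\<phi> i (scale c u) = c * \<phi> i u" for u v c
    using \<phi>_dual[OF i] by (auto simp: dual_iff[OF vs])
  have "\<phi> i 0 = 0" using add[of 0 0] by simp
  then have "\<phi> i (\<Sum>j\<in>I. f j) = (\<Sum>j\<in>I. \<phi> i (f j))" for I :: "nat set" and f
    by (induction I rule: infinite_finite_induct) (simp_all add: add)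
  then have "\<phi> i (vec x) = (\<Sum>j\<le>n. if i = j then x j else 0)"
    unfolding vec_def by (simp add: sc \<phi>_e[OF i] if_distrib[of "\<lambda>y. _ * y"] cong: if_cong)
  then show ?thesis using i by simp
qed

lemma vec_nonzero: "nonzero n x \<Longrightarrow> vec x \<noteq> 0"
proof
  assume "nonzero n x" "vec x = 0"
  then obtain i where i: "i \<le> n" "x i \<noteq> 0" by (auto simp: nonzero_def)
  have "\<phi> i (0 + 0) = \<phi> i 0 + \<phi> i 0" using \<phi>_dual[OF i(1)] unfolding dual_iff[OF vs] by blast
  then show False using \<phi>_vec[OF i(1), of x] \<open>vec x = 0\<close> i(2) by simp
qed

lemma zero_at_cong: "(\<And>i. i \<le> n \<Longrightarrow> x i = y i) \<Longrightarrow> sys.zero_at m a M x \<longleftrightarrow> sys.zero_at m a M y"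
  unfolding sys.zero_at_def using mev_cong[of _ n "Suc m" x y] by (simp cong: sum.cong)

lemma eigenvector_vec:
  assumes "M \<in> Hom_sym_ext scale m a" "nonzero n x" "sys.zero_at m a M x"
  shows "eigenvector scale m M (vec x)"
  unfolding eigenvector_iff_zero_at[OF assms(1)]
  using vec_nonzero[OF assms(2)] assms(3) zero_at_cong[of "\<lambda>i. \<phi> i (vec x)" x] \<phi>_vec by blast

lemma proj_point_vec_eq_imp:
  assumes "proj_point scale (vec x) = proj_point scale (vec y)"
  shows "\<not> nonprop n x y"
proof -
  interpret vector_space scale by (rule vs)
  have "vec x \<in> proj_point scale (vec y)" using assms span_base[of "vec x" "{vec x}"] by (simp add: proj_point_def)
  then obtain k where k: "vec x = scale k (vec y)" by (auto simp: proj_point_def span_singleton)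
  have "x i = k * y i" if "i \<le> n" for i
  proof -
    have "x i = \<phi> i (scale k (vec y))" using \<phi>_vec[OF that, of x] k by simp
    also have "\<dots> = k * y i" using \<phi>_dual[OF that] \<phi>_vec[OF that, of y] by (simp add: dual_iff[OF vs])
    finally show ?thesis .
  qed
  then show ?thesis by (auto simp: nonprop_def)
qed

lemma not_nonprop_imp_proj_point_eq:
  assumes "nonzero n x" "nonzero n y" "\<not> nonprop n x y" "\<And>i. i \<le> n \<Longrightarrow> \<phi> i v = x i"
  shows "proj_point scale v = proj_point scale (vec y)"
proof -
  interpret vector_space scale by (rule vs)
  have eq: "x i * y j = x j * y i" if "i \<le> n" "j \<le> n" for i j using assms(3) that by (auto simp: nonprop_def)
  obtain j where j: "j \<le> n" "y j \<noteq> 0" using assms(2) by (auto simp: nonzero_def)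
  define k where "k = x j / y j"
  have xk: "x i = k * y i" if "i \<le> n" for i using eq[OF that j(1)] j(2) by (simp add: k_def field_simps)
  have "k \<noteq> 0" using assms(1) xk by (auto simp: nonzero_def)
  have "v = (\<Sum>i\<le>n. scale (\<phi> i v) (e i))" by (rule expand)
  also have "\<dots> = (\<Sum>i\<le>n. scale k (scale (y i) (e i)))" using assms(4) xk by (intro sum.cong) auto
  also have "\<dots> = scale k (vec y)" by (simp add: vec_def scale_sum_right)
  finally have v: "v = scale k (vec y)" .
  have "range (\<lambda>c. scale c v) = range (\<lambda>c. scale c (vec y))"
  proof (intro equalityI subsetI)
    fix w assume "w \<in> range (\<lambda>c. scale c v)"
    then obtain c where "w = scale (c * k) (vec y)" by (auto simp: v)
    then show "w \<in> range (\<lambda>c. scale c (vec y))" by blast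
  next
    fix w assume "w \<in> range (\<lambda>c. scale c (vec y))"
    then obtain c where "w = scale (c / k) v" using \<open>k \<noteq> 0\<close> by (auto simp: v)
    then show "w \<in> range (\<lambda>c. scale c v)" by blast
  qed
  then show ?thesis by (simp add: proj_point_def span_singleton)
qed

lemma eigenpoints_card:
  assumes M: "M \<in> Hom_sym_ext scale m a" and Q: "point_set n Q" "\<forall>q\<in>Q. sys.zero_at m a M q"
    "\<forall>x. nonzero n x \<and> sys.zero_at m a M x \<longrightarrow> (\<exists>q\<in>Q. \<not> nonprop n x q)"
  shows "finite (eigenpoints scale m M) \<and> card (eigenpoints scale m M) = card Q"
proof -
  have "eigenpoints scale m M = (\<lambda>q. proj_point scale (vec q)) ` Q"
  proof (intro equalityI subsetI)
    fix l assume "l \<in> eigenpoints scale m M"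
    then obtain v where v: "l = proj_point scale v" "eigenvector scale m M v" by (auto simp: eigenpoints_def)
    let ?x = "\<lambda>i. \<phi> i v"
    have z: "v \<noteq> 0" "sys.zero_at m a M ?x" using v(2) unfolding eigenvector_iff_zero_at[OF M] by auto
    have nz: "nonzero n ?x"
    proof (rule ccontr)
      assume "\<not> nonzero n ?x"
      interpret vector_space scale by (rule vs)
      have "v = (\<Sum>i\<le>n. scale (\<phi> i v) (e i))" by (rule expand)
      also have "\<dots> = 0" using \<open>\<not> nonzero n ?x\<close> by (intro sum.neutral) (auto simp: nonzero_def)
      finally show False using z(1) by simp
    qed
    then obtain q where q: "q \<in> Q" "\<not> nonprop n ?x q" using Q(3) z(2) by blast
    have "l = proj_point scale (vec q)"
      unfolding v(1) using Q(1) q(1) by (intro not_nonprop_imp_proj_point_eq[OF nz _ q(2)]) (auto simp: point_set_def)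
    then show "l \<in> (\<lambda>q. proj_point scale (vec q)) ` Q" using q(1) by blast
  next
    fix l assume "l \<in> (\<lambda>q. proj_point scale (vec q)) ` Q"
    then obtain q where q: "q \<in> Q" "l = proj_point scale (vec q)" by blast
    then have "eigenvector scale m M (vec q)" using Q by (intro eigenvector_vec[OF M]) (auto simp: point_set_def)
    then show "l \<in> eigenpoints scale m M" using q(2) by (auto simp: eigenpoints_def)
  qed
  moreover have "inj_on (\<lambda>q. proj_point scale (vec q)) Q"
  proof (rule inj_onI, rule ccontr)
    fix p q assume pq: "p \<in> Q" "q \<in> Q" "proj_point scale (vec p) = proj_point scale (vec q)" "p \<noteq> q"
    then have "nonprop n p q" using Q(1) by (simp add: point_set_def)
    then show False using proj_point_vec_eq_imp[OF pq(3)] by blast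
  qed
  moreover have "finite Q" using Q(1) by (simp add: point_set_def)
  ultimately show ?thesis by (simp add: card_image)
qed

lemma eigenpoints_infinite:
  fixes x :: "complex \<Rightarrow> nat \<Rightarrow> complex"
  assumes M: "M \<in> Hom_sym_ext scale m a" and x: "\<And>t. nonzero n (x t)" "\<And>t. sys.zero_at m a M (x t)"
    "\<And>t t'. t \<noteq> t' \<Longrightarrow> nonprop n (x t) (x t')"
  shows "infinite (eigenpoints scale m M)"
proof
  assume fin: "finite (eigenpoints scale m M)"
  have "range (\<lambda>t. proj_point scale (vec (x t))) \<subseteq> eigenpoints scale m M"
    using eigenvector_vec[OF M x(1,2)] by (auto simp: eigenpoints_def)
  then have "finite (range (\<lambda>t. proj_point scale (vec (x t))))" by (rule finite_subset[OF _ fin])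
  moreover have "inj (\<lambda>t. proj_point scale (vec (x t)))"
    using x(3) proj_point_vec_eq_imp by (auto intro!: injI)
  ultimately have "finite (UNIV :: complex set)" by (rule finite_imageD)
  then show False using infinite_UNIV_char_0 by blast
qed

lemma ext_power_add_scale:
  assumes "t \<in> ext_power scale k" "t' \<in> ext_power scale k"
  shows "t + t' \<in> ext_power scale k" "tscale z t \<in> ext_power scale k"
proof -
  have *: "\<forall>\<phi>s. \<not> (length \<phi>s = k \<and> set \<phi>s \<subseteq> dual scale) \<longrightarrow> u \<phi>s = 0" "multilinear scale k u"
    "\<forall>\<phi>s. \<not> distinct \<phi>s \<longrightarrow> u \<phi>s = 0" if "u \<in> ext_power scale k" for u
    using that tensor_power_iff[OF vs, of u k] unfolding ext_power_def by blast+
  have "multilinear scale k (t + t')" "multilinear scale k (tscale z t)"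
    using *(2)[OF assms(1)] *(2)[OF assms(2)] linear_on_scale[of "dual scale" "pscale (*)" _ z]
    by (simp_all add: multilinear_def linear_on_add pscale_def[of _ z])
  then show "t + t' \<in> ext_power scale k" "tscale z t \<in> ext_power scale k"
    using *(1,3)[OF assms(1)] *(1,3)[OF assms(2)]
    by (simp_all add: ext_power_def tensor_power_iff[OF vs] pscale_def)
qed

lemma general_Hom_from_poly:
  assumes D: "D \<in> poly_funs (Hom_sym_ext scale m a) (pscale tscale)" "D M0 \<noteq> 0" "M0 \<in> Hom_sym_ext scale m a"
    and P: "\<forall>M\<in>Hom_sym_ext scale m a. D M \<noteq> 0 \<longrightarrow> P M"
  shows "general_Hom scale m a P"
proof (rule general_from_poly[OF D _ _ _ P])
  let ?H = "Hom_sym_ext scale m a"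
  have HD: "M t \<in> ext_power scale a" "M (t + t') = M t + M t'" "M (tscale z t) = tscale z (M t)"
    if "M \<in> ?H" "t \<in> sym_power scale m" "t' \<in> sym_power scale m" for M t t' z
    using that unfolding Hom_sym_ext_def linear_on_def by blast+
  have H0: "M t = 0" if "M \<in> ?H" "t \<notin> sym_power scale m" for M t
    using that unfolding Hom_sym_ext_def by blast
  have HI: "M \<in> ?H" if "\<And>t. t \<in> sym_power scale m \<Longrightarrow> M t \<in> ext_power scale a"
    "\<And>t t'. t \<in> sym_power scale m \<Longrightarrow> t' \<in> sym_power scale m \<Longrightarrow> M (t + t') = M t + M t'"
    "\<And>t z. t \<in> sym_power scale m \<Longrightarrow> M (tscale z t) = tscale z (M t)"
    "\<And>t. t \<notin> sym_power scale m \<Longrightarrow> M t = 0" for M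
    using that unfolding Hom_sym_ext_def linear_on_def by blast
  show "\<forall>x\<in>?H. \<forall>y\<in>?H. x + y \<in> ?H"
  proof (intro ballI)
    fix x y assume xy: "x \<in> ?H" "y \<in> ?H"
    show "x + y \<in> ?H"
    proof (rule HI)
      fix t assume t: "t \<in> sym_power scale m"
      show "(x + y) t \<in> ext_power scale a"
        unfolding plus_fun_apply[of x y] by (rule ext_power_add_scale(1)[OF HD(1)[OF xy(1) t t] HD(1)[OF xy(2) t t]])
      show "(x + y) (tscale z t) = tscale z ((x + y) t)" for z
        unfolding plus_fun_apply[of x y] HD(3)[OF xy(1) t t] HD(3)[OF xy(2) t t] by (simp add: pscale_def fun_eq_iff distrib_left)
      fix t' assume t': "t' \<in> sym_power scale m"
      show "(x + y) (t + t') = (x + y) t + (x + y) t'"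
        unfolding plus_fun_apply[of x y] HD(2)[OF xy(1) t t'] HD(2)[OF xy(2) t t'] by (simp add: fun_eq_iff)
    next
      fix t assume t: "t \<notin> sym_power scale m"
      show "(x + y) t = 0" unfolding plus_fun_apply[of x y] H0[OF xy(1) t] H0[OF xy(2) t] by (rule add_0)
    qed
  qed
  show "\<forall>c. \<forall>x\<in>?H. pscale tscale c x \<in> ?H"
  proof (intro allI ballI)
    fix c x assume x: "x \<in> ?H"
    show "pscale tscale c x \<in> ?H"
    proof (rule HI)
      fix t assume t: "t \<in> sym_power scale m"
      show "pscale tscale c x t \<in> ext_power scale a"
        unfolding pscale_def[of tscale] by (rule ext_power_add_scale(2)[OF HD(1)[OF x t t] HD(1)[OF x t t]])
      show "pscale tscale c x (tscale z t) = tscale z (pscale tscale c x t)" for z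
        unfolding pscale_def[of tscale] HD(3)[OF x t t] by (simp add: pscale_def fun_eq_iff)
      fix t' assume t': "t' \<in> sym_power scale m"
      show "pscale tscale c x (t + t') = pscale tscale c x t + pscale tscale c x t'"
        unfolding pscale_def[of tscale] HD(2)[OF x t t'] by (simp add: pscale_def fun_eq_iff distrib_left)
    next
      fix t assume t: "t \<notin> sym_power scale m"
      show "pscale tscale c x t = 0"
        unfolding pscale_def[of tscale] H0[OF x t] by (simp add: pscale_def fun_eq_iff)
    qed
  qed
  show "\<forall>x\<in>?H. \<forall>y\<in>?H. pscale tscale 0 x + pscale tscale 1 y = y \<and> pscale tscale 1 x + pscale tscale 0 y = x"
    by (simp add: pscale_def fun_eq_iff)
qed

lemma general_count:
  assumes M0: "M0 \<in> Hom_sym_ext scale m a" and P: "point_set n P" "card P = N"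
    and lifts: "\<forall>M\<in>Hom_sym_ext scale m a. \<forall>p\<in>P. sys.lifts m a M0 M p"
    and det: "\<exists>d0. \<forall>d\<ge>d0. \<exists>T. sys.determines m a M0 d T \<and> card T \<le> N"
  shows "general_Hom scale m a (\<lambda>M. finite (eigenpoints scale m M) \<and> card (eigenpoints scale m M) = N)"
proof -
  obtain d0 where d0: "\<forall>d\<ge>d0. \<exists>T. sys.determines m a M0 d T \<and> card T \<le> N" using det by blast
  obtain D where D: "D \<in> poly_funs (Hom_sym_ext scale m a) (pscale tscale)" "D M0 \<noteq> 0"
    "\<forall>M\<in>Hom_sym_ext scale m a. D M \<noteq> 0 \<longrightarrow>
    (\<exists>Q. point_set n Q \<and> card Q = N \<and> (\<forall>q\<in>Q. sys.zero_at m a M q) \<and>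
      (\<forall>x. nonzero n x \<and> sys.zero_at m a M x \<longrightarrow> (\<exists>q\<in>Q. \<not> nonprop n x q)))"
    using sys.generic_zero_count[OF M0 P lifts d0] by blast
  show ?thesis
  proof (rule general_Hom_from_poly[OF D(1,2) M0], intro ballI impI)
    fix M assume M: "M \<in> Hom_sym_ext scale m a" "D M \<noteq> 0"
    then obtain Q where Q: "point_set n Q" "card Q = N" "\<forall>q\<in>Q. sys.zero_at m a M q"
      "\<forall>x. nonzero n x \<and> sys.zero_at m a M x \<longrightarrow> (\<exists>q\<in>Q. \<not> nonprop n x q)" using D(3) by blast
    show "finite (eigenpoints scale m M) \<and> card (eigenpoints scale m M) = N"
      using eigenpoints_card[OF M(1) Q(1,3,4)] Q(2) by simp
  qed
qed

lemma zero_at_iff_wsum: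
  "sys.zero_at m a M x \<longleftrightarrow> (\<forall>J\<in>eqs a. wsum (\<lambda>K. \<Sum>\<alpha>\<in>mons n m. hcoeff m M K \<alpha> * mev x \<alpha>) x J = 0)"
proof -
  have "(\<Sum>\<beta>\<in>mons n (Suc m). wcoeff (hcoeff m M) J \<beta> * mev x \<beta>) =
      wsum (\<lambda>K. \<Sum>\<alpha>\<in>mons n m. hcoeff m M K \<alpha> * mev x \<alpha>) x J" if "J \<in> eqs a" for J
    using that by (intro sum_wcoeff_mev) (simp add: eqs_def)
  then show ?thesis unfolding sys.zero_at_def by simp
qed

lemma alternating_hcoeff_sum:
  assumes "M \<in> Hom_sym_ext scale m a"
  shows "alternating (\<lambda>K. \<Sum>\<alpha>\<in>mons n m. hcoeff m M K \<alpha> * mev x \<alpha>)"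
  unfolding alternating_def
proof (intro allI)
  fix us i j ws
  show "(\<Sum>\<alpha>\<in>mons n m. hcoeff m M (us @ i # j # ws) \<alpha> * mev x \<alpha>) =
      - (\<Sum>\<alpha>\<in>mons n m. hcoeff m M (us @ j # i # ws) \<alpha> * mev x \<alpha>)"
    unfolding sum_negf[symmetric]
    by (intro sum.cong refl) (simp only: hcoeff_alternating[OF assms, of us i j ws] mult_minus_left)
qed

text \<open>A list of n + 2 indices out of n + 1 repeats one of them, and alternating functions
  vanish there.\<close>

lemma zero_at_top:
  assumes "M \<in> Hom_sym_ext scale m (n + 1)"
  shows "sys.zero_at m (n + 1) M x"
  unfolding zero_at_iff_wsum
proof
  fix J assume J: "J \<in> eqs (n + 1)"
  have "card (set J) \<le> card {..n}" using J by (intro card_mono) (auto simp: eqs_def)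
  then have "\<not> distinct J" using J distinct_card[of J] by (auto simp: eqs_def)
  then show "wsum (\<lambda>K. \<Sum>\<alpha>\<in>mons n m. hcoeff m M K \<alpha> * mev x \<alpha>) x J = 0"
    by (rule alternating_not_distinct[OF alternating_wsum[OF alternating_hcoeff_sum[OF assms]]])
qed

text \<open>Every nonzero vector is an eigenvector; the points (1 : t : ... : t) already form an
  infinite family.\<close>

lemma infinite_top:
  assumes "1 \<le> n" "M \<in> Hom_sym_ext scale m (n + 1)"
  shows "infinite (eigenpoints scale m M)"
proof (rule eigenpoints_infinite[OF assms(2), where x = "\<lambda>t i. if i = 0 then 1 else t"])
  show "nonzero n (\<lambda>i. if i = 0 then 1 else t)" for t by (auto simp: nonzero_def)
  show "nonprop n (\<lambda>i. if i = 0 then 1 else t) (\<lambda>i. if i = 0 then 1 else t')" if "t \<noteq> t'" for t t'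
    unfolding nonprop_def using assms(1) that by (intro exI[of _ 0] conjI exI[of _ 1]) auto
qed (rule zero_at_top[OF assms(2)])

text \<open>The eigenpoints form the hypersurface of a single form \<open>f\<close> of degree m. Its
  points are produced on infinitely many parallel lines, each of which meets it by the fundamental
  theorem of algebra.\<close>

lemma infinite_bottom:
  assumes n: "1 < n" and m: "1 \<le> m" and M: "M \<in> Hom_sym_ext scale m 0"
  shows "infinite (eigenpoints scale m M)"
proof -
  define f where "f x = (\<Sum>\<alpha>\<in>mons n m. hcoeff m M [] \<alpha> * mev x \<alpha>)" for x
  have zero: "sys.zero_at m 0 M x" if "f x = 0" for x
    unfolding zero_at_iff_wsum
  proof
    fix J assume "J \<in> eqs 0"
    then obtain j where "J = [j]" by (auto simp: eqs_def length_Suc_conv)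
    then show "wsum (\<lambda>K. \<Sum>\<alpha>\<in>mons n m. hcoeff m M K \<alpha> * mev x \<alpha>) x J = 0"
      using that by (simp add: f_def)
  qed
  \<comment> \<open>If \<open>f b \<noteq> 0\<close>, this value is the coefficient of z^m in the
    restriction of \<open>f\<close> to any line in direction \<open>b\<close>, so the restriction is
    not constant and has a root.\<close>
  have "\<exists>b. nonzero n b \<and> (\<forall>u. \<exists>z. f (\<lambda>i. u i + z * b i) = 0)"
  proof (cases "\<exists>b. f b \<noteq> 0")
    case False
    then show ?thesis by (intro exI[of _ "\<lambda>_. 1"]) (auto simp: nonzero_def)
  next
    case True
    then obtain b where b: "f b \<noteq> 0" by blast
    have "nonzero n b"
    proof (rule ccontr)
      assume nz: "\<not> nonzero n b"
      have "mev b \<alpha> = 0" if \<alpha>: "\<alpha> \<in> mons n m" for \<alpha>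
      proof -
        obtain m' where "m = Suc m'" using m by (cases m) auto
        then obtain i \<beta> where "i \<le> n" "\<alpha> = add_mset i \<beta>" using mons_Suc \<alpha> by blast
        then show ?thesis using nz by (auto simp: nonzero_def)
      qed
      then show False using b by (simp add: f_def)
    qed
    moreover have "\<exists>z. f (\<lambda>i. u i + z * b i) = 0" for u
    proof -
      define p where "p = (\<Sum>\<alpha>\<in>mons n m. [:hcoeff m M [] \<alpha>:] * mev (\<lambda>i. [:u i, b i:]) \<alpha>)"
      have poly_p: "poly p z = f (\<lambda>i. u i + z * b i)" for z
        by (simp add: p_def f_def poly_sum poly_mev mult.commute)
      have lead: "degree (mev (\<lambda>i. [:u i, b i:]) \<alpha>) \<le> size \<alpha> \<and> coeff (mev (\<lambda>i. [:u i, b i:]) \<alpha>) (size \<alpha>) = mev b \<alpha>" for \<alpha>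
      proof (induction \<alpha>)
        case (add i \<alpha>)
        let ?q = "mev (\<lambda>i. [:u i, b i:]) \<alpha>"
        have "degree ([:u i, b i:] * ?q) \<le> degree [:u i, b i:] + degree ?q" by (rule degree_mult_le)
        also have "\<dots> \<le> Suc (size \<alpha>)" using add degree_pCons_le[of "u i" "[:b i:]"] by simp
        finally have "degree ([:u i, b i:] * ?q) \<le> Suc (size \<alpha>)" .
        moreover have "coeff ?q (Suc (size \<alpha>)) = 0" using add by (intro coeff_eq_0) simp
        ultimately show ?case using add by simp
      qed simp
      have "coeff p m = f b"
        unfolding p_def f_def coeff_sum
      proof (rule sum.cong[OF refl])
        fix \<alpha> assume "\<alpha> \<in> mons n m"
        then have "size \<alpha> = m" by (simp add: mons_def)
        then show "coeff ([:hcoeff m M [] \<alpha>:] * mev (\<lambda>i. [:u i, b i:]) \<alpha>) m = hcoeff m M [] \<alpha> * mev b \<alpha>"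
          using lead[of \<alpha>] by simp
      qed
      then have "m \<le> degree p" using b by (intro le_degree) simp
      then have "\<not> constant (poly p)" using m by (simp add: constant_degree)
      then obtain z where "poly p z = 0" using fundamental_theorem_of_algebra by blast
      then show ?thesis using poly_p by auto
    qed
    ultimately show ?thesis by blast
  qed
  then obtain b where b: "nonzero n b" "\<forall>u. \<exists>z. f (\<lambda>i. u i + z * b i) = 0" by blast
  obtain j where j: "j \<le> n" "b j \<noteq> 0" using b(1) by (auto simp: nonzero_def)
  \<comment> \<open>From \<open>1 < n\<close> there are two indices besides \<open>j\<close>. The
    plane they span does not contain \<open>b\<close>, so adding multiples of \<open>b\<close>
    cannot identify the points \<open>u t\<close>.\<close>
  obtain i k where ik: "i \<le> n" "k \<le> n" "i \<noteq> k" "i \<noteq> j" "k \<noteq> j"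
  proof -
    have "card ({..2} - {j}) \<ge> 2" by (cases "j \<le> 2") (auto simp: card_Diff_singleton_if)
    then obtain S where "S \<subseteq> {..2} - {j}" "card S = 2" by (meson obtain_subset_with_card_n)
    then obtain i k where "S = {i, k}" "i \<noteq> k" by (auto simp: card_2_iff)
    then show thesis using that[of i k] \<open>S \<subseteq> {..2} - {j}\<close> n by auto
  qed
  define u where "u t l = (if l = i then 1 else if l = k then t else 0)" for t :: complex and l
  from b(2) have "\<forall>t. \<exists>z. f (\<lambda>l. u t l + z * b l) = 0" by blast
  from choice[OF this] obtain z where z: "\<And>t. f (\<lambda>l. u t l + z t * b l) = 0" by blast
  define x where "x t l = u t l + z t * b l" for t l
  \<comment> \<open>\<open>L r\<close> vanishes at \<open>b\<close> and hence ignores the unknown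
    multiple \<open>z t\<close> of \<open>b\<close> in \<open>x t\<close>.\<close>
  define L where "L r l = (if l = r then b j else 0) - (if l = j then b r else 0)" for r l
  have L: "linform n (L r) y = b j * y r - b r * y j" if "r \<le> n" for r y
    using that j(1) by (simp add: linform_def L_def left_diff_distrib sum_subtractf if_distrib[of "\<lambda>v. v * _"] cong: if_cong)
  have Li: "linform n (L i) (x t) = b j" and Lk: "linform n (L k) (x t) = b j * t" for t
    using ik by (simp_all add: L x_def u_def algebra_simps)
  show ?thesis
  proof (rule eigenpoints_infinite[OF M, where x = x])
    show "nonzero n (x t)" for t
    proof (rule ccontr)
      assume "\<not> nonzero n (x t)"
      then have "linform n (L i) (x t) = 0" by (simp add: linform_def nonzero_def)
      then show False using Li j(2) by simp
    qed
    show "sys.zero_at m 0 M (x t)" for t using zero z by (simp add: x_def[abs_def])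
    show "nonprop n (x t) (x t')" if "t \<noteq> t'" for t t'
      by (rule nonpropI_linform[of n "L i" _ "L k"]) (use that j(2) in \<open>simp add: Li Lk\<close>)
  qed
qed

end

subsection \<open>Systems of binomials\<close>

lemma comm_ring_hom_const_poly: "comm_ring_hom (\<lambda>c :: complex. [:c:])"
  by unfold_locales (simp_all add: one_pCons)

lemma comm_ring_hom_self: "comm_ring_hom (\<lambda>c :: complex. c)"
  by unfold_locales simp_all

text \<open>The N-th root of unity z is the value of x_1/x_0. Coordinate 0 of each point is 1 and
  coordinate 1 is z, so distinct roots give distinct points; closing the cycle needs exactly the
  N-th power of z to be 1.\<close>

lemma unity_points:
  fixes q :: int and n N :: nat
  assumes n: "1 \<le> n" and N: "int N = \<bar>geom q (n + 1)\<bar>" "0 < N"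
  defines "P \<equiv> (\<lambda>z l. z powi geom q l :: complex) ` {z. z ^ N = 1}"
  shows "point_set n P" "card P = N"
    "p \<in> P \<Longrightarrow> \<exists>z. z \<noteq> 0 \<and> z powi geom q (n + 1) = 1 \<and> p = (\<lambda>l. z powi geom q l)"
proof -
  let ?U = "{z :: complex. z ^ N = 1}"
  let ?f = "\<lambda>z l. z powi geom q l :: complex"
  have inj: "inj_on ?f ?U"
  proof (rule inj_onI)
    fix z z' assume "?f z = ?f z'"
    then have "?f z 1 = ?f z' 1" by (rule fun_cong)
    then show "z = z'" by simp
  qed
  have card: "card ?U = N" using N(2) by (intro card_roots_unity_eq) simp
  then show "card P = N" unfolding P_def by (simp add: card_image[OF inj])
  have fin: "finite P" using \<open>card P = N\<close> N(2) card.infinite by fastforce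
  have z0: "f 0 = 1" if "f \<in> P" for f using that by (auto simp: P_def)
  show "point_set n P" unfolding point_set_def
  proof (intro conjI ballI impI)
    show "nonzero n f" if "f \<in> P" for f using z0[OF that] by (auto simp: nonzero_def intro!: exI[of _ 0])
    fix f f' assume ff: "f \<in> P" "f' \<in> P" "f \<noteq> f'"
    then obtain z z' where z: "f = ?f z" "f' = ?f z'" by (auto simp: P_def)
    then have "z \<noteq> z'" using ff(3) by auto
    then have "f 0 * f' 1 \<noteq> f 1 * f' 0" by (simp add: z)
    then show "nonprop n f f'" unfolding nonprop_def using n by blast
  qed (rule fin)
  assume "p \<in> P"
  then obtain z where z: "z ^ N = 1" "p = ?f z" by (auto simp: P_def)
  have "z \<noteq> 0" using z(1) N(2) by (auto simp: power_0_left)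
  moreover have "z powi int N = 1" using z(1) by simp
  then have "z powi geom q (n + 1) = 1"
    using N(1) by (cases "geom q (n + 1) \<ge> 0") (auto simp: power_int_minus)
  ultimately show "\<exists>z. z \<noteq> 0 \<and> z powi geom q (n + 1) = 1 \<and> p = (\<lambda>l. z powi geom q l)" using z(2) by blast
qed

context coords
begin

text \<open>The equation \<open>J\<close> of \<open>M\<close> is \<sigma> times a difference of two
  monomials. An arbitrary \<open>g\<close> replaces the monomials, so the same fact applies to
  functionals and to points with polynomial coordinates.\<close>

definition binomial_row :: "nat \<Rightarrow> ('v tensor \<Rightarrow> 'v tensor) \<Rightarrow> nat list \<Rightarrow> complex \<Rightarrow> nat multiset \<Rightarrow> nat multiset \<Rightarrow> bool"
  where "binomial_row m M J \<sigma> \<beta> \<beta>' \<longleftrightarrow> \<sigma> \<noteq> 0 \<and> \<beta> \<in> mons n (Suc m) \<and> \<beta>' \<in> mons n (Suc m) \<and>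
    (\<forall>g :: nat multiset \<Rightarrow> complex poly.
      (\<Sum>\<gamma>\<in>mons n (Suc m). [:wcoeff (hcoeff m M) J \<gamma>:] * g \<gamma>) = [:\<sigma>:] * (g \<beta> - g \<beta>'))"

lemma binomial_row_equiv:
  assumes J: "J \<in> eqs a" and row: "binomial_row m M J \<sigma> \<beta> \<beta>'"
  shows "sys.equiv_mon m a M \<beta> \<beta>'"
proof -
  have mons: "\<beta> \<in> mons n (Suc m)" "\<beta>' \<in> mons n (Suc m)" and \<sigma>: "\<sigma> \<noteq> 0" using row by (auto simp: binomial_row_def)
  have "\<mu> \<beta> = \<mu> \<beta>'" if \<mu>: "\<mu> \<in> sys.ann m a M (Suc m)" for \<mu>
  proof -
    have "{#} \<in> mons n 0" by (simp add: mons_def)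
    then have "(\<Sum>\<gamma>\<in>mons n (Suc m). wcoeff (hcoeff m M) J \<gamma> * \<mu> (\<gamma> + {#})) = 0"
      using \<mu> J unfolding sys.ann_def by fastforce
    moreover have "(\<Sum>\<gamma>\<in>mons n (Suc m). [:wcoeff (hcoeff m M) J \<gamma>:] * [:\<mu> \<gamma>:]) = [:\<sigma>:] * ([:\<mu> \<beta>:] - [:\<mu> \<beta>':])"
      using row[unfolded binomial_row_def, THEN conjunct2, THEN conjunct2, THEN conjunct2, rule_format, of "\<lambda>\<gamma>. [:\<mu> \<gamma>:]"] .
    then have "poly (\<Sum>\<gamma>\<in>mons n (Suc m). [:wcoeff (hcoeff m M) J \<gamma>:] * [:\<mu> \<gamma>:]) 0 = poly ([:\<sigma>:] * ([:\<mu> \<beta>:] - [:\<mu> \<beta>':])) 0"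
      by (rule arg_cong)
    then have "(\<Sum>\<gamma>\<in>mons n (Suc m). wcoeff (hcoeff m M) J \<gamma> * \<mu> \<gamma>) = \<sigma> * (\<mu> \<beta> - \<mu> \<beta>')"
      by (simp add: poly_sum mult.commute)
    ultimately show ?thesis using \<sigma> by simp
  qed
  then show ?thesis using mons by (simp add: sys.equiv_mon_def mons_def)
qed

text \<open>The binomials for the index lists \<open>J i\<close> can be lifted, and the remaining equations follow modulo
  every power of \<open>t\<close>: those with \<open>0 \<in> set J'\<close> by \<open>propagate\<close>, the others from \<open>(w \<and> x) \<and> x = 0\<close> and \<open>x 0 = 1\<close>.\<close>

lemma lifts_from_rows:
  fixes J :: "nat \<Rightarrow> nat list"
  assumes M: "M0 \<in> Hom_sym_ext scale m a" "M \<in> Hom_sym_ext scale m a"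
    and p: "p 0 = 1" "\<And>i. p i \<noteq> 0"
    and J: "\<And>i. i \<in> I \<Longrightarrow> J i \<in> eqs a"
    and row: "\<And>i. i \<in> I \<Longrightarrow> binomial_row m M0 (J i) (\<sigma> i) (\<beta> i) (\<beta>' i)"
    and peq: "\<And>i. i \<in> I \<Longrightarrow> mev p (\<beta> i) = mev p (\<beta>' i)"
    and solve: "\<And>\<rho>. \<exists>\<epsilon>. \<epsilon> 0 = (0::complex) \<and> (\<forall>i\<in>I. (\<Sum>l\<in>#\<beta> i. \<epsilon> l) - (\<Sum>l\<in>#\<beta>' i. \<epsilon> l) = \<rho> i)"
    and propagate: "\<And>(W :: nat list \<Rightarrow> complex poly) y J'. alternating W \<Longrightarrow> \<forall>i\<in>I. y dvd W (J i) \<Longrightarrow>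
      J' \<in> eqs a \<Longrightarrow> 0 \<in> set J' \<Longrightarrow> y dvd W J'"
  shows "sys.lifts m a M0 M p"
  unfolding sys.lifts_def
proof
  fix k
  let ?C = "hcoeff m M0" and ?C' = "hcoeff m M"
  \<comment> \<open>Along the line from \<open>M0\<close> to \<open>M\<close> the equation
    \<open>J i\<close> is its binomial plus t times this difference of forms.\<close>
  define h where "h i x = (\<Sum>\<gamma>\<in>mons n (Suc m). [:wcoeff ?C' (J i) \<gamma> - wcoeff ?C (J i) \<gamma>:] * mev x \<gamma>)"
    for i and x :: "nat \<Rightarrow> complex poly"
  have hd: "y dvd h i x' - h i x" if "\<And>l. y dvd x' l - x l" for i y x x'
    unfolding h_def sum_subtractf[symmetric] right_diff_distrib[symmetric]
    by (intro dvd_sum dvd_mult dvd_mev_diff that)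
  have \<sigma>: "\<sigma> i \<noteq> 0" if "i \<in> I" for i using row[OF that] by (simp add: binomial_row_def)
  obtain x where x: "x 0 = 1" "\<forall>l. poly (x l) 0 = p l"
    "\<forall>i\<in>I. [:0, 1:] ^ Suc k dvd [:\<sigma> i:] * (mev x (\<beta> i) - mev x (\<beta>' i)) + [:0, 1:] * h i x"
    using hensel_binomials[of p I \<beta> \<beta>' \<sigma> h k, OF p peq \<sigma> solve hd] by blast
  define w where "w K = (\<Sum>\<alpha>\<in>mons n m. [:?C K \<alpha>, ?C' K \<alpha> - ?C K \<alpha>:] * mev x \<alpha>)" for K
  define W where "W = wsum w x"
  have eqW: "(\<Sum>\<gamma>\<in>mons n (Suc m). [:wcoeff ?C J' \<gamma>, wcoeff ?C' J' \<gamma> - wcoeff ?C J' \<gamma>:] * mev x \<gamma>) = W J'"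
    if "J' \<in> eqs a" for J'
    using that sum_wcoeff_mev[of J' n "\<lambda>K \<alpha>. [:?C K \<alpha>, ?C' K \<alpha> - ?C K \<alpha>:]" x m]
    unfolding wcoeff_pCons W_def w_def[abs_def] by (simp add: eqs_def)
  have "alternating w" unfolding alternating_def
  proof (intro allI)
    fix us i j vs
    show "w (us @ i # j # vs) = - w (us @ j # i # vs)" unfolding w_def sum_negf[symmetric]
    proof (rule sum.cong[OF refl])
      fix \<alpha>
      have "[:- c, - c' - - c:] * y = - ([:c, c' - c:] * y)" for c c' :: complex and y
      proof -
        have "[:- c, - c' - - c:] = - [:c, c' - c:]" by simp
        then show ?thesis by (simp only: mult_minus_left)
      qed
      then show "[:?C (us @ i # j # vs) \<alpha>, ?C' (us @ i # j # vs) \<alpha> - ?C (us @ i # j # vs) \<alpha>:] * mev x \<alpha> =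
        - ([:?C (us @ j # i # vs) \<alpha>, ?C' (us @ j # i # vs) \<alpha> - ?C (us @ j # i # vs) \<alpha>:] * mev x \<alpha>)"
        unfolding hcoeff_alternating[OF M(1), of us i j vs \<alpha>] hcoeff_alternating[OF M(2), of us i j vs \<alpha>] .
    qed
  qed
  then have alt: "alternating W" unfolding W_def by (rule alternating_wsum)
  have "[:0, 1:] ^ Suc k dvd W (J i)" if i: "i \<in> I" for i
  proof -
    have "W (J i) = (\<Sum>\<gamma>\<in>mons n (Suc m). [:wcoeff ?C (J i) \<gamma>:] * mev x \<gamma> +
        [:0, 1:] * ([:wcoeff ?C' (J i) \<gamma> - wcoeff ?C (J i) \<gamma>:] * mev x \<gamma>))"
      unfolding eqW[OF J[OF i], symmetric] by (intro sum.cong refl) (simp add: algebra_simps)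
    also have "\<dots> = [:\<sigma> i:] * (mev x (\<beta> i) - mev x (\<beta>' i)) + [:0, 1:] * h i x"
      using row[OF i] unfolding binomial_row_def h_def sum_distrib_left sum.distrib by auto
    finally show ?thesis using x(3) i by simp
  qed
  then have W0: "[:0, 1:] ^ Suc k dvd W J'" if "J' \<in> eqs a" "0 \<in> set J'" for J'
    using propagate[OF alt _ that] by blast
  have "[:0, 1:] ^ Suc k dvd W J'" if J': "J' \<in> eqs a" for J'
  proof -
    have rest: "[:0, 1:] ^ Suc k dvd wsum (\<lambda>K. W (0 # K)) x J'"
      using J' by (intro wsum_dvd W0) (auto simp: eqs_def)
    have "wsum W x (0 # J') = 0" unfolding W_def by (rule wsum_wsum)
    then have "(-1) ^ length J' * W J' = - wsum (\<lambda>K. W (0 # K)) x J'" by (simp add: x(1) add_eq_0_iff2)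
    then have "[:0, 1:] ^ Suc k dvd (-1) ^ length J' * W J'" using rest by simp
    then have "[:0, 1:] ^ Suc k dvd (-1) ^ length J' * ((-1) ^ length J' * W J')" by (rule dvd_mult)
    then show ?thesis by (simp add: mult.assoc[symmetric] power_mult_distrib[symmetric])
  qed
  then have "[:0, 1:] ^ k dvd W J'" if "J' \<in> eqs a" for J'
    using that by (meson dvd_trans le_imp_power_dvd le_SucI order_refl)
  then show "\<exists>x. (\<forall>i\<le>n. poly (x i) 0 = p i) \<and> (\<forall>J\<in>eqs a. [:0, 1:] ^ k dvd
      (\<Sum>\<gamma>\<in>mons n (Suc m). [:wcoeff ?C J \<gamma>, wcoeff ?C' J \<gamma> - wcoeff ?C J \<gamma>:] * mev x \<gamma>))"
    using x(2) eqW by (intro exI[of _ x]) simp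
qed

text \<open>The common frame of the cases a = 1 and a = n-1: \<open>row\<close>, \<open>peq\<close>,
  \<open>solve\<close> and \<open>propagate\<close> yield the lifts of the N points, while
  \<open>succ\<close>, \<open>rel\<close> and \<open>exps\<close> yield the upper bound N at
  \<open>M0\<close>.\<close>

lemma binomial_count:
  fixes J :: "nat \<Rightarrow> nat list" and b b' c c' m N :: nat and q :: int
  defines "X \<equiv> (\<lambda>i. i mod (n + 1))"
  assumes n: "1 \<le> n" and N: "int N = \<bar>geom q (n + 1)\<bar>" "0 < N"
    and M0: "M0 \<in> Hom_sym_ext scale m a"
    and J: "\<And>i. i \<in> I \<Longrightarrow> J i \<in> eqs a"
    and row: "\<And>i. i \<in> I \<Longrightarrow> binomial_row m M0 (J i) (\<sigma> i) (\<beta> i) (\<beta>' i)"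
    and peq: "\<And>z i. z \<noteq> 0 \<Longrightarrow> z powi geom q (n + 1) = 1 \<Longrightarrow> i \<in> I \<Longrightarrow>
      mev (\<lambda>l. z powi geom q l :: complex) (\<beta> i) = mev (\<lambda>l. z powi geom q l) (\<beta>' i)"
    and solve: "\<And>\<rho>. \<exists>\<epsilon>. \<epsilon> 0 = (0::complex) \<and> (\<forall>i\<in>I. (\<Sum>l\<in>#\<beta> i. \<epsilon> l) - (\<Sum>l\<in>#\<beta>' i. \<epsilon> l) = \<rho> i)"
    and propagate: "\<And>(W :: nat list \<Rightarrow> complex poly) y J'. alternating W \<Longrightarrow> \<forall>i\<in>I. y dvd W (J i) \<Longrightarrow>
      J' \<in> eqs a \<Longrightarrow> 0 \<in> set J' \<Longrightarrow> y dvd W J'"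
    and succ: "\<forall>i\<le>n. \<exists>\<tau>. sys.equiv_mon m a M0 (replicate_mset (m + 1) i) (add_mset (X (i + 1)) \<tau>)"
    and rel: "\<forall>i. sys.equiv_mon m a M0 ({#X (i + 2)#} + replicate_mset b (X i) + replicate_mset b' (X (i + 1)))
      (replicate_mset c (X i) + replicate_mset c' (X (i + 1)))"
    and exps: "b + b' + 1 = c + c'" "int c - int b = - q" "int c' - int b' = 1 + q"
  shows "general_Hom scale m a (\<lambda>M. finite (eigenpoints scale m M) \<and> card (eigenpoints scale m M) = N)"
proof (rule general_count[OF M0 unity_points(1,2)[OF n N]])
  show "\<forall>M\<in>Hom_sym_ext scale m a. \<forall>p\<in>(\<lambda>z l. z powi geom q l) ` {z. z ^ N = 1}. sys.lifts m a M0 M p"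
  proof (intro ballI)
    fix M p assume M: "M \<in> Hom_sym_ext scale m a" and "p \<in> (\<lambda>z l. z powi geom q l :: complex) ` {z. z ^ N = 1}"
    then obtain z where z: "z \<noteq> 0" "z powi geom q (n + 1) = 1" "p = (\<lambda>l. z powi geom q l)"
      using unity_points(3)[OF n N] by blast
    show "sys.lifts m a M0 M p"
    proof (rule lifts_from_rows[OF M0 M, where I = I and J = J and \<sigma> = \<sigma> and \<beta> = \<beta> and \<beta>' = \<beta>'])
      show "p 0 = 1" "p i \<noteq> 0" for i using z(1,3) by (simp_all add: power_int_eq_0_iff)
      show "mev p (\<beta> i) = mev p (\<beta>' i)" if "i \<in> I" for i unfolding z(3) by (rule peq[OF z(1,2) that])
    qed (use J row solve propagate in blast)+
  qed
  show "\<exists>d0. \<forall>d\<ge>d0. \<exists>T. sys.determines m a M0 d T \<and> card T \<le> N"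
    by (rule sys.binomial_determines[OF n N succ[unfolded X_def] rel[unfolded X_def] exps])
qed


subsection \<open>Counting eigenpoints\<close>

text \<open>The map \<open>M0\<close> sends \<open>v\<^sup>m\<close> to the sum of \<open>v\<^sub>k\<^sup>m e\<^sub>k\<^sub>+\<^sub>1\<close>, with indices modulo \<open>n + 1\<close>.\<close>

lemma count_degree_one:
  assumes n: "1 \<le> n" and m: "1 \<le> m"
  shows "general_Hom scale m 1 (\<lambda>M. finite (eigenpoints scale m M) \<and>
    card (eigenpoints scale m M) = nat (geom (int m) (n + 1)))"
proof -
  define suc where "suc k = (k + 1) mod (n + 1)" for k
  define prd where "prd k = (k + n) mod (n + 1)" for k
  have le: "suc k \<le> n" "prd k \<le> n" for k by (simp_all add: suc_def prd_def mod_Suc_le_divisor)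
  have prd_suc: "prd (suc k) = k" and suc_prd: "suc (prd k) = k" if "k \<le> n" for k
    using suc_eq_iff_prd[OF that le(1)[of k]] suc_eq_iff_prd[OF le(2)[of k] that] by (simp_all add: suc_def prd_def)
  define M0 where "M0 = sparse_hom m (\<lambda>_. 1) (\<lambda>k. k) (\<lambda>k. rev (cyc n k 1))"
  have M0: "M0 \<in> Hom_sym_ext scale m 1" unfolding M0_def by (rule sparse_hom_in_Hom) simp
  have pos: "0 \<le> geom (int m) i" for i by (simp add: geom_def sum_nonneg)
  have pos': "0 < geom (int m) (Suc i)" for i using pos[of i] by (simp add: geom_Suc add_pos_nonneg)
  have row: "binomial_row m M0 [i, l] 1 (add_mset l (replicate_mset m (prd i))) (add_mset i (replicate_mset m (prd l)))"
    if il: "i \<le> n" "l \<le> n" for i l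
    unfolding binomial_row_def
  proof (intro conjI allI)
    show "add_mset l (replicate_mset m (prd i)) \<in> mons n (Suc m)" "add_mset i (replicate_mset m (prd l)) \<in> mons n (Suc m)"
      by (intro add_mset_mons replicate_mons il le)+
    fix g :: "nat multiset \<Rightarrow> complex poly"
    have ws: "wsum (\<lambda>K. [:ext_basis (rev (cyc n k 1)) K:]) (\<lambda>a. g (add_mset a (replicate_mset m k))) [i, l] =
        (if k = prd i then g (add_mset l (replicate_mset m k)) else 0) -
        (if k = prd l then g (add_mset i (replicate_mset m k)) else 0)" if "k \<le> n" for k
    proof -
      have "[:ext_basis (rev (cyc n k 1)) [x]:] = (if k = prd x then 1 else 0)" if "x \<le> n" for x
      proof -
        have "cyc n k 1 = [suc k]" by (simp add: cyc_def suc_def)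
        moreover have "suc k = x \<longleftrightarrow> k = prd x"
          unfolding suc_def prd_def by (rule suc_eq_iff_prd[OF \<open>k \<le> n\<close> that])
        ultimately show ?thesis by auto
      qed
      then show ?thesis using il by simp
    qed
    have "(\<Sum>\<gamma>\<in>mons n (Suc m). [:wcoeff (hcoeff m M0) [i, l] \<gamma>:] * g \<gamma>) =
      (\<Sum>k\<le>n. [:1:] * wsum (\<lambda>K. [:ext_basis (rev (cyc n k 1)) K:]) (\<lambda>a. g (add_mset a (replicate_mset m k))) [i, l])"
      unfolding M0_def using set_cyc_subset il
      by (intro sparse_hom_equation[OF comm_ring_hom_const_poly]) auto
    also have "\<dots> = (\<Sum>k\<le>n. (if k = prd i then g (add_mset l (replicate_mset m k)) else 0) -
        (if k = prd l then g (add_mset i (replicate_mset m k)) else 0))"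
      by (intro sum.cong refl) (simp only: ws atMost_iff one_pCons[symmetric] mult_1_left)
    also have "\<dots> = g (add_mset l (replicate_mset m (prd i))) - g (add_mset i (replicate_mset m (prd l)))"
      using le(2)[of i] le(2)[of l] by (simp add: sum_subtractf)
    finally show "(\<Sum>\<gamma>\<in>mons n (Suc m). [:wcoeff (hcoeff m M0) [i, l] \<gamma>:] * g \<gamma>) =
      [:1:] * (g (add_mset l (replicate_mset m (prd i))) - g (add_mset i (replicate_mset m (prd l))))"
      by (simp only: one_pCons[symmetric] mult_1_left)
  qed simp
  have eqsI: "[i, l] \<in> eqs 1" if "i \<le> n" "l \<le> n" for i l using that by (simp add: eqs_def)
  have p0: "prd 0 = n" by (simp add: prd_def)
  have pS: "prd i = i - 1" if "i \<in> {1..n}" for i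
  proof -
    have "i + n = i - 1 + (n + 1)" using that by simp
    then have "prd i = (i - 1) mod (n + 1)" unfolding prd_def by (simp only: mod_add_self2)
    also have "\<dots> = i - 1" using that by (intro mod_less) auto
    finally show ?thesis .
  qed
  show ?thesis
  proof (rule binomial_count[OF n _ _ M0, where I = "{1..n}" and J = "\<lambda>i. [0, i]" and \<sigma> = "\<lambda>_. 1" and
      \<beta> = "\<lambda>i. add_mset i (replicate_mset m n)" and \<beta>' = "\<lambda>i. add_mset 0 (replicate_mset m (i - 1))" and
      q = "int m" and b = m and b' = 0 and c = 0 and c' = "m + 1"])
    show "int (nat (geom (int m) (n + 1))) = \<bar>geom (int m) (n + 1)\<bar>" "0 < nat (geom (int m) (n + 1))"
      using pos[of "n + 1"] pos'[of n] by simp_all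
    show "[0, i] \<in> eqs 1" if "i \<in> {1..n}" for i using that by (intro eqsI) auto
    show "binomial_row m M0 [0, i] 1 (add_mset i (replicate_mset m n)) (add_mset 0 (replicate_mset m (i - 1)))"
      if "i \<in> {1..n}" for i
      using row[of 0 i] that p0 pS[OF that] by simp
    show "mev (\<lambda>l. z powi geom (int m) l) (add_mset i (replicate_mset m n)) =
        mev (\<lambda>l. z powi geom (int m) l) (add_mset 0 (replicate_mset m (i - 1)))"
      if z: "z \<noteq> 0" "z powi geom (int m) (n + 1) = 1" "i \<in> {1..n}" for z :: complex and i
    proof -
      obtain j where j: "i = Suc j" using z(3) by (cases i) auto
      \<comment> \<open>Both exponents equal 1 + m geom(i-1) + m geom(n), and the exponent geom(n+1)
        contributes the factor 1.\<close>
      have "geom (int m) i + geom (int m) n * int m = geom (int m) j * int m + geom (int m) (n + 1)"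
        unfolding j by (simp add: geom_Suc mult.commute)
      then have "z powi (geom (int m) i + geom (int m) n * int m) = z powi (geom (int m) j * int m)"
        using z(1,2) by (simp add: power_int_add)
      then have "z powi geom (int m) i * (z powi geom (int m) n) ^ m = (z powi geom (int m) j) ^ m"
        using z(1) by (simp add: power_int_add power_int_mult)
      then show ?thesis by (simp add: mev_replicate j)
    qed
    show "\<exists>\<epsilon>. \<epsilon> 0 = (0::complex) \<and> (\<forall>i\<in>{1..n}. (\<Sum>l\<in>#add_mset i (replicate_mset m n). \<epsilon> l) -
        (\<Sum>l\<in>#add_mset 0 (replicate_mset m (i - 1)). \<epsilon> l) = \<rho> i)" for \<rho>
    proof -
      have "(of_int (geom (int m) (Suc n)) :: complex) \<noteq> 0" using pos'[of n] by (simp only: of_int_eq_0_iff)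
      then obtain \<epsilon> where \<epsilon>: "\<epsilon> 0 = (0::complex)" "\<forall>i<n. \<epsilon> (Suc i) + of_nat m * \<epsilon> n - of_nat m * \<epsilon> i = \<rho> (Suc i)"
        using solve_first_order[of "\<lambda>i. of_int (geom (int m) i)" "of_nat m" n "\<lambda>i. \<rho> (Suc i)"]
        by (auto simp: geom_Suc)
      have "(\<Sum>l\<in>#add_mset i (replicate_mset m n). \<epsilon> l) - (\<Sum>l\<in>#add_mset 0 (replicate_mset m (i - 1)). \<epsilon> l) = \<rho> i"
        if i: "i \<in> {1..n}" for i
      proof -
        obtain j where "i = Suc j" "j < n" using i by (cases i) auto
        then show ?thesis using \<epsilon> by (simp add: image_replicate_mset sum_mset_replicate_mset)
      qed
      then show ?thesis using \<epsilon>(1) by blast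
    qed
    show "y dvd W J'" if W: "alternating W" "\<forall>i\<in>{1..n}. y dvd W [0, i]" "J' \<in> eqs 1" "0 \<in> set J'"
      for W :: "nat list \<Rightarrow> complex poly" and y J'
    proof (cases "distinct J'")
      case False
      then show ?thesis by (simp add: alternating_not_distinct[OF W(1)])
    next
      case True
      obtain i l where J': "J' = [i, l]" "i \<le> n" "l \<le> n"
        using W(3) by (auto simp: eqs_def length_Suc_conv)
      show ?thesis
      proof (cases "i = 0")
        case True
        then show ?thesis using W(2) J' \<open>distinct J'\<close> by auto
      next
        case False
        then have "l = 0" "i \<in> {1..n}" using W(4) J' by auto
        then show ?thesis using W(2) alternating_dvd_mset[OF W(1), of y "[0, i]" "[i, l]"] J' by simp
      qed
    qed
    show "\<forall>i\<le>n. \<exists>\<tau>. sys.equiv_mon m 1 M0 (replicate_mset (m + 1) i) (add_mset ((i + 1) mod (n + 1)) \<tau>)"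
    proof (intro allI impI)
      fix i assume i: "i \<le> n"
      \<comment> \<open>The row for the pair (i+1, i) reads x_i^(m+1) = x_(i+1) x_(i-1)^m.\<close>
      have "sys.equiv_mon m 1 M0 (add_mset i (replicate_mset m (prd (suc i)))) (add_mset (suc i) (replicate_mset m (prd i)))"
        by (rule binomial_row_equiv[OF eqsI row]) (use i le in auto)
      then show "\<exists>\<tau>. sys.equiv_mon m 1 M0 (replicate_mset (m + 1) i) (add_mset ((i + 1) mod (n + 1)) \<tau>)"
        unfolding prd_suc[OF i] unfolding suc_def by (intro exI[of _ "replicate_mset m (prd i)"]) simp
    qed
    show "\<forall>i. sys.equiv_mon m 1 M0
        ({#(i + 2) mod (n + 1)#} + replicate_mset m (i mod (n + 1)) + replicate_mset 0 ((i + 1) mod (n + 1)))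
        (replicate_mset 0 (i mod (n + 1)) + replicate_mset (m + 1) ((i + 1) mod (n + 1)))"
    proof
      fix i
      let ?i = "i mod (n + 1)"
      have i: "?i \<le> n" by (simp add: mod_Suc_le_divisor)
      have s: "suc ?i = (i + 1) mod (n + 1)" by (simp add: suc_def mod_Suc_eq)
      have ss: "suc (suc ?i) = (i + 2) mod (n + 1)" unfolding s by (simp add: suc_def mod_Suc_eq)
      \<comment> \<open>The row for the pair (i+1, i+2) reads x_(i+2) x_i^m = x_(i+1)^(m+1).\<close>
      have "sys.equiv_mon m 1 M0 (add_mset (suc (suc ?i)) (replicate_mset m (prd (suc ?i))))
          (add_mset (suc ?i) (replicate_mset m (prd (suc (suc ?i)))))"
        by (rule binomial_row_equiv[OF eqsI row]) (use le in auto)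
      then show "sys.equiv_mon m 1 M0
        ({#(i + 2) mod (n + 1)#} + replicate_mset m (i mod (n + 1)) + replicate_mset 0 ((i + 1) mod (n + 1)))
        (replicate_mset 0 (i mod (n + 1)) + replicate_mset (m + 1) ((i + 1) mod (n + 1)))"
        unfolding prd_suc[OF i] prd_suc[OF le(1)] unfolding ss unfolding s by simp
    qed
  qed simp_all
qed


text \<open>The map \<open>M0\<close> sends \<open>v\<^sup>m\<close> to the sum of \<open>\<plusminus> v\<^sub>k\<^sub>-\<^sub>1\<^sup>m e\<^sub>k\<^sub>+\<^sub>1 \<and> \<dots> \<and> e\<^sub>k\<^sub>+\<^sub>n\<^sub>-\<^sub>1\<close>; the signs
  make all equations differences \<open>v\<^sub>k\<^sub>-\<^sub>1\<^sup>m\<^sup>+\<^sup>1 - v\<^sub>k\<^sup>m v\<^sub>k\<^sub>+\<^sub>1\<close>.\<close>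

lemma count_codegree_one:
  assumes n: "1 \<le> n" and m: "1 \<le> m"
  shows "general_Hom scale m (n - 1) (\<lambda>M. finite (eigenpoints scale m M) \<and>
    card (eigenpoints scale m M) = nat \<bar>geom (- (int m + 1)) (n + 1)\<bar>)"
proof -
  define q where "q = - (int m + 1)"
  define suc where "suc k = (k + 1) mod (n + 1)" for k
  define prd where "prd k = (k + n) mod (n + 1)" for k
  have le: "suc k \<le> n" "prd k \<le> n" for k by (simp_all add: suc_def prd_def)
  have prd_suc: "prd (suc k) = k" and suc_prd: "suc (prd k) = k" if "k \<le> n" for k
    using suc_eq_iff_prd[OF that le(1)[of k]] suc_eq_iff_prd[OF le(2)[of k] that] by (simp_all add: suc_def prd_def)
  define I where "I k = rev (cyc n k (n - 1))" for k
  define M0 where "M0 = sparse_hom m (\<lambda>k. (-1) ^ (n * k)) prd I"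
  have M0: "M0 \<in> Hom_sym_ext scale m (n - 1)" unfolding M0_def by (rule sparse_hom_in_Hom) (simp add: I_def)
  have notin: "k \<notin> set (I k)" "prd k \<notin> set (I k)" if "k \<le> n" for k
    using cyc_offset[of "n - 1" n 0 k] cyc_offset[of "n - 1" n n k] that n by (simp_all add: I_def prd_def)
  have neq: "prd k \<noteq> k" if "k \<le> n" for k
    using mod_add_inj[of n n 0 k] that n by (simp add: prd_def)
  have self: "ext_basis (I k) (cyc n k (n - 1)) = 1" for k
    unfolding I_def by (intro ext_basis_self distinct_cyc) simp
  have setJ: "set (cyc n i n) = {..n} - {i}" if "i \<le> n" for i using set_cyc_n[of n i] that by simp
  have row: "binomial_row m M0 (cyc n i n) ((-1) ^ (n * i)) (replicate_mset (m + 1) (prd i)) (add_mset (suc i) (replicate_mset m i))"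
    if i: "i \<le> n" for i
    unfolding binomial_row_def
  proof (intro conjI allI)
    show "replicate_mset (m + 1) (prd i) \<in> mons n (Suc m)" using replicate_mons[OF le(2)[of i], of "Suc m"] by simp
    show "add_mset (suc i) (replicate_mset m i) \<in> mons n (Suc m)"
      by (intro add_mset_mons replicate_mons i le)
    fix g :: "nat multiset \<Rightarrow> complex poly"
    \<comment> \<open>The contribution of summand \<open>k\<close> to the equation that omits index
      \<open>i\<close>. As \<open>I k\<close> omits exactly \<open>k\<close> and its predecessor,
      one of these must be \<open>i\<close> and the other is supplied by v; only
      \<open>k = i\<close> and \<open>k = suc i\<close> remain.\<close>
    define T where "T k = wsum (\<lambda>K. [:ext_basis (I k) K:]) (\<lambda>a. g (add_mset a (replicate_mset m (prd k)))) (cyc n i n)" for k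
    obtain n' where n': "n = Suc n'" using n by (cases n) auto
    have Ti: "T i = g (replicate_mset (m + 1) (prd i))"
    proof -
      have J: "cyc n i n = cyc n i (n - 1) @ [prd i]"
        using cyc_snoc[of n i n'] by (simp add: n' prd_def)
      have "T i = g (add_mset (prd i) (replicate_mset m (prd i))) * [:ext_basis (I i) (cyc n i (n - 1)):]"
        unfolding T_def J using ext_basis_notin[OF _ notin(2)[OF i]] by (intro wsum_snoc_of_zero) simp
      then show ?thesis unfolding self by simp
    qed
    have Ts: "T (suc i) = (-1) ^ (n - 1) * g (add_mset (suc i) (replicate_mset m i))"
    proof -
      have J: "cyc n i n = suc i # cyc n (suc i) (n - 1)"
        using cyc_Cons[of n i n'] by (simp add: n' suc_def)
      have "T (suc i) = (-1) ^ length (cyc n (suc i) (n - 1)) * g (add_mset (suc i) (replicate_mset m (prd (suc i)))) *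
          [:ext_basis (I (suc i)) (cyc n (suc i) (n - 1)):]"
        unfolding T_def J using ext_basis_notin[OF _ notin(1)[OF le(1)]] by (intro wsum_Cons_of_zero) simp
      then show ?thesis unfolding self prd_suc[OF i] by simp
    qed
    have T0: "T k = 0" if k: "k \<le> n" "k \<noteq> i" "k \<noteq> suc i" for k
      unfolding T_def
    proof (rule wsum_eq_0)
      fix us b vs assume J: "cyc n i n = us @ b # vs"
      have "prd k \<noteq> i" using k(1,3) suc_prd by metis
      then have "k \<in> set (us @ b # vs)" "prd k \<in> set (us @ b # vs)"
        using k(1,2) le(2)[of k] setJ[OF i] unfolding J by auto
      then have "k \<in> set (us @ vs) \<or> prd k \<in> set (us @ vs)" using neq[OF k(1)] by auto
      then have "ext_basis (I k) (us @ vs) = 0" using ext_basis_notin notin[OF k(1)] by blast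
      then show "g (add_mset b (replicate_mset m (prd k))) * [:ext_basis (I k) (us @ vs):] = 0" by simp
    qed
    have "suc i \<noteq> i" using neq[OF le(1), of i] prd_suc[OF i] by auto
    \<comment> \<open>This is why the coefficients of \<open>M0\<close> are (-1)^(n k): both
      surviving terms acquire opposite signs, also at the wraparound i = n, where n^2 and n have the
      same parity.\<close>
    have sign: "(-1) ^ (n * suc i) * (-1) ^ (n - 1) = - ((-1) ^ (n * i) :: complex)"
    proof (cases "i = n")
      case True
      then show ?thesis using n by (cases "even n") (simp_all add: suc_def)
    next
      case False
      then have "suc i = Suc i" using i by (simp add: suc_def)
      then show ?thesis using n by (cases "even n") (simp_all add: power_add)
    qed
    have "(\<Sum>\<gamma>\<in>mons n (Suc m). [:wcoeff (hcoeff m M0) (cyc n i n) \<gamma>:] * g \<gamma>) = (\<Sum>k\<le>n. [:(-1) ^ (n * k):] * T k)"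
      unfolding M0_def T_def using set_cyc_subset le
      by (intro sparse_hom_equation[OF comm_ring_hom_const_poly]) (simp_all add: I_def)
    also have "\<dots> = (\<Sum>k\<in>{i, suc i}. [:(-1) ^ (n * k):] * T k)"
      using i le by (intro sum.mono_neutral_right) (auto simp: T0)
    also have "\<dots> = [:(-1) ^ (n * i):] * T i + [:(-1) ^ (n * suc i):] * T (suc i)"
      using \<open>suc i \<noteq> i\<close> by simp
    also have "[:(-1) ^ (n * suc i):] * T (suc i) =
        [:(-1) ^ (n * suc i) * (-1) ^ (n - 1):] * g (add_mset (suc i) (replicate_mset m i))"
      unfolding Ts by (cases "even (n - 1)") simp_all
    also have "[:(-1) ^ (n * i):] * T i + \<dots> =
        [:(-1) ^ (n * i):] * (g (replicate_mset (m + 1) (prd i)) - g (add_mset (suc i) (replicate_mset m i)))"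
      unfolding sign Ti by (simp add: smult_diff_right)
    finally show "(\<Sum>\<gamma>\<in>mons n (Suc m). [:wcoeff (hcoeff m M0) (cyc n i n) \<gamma>:] * g \<gamma>) =
        [:(-1) ^ (n * i):] * (g (replicate_mset (m + 1) (prd i)) - g (add_mset (suc i) (replicate_mset m i)))" .
  qed simp
  have eqsI: "cyc n i n \<in> eqs (n - 1)" for i using n set_cyc_subset by (simp add: eqs_def)
  have prd_Suc: "prd (Suc j) = j" if "j < n" for j
  proof -
    have "Suc j + n = j + (n + 1)" by simp
    then have "prd (Suc j) = j mod (n + 1)" unfolding prd_def by (simp only: mod_add_self2)
    then show ?thesis using that by simp
  qed
  have suc_Suc: "suc (Suc j) = (if Suc j = n then 0 else Suc (Suc j))" if "j < n" for j
    using that by (auto simp: suc_def)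
  have alt_geom: "geom q (Suc (Suc j)) = (int m + 1) * geom q j - int m * geom q (Suc j)" for j
    unfolding geom_Suc_Suc by (simp add: q_def algebra_simps)
  \<comment> \<open>Modulo m + 1 the number \<open>geom q (n + 1)\<close> is 1.\<close>
  have geom_neq: "geom q (n + 1) \<noteq> 0"
  proof
    assume "geom q (n + 1) = 0"
    then have "1 = (int m + 1) * geom q n" by (simp add: geom_Suc q_def algebra_simps)
    then have "int m + 1 dvd 1" by (rule dvdI)
    then show False using m by (auto dest: zdvd_imp_le)
  qed
  show ?thesis
    unfolding q_def[symmetric]
  proof (rule binomial_count[OF n _ _ M0, where I = "{1..n}" and J = "\<lambda>i. cyc n i n" and \<sigma> = "\<lambda>i. (-1) ^ (n * i)" and
      \<beta> = "\<lambda>i. replicate_mset (m + 1) (prd i)" and \<beta>' = "\<lambda>i. add_mset (suc i) (replicate_mset m i)" and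
      q = q and b = 0 and b' = m and c = "m + 1" and c' = 0])
    show "int (nat \<bar>geom q (n + 1)\<bar>) = \<bar>geom q (n + 1)\<bar>" "0 < nat \<bar>geom q (n + 1)\<bar>" using geom_neq by simp_all
    show "cyc n i n \<in> eqs (n - 1)" for i by (rule eqsI)
    show "binomial_row m M0 (cyc n i n) ((-1) ^ (n * i)) (replicate_mset (m + 1) (prd i)) (add_mset (suc i) (replicate_mset m i))"
      if "i \<in> {1..n}" for i using that by (intro row) simp
    show "mev (\<lambda>l. z powi geom q l) (replicate_mset (m + 1) (prd i)) =
        mev (\<lambda>l. z powi geom q l) (add_mset (suc i) (replicate_mset m i))"
      if z: "z \<noteq> 0" "z powi geom q (n + 1) = 1" "i \<in> {1..n}" for z :: complex and i
    proof -
      obtain j where j: "i = Suc j" "j < n" using z(3) by (cases i) auto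
      \<comment> \<open>At the wraparound the exponents \<open>geom q 0 = 0\<close> and
        \<open>geom q (n + 1)\<close> both give the power 1.\<close>
      have "z powi geom q (suc i) = z powi geom q (Suc (Suc j))"
        using z(2) suc_Suc[OF j(2)] by (auto simp: j(1))
      moreover have "geom q j * int (m + 1) = geom q (Suc (Suc j)) + geom q (Suc j) * int m"
        unfolding alt_geom by (simp add: algebra_simps)
      then have "z powi (geom q j * int (m + 1)) = z powi geom q (Suc (Suc j)) * z powi (geom q (Suc j) * int m)"
        using z(1) by (simp only: power_int_add simp_thms)
      then have "(z powi geom q j) ^ (m + 1) = z powi geom q (Suc (Suc j)) * (z powi geom q (Suc j)) ^ m"
        by (simp only: power_int_mult power_int_of_nat)
      ultimately show ?thesis
        unfolding mev_add_mset mev_replicate j(1) prd_Suc[OF j(2)] by simp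
    qed
    show "\<exists>\<epsilon>. \<epsilon> 0 = (0::complex) \<and> (\<forall>i\<in>{1..n}. (\<Sum>l\<in>#replicate_mset (m + 1) (prd i). \<epsilon> l) -
        (\<Sum>l\<in>#add_mset (suc i) (replicate_mset m i). \<epsilon> l) = \<rho> i)" for \<rho>
    proof -
      have "(of_int (geom q (Suc n)) :: complex) \<noteq> 0" using geom_neq by simp
      moreover have "(of_int (geom q (Suc (Suc i))) :: complex) =
          of_nat (m + 1) * of_int (geom q i) + - of_nat m * of_int (geom q (Suc i))" for i
        unfolding alt_geom by simp
      ultimately obtain \<epsilon> where \<epsilon>: "\<epsilon> 0 = (0::complex)" "\<epsilon> (Suc n) = 0"
        "\<forall>i<n. of_nat (m + 1) * \<epsilon> i + - of_nat m * \<epsilon> (Suc i) - \<epsilon> (Suc (Suc i)) = \<rho> (Suc i)"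
        using solve_second_order[of "\<lambda>i. of_int (geom q i)" "of_nat (m + 1)" "- of_nat m" n "\<lambda>i. \<rho> (Suc i)"]
        by auto
      have "(\<Sum>l\<in>#replicate_mset (m + 1) (prd i). \<epsilon> l) - (\<Sum>l\<in>#add_mset (suc i) (replicate_mset m i). \<epsilon> l) = \<rho> i"
        if i: "i \<in> {1..n}" for i
      proof -
        obtain j where j: "i = Suc j" "j < n" using i by (cases i) auto
        have "\<epsilon> (suc i) = \<epsilon> (Suc (Suc j))" using \<epsilon>(1,2) suc_Suc[OF j(2)] by (auto simp: j(1))
        moreover have "(\<Sum>l\<in>#replicate_mset (m + 1) (prd i). \<epsilon> l) - (\<Sum>l\<in>#add_mset (suc i) (replicate_mset m i). \<epsilon> l) =
            of_nat (m + 1) * \<epsilon> j - (\<epsilon> (suc i) + of_nat m * \<epsilon> (Suc j))"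
          unfolding image_replicate_mset image_mset_add_mset sum_mset.add_mset sum_mset_replicate_mset
          by (simp only: j(1) prd_Suc[OF j(2)])
        ultimately show ?thesis using \<epsilon>(3)[rule_format, OF j(2)] by (simp add: j(1) diff_diff_eq add.commute)
      qed
      then show ?thesis using \<epsilon>(1) by blast
    qed
    show "y dvd W J'" if W: "alternating W" "\<forall>i\<in>{1..n}. y dvd W (cyc n i n)" "J' \<in> eqs (n - 1)" "0 \<in> set J'"
      for W :: "nat list \<Rightarrow> complex poly" and y J'
    proof (cases "distinct J'")
      case False
      then show ?thesis by (simp add: alternating_not_distinct[OF W(1)])
    next
      case True
      have J': "set J' \<subseteq> {..n}" "length J' = n" using W(3) n by (auto simp: eqs_def)
      \<comment> \<open>A list without repetition is determined up to order by its one missing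
        index, and this index is not 0 because 0 occurs in the list.\<close>
      have "card ({..n} - set J') = 1" using J' distinct_card[OF True] by (simp add: card_Diff_subset)
      then obtain i where i: "{..n} - set J' = {i}" by (auto simp: card_1_singleton_iff)
      then have "i \<in> {1..n}" using W(4) by (cases i) auto
      have "set (cyc n i n) = set J'" using setJ[of i] i J'(1) \<open>i \<in> {1..n}\<close> by auto
      then have "mset (cyc n i n) = mset J'"
        using set_eq_iff_mset_eq_distinct[OF distinct_cyc True] by blast
      then show ?thesis using W(2) \<open>i \<in> {1..n}\<close> alternating_dvd_mset[OF W(1)] by blast
    qed
    show "\<forall>i\<le>n. \<exists>\<tau>. sys.equiv_mon m (n - 1) M0 (replicate_mset (m + 1) i) (add_mset ((i + 1) mod (n + 1)) \<tau>)"
    proof (intro allI impI)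
      fix i assume i: "i \<le> n"
      \<comment> \<open>The row at \<open>suc i\<close> reads x_i^(m+1) = x_(i+2) x_(i+1)^m, and
        \<open>1 \<le> m\<close> exhibits the factor x_(i+1).\<close>
      obtain m' where m': "m = Suc m'" using m by (cases m) auto
      have "sys.equiv_mon m (n - 1) M0 (replicate_mset (m + 1) (prd (suc i))) (add_mset (suc (suc i)) (replicate_mset m (suc i)))"
        by (rule binomial_row_equiv[OF eqsI row[OF le(1)]])
      then show "\<exists>\<tau>. sys.equiv_mon m (n - 1) M0 (replicate_mset (m + 1) i) (add_mset ((i + 1) mod (n + 1)) \<tau>)"
        unfolding prd_suc[OF i] unfolding suc_def[symmetric]
        by (intro exI[of _ "add_mset (suc (suc i)) (replicate_mset m' (suc i))"])
          (simp only: m' replicate_mset_Suc add_mset_commute)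
    qed
    show "\<forall>i. sys.equiv_mon m (n - 1) M0
        ({#(i + 2) mod (n + 1)#} + replicate_mset 0 (i mod (n + 1)) + replicate_mset m ((i + 1) mod (n + 1)))
        (replicate_mset (m + 1) (i mod (n + 1)) + replicate_mset 0 ((i + 1) mod (n + 1)))"
    proof
      fix i
      let ?i = "i mod (n + 1)"
      have i: "?i \<le> n" by simp
      have s: "suc ?i = (i + 1) mod (n + 1)" by (simp add: suc_def mod_Suc_eq)
      have ss: "suc (suc ?i) = (i + 2) mod (n + 1)" unfolding s by (simp add: suc_def mod_Suc_eq)
      have "sys.equiv_mon m (n - 1) M0 (replicate_mset (m + 1) (prd (suc ?i))) (add_mset (suc (suc ?i)) (replicate_mset m (suc ?i)))"
        by (rule binomial_row_equiv[OF eqsI row[OF le(1)]])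
      then show "sys.equiv_mon m (n - 1) M0
        ({#(i + 2) mod (n + 1)#} + replicate_mset 0 (i mod (n + 1)) + replicate_mset m ((i + 1) mod (n + 1)))
        (replicate_mset (m + 1) (i mod (n + 1)) + replicate_mset 0 ((i + 1) mod (n + 1)))"
        unfolding prd_suc[OF i] ss unfolding s using sys.equiv_mon_sym by simp
    qed
  qed (simp_all add: q_def)
qed


text \<open>The map \<open>M0\<close> sends \<open>v\<^sup>m\<close> to the sum of \<open>v\<^sub>k\<^sup>m e\<^sub>k\<^sub>+\<^sub>1 \<and> \<dots> \<and> e\<^sub>k\<^sub>+\<^sub>a\<close>. Its equations include the monomials
  \<open>v\<^sub>k\<^sup>m v\<^sub>k\<^sub>-\<^sub>1\<close> and the binomials \<open>v\<^sub>k\<^sup>m v\<^sub>k\<^sub>+\<^sub>a\<^sub>+\<^sub>1 \<plusminus> v\<^sub>k\<^sub>+\<^sub>1\<^sup>m\<^sup>+\<^sup>1\<close>, so every variable is nilpotent modulo them.\<close>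

lemma no_zeros_middle:
  assumes a: "2 \<le> a" "a + 2 \<le> n" and m: "1 \<le> m"
  shows "general_Hom scale m a (\<lambda>M. finite (eigenpoints scale m M) \<and> card (eigenpoints scale m M) = 0)"
proof -
  define suc where "suc k = (k + 1) mod (n + 1)" for k
  define prd where "prd k = (k + n) mod (n + 1)" for k
  have le: "suc k \<le> n" "prd k \<le> n" for k by (simp_all add: suc_def prd_def)
  have suc_prd: "suc (prd k) = k" if "k \<le> n" for k
    using suc_eq_iff_prd[OF le(2)[of k] that] by (simp add: suc_def prd_def)
  define I where "I k = rev (cyc n k a)" for k
  define M0 where "M0 = sparse_hom m (\<lambda>_. 1) (\<lambda>k. k) I"
  have M0: "M0 \<in> Hom_sym_ext scale m a" unfolding M0_def by (rule sparse_hom_in_Hom) (simp add: I_def)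
  have setI: "set (I k) = {(k + l) mod (n + 1) | l. 1 \<le> l \<and> l \<le> a}" for k by (simp add: I_def set_cyc)
  have self: "ext_basis (I k) (cyc n k a) = 1" for k
    unfolding I_def using a by (intro ext_basis_self distinct_cyc) simp
  have expand_row: "(\<Sum>\<gamma>\<in>mons n (Suc m). wcoeff (hcoeff m M0) J \<gamma> * g \<gamma>) =
      (\<Sum>k\<le>n. wsum (ext_basis (I k)) (\<lambda>b. g (add_mset b (replicate_mset m k))) J)"
    if "set J \<subseteq> {..n}" for J and g :: "nat multiset \<Rightarrow> complex"
    using sparse_hom_equation[OF comm_ring_hom_self _ that, of "\<lambda>k. k" I m "\<lambda>_. 1" g] set_cyc_subset
    by (simp add: M0_def I_def)
  have offset: "(k + l) mod (n + 1) \<notin> (\<lambda>l. (k + l) mod (n + 1)) ` L" if "L \<subseteq> {..n}" "l \<le> n" "l \<notin> L" for k l L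
    using that mod_add_inj[of l n _ k] by auto
  have missing: "wsum (ext_basis (I k)) x J = 0"
    if "b \<in> set (I k)" "b \<notin> set J" "length J = Suc a" for k x J b
    using wsum_ext_basis_missing[OF comm_ring_hom_self that(1,2)] that(3) by (simp add: I_def)
  have row1: "(\<Sum>\<gamma>\<in>mons n (Suc m). wcoeff (hcoeff m M0) (cyc n k a @ [prd k]) \<gamma> * g \<gamma>) =
      g (add_mset (prd k) (replicate_mset m k))" if k: "k \<le> n" for k and g :: "nat multiset \<Rightarrow> complex"
  proof -
    let ?J = "cyc n k a @ [prd k]"
    let ?W = "\<lambda>k. wsum (ext_basis (I k)) (\<lambda>b. g (add_mset b (replicate_mset m k))) ?J"
    have J: "set ?J = (\<lambda>l. (k + l) mod (n + 1)) ` ({1..a} \<union> {n})" by (auto simp: set_cyc prd_def)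
    have "?W k = g (add_mset (prd k) (replicate_mset m k)) * ext_basis (I k) (cyc n k a)"
    proof (rule wsum_snoc_of_zero)
      have "prd k \<notin> set (I k)" using cyc_offset[of a n n k] a by (simp add: I_def prd_def)
      then show "ext_basis (I k) K = 0" if "prd k \<in> set K" for K using ext_basis_notin[OF that] by blast
    qed
    moreover have "?W i = 0" if i: "i \<le> n" "i \<noteq> k" for i
    proof -
      obtain t where t: "t \<le> n" "i = (k + t) mod (n + 1)" using ex_offset[OF k i(1)] by blast
      then have "1 \<le> t" using i(2) k by (cases t) auto
      \<comment> \<open>An index i + l of \<open>I i\<close> outside the list is needed; relative to
        \<open>k\<close> the list occupies the offsets 1..a and n. The choice lands on offset a + 1
        or t + 1, or wraps to 0. For t = n - 1 the step 2 jumps over n, which uses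
        \<open>2 \<le> a\<close>.\<close>
      define l where "l = (if t \<le> a then a + 1 - t else if t = n - 1 then 2 else 1)"
      have l: "1 \<le> l" "l \<le> a" using a \<open>1 \<le> t\<close> by (auto simp: l_def)
      define r where "r = (if t + l \<le> n then t + l else 0)"
      have r: "r \<le> n" "r \<notin> {1..a} \<union> {n}" using a t(1) \<open>1 \<le> t\<close> by (auto simp: r_def l_def)
      have "(k + r) mod (n + 1) = (i + l) mod (n + 1)"
      proof (cases "t + l \<le> n")
        case True
        then show ?thesis by (simp add: r_def t(2) mod_simps add.assoc)
      next
        case False
        then have "t + l = n + 1" using a t(1) by (auto simp: l_def split: if_splits)
        have "(i + l) mod (n + 1) = (k + (t + l)) mod (n + 1)" by (simp only: t(2) mod_add_left_eq add.assoc)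
        also have "\<dots> = k mod (n + 1)" by (simp only: \<open>t + l = n + 1\<close> mod_add_self2)
        finally show ?thesis using False by (simp add: r_def)
      qed
      then have "(i + l) mod (n + 1) \<notin> set ?J" unfolding J using offset[OF _ r, of k] a by auto
      moreover have "(i + l) mod (n + 1) \<in> set (I i)" unfolding setI using l by blast
      ultimately show ?thesis by (intro missing) simp_all
    qed
    then have "(\<Sum>i\<le>n. ?W i) = ?W k" using k by (subst sum.mono_neutral_right[of "{..n}" "{k}"]) auto
    ultimately show ?thesis using expand_row[of ?J g] set_cyc_subset[of n k a] le(2)[of k] by (simp add: self)
  qed
  have row2: "(\<Sum>\<gamma>\<in>mons n (Suc m). wcoeff (hcoeff m M0) (cyc n k (Suc a)) \<gamma> * g \<gamma>) =
      g (add_mset ((k + Suc a) mod (n + 1)) (replicate_mset m k)) + (-1) ^ a * g (replicate_mset (Suc m) (suc k))"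
    if k: "k \<le> n" for k and g :: "nat multiset \<Rightarrow> complex"
  proof -
    let ?J = "cyc n k (Suc a)"
    let ?W = "\<lambda>k. wsum (ext_basis (I k)) (\<lambda>b. g (add_mset b (replicate_mset m k))) ?J"
    have J: "set ?J = (\<lambda>l. (k + l) mod (n + 1)) ` {1..Suc a}" by (auto simp: set_cyc)
    have "?W k = g (add_mset ((k + Suc a) mod (n + 1)) (replicate_mset m k)) * ext_basis (I k) (cyc n k a)"
      unfolding cyc_snoc
    proof (rule wsum_snoc_of_zero)
      have "(k + Suc a) mod (n + 1) \<notin> set (I k)" using cyc_offset[of a n "Suc a" k] a by (simp add: I_def)
      then show "ext_basis (I k) K = 0" if "(k + Suc a) mod (n + 1) \<in> set K" for K using ext_basis_notin[OF that] by blast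
    qed
    moreover have "?W (suc k) = (-1) ^ length (cyc n (suc k) a) * g (add_mset (suc k) (replicate_mset m (suc k))) *
        ext_basis (I (suc k)) (cyc n (suc k) a)"
      unfolding cyc_Cons suc_def[of k, symmetric]
    proof (rule wsum_Cons_of_zero)
      have "suc k \<notin> set (I (suc k))" using cyc_offset[of a n 0 "suc k"] a le(1)[of k] by (simp add: I_def)
      then show "ext_basis (I (suc k)) K = 0" if "suc k \<in> set K" for K using ext_basis_notin[OF that] by blast
    qed
    moreover have "?W i = 0" if i: "i \<le> n" "i \<noteq> k" "i \<noteq> suc k" for i
    proof -
      obtain t where t: "t \<le> n" "i = (k + t) mod (n + 1)" using ex_offset[OF k i(1)] by blast
      have "t \<noteq> 0" using i(2) k t(2) by (cases t) auto
      moreover have "t \<noteq> 1" using i(3) t(2) by (auto simp: suc_def)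
      ultimately have t2: "2 \<le> t" by simp
      \<comment> \<open>Now the list occupies the offsets 1..a+1. The choice lands on offset a + 2,
        which \<open>a + 2 \<le> n\<close> allows, on t + 1 beyond it, or wraps to 0.\<close>
      define l where "l = (if t \<le> a + 1 then a + 2 - t else 1)"
      have l: "1 \<le> l" "l \<le> a" using a t2 by (auto simp: l_def)
      define r where "r = (if t + l \<le> n then t + l else 0)"
      have r: "r \<le> n" "r \<notin> {1..Suc a}" using a t(1) t2 by (auto simp: r_def l_def)
      have "(k + r) mod (n + 1) = (i + l) mod (n + 1)"
      proof (cases "t + l \<le> n")
        case True
        then show ?thesis by (simp add: r_def t(2) mod_simps add.assoc)
      next
        case False
        then have "t + l = n + 1" using a t(1) by (auto simp: l_def split: if_splits)
        have "(i + l) mod (n + 1) = (k + (t + l)) mod (n + 1)" by (simp only: t(2) mod_add_left_eq add.assoc)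
        also have "\<dots> = k mod (n + 1)" by (simp only: \<open>t + l = n + 1\<close> mod_add_self2)
        finally show ?thesis using False by (simp add: r_def)
      qed
      then have "(i + l) mod (n + 1) \<notin> set ?J" unfolding J using offset[OF _ r, of k] a by auto
      moreover have "(i + l) mod (n + 1) \<in> set (I i)" unfolding setI using l by blast
      ultimately show ?thesis by (intro missing) simp_all
    qed
    moreover have "suc k \<noteq> k"
      using mod_add_inj[of 1 n 0 k] k a by (simp add: suc_def)
    ultimately have "(\<Sum>i\<le>n. ?W i) = ?W k + ?W (suc k)"
      using k le(1)[of k] by (subst sum.mono_neutral_right[of "{..n}" "{k, suc k}"]) auto
    then show ?thesis
      using expand_row[OF set_cyc_subset, of k "Suc a" g] \<open>?W k = _\<close> \<open>?W (suc k) = _\<close> by (simp only: self length_cyc mult_1_right replicate_mset_Suc)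
  qed
  \<comment> \<open>After one equation of degree \<open>Suc m\<close> is split off, the remaining
    degree still forces, by the pigeonhole principle, a factor x_i^(2m+1) in every monomial.\<close>
  let ?d = "Suc m + (n + 1) * (2 * m + 1)"
  have "sys.determines m a M0 ?d {}"
    unfolding sys.determines_def
  proof (intro conjI ballI impI)
    fix \<mu> \<alpha> assume \<mu>: "\<mu> \<in> sys.ann m a M0 ?d" and \<alpha>: "\<alpha> \<in> mons n ?d"
    have ann: "(\<Sum>\<gamma>\<in>mons n (Suc m). wcoeff (hcoeff m M0) J \<gamma> * \<mu> (\<gamma> + \<delta>)) = 0"
      if "J \<in> eqs a" "\<delta> \<in> mons n ((n + 1) * (2 * m + 1))" for J \<delta>
      using \<mu> that unfolding sys.ann_def by blast
    have zero: "\<mu> \<alpha>' = 0" if \<alpha>': "\<alpha>' \<in> mons n ?d" "i \<le> n" "\<alpha>' = add_mset (prd i) (replicate_mset m i) + \<delta>" for \<alpha>' i \<delta>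
    proof -
      have "\<delta> \<in> mons n ((n + 1) * (2 * m + 1))" using \<alpha>'(1) unfolding \<alpha>'(3) by (simp add: mons_def)
      then show ?thesis
        using ann[of "cyc n i a @ [prd i]" \<delta>] row1[OF \<alpha>'(2), of "\<lambda>\<gamma>. \<mu> (\<gamma> + \<delta>)"]
          set_cyc_subset[of n i a] le(2)[of i] \<alpha>'(3) by (simp add: eqs_def)
    qed
    obtain i \<beta> where i: "i \<le> n" "\<alpha> = replicate_mset (2 * m + 1) i + \<beta>"
      using pigeonhole_mons[OF \<alpha>, of "2 * m + 1"] by auto
    \<comment> \<open>The binomial at i - 1 exchanges x_i^(m+1) for a multiple of x_(i-1)^m;
      together with the remaining x_i^m this contains x_i^m x_(i-1), which lies in the
      ideal.\<close>
    have "replicate_mset (2 * m + 1) i = replicate_mset (Suc m) i + replicate_mset m i"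
      unfolding replicate_mset_plus[symmetric] by (simp add: mult_2)
    then have \<alpha>_eq: "\<alpha> = replicate_mset (Suc m) (suc (prd i)) + (replicate_mset m i + \<beta>)"
      unfolding i(2) suc_prd[OF i(1)] by (simp only: union_assoc)
    define \<delta> where "\<delta> = replicate_mset m i + \<beta>"
    have \<delta>: "\<delta> \<in> mons n ((n + 1) * (2 * m + 1))" using \<alpha> unfolding \<alpha>_eq \<delta>_def[symmetric] by (simp add: mons_def)
    obtain j where j: "j = (prd i + Suc a) mod (n + 1)" "j \<le> n" by simp
    obtain m' where m': "m = Suc m'" using m by (cases m) auto
    let ?\<alpha>' = "add_mset j (replicate_mset m (prd i)) + \<delta>"
    have "?\<alpha>' \<in> mons n ?d" by (intro plus_mons add_mset_mons replicate_mons j le \<delta>)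
    moreover have "?\<alpha>' = add_mset (prd i) (replicate_mset m i) + (add_mset j (replicate_mset m' (prd i)) + \<beta>)"
      unfolding \<delta>_def m' replicate_mset_Suc by (simp add: ac_simps)
    ultimately have "\<mu> ?\<alpha>' = 0" using zero i(1) by blast
    moreover have "\<mu> ?\<alpha>' + (-1) ^ a * \<mu> (replicate_mset (Suc m) (suc (prd i)) + \<delta>) = 0"
      using row2[OF le(2), of i "\<lambda>\<gamma>. \<mu> (\<gamma> + \<delta>)"] ann[OF _ \<delta>, of "cyc n (prd i) (Suc a)"] set_cyc_subset
      unfolding j(1)[symmetric] by (simp add: eqs_def del: replicate_mset_Suc)
    ultimately show "\<mu> \<alpha> = 0" unfolding \<alpha>_eq \<delta>_def[symmetric] by simp
  qed simp
  moreover have "Suc m \<le> ?d" by simp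
  ultimately obtain L D where D: "D \<in> poly_funs (Hom_sym_ext scale m a) (pscale tscale)" "D M0 \<noteq> 0"
    "\<forall>M. D M \<noteq> 0 \<longrightarrow> sys.determines m a M ?d {}"
    using sys.generic_determines by blast
  show ?thesis
  proof (rule general_Hom_from_poly[OF D(1,2) M0], intro ballI impI)
    fix M assume M: "M \<in> Hom_sym_ext scale m a" "D M \<noteq> 0"
    have "\<not> (nonzero n x \<and> sys.zero_at m a M x)" for x
    proof
      assume x: "nonzero n x \<and> sys.zero_at m a M x"
      have "card {x} \<le> card ({} :: nat multiset set)"
        by (rule sys.card_zeros_le[of "{x}" ?d]) (use x D(3) M(2) in \<open>auto simp: point_set_def\<close>)
      then show False by simp
    qed
    then show "finite (eigenpoints scale m M) \<and> card (eigenpoints scale m M) = 0"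
      using eigenpoints_card[OF M(1), of "{}"] by (simp add: point_set_def)
  qed
qed

text \<open>Here 1 = n + 1 is above the top degree, so every nonzero vector is an eigenvector, and
  projective space is a single point.\<close>

lemma count_line:
  assumes "n = 0"
  shows "general_Hom scale m 1 (\<lambda>M. finite (eigenpoints scale m M) \<and> card (eigenpoints scale m M) = 1)"
proof (rule general_all, rule ballI)
  fix M assume M: "M \<in> Hom_sym_ext scale m 1"
  have "sys.zero_at m 1 M (\<lambda>_. 1)" using zero_at_top[of M m] M assms by simp
  moreover have "point_set n {\<lambda>_. 1}" by (auto simp: point_set_def nonzero_def)
  moreover have "\<not> nonprop n x (\<lambda>_. 1)" for x using assms by (simp add: nonprop_def)
  ultimately show "finite (eigenpoints scale m M) \<and> card (eigenpoints scale m M) = 1"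
    using eigenpoints_card[OF M, of "{\<lambda>_. 1}"] by simp
qed

end

section \<open>Closed forms of the counts and assembly of the cases\<close>

lemma geom_closed_form: "(q - 1) * geom q k = q ^ k - 1"
  by (induction k) (simp_all add: geom_Suc algebra_simps)

theorem theorem3p4:
  fixes scale :: "complex \<Rightarrow> 'v::ab_group_add \<Rightarrow> 'v" and n m a :: nat
  assumes "vector_space scale"
    and "vector_space.dim scale (UNIV :: 'v set) = n + 1"
    and "m \<ge> 1"
  shows "(a = 0 \<and> n = 1 \<longrightarrow>
            general_Hom scale m a (\<lambda>M.
              finite (eigenpoints scale m M) \<and> card (eigenpoints scale m M) = m)) \<and>
         (a = 2 \<and> n = 1 \<longrightarrow>
            general_Hom scale m a (\<lambda>M. infinite (eigenpoints scale m M))) \<and>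
         ((a = 0 \<or> a = n + 1) \<and> n > 1 \<longrightarrow>
            general_Hom scale m a (\<lambda>M. infinite (eigenpoints scale m M))) \<and>
         (a = 1 \<longrightarrow>
            general_Hom scale m a (\<lambda>M.
              finite (eigenpoints scale m M) \<and>
              real (card (eigenpoints scale m M)) =
                (if m = 1 then real (n + 1) else (real m ^ (n + 1) - 1) / (real m - 1)))) \<and>
         (2 \<le> a \<and> a + 2 \<le> n \<longrightarrow>
            general_Hom scale m a (\<lambda>M.
              finite (eigenpoints scale m M) \<and> card (eigenpoints scale m M) = 0)) \<and>
         (a + 1 = n \<longrightarrow>
            general_Hom scale m a (\<lambda>M.
              finite (eigenpoints scale m M) \<and>
              real (card (eigenpoints scale m M)) =
                ((real m + 1) ^ (n + 1) + (- 1) ^ n) / (real m + 2)))"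
proof -
  obtain e \<phi> where "coords scale n e \<phi>" using ex_coords[OF assms(1,2)] by blast
  then interpret coords scale n e \<phi> .
  have mono: "general_Hom scale m a Q" if "general_Hom scale m a P" "\<And>M. P M \<Longrightarrow> Q M" for a P Q
    using that unfolding general_def by blast
  let ?N = "nat \<bar>geom (- (int m + 1)) (n + 1)\<bar>"
  have N: "real ?N = ((real m + 1) ^ (n + 1) + (- 1) ^ n) / (real m + 2)"
  proof -
    let ?q = "- (int m + 1)" and ?G = "geom (- (int m + 1)) (n + 1)"
    have "(?q - 1) * ?G = ?q ^ (n + 1) - 1" by (rule geom_closed_form)
    moreover have "?q ^ (n + 1) = (-1) ^ (n + 1) * (int m + 1) ^ (n + 1)" by (rule power_minus)
    \<comment> \<open>Since q - 1 = -(m + 2), the sum \<open>?G\<close> carries the sign (-1)^n; the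
      count is its absolute value.\<close>
    ultimately have "(int m + 2) * ?G = (-1) ^ n * ((int m + 1) ^ (n + 1) + (-1) ^ n)"
      by (cases "even n") (simp_all add: algebra_simps)
    then have "\<bar>int m + 2\<bar> * \<bar>?G\<bar> = \<bar>(int m + 1) ^ (n + 1) + (-1) ^ n\<bar>"
      unfolding abs_mult[symmetric] by (cases "even n") (simp_all only: abs_mult, simp_all)
    moreover have "1 \<le> (int m + 1) ^ (n + 1)" by (rule one_le_power) simp
    then have "0 \<le> (int m + 1) ^ (n + 1) + (-1) ^ n" by (cases "even n") simp_all
    ultimately have "(int m + 2) * \<bar>?G\<bar> = (int m + 1) ^ (n + 1) + (-1) ^ n" by simp
    then have "real_of_int ((int m + 2) * \<bar>?G\<bar>) = real_of_int ((int m + 1) ^ (n + 1) + (-1) ^ n)" by (rule arg_cong)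
    then have "(real m + 2) * real ?N = (real m + 1) ^ (n + 1) + (-1) ^ n"
      by (simp only: of_int_mult of_int_add of_int_power of_int_of_nat_eq of_int_1 of_int_numeral of_int_minus of_nat_nat abs_ge_zero)
    then show ?thesis by (simp add: eq_divide_eq mult.commute)
  qed
  have top: "general_Hom scale m a (\<lambda>M. infinite (eigenpoints scale m M))" if "a = n + 1" "1 \<le> n"
    unfolding that(1) by (rule general_all) (use infinite_top[OF that(2)] in blast)
  have bottom: "general_Hom scale m a (\<lambda>M. infinite (eigenpoints scale m M))" if "a = 0" "1 < n"
    unfolding that(1) by (rule general_all) (use infinite_bottom[OF that(2) assms(3)] in blast)
  have line: "general_Hom scale m a (\<lambda>M. finite (eigenpoints scale m M) \<and> card (eigenpoints scale m M) = m)"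
    if "a = 0" "n = 1"
  proof -
    have "?N = m" using that by (simp add: geom_def)
    then show ?thesis using count_codegree_one[OF _ assms(3)] that by simp
  qed
  have one: "general_Hom scale m a (\<lambda>M. finite (eigenpoints scale m M) \<and> real (card (eigenpoints scale m M)) =
      (if m = 1 then real (n + 1) else (real m ^ (n + 1) - 1) / (real m - 1)))" if "a = 1"
  proof -
    have N: "real (nat (geom (int m) (n + 1))) = (if m = 1 then real (n + 1) else (real m ^ (n + 1) - 1) / (real m - 1))"
    proof (cases "m = 1")
      case True
      then show ?thesis by (simp add: geom_def)
    next
      case False
      let ?G = "geom (int m) (n + 1)"
      have "0 \<le> ?G" by (simp add: geom_def sum_nonneg)
      then have "real (nat ?G) = real_of_int ?G" by simp
      moreover have "real_of_int ((int m - 1) * ?G) = real_of_int (int m ^ (n + 1) - 1)"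
        by (simp only: geom_closed_form)
      then have "(real m - 1) * real_of_int ?G = real m ^ (n + 1) - 1"
        by (simp only: of_int_mult of_int_diff of_int_power of_int_of_nat_eq of_int_1)
      ultimately show ?thesis using False by (simp add: eq_divide_eq mult.commute)
    qed
    have "general_Hom scale m a (\<lambda>M. finite (eigenpoints scale m M) \<and>
        card (eigenpoints scale m M) = nat (geom (int m) (n + 1)))"
    proof (cases "n = 0")
      case True
      then show ?thesis using count_line that by simp
    next
      case False
      then show ?thesis using count_degree_one[OF _ assms(3)] that by simp
    qed
    then show ?thesis by (rule mono) (simp only: N simp_thms)
  qed
  have codegree_one: "general_Hom scale m a (\<lambda>M. finite (eigenpoints scale m M) \<and> real (card (eigenpoints scale m M)) =
      ((real m + 1) ^ (n + 1) + (- 1) ^ n) / (real m + 2))" if "a + 1 = n"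
  proof -
    have "1 \<le> n" "n - 1 = a" using that by auto
    then have "general_Hom scale m a (\<lambda>M. finite (eigenpoints scale m M) \<and> card (eigenpoints scale m M) = ?N)"
      using count_codegree_one[OF _ assms(3)] by metis
    then show ?thesis by (rule mono) (simp only: N simp_thms)
  qed
  show ?thesis
  proof (intro conjI impI, goal_cases)
    case 1
    then show ?case by (intro line) auto
  next
    \<comment> \<open>Here \<open>a = 2\<close> equals \<open>n + 1\<close>, so every nonzero vector
      of the plane is an eigenvector.\<close>
    case 2
    then show ?case by (intro top) auto
  next
    case 3
    then show ?case using top bottom by auto
  next
    case 4
    then show ?case by (rule one)
  next
    case 5
    then show ?case by (intro no_zeros_middle assms(3)) auto
  next
    case 6
    then show ?case by (rule codegree_one)
  qed
qed

end
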